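(* Let $L$ be a finite simplicial complex on vertex set $\mathsf{V}$, let $T_L$ be the associated toric complex, and $G_L=\pi_1(T_L)$. Let $\nu\colon G_L\twoheadrightarrow\mathbb{Z}^r$ ($r\ge 1$) be an epimorphism, let $T_L^\nu\to T_L$ be the corresponding regular $\mathbb{Z}^r$-cover, let $\Bbbk$ be a field, and let $\nu^*\colon H^1(\mathbb{Z}^r,\mathbb{Q})\to H^1(G_L,\mathbb{Q})=\mathbb{Q}^{\mathsf{V}}$ be the induced homomorphism. For each $q\ge0$, the following are equivalent: (i) $\dim_{\Bbbk}H_i(T_L^\nu,\Bbbk)<\infty$, for all $i\le q$. (ii) $\mathrm{im}(\nu^* )\cap\mathbb{Q}^{\mathsf{W}}=\{0\}$, for all $\mathsf{W}\subseteq\mathsf{V}$ such that $\beta_i(\Bbbk\langle L\rangle,z_{\mathsf{W}})\ne0$ for some $i\le q$.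
   Context: Toric complex: with $n=|\mathsf{V}|$ and $T^n=(S^1)^{\mathsf{V}}$ with its standard product CW-structure (one cell for each subset of $\mathsf{V}$), $T_L\subseteq T^n$ is the subcomplex obtained by deleting the cells corresponding to non-faces of $L$. $G_L$ is the right-angled Artin group generated by $\mathsf{V}$, with $vw=wv$ for each edge $\{v,w\}$ of $L$; thus $H^1(G_L,\mathbb{Q})=\mathbb{Q}^{\mathsf{V}}$ with basis dual to $\mathsf{V}$, and $\mathbb{Q}^{\mathsf{W}}$ is the coordinate subspace spanned by the duals of the elements of $\mathsf{W}$. $\Bbbk\langle L\rangle$ is the exterior Stanley–Reisner ring: the quotient of the exterior algebra over $\Bbbk$ on degree-one generators $v^*$ ($v\in\mathsf{V}$) by the monomials corresponding to missing faces of $L$ (it is isomorphic to $H^*(T_L,\Bbbk)$). For $\mathsf{W}\subseteq\mathsf{V}$, $z_{\mathsf{W}}=\sum_{v\in\mathsf{W}}v^*$, and $\beta_i(\Bbbk\langle L\rangle,z)$ is the dimension of the $i$-th cohomology of the cochain complex $\Bbbk\langle L\rangle$ with differential multiplication by $z$. *)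

theory Defs
  imports
    "HOL-Homology.Homology"
    "HOL-Algebra.Product_Groups"
    "HOL-Library.Extended_Nat"
begin

section \<open>Vector spaces of finitely supported functions, and dimensions of quotients\<close>

definition pm_scale :: "'k::field \<Rightarrow> ('b \<Rightarrow>\<^sub>0 'k) \<Rightarrow> ('b \<Rightarrow>\<^sub>0 'k)"
  where "pm_scale c a = Poly_Mapping.map (\<lambda>x. c * x) a"

lemma lookup_pm_scale: "Poly_Mapping.lookup (pm_scale c a) x = c * Poly_Mapping.lookup a x"
  by (simp add: pm_scale_def Poly_Mapping.map.rep_eq when_def)

global_interpretation pm: vector_space "pm_scale :: 'k::field \<Rightarrow> ('b \<Rightarrow>\<^sub>0 'k) \<Rightarrow> _"
  by unfold_locales
    (auto intro!: poly_mapping_eqI simp: lookup_pm_scale lookup_add algebra_simps)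

text \<open>For subspaces \<open>B \<subseteq> U\<close>, the set \<open>F\<close> consists of representatives of a basis of \<open>U / B\<close>
  (no two of them representing the same class) iff \<open>F\<close> is independent and
  \<open>U\<close> is the direct sum of \<open>span F\<close> and \<open>B\<close>.\<close>

definition quotient_basis ::
    "('b \<Rightarrow>\<^sub>0 'k::field) set \<Rightarrow> ('b \<Rightarrow>\<^sub>0 'k) set \<Rightarrow> ('b \<Rightarrow>\<^sub>0 'k) set \<Rightarrow> bool"
  where "quotient_basis U B F \<longleftrightarrow>
    pm.independent F \<and> pm.span F \<inter> B = {0} \<and> U = {f + b |f b. f \<in> pm.span F \<and> b \<in> B}"

definition quotient_dim :: "('b \<Rightarrow>\<^sub>0 'k::field) set \<Rightarrow> ('b \<Rightarrow>\<^sub>0 'k) set \<Rightarrow> enat"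
  where "quotient_dim U B =
    (if \<exists>F. finite F \<and> quotient_basis U B F
     then enat (card (SOME F. quotient_basis U B F)) else \<infinity>)"


section \<open>Singular homology with coefficients in a field\<close>

text \<open>The library's singular chains have integer coefficients; these are the same definitions
  over \<open>'k\<close>, on the library's singular simplices and their faces.\<close>

definition field_chains :: "nat \<Rightarrow> 'a topology \<Rightarrow> (((nat \<Rightarrow> real) \<Rightarrow> 'a) \<Rightarrow>\<^sub>0 'k::field) set"
  where "field_chains i X = {c. Poly_Mapping.keys c \<subseteq> singular_simplex_set i X}"

definition field_boundary ::
    "nat \<Rightarrow> (((nat \<Rightarrow> real) \<Rightarrow> 'a) \<Rightarrow>\<^sub>0 'k::field) \<Rightarrow> (((nat \<Rightarrow> real) \<Rightarrow> 'a) \<Rightarrow>\<^sub>0 'k)"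
  where "field_boundary i c =
    (if i = 0 then 0 else
     (\<Sum>f\<in>Poly_Mapping.keys c. \<Sum>j\<le>i.
        Poly_Mapping.single (singular_face i j f) ((-1) ^ j * Poly_Mapping.lookup c f)))"

definition homology_dim :: "'k::field itself \<Rightarrow> nat \<Rightarrow> 'a topology \<Rightarrow> enat"
  where "homology_dim _ i X =
    quotient_dim {c \<in> field_chains i X. field_boundary i c = (0 :: _ \<Rightarrow>\<^sub>0 'k)}
                 (field_boundary (Suc i) ` field_chains (Suc i) X)"


section \<open>Fundamental groups and coverings\<close>

definition loops :: "'a::topological_space set \<Rightarrow> 'a \<Rightarrow> (real \<Rightarrow> 'a) set"
  where "loops X x = {g. path g \<and> path_image g \<subseteq> X \<and> pathstart g = x \<and> pathfinish g = x}"

definition path_class :: "'a::topological_space set \<Rightarrow> (real \<Rightarrow> 'a) \<Rightarrow> (real \<Rightarrow> 'a) set"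
  where "path_class X g = {h. homotopic_paths X g h}"

definition fundamental_group :: "'a::topological_space set \<Rightarrow> 'a \<Rightarrow> (real \<Rightarrow> 'a) set monoid"
  where "fundamental_group X x =
    \<lparr>carrier = path_class X ` loops X x,
     monoid.mult = (\<lambda>A B. \<Union>g\<in>A. \<Union>h\<in>B. path_class X (g +++ h)),
     one = path_class X (\<lambda>_. x)\<rparr>"

definition fundamental_group_map ::
    "'b::topological_space set \<Rightarrow> ('a \<Rightarrow> 'b) \<Rightarrow> (real \<Rightarrow> 'a) set \<Rightarrow> (real \<Rightarrow> 'b) set"
  where "fundamental_group_map Y f A = (\<Union>g\<in>A. path_class Y (f \<circ> g))"

text \<open>\<open>p : E \<rightarrow> X\<close> is (a model of) the connected pointed covering of \<open>(X, x)\<close> that classifies the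
  subgroup \<open>N\<close> of the fundamental group; it is a regular covering when \<open>N\<close> is normal.\<close>

definition covering_of_subgroup ::
    "'e::topological_space set \<Rightarrow> 'e \<Rightarrow> ('e \<Rightarrow> 'a) \<Rightarrow>
     'a::topological_space set \<Rightarrow> 'a \<Rightarrow> (real \<Rightarrow> 'a) set set \<Rightarrow> bool"
  where "covering_of_subgroup E e p X x N \<longleftrightarrow>
    covering_space E p X \<and> path_connected E \<and> e \<in> E \<and> p e = x \<and>
    fundamental_group_map X p ` carrier (fundamental_group E e) = N"


section \<open>Toric complexes\<close>

text \<open>The vertex set is the whole of the finite type \<open>'v\<close>; every vertex is a face.\<close>

definition simplicial_complex :: "'v::finite set set \<Rightarrow> bool"
  where "simplicial_complex L \<longleftrightarrow>
    {} \<in> L \<and> (\<forall>\<sigma>\<in>L. \<forall>\<tau>. \<tau> \<subseteq> \<sigma> \<longrightarrow> \<tau> \<in> L) \<and> (\<forall>v. {v} \<in> L)"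

definition torus :: "(complex ^ 'v::finite) set"
  where "torus = {x. \<forall>v. norm (x $ v) = 1}"

text \<open>The circle has the single \<open>0\<close>-cell \<open>1\<close>; a product cell is open, of dimension \<open>card \<sigma>\<close>.\<close>

definition torus_cell :: "'v::finite set \<Rightarrow> (complex ^ 'v) set"
  where "torus_cell \<sigma> = {x \<in> torus. \<forall>v. x $ v \<noteq> 1 \<longleftrightarrow> v \<in> \<sigma>}"

definition toric_complex :: "'v::finite set set \<Rightarrow> (complex ^ 'v) set"
  where "toric_complex L = torus - (\<Union>\<sigma>\<in>-L. torus_cell \<sigma>)"

definition toric_basepoint :: "complex ^ 'v::finite"
  where "toric_basepoint = (\<chi> v. 1)"

abbreviation toric_group :: "'v::finite set set \<Rightarrow> (real \<Rightarrow> complex ^ 'v) set monoid"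
  where "toric_group L \<equiv> fundamental_group (toric_complex L) toric_basepoint"

text \<open>The generator \<open>v\<close> of the right-angled Artin group: the class of the loop that runs once
  around the \<open>1\<close>-cell of \<open>v\<close>.\<close>

definition toric_generator :: "'v::finite set set \<Rightarrow> 'v \<Rightarrow> (real \<Rightarrow> complex ^ 'v) set"
  where "toric_generator L v =
    path_class (toric_complex L) (\<lambda>t. \<chi> w. if w = v then cis (2 * pi * t) else 1)"


section \<open>First cohomology with rational coefficients\<close>

definition rational_group :: "rat monoid"
  where "rational_group = \<lparr>carrier = UNIV, monoid.mult = (+), one = 0\<rparr>"

abbreviation lattice_group :: "nat \<Rightarrow> (nat \<Rightarrow> int) monoid"
  where "lattice_group r \<equiv> product_group {..<r} (\<lambda>_. integer_group)"

text \<open>\<open>H\<^sup>1(G, \<rat>)\<close> is \<open>hom G rational_group\<close>. For the group of a toric complex it is identified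
  with \<open>rat ^ 'v\<close> by evaluation on the generators. Library homomorphisms are unconstrained
  outside the carrier, and evaluation ignores their values there.\<close>

definition H1_coords ::
    "'v::finite set set \<Rightarrow> ((real \<Rightarrow> complex ^ 'v) set \<Rightarrow> rat) \<Rightarrow> rat ^ 'v"
  where "H1_coords L \<phi> = (\<chi> v. \<phi> (toric_generator L v))"

definition H1_image ::
    "'v::finite set set \<Rightarrow> nat \<Rightarrow> ((real \<Rightarrow> complex ^ 'v) set \<Rightarrow> nat \<Rightarrow> int) \<Rightarrow> (rat ^ 'v) set"
  where "H1_image L r \<nu> = (\<lambda>\<phi>. H1_coords L (\<phi> \<circ> \<nu>)) ` hom (lattice_group r) rational_group"

definition coordinate_subspace :: "'v::finite set \<Rightarrow> (rat ^ 'v) set"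
  where "coordinate_subspace W = vec.span ((\<lambda>v. axis v 1) ` W)"


section \<open>Exterior Stanley-Reisner rings\<close>

text \<open>The exterior algebra on the generators \<open>v\<^sup>*\<close> has the basis of monomials
  \<open>v\<^sub>1\<^sup>* \<and> \<dots> \<and> v\<^sub>i\<^sup>*\<close>, \<open>v\<^sub>1 < \<dots> < v\<^sub>i\<close>, which are indexed by the subsets of \<open>'v\<close>. The vertices are
  ordered by the injection \<open>to_nat\<close>; another order only changes signs of monomials.\<close>

definition ext_sign :: "'v::finite set \<Rightarrow> 'v set \<Rightarrow> 'k::field"
  where "ext_sign \<sigma> \<tau> =
    (if \<sigma> \<inter> \<tau> = {} then (-1) ^ card {(s, t). s \<in> \<sigma> \<and> t \<in> \<tau> \<and> to_nat t < to_nat s} else 0)"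

definition ext_mult ::
    "('v::finite set \<Rightarrow>\<^sub>0 'k::field) \<Rightarrow> ('v set \<Rightarrow>\<^sub>0 'k) \<Rightarrow> ('v set \<Rightarrow>\<^sub>0 'k)" (infixl \<open>\<odot>\<close> 70)
  where "a \<odot> b = (\<Sum>\<sigma>\<in>Poly_Mapping.keys a. \<Sum>\<tau>\<in>Poly_Mapping.keys b.
    Poly_Mapping.single (\<sigma> \<union> \<tau>)
      (ext_sign \<sigma> \<tau> * Poly_Mapping.lookup a \<sigma> * Poly_Mapping.lookup b \<tau>))"

definition ext_monomial :: "'v::finite set \<Rightarrow> ('v set \<Rightarrow>\<^sub>0 'k::field)"
  where "ext_monomial \<sigma> = Poly_Mapping.single \<sigma> 1"

definition ext_degree :: "nat \<Rightarrow> ('v::finite set \<Rightarrow>\<^sub>0 'k::field) set"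
  where "ext_degree i = {a. \<forall>\<sigma>\<in>Poly_Mapping.keys a. card \<sigma> = i}"

definition SR_ideal :: "'v::finite set set \<Rightarrow> ('v set \<Rightarrow>\<^sub>0 'k::field) set"
  where "SR_ideal L = pm.span {a \<odot> ext_monomial \<sigma> \<odot> b |a b \<sigma>. \<sigma> \<notin> L}"

definition z_elem :: "'v::finite set \<Rightarrow> ('v set \<Rightarrow>\<^sub>0 'k::field)"
  where "z_elem W = (\<Sum>v\<in>W. ext_monomial {v})"

text \<open>The Stanley-Reisner ring is the quotient of the exterior algebra by \<open>SR_ideal L\<close>. Its degree
  \<open>i\<close> cocycles and coboundaries for multiplication by \<open>z\<close> are represented by their preimages
  in degree \<open>i\<close> of the exterior algebra; both contain the degree \<open>i\<close> part of the ideal.\<close>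

definition SR_cocycles ::
    "'v::finite set set \<Rightarrow> ('v set \<Rightarrow>\<^sub>0 'k::field) \<Rightarrow> nat \<Rightarrow> ('v set \<Rightarrow>\<^sub>0 'k) set"
  where "SR_cocycles L z i = {a \<in> ext_degree i. z \<odot> a \<in> SR_ideal L}"

definition SR_coboundaries ::
    "'v::finite set set \<Rightarrow> ('v set \<Rightarrow>\<^sub>0 'k::field) \<Rightarrow> nat \<Rightarrow> ('v set \<Rightarrow>\<^sub>0 'k) set"
  where "SR_coboundaries L z i =
    {d + j |d j. d \<in> (case i of 0 \<Rightarrow> {0} | Suc m \<Rightarrow> (\<lambda>a. z \<odot> a) ` ext_degree m) \<and>
                 j \<in> SR_ideal L \<inter> ext_degree i}"

definition SR_betti :: "'v::finite set set \<Rightarrow> ('v set \<Rightarrow>\<^sub>0 'k::field) \<Rightarrow> nat \<Rightarrow> enat"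
  where "SR_betti L z i = quotient_dim (SR_cocycles L z i) (SR_coboundaries L z i)"

end

theory Submission imports Defs "HOL-Analysis.Complex_Transcendental" "HOL-Analysis.Cartesian_Euclidean_Space" "HOL-Library.Function_Algebras" begin


text \<open>The fibre of the cover over the basepoint is a copy of Z^r, and the cells of the cover
  are pairs of a face of \<open>L\<close> and a point of the fibre. The cellular chains are thus
  functions from faces to the group ring k[Z^r]; the boundary \<open>cbd\<close> removes a vertex v
  from a face and multiplies by t_v - 1, where t_v is translation by the image a_v of the generator
  v under \<nu>. The map \<open>Phi\<close> sends cellular chains to singular chains by sweeping
  fibre points along lifted coordinate rotations, and \<open>QI_L\<close> says that its mapping cone
  is acyclic. This is an induction over vertices: the part of the cover over a complex K arises from
  the part over the deletion of v by attaching a cylinder over the part over the link of v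
  (\<open>attachment\<close>, \<open>attaching_step\<close>). Condition (i) becomes finiteness of
  algebraic homology, \<open>hfin\<close> (\<open>homology_finite_iff\<close>).

  Replacing t_v - 1 by 1 for v in W and by 0 for v outside W gives the unit complex of W, the
  transpose of multiplication by z_W on the Stanley-Reisner ring. Hence the Betti number of W in
  degree i is nonzero iff \<open>kexact (unit_ops W) UNIV L i\<close> fails
  (\<open>SR_betti_kexact\<close>). Condition (ii) says that a functional on Q^r that kills every
  a_v with v outside such a W kills all a_v (\<open>resonance_iff\<close>). No nonzero functional
  kills all a_v: this is the implication from (i) to (ii) for the empty W in degree 0, where
  finiteness is connectedness of the cover. So (ii) says that the a_v with v outside W span Q^r, for
  each W whose unit complex is not exact up to degree q.

  From (i) to (ii) (\<open>functional_zero_of_hfin\<close>): suppose that a nonzero integral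
  functional \<phi> kills a_v for all v outside W. Finiteness survives the passage to the infinite
  cyclic quotient cover given by \<phi> (\<open>hfin_sublattice\<close>,
  \<open>hfin_quotient\<close>). There t_v - 1 is injective if \<phi>(a_v) is nonzero and is 0
  otherwise. Let W' be the set of the v of the first kind. A class of the unit complex of W',
  multiplied by elements of the group ring and by suitable products of the t_v - 1, would give
  infinitely many independent homology classes; so the unit complex of W' is exact
  (\<open>kexact_of_hfin\<close>). Exactness passes from W' to the larger set W
  (\<open>kexact_unit_ops_mono\<close>).

  From (ii) to (i) (\<open>hfin_of_spanning\<close>): each vertex v is resolved in two ways. Either
  t_v - 1 is replaced by 1, or v is made a cone vertex; \<open>hfin_cone_step\<close> derives
  finiteness from these two cases. When all vertices are resolved, those of the first kind form a
  set W, and the complex is the join of the faces inside W with the full simplex on A = - W. If the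
  unit complex of the faces inside W is exact up to degree q, so is the join
  (\<open>kexact_join_simplex\<close>). Otherwise the a_v with v in A span Q^r. As cone vertices
  they act trivially on homology, hence so does some M Z^r with M > 0, and the homology embeds into
  that of a complex over the finite group Z^r / M Z^r (\<open>hfin_cone_spanning\<close>).\<close>

abbreviation "keys \<equiv> Poly_Mapping.keys"
abbreviation "lookup \<equiv> Poly_Mapping.lookup"
abbreviation "single \<equiv> Poly_Mapping.single"

section \<open>Linear algebra of finitely supported functions\<close>

subsection \<open>Linear extension\<close>

definition lin :: "('a \<Rightarrow> ('b \<Rightarrow>\<^sub>0 'k::field)) \<Rightarrow> ('a \<Rightarrow>\<^sub>0 'k) \<Rightarrow> ('b \<Rightarrow>\<^sub>0 'k)"
  where "lin g c = (\<Sum>x\<in>keys c. pm_scale (lookup c x) (g x))"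

lemma lin_superset:
  assumes "finite S" "keys c \<subseteq> S"
  shows "lin g c = (\<Sum>x\<in>S. pm_scale (lookup c x) (g x))"
  unfolding lin_def using assms
  by (intro sum.mono_neutral_left) (auto simp: in_keys_iff)

lemma lin_0 [simp]: "lin g 0 = 0"
  by (simp add: lin_def)

lemma lin_add: "lin g (a + b) = lin g a + lin g b"
proof -
  have "keys (a + b) \<subseteq> keys a \<union> keys b"
    by (rule Poly_Mapping.keys_add)
  then show ?thesis
    by (simp add: lin_superset[of "keys a \<union> keys b"] lookup_add pm.scale_left_distrib sum.distrib)
qed

lemma keys_pm_scale: "keys (pm_scale r c) \<subseteq> keys c"
  by (auto simp: in_keys_iff lookup_pm_scale)

lemma lin_scale: "lin g (pm_scale r c) = pm_scale r (lin g c)"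
  using keys_pm_scale[of r c]
  by (simp add: lin_superset[of "keys c"] lookup_pm_scale pm.scale_sum_right)

lemma lin_uminus: "lin g (- c) = - lin g c"
  using lin_add[of g c "-c"] by (simp add: add_eq_0_iff)

lemma lin_diff: "lin g (a - b) = lin g a - lin g b"
  using lin_add[of g a "-b"] by (simp add: lin_uminus)

lemma lin_sum: "lin g (\<Sum>i\<in>I. f i) = (\<Sum>i\<in>I. lin g (f i))"
  by (induction I rule: infinite_finite_induct) (simp_all add: lin_add)

lemma lin_single [simp]: "lin g (single x r) = pm_scale r (g x)"
  by (simp add: lin_superset[of "{x}"])

lemma pm_scale_single [simp]: "pm_scale r (single x s) = single x (r * s)"
  by (rule poly_mapping_eqI) (simp add: lookup_pm_scale lookup_single when_def)

lemma lin_cong: "(\<And>x. x \<in> keys c \<Longrightarrow> f x = g x) \<Longrightarrow> lin f c = lin g c"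
  by (simp add: lin_def)

lemma lin_lin: "lin g (lin h c) = lin (\<lambda>x. lin g (h x)) c"
  unfolding lin_def[of h] lin_def[of "\<lambda>x. lin g (h x)"] lin_sum lin_scale ..

lemma lin_fun_add: "lin (\<lambda>x. f x + g x) c = lin f c + lin g c"
  by (simp add: lin_def pm.scale_right_distrib sum.distrib)

lemma lin_fun_diff: "lin (\<lambda>x. f x - g x) c = lin f c - lin g c"
  by (simp add: lin_def pm.scale_right_diff_distrib sum_subtractf)

lemma lin_fun_uminus: "lin (\<lambda>x. - f x) c = - lin f c"
  by (simp add: lin_def sum_negf)

lemma lin_fun_sum: "lin (\<lambda>x. \<Sum>i\<in>I. f i x) c = (\<Sum>i\<in>I. lin (f i) c)"
  by (induction I rule: infinite_finite_induct) (simp_all add: lin_fun_add lin_def[of "\<lambda>x. 0"])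

lemma lin_fun_0 [simp]: "lin (\<lambda>x. 0) c = 0"
  by (simp add: lin_def)

lemma lin_ident [simp]: "lin (\<lambda>x. single x 1) c = c"
proof (rule poly_mapping_eqI)
  fix y
  have "lookup (lin (\<lambda>x. single x 1) c) y = (\<Sum>x\<in>keys c. if x = y then lookup c y else 0)"
    unfolding lin_def lookup_sum by (intro sum.cong) (auto simp: lookup_single when_def)
  then show "lookup (lin (\<lambda>x. single x 1) c) y = lookup c y"
    by (auto simp: in_keys_iff)
qed

lemma keys_sum_subset: "keys (\<Sum>i\<in>I. f i) \<subseteq> (\<Union>i\<in>I. keys (f i))"
  by (rule Poly_Mapping.keys_sum)

lemma keys_lin: "keys (lin g c) \<subseteq> (\<Union>x\<in>keys c. keys (g x))"
proof -
  have "keys (lin g c) \<subseteq> (\<Union>x\<in>keys c. keys (pm_scale (lookup c x) (g x)))"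
    unfolding lin_def by (rule keys_sum_subset)
  also have "\<dots> \<subseteq> (\<Union>x\<in>keys c. keys (g x))"
    by (rule UN_mono[OF subset_refl keys_pm_scale])
  finally show ?thesis .
qed

lemma keys_lin_subset:
  "(\<And>x. x \<in> keys c \<Longrightarrow> keys (g x) \<subseteq> S) \<Longrightarrow> keys (lin g c) \<subseteq> S"
  using keys_lin[of g c] by blast

lemma keys_diff_subset: "keys (a - b :: 'a \<Rightarrow>\<^sub>0 'k::ab_group_add) \<subseteq> keys a \<union> keys b"
  by (rule Poly_Mapping.keys_diff)

lemma pm_cases_single:
  assumes "\<And>x. x \<in> keys c \<Longrightarrow> lin f (single x 1) = lin g (single x 1)"
  shows "lin f c = lin g c"
  using assms by (intro lin_cong) simp

definition pm_restrict :: "'a set \<Rightarrow> ('a \<Rightarrow>\<^sub>0 'k::field) \<Rightarrow> ('a \<Rightarrow>\<^sub>0 'k)"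
  where "pm_restrict S = lin (\<lambda>x. if x \<in> S then single x 1 else 0)"

lemma lookup_pm_restrict: "lookup (pm_restrict S c) x = (if x \<in> S then lookup c x else 0)"
proof -
  have "lookup (pm_restrict S c) x = (\<Sum>y\<in>keys c. if y = x then (if x \<in> S then lookup c x else 0) else 0)"
    unfolding pm_restrict_def lin_def lookup_sum
    by (intro sum.cong) (auto simp: lookup_single when_def lookup_pm_scale)
  then show ?thesis
    by (auto simp: in_keys_iff)
qed

lemma keys_pm_restrict: "keys (pm_restrict S c) = keys c \<inter> S"
  by (auto simp: in_keys_iff lookup_pm_restrict split: if_splits)

lemma pm_restrict_split: "c = pm_restrict S c + pm_restrict (- S) c"
  by (rule poly_mapping_eqI) (auto simp: lookup_add lookup_pm_restrict)

lemma pm_restrict_add: "pm_restrict S (a + b) = pm_restrict S a + pm_restrict S b"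
  by (simp add: pm_restrict_def lin_add)

lemma pm_restrict_diff: "pm_restrict S (a - b) = pm_restrict S a - pm_restrict S b"
  by (simp add: pm_restrict_def lin_diff)

lemma pm_restrict_same: "keys c \<subseteq> S \<Longrightarrow> pm_restrict S c = c"
  by (rule poly_mapping_eqI) (auto simp: lookup_pm_restrict in_keys_iff)

lemma pm_restrict_disjoint: "keys c \<inter> S = {} \<Longrightarrow> pm_restrict S c = 0"
  by (rule poly_mapping_eqI) (auto simp: lookup_pm_restrict in_keys_iff)

section \<open>Base change of integral chain operators to the field\<close>

subsection \<open>Integral operators over a field\<close>

definition iz :: "('a \<Rightarrow>\<^sub>0 int) \<Rightarrow> ('a \<Rightarrow>\<^sub>0 'k::field)"
  where "iz c = Poly_Mapping.map of_int c"

lemma lookup_iz [simp]: "lookup (iz c) x = of_int (lookup c x)"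
  by (simp add: iz_def Poly_Mapping.map.rep_eq when_def)

lemma keys_iz: "keys (iz c) \<subseteq> keys c"
  by (auto simp: in_keys_iff)

lemma iz_0 [simp]: "iz 0 = 0"
  by (rule poly_mapping_eqI) simp

lemma iz_add: "iz (a + b) = iz a + iz b"
  by (rule poly_mapping_eqI) (simp add: lookup_add)

lemma iz_diff: "iz (a - b) = iz a - iz b"
  by (rule poly_mapping_eqI) (simp add: lookup_minus)

lemma iz_frag_of [simp]: "iz (frag_of x) = single x 1"
  by (rule poly_mapping_eqI) (simp add: lookup_single when_def)

lemma iz_frag_cmul: "iz (frag_cmul r a) = pm_scale (of_int r) (iz a)"
  by (rule poly_mapping_eqI) (simp add: lookup_pm_scale)

lemma iz_sum: "iz (\<Sum>i\<in>I. f i) = (\<Sum>i\<in>I. iz (f i))"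
  by (induction I rule: infinite_finite_induct) (simp_all add: iz_add)

text \<open>Lets integral chain operators act over the field. Two operators that agree on every
  singular simplex have the same extension (\<open>kext_identity\<close>), so naturality and
  boundary formulas are verified over the integers.\<close>

definition kext :: "(('a \<Rightarrow>\<^sub>0 int) \<Rightarrow> ('b \<Rightarrow>\<^sub>0 int)) \<Rightarrow> ('a \<Rightarrow>\<^sub>0 'k::field) \<Rightarrow> ('b \<Rightarrow>\<^sub>0 'k)"
  where "kext G = lin (\<lambda>x. iz (G (frag_of x)))"

definition addit :: "(('a \<Rightarrow>\<^sub>0 int) \<Rightarrow> ('b \<Rightarrow>\<^sub>0 int)) \<Rightarrow> bool"
  where "addit G \<longleftrightarrow> (\<forall>a b. G (a - b) = G a - G b)"

lemma addit_0: "addit G \<Longrightarrow> G 0 = 0"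
  unfolding addit_def by (metis diff_self)

lemma addit_comp: "addit G \<Longrightarrow> addit H \<Longrightarrow> addit (\<lambda>c. G (H c))"
  by (simp add: addit_def)

lemma kext_0 [simp]: "kext G 0 = 0" by (simp add: kext_def)
lemma kext_add: "kext G (a + b) = kext G a + kext G b" by (simp add: kext_def lin_add)
lemma kext_diff: "kext G (a - b) = kext G a - kext G b" by (simp add: kext_def lin_diff)
lemma kext_uminus: "kext G (- b) = - kext G b" by (simp add: kext_def lin_uminus)
lemma kext_scale: "kext G (pm_scale r b) = pm_scale r (kext G b)" by (simp add: kext_def lin_scale)
lemma kext_sum: "kext G (\<Sum>i\<in>I. f i) = (\<Sum>i\<in>I. kext G (f i))" by (simp add: kext_def lin_sum)
lemma kext_single [simp]: "kext G (single x r) = pm_scale r (iz (G (frag_of x)))" by (simp add: kext_def)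

lemma kext_iz:
  assumes "addit G"
  shows "kext G (iz c) = iz (G c)"
  using subset_UNIV
proof (induction c rule: frag_induction)
  case zero show ?case by (simp add: addit_0[OF assms])
next
  case (one x) show ?case by simp
next
  case (diff a b) then show ?case using assms by (simp add: iz_diff kext_diff addit_def)
qed

lemma kext_comp:
  assumes "addit G"
  shows "kext G (kext H c) = kext (\<lambda>x. G (H x)) c"
proof -
  have "kext G (kext H c) = lin (\<lambda>x. kext G (iz (H (frag_of x)))) c"
    unfolding kext_def by (rule lin_lin)
  then show ?thesis
    unfolding kext_iz[OF assms] by (simp add: kext_def[of "\<lambda>x. G (H x)"])
qed

lemma kext_cong:
  assumes "\<And>x. x \<in> keys c \<Longrightarrow> G (frag_of x) = H (frag_of x)"
  shows "kext G c = kext H c"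
  unfolding kext_def using assms by (intro lin_cong) simp

lemma kext_fun_add: "kext (\<lambda>x. G x + H x) c = kext G c + kext H c"
  by (simp add: kext_def iz_add lin_fun_add)

lemma kext_fun_diff: "kext (\<lambda>x. G x - H x) c = kext G c - kext H c"
  by (simp add: kext_def iz_diff lin_fun_diff)

lemma keys_kext: "keys (kext G c) \<subseteq> (\<Union>x\<in>keys c. keys (G (frag_of x)))"
  unfolding kext_def
  by (rule order_trans[OF keys_lin UN_mono[OF subset_refl keys_iz]])


section \<open>The algebraic model of the cellular chains\<close>

subsection \<open>The Koszul-type complex of a simplicial complex\<close>

definition del :: "'v set set \<Rightarrow> 'v \<Rightarrow> 'v set set"
  where "del K v = {\<sigma>\<in>K. v \<notin> \<sigma>}"

definition lk :: "'v set set \<Rightarrow> 'v \<Rightarrow> 'v set set"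
  where "lk K v = {\<sigma>. v \<notin> \<sigma> \<and> insert v \<sigma> \<in> K}"

definition down_closed :: "'a set set \<Rightarrow> bool"
  where "down_closed K \<longleftrightarrow> (\<forall>\<sigma>\<in>K. \<forall>\<tau>. \<tau> \<subseteq> \<sigma> \<longrightarrow> \<tau> \<in> K)"

lemma down_closedD: "down_closed K \<Longrightarrow> \<sigma> \<in> K \<Longrightarrow> \<tau> \<subseteq> \<sigma> \<Longrightarrow> \<tau> \<in> K"
  by (auto simp: down_closed_def)

lemma down_closed_del: "down_closed K \<Longrightarrow> down_closed (del K v)"
  by (auto simp: down_closed_def del_def)

lemma down_closed_lk: "down_closed K \<Longrightarrow> down_closed (lk K v)"
  unfolding down_closed_def lk_def by (metis (no_types, lifting) insert_mono mem_Collect_eq subset_iff)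

lemma lk_subset_del: "down_closed K \<Longrightarrow> lk K v \<subseteq> del K v"
  by (auto simp: lk_def del_def intro: down_closedD)

text \<open>The sign (-1)^n, for coefficients that only form an abelian group.\<close>

definition sg :: "nat \<Rightarrow> 'm \<Rightarrow> 'm::ab_group_add"
  where "sg n a = (if even n then a else - a)"

lemma sg_0 [simp]: "sg 0 a = a" "sg n 0 = 0"
  by (simp_all add: sg_def)

lemma sg_Suc [simp]: "sg (Suc n) a = - sg n a"
  by (simp add: sg_def)

lemma sg_add: "sg n (a + b) = sg n a + sg n b"
  by (simp add: sg_def)

lemma sg_minus: "sg n (- a) = - sg n a"
  by (simp add: sg_def)

lemma sg_diff: "sg n (a - b) = sg n a - sg n b"
  by (simp add: sg_def)

lemma sg_sum: "sg n (\<Sum>i\<in>I. f i) = (\<Sum>i\<in>I. sg n (f i))"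
  by (simp add: sg_def sum_negf)

lemma sg_sg: "sg m (sg n a) = sg (m + n) a"
  by (simp add: sg_def)

lemma sg_commute: "sg m (sg n a) = sg n (sg m a)"
  by (simp add: sg_def)

lemma sg_cong: "even m = even n \<Longrightarrow> sg m a = sg n a"
  by (simp add: sg_def)

definition below :: "'v::finite \<Rightarrow> 'v set \<Rightarrow> nat"
  where "below v \<tau> = card {u\<in>\<tau>. to_nat u < to_nat v}"

lemma below_insert: "w \<notin> \<tau> \<Longrightarrow> below v (insert w \<tau>) = below v \<tau> + (if to_nat w < to_nat v then 1 else 0)"
proof -
  assume w: "w \<notin> \<tau>"
  have "{u \<in> insert w \<tau>. to_nat u < to_nat v}
      = (if to_nat w < to_nat v then insert w {u\<in>\<tau>. to_nat u < to_nat v} else {u\<in>\<tau>. to_nat u < to_nat v})"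
    by auto
  then show ?thesis using w by (simp add: below_def)
qed

lemma below_remove: "w \<in> \<tau> \<Longrightarrow> below v \<tau> = below v (\<tau> - {w}) + (if to_nat w < to_nat v then 1 else 0)"
  using below_insert[of w "\<tau> - {w}" v] by (simp add: insert_absorb)

lemma below_self: "below v (insert v \<tau>) = below v \<tau>" "below v (\<tau> - {v}) = below v \<tau>"
  unfolding below_def by (rule arg_cong[where f = card]; auto)+

text \<open>A boundary, written from the point of view of the target face, so it lowers the degree.
  For x_v = t_v - 1 it is the cellular boundary of the cover; for \<open>unit_ops W\<close> it is
  the transpose of multiplication by \<open>z_elem W\<close>.\<close>

definition cbd :: "('v \<Rightarrow> 'm \<Rightarrow> 'm) \<Rightarrow> ('v::finite set \<Rightarrow> 'm::ab_group_add) \<Rightarrow> 'v set \<Rightarrow> 'm"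
  where "cbd x c \<tau> = (\<Sum>v\<in>-\<tau>. sg (below v \<tau>) (x v (c (insert v \<tau>))))"

definition kchains :: "'v::finite set set \<Rightarrow> nat \<Rightarrow> 'm set \<Rightarrow> ('v set \<Rightarrow> 'm::ab_group_add) set"
  where "kchains K i N = {c. \<forall>\<sigma>. c \<sigma> \<in> N \<and> (c \<sigma> \<noteq> 0 \<longrightarrow> \<sigma> \<in> K \<and> card \<sigma> = i)}"

definition additive_ops :: "('v \<Rightarrow> 'm \<Rightarrow> 'm::ab_group_add) \<Rightarrow> bool"
  where "additive_ops x \<longleftrightarrow> (\<forall>v a b. x v (a + b) = x v a + x v b)"

lemma additive_opsD: "additive_ops x \<Longrightarrow> x v (a + b) = x v a + x v b"
  by (simp add: additive_ops_def)

lemma additive_ops_0: "additive_ops x \<Longrightarrow> x v 0 = 0"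
  by (metis add_cancel_right_right add_0 additive_opsD)

lemma additive_ops_minus: "additive_ops x \<Longrightarrow> x v (- a) = - x v a"
  using additive_opsD[of x v a "-a"] additive_ops_0[of x v] by (simp add: add_eq_0_iff)

lemma additive_ops_diff: "additive_ops x \<Longrightarrow> x v (a - b) = x v a - x v b"
  using additive_opsD[of x v a "-b"] additive_ops_minus[of x v b] by simp

lemma additive_ops_sg: "additive_ops x \<Longrightarrow> x v (sg n a) = sg n (x v a)"
  by (simp add: sg_def additive_ops_minus)

lemma additive_ops_sum: "additive_ops x \<Longrightarrow> x v (\<Sum>i\<in>I. f i) = (\<Sum>i\<in>I. x v (f i))"
  by (induction I rule: infinite_finite_induct) (simp_all add: additive_ops_0 additive_opsD)

lemma cbd_add: "additive_ops x \<Longrightarrow> cbd x (\<lambda>\<sigma>. a \<sigma> + b \<sigma>) \<tau> = cbd x a \<tau> + cbd x b \<tau>"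
  by (simp add: cbd_def additive_opsD sg_add sum.distrib)

lemma cbd_minus: "additive_ops x \<Longrightarrow> cbd x (\<lambda>\<sigma>. - a \<sigma>) \<tau> = - cbd x a \<tau>"
  by (simp add: cbd_def additive_ops_minus sg_minus sum_negf)

lemma cbd_diff: "additive_ops x \<Longrightarrow> cbd x (\<lambda>\<sigma>. a \<sigma> - b \<sigma>) \<tau> = cbd x a \<tau> - cbd x b \<tau>"
  by (simp add: cbd_def additive_ops_diff sg_diff sum_subtractf)

lemma cbd_0: "additive_ops x \<Longrightarrow> cbd x (\<lambda>\<sigma>. 0) \<tau> = 0"
  by (simp add: cbd_def additive_ops_0)

text \<open>The chain c0 + v c1. It is applied when v precedes all vertices of c0 and c1, so that no
  sign arises.\<close>

definition join :: "'v \<Rightarrow> ('v set \<Rightarrow> 'm) \<Rightarrow> ('v set \<Rightarrow> 'm) \<Rightarrow> 'v set \<Rightarrow> 'm"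
  where "join v c0 c1 = (\<lambda>\<sigma>. if v \<in> \<sigma> then c1 (\<sigma> - {v}) else c0 \<sigma>)"

definition supported :: "('v set \<Rightarrow> 'm::zero) \<Rightarrow> 'v set \<Rightarrow> bool"
  where "supported c S \<longleftrightarrow> (\<forall>\<sigma>. c \<sigma> \<noteq> 0 \<longrightarrow> \<sigma> \<subseteq> S)"

lemma cbd_supported: "additive_ops x \<Longrightarrow> supported c S \<Longrightarrow> supported (cbd x c) S"
proof -
  assume x: "additive_ops x" and c: "supported c S"
  have "cbd x c \<tau> = 0" if "\<not> \<tau> \<subseteq> S" for \<tau>
  proof -
    have "c (insert w \<tau>) = 0" for w using that c unfolding supported_def by blast
    then show ?thesis by (simp add: cbd_def additive_ops_0[OF x])
  qed
  then show ?thesis by (auto simp: supported_def)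
qed

text \<open>Since v precedes every vertex of \<open>S\<close>, it adds one to all the other sign
  exponents and has exponent 0 itself. So splitting off the first vertex exhibits a complex as the
  mapping cone of x_v from the link to the deletion.\<close>

lemma cbd_join:
  assumes x: "additive_ops x" and S: "v \<notin> S" "\<And>u. u \<in> S \<Longrightarrow> to_nat v < to_nat u"
    and c: "supported c0 S" "supported c1 S"
  shows "cbd x (join v c0 c1) = join v (\<lambda>\<tau>. cbd x c0 \<tau> + x v (c1 \<tau>)) (\<lambda>\<tau>. - cbd x c1 \<tau>)"
proof
  fix \<tau> :: "'a set"
  show "cbd x (join v c0 c1) \<tau> = join v (\<lambda>\<tau>. cbd x c0 \<tau> + x v (c1 \<tau>)) (\<lambda>\<tau>. - cbd x c1 \<tau>) \<tau>"
  proof (cases "v \<in> \<tau>")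
    case True
    define \<tau>' where "\<tau>' = \<tau> - {v}"
    have \<tau>: "\<tau> = insert v \<tau>'" "v \<notin> \<tau>'" using True by (auto simp: \<tau>'_def)
    have "cbd x (join v c0 c1) \<tau> = (\<Sum>w\<in>-\<tau>. - sg (below w \<tau>') (x w (c1 (insert w \<tau>'))))"
      unfolding cbd_def
    proof (rule sum.cong)
      fix w assume w: "w \<in> - \<tau>"
      have eq: "insert w \<tau> - {v} = insert w \<tau>'" using w \<tau> by auto
      have j: "join v c0 c1 (insert w \<tau>) = c1 (insert w \<tau>')" using True by (simp add: join_def eq)
      show "sg (below w \<tau>) (x w (join v c0 c1 (insert w \<tau>))) = - sg (below w \<tau>') (x w (c1 (insert w \<tau>')))"
      proof (cases "c1 (insert w \<tau>') = 0")
        case True then show ?thesis by (simp add: j additive_ops_0[OF x])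
      next
        case False
        then have "w \<in> S" using c(2) by (auto simp: supported_def)
        then show ?thesis unfolding j using S below_insert[of v \<tau>' w] \<tau> by simp
      qed
    qed simp
    also have "\<dots> = - (\<Sum>w\<in>-\<tau>. sg (below w \<tau>') (x w (c1 (insert w \<tau>'))))" by (simp add: sum_negf)
    also have "(\<Sum>w\<in>-\<tau>. sg (below w \<tau>') (x w (c1 (insert w \<tau>')))) = cbd x c1 \<tau>'"
      unfolding cbd_def
    proof (rule sum.mono_neutral_left)
      have "c1 (insert v \<tau>') = 0" using c(2) S(1) unfolding supported_def by blast
      then show "\<forall>w\<in>- \<tau>' - - \<tau>. sg (below w \<tau>') (x w (c1 (insert w \<tau>'))) = 0"
        using \<tau> by (auto simp: additive_ops_0[OF x])
    qed (use \<tau> in auto)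
    finally show ?thesis using True by (simp add: join_def \<tau>'_def)
  next
    case False
    have "cbd x (join v c0 c1) \<tau> = sg (below v \<tau>) (x v (join v c0 c1 (insert v \<tau>)))
        + (\<Sum>w\<in>-\<tau> - {v}. sg (below w \<tau>) (x w (join v c0 c1 (insert w \<tau>))))"
      unfolding cbd_def using False by (subst sum.remove[of _ v]) auto
    also have "sg (below v \<tau>) (x v (join v c0 c1 (insert v \<tau>))) = x v (c1 \<tau>)"
    proof -
      have j: "join v c0 c1 (insert v \<tau>) = c1 \<tau>" using False by (simp add: join_def)
      show ?thesis
      proof (cases "c1 \<tau> = 0")
        case True then show ?thesis by (simp add: j additive_ops_0[OF x])
      next
        case nz: False
        then have "\<tau> \<subseteq> S" using c(2) by (auto simp: supported_def)
        then have "{u\<in>\<tau>. to_nat u < to_nat v} = {}" using S by fastforce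
        then show ?thesis by (simp only: j below_def card.empty sg_0)
      qed
    qed
    also have "(\<Sum>w\<in>-\<tau> - {v}. sg (below w \<tau>) (x w (join v c0 c1 (insert w \<tau>))))
        = (\<Sum>w\<in>-\<tau> - {v}. sg (below w \<tau>) (x w (c0 (insert w \<tau>))))"
      using False by (intro sum.cong) (auto simp: join_def)
    also have "\<dots> = cbd x c0 \<tau>"
      unfolding cbd_def
    proof (rule sum.mono_neutral_left)
      have "c0 (insert v \<tau>) = 0" using c(1) S by (auto simp: supported_def)
      then show "\<forall>w\<in>- \<tau> - (- \<tau> - {v}). sg (below w \<tau>) (x w (c0 (insert w \<tau>))) = 0"
        by (auto simp: additive_ops_0[OF x])
    qed auto
    finally show ?thesis using False by (simp add: join_def add.commute)
  qed
qed

definition shift_op :: "('v \<Rightarrow> 'x \<Rightarrow> 'x) \<Rightarrow> 'v \<Rightarrow> ('x \<Rightarrow>\<^sub>0 'k::field) \<Rightarrow> ('x \<Rightarrow>\<^sub>0 'k)"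
  where "shift_op T v m = lin (\<lambda>x. single (T v x) 1) m - m"

lemma additive_shift_op: "additive_ops (shift_op T)"
  by (simp add: additive_ops_def shift_op_def lin_add)

definition pm_on :: "'x set \<Rightarrow> ('x \<Rightarrow>\<^sub>0 'k::field) set"
  where "pm_on X = {m. keys m \<subseteq> X}"

lemma pm_on_closed: "0 \<in> pm_on X" "a \<in> pm_on X \<Longrightarrow> b \<in> pm_on X \<Longrightarrow> a + b \<in> pm_on X"
  "a \<in> pm_on X \<Longrightarrow> b \<in> pm_on X \<Longrightarrow> a - b \<in> pm_on X" "a \<in> pm_on X \<Longrightarrow> - a \<in> pm_on X"
  using Poly_Mapping.keys_add[of a b] Poly_Mapping.keys_diff[of a b] by (auto simp: pm_on_def)

lemma pm_on_lin: "(\<And>x. x \<in> keys m \<Longrightarrow> g x \<in> pm_on X) \<Longrightarrow> lin g m \<in> pm_on X"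
  unfolding pm_on_def mem_Collect_eq by (rule keys_lin_subset)

lemma pm_on_shift: "(\<And>x. x \<in> X \<Longrightarrow> T v x \<in> X) \<Longrightarrow> m \<in> pm_on X \<Longrightarrow> shift_op T v m \<in> pm_on X"
  unfolding shift_op_def
  by (intro pm_on_closed pm_on_lin) (auto simp: pm_on_def)

lemma kchains_mono: "K \<subseteq> K' \<Longrightarrow> c \<in> kchains K i N \<Longrightarrow> c \<in> kchains K' i N"
  by (auto simp: kchains_def)

lemma kchains_0: "0 \<in> N \<Longrightarrow> (\<lambda>_. 0) \<in> kchains K i N"
  by (simp add: kchains_def)

lemma kchains_add:
  "a \<in> kchains K i (pm_on X) \<Longrightarrow> b \<in> kchains K i (pm_on X) \<Longrightarrow> (\<lambda>\<sigma>. a \<sigma> + b \<sigma>) \<in> kchains K i (pm_on X)"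
  unfolding kchains_def by (auto intro: pm_on_closed) (metis add.right_neutral)+

lemma kchains_minus: "a \<in> kchains K i (pm_on X) \<Longrightarrow> (\<lambda>\<sigma>. - a \<sigma>) \<in> kchains K i (pm_on X)"
  unfolding kchains_def by (auto intro: pm_on_closed)

lemma kchains_diff:
  "a \<in> kchains K i (pm_on X) \<Longrightarrow> b \<in> kchains K i (pm_on X) \<Longrightarrow> (\<lambda>\<sigma>. a \<sigma> - b \<sigma>) \<in> kchains K i (pm_on X)"
  using kchains_add[OF _ kchains_minus] by fastforce

lemma kchains_op:
  assumes "additive_ops x" "\<And>m. m \<in> N \<Longrightarrow> x v m \<in> N" "c \<in> kchains K i N"
  shows "(\<lambda>\<sigma>. x v (c \<sigma>)) \<in> kchains K i N"
  using assms additive_ops_0[OF assms(1)] unfolding kchains_def by (auto, metis+)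

lemma kchains_supported: "c \<in> kchains K i N \<Longrightarrow> (\<And>\<sigma>. \<sigma> \<in> K \<Longrightarrow> \<sigma> \<subseteq> S) \<Longrightarrow> supported c S"
  by (auto simp: kchains_def supported_def)

lemma cbd_degree_0: "additive_ops x \<Longrightarrow> c \<in> kchains K 0 N \<Longrightarrow> cbd x c = (\<lambda>_. 0)"
proof
  fix \<tau> assume x: "additive_ops x" and c: "c \<in> kchains K 0 N"
  have "c (insert w \<tau>) = 0" for w using c by (auto simp: kchains_def)
  then show "cbd x c \<tau> = 0" by (simp add: cbd_def additive_ops_0[OF x])
qed

lemma sum_closed:
  "0 \<in> N \<Longrightarrow> (\<And>a b. a \<in> N \<Longrightarrow> b \<in> N \<Longrightarrow> a + b \<in> N) \<Longrightarrow> (\<And>i. i \<in> I \<Longrightarrow> f i \<in> N) \<Longrightarrow> (\<Sum>i\<in>I. f i) \<in> N"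
  by (induction I rule: infinite_finite_induct) auto

lemma cbd_kchains:
  assumes x: "additive_ops x" "\<And>v m. m \<in> N \<Longrightarrow> x v m \<in> N"
    and N: "0 \<in> N" "\<And>a b. a \<in> N \<Longrightarrow> b \<in> N \<Longrightarrow> a + b \<in> N" "\<And>a. a \<in> N \<Longrightarrow> - a \<in> N"
    and K: "down_closed K" and c: "c \<in> kchains K i N"
  shows "cbd x c \<in> kchains K (i - 1) N"
  unfolding kchains_def
proof (intro CollectI allI conjI impI)
  fix \<tau>
  show "cbd x c \<tau> \<in> N"
    unfolding cbd_def by (intro sum_closed N) (use N x c in \<open>auto simp: sg_def kchains_def\<close>)
  assume "cbd x c \<tau> \<noteq> 0"
  then obtain w where "w \<notin> \<tau>" "c (insert w \<tau>) \<noteq> 0"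
    unfolding cbd_def by (metis (no_types, lifting) ComplD additive_ops_0[OF x(1)] sg_0(2) sum.neutral)
  then have "insert w \<tau> \<in> K" "card (insert w \<tau>) = i" "w \<notin> \<tau>" using c by (auto simp: kchains_def)
  then show "\<tau> \<in> K" "card \<tau> = i - 1" using down_closedD[OF K] by auto
qed

lemma shift_op_commute:
  assumes "keys m \<subseteq> X" "\<And>x. x \<in> X \<Longrightarrow> T v (T w x) = T w (T v x)"
  shows "shift_op T v (shift_op T w m) = shift_op T w (shift_op T v m)"
proof -
  have "lin (\<lambda>x. single (T v (T w x)) 1) m = lin (\<lambda>x. single (T w (T v x)) 1) m"
    using assms by (intro lin_cong) auto
  then show ?thesis by (simp add: shift_op_def lin_diff lin_lin)
qed


section \<open>A natural homotopy between a chain and its iterated subdivision\<close>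

subsection \<open>Natural chain homotopies by acyclic models\<close>

abbreviation "simplex_space p \<equiv> subtopology (powertop_real UNIV) (standard_simplex p)"
abbreviation "cyl X \<equiv> prod_topology X (top_of_set {0..1::real})"
abbreviation "fund p \<equiv> frag_of (restrict id (standard_simplex p))"
abbreviation "times_id f \<equiv> (\<lambda>(x, t::real). (f x, t))"
abbreviation "cyl_end t \<equiv> (\<lambda>x. (x, t::real))"

lemma addit_chain_map: "addit (chain_map p g)"
  by (simp add: addit_def chain_map_diff)

lemma addit_chain_boundary: "addit (chain_boundary p)"
  by (simp add: addit_def chain_boundary_diff)

lemma addit_subdivision: "addit (singular_subdivision p ^^ n)"
  by (simp add: addit_def singular_subdivision_power_diff)

lemma singular_chain_subdivision_power:
  "singular_chain p X c \<Longrightarrow> singular_chain p X ((singular_subdivision p ^^ n) c)"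
  by (induction n) (auto simp: singular_chain_singular_subdivision)

lemma naturality_subdivision_power:
  "singular_chain p X c \<Longrightarrow>
    (singular_subdivision p ^^ n) (chain_map p g c) = chain_map p g ((singular_subdivision p ^^ n) c)"
  by (induction n)
    (simp_all add: naturality_singular_subdivision[OF singular_chain_subdivision_power])

lemma chain_boundary_subdivision_power:
  "singular_chain p X c \<Longrightarrow> chain_boundary p ((singular_subdivision p ^^ n) c)
    = (singular_subdivision (p - Suc 0) ^^ n) (chain_boundary p c)"
  by (induction n)
    (simp_all add: chain_boundary_singular_subdivision[OF singular_chain_subdivision_power])

lemma subdivision_power_zero:
  "singular_chain 0 X c \<Longrightarrow> (singular_subdivision 0 ^^ n) c = c"
  by (induction n) (simp_all add: singular_subdivision_zero)

lemma singular_simplex_fund: "singular_chain p (simplex_space p) (fund p)"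
  by (simp add: singular_chain_of singular_simplex_def)

lemma contractible_simplex_space: "contractible_space (simplex_space p)"
proof -
  let ?o = "\<lambda>j::nat. if j = 0 then 1 else (0::real)"
  define h :: "real \<times> (nat \<Rightarrow> real) \<Rightarrow> nat \<Rightarrow> real" where "h = (\<lambda>(u, x) i. (1 - u) * x i + u * ?o i)"
  have "continuous_map (prod_topology (top_of_set {0..1::real}) (simplex_space p)) (powertop_real UNIV) h"
    unfolding continuous_map_componentwise_UNIV
  proof
    fix i
    have 1: "continuous_map (prod_topology (top_of_set {0..1::real}) (simplex_space p)) euclideanreal fst"
      by (metis continuous_map_fst continuous_map_in_subtopology)
    have "continuous_map (prod_topology (top_of_set {0..1::real}) (simplex_space p)) (simplex_space p) snd"
      by (simp add: continuous_map_snd)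
    then have "continuous_map (prod_topology (top_of_set {0..1::real}) (simplex_space p)) (powertop_real UNIV) snd"
      by (metis continuous_map_in_subtopology)
    then have "continuous_map (prod_topology (top_of_set {0..1::real}) (simplex_space p)) euclideanreal (\<lambda>z. snd z i)"
      by (simp add: continuous_map_componentwise_UNIV)
    then show "continuous_map (prod_topology (top_of_set {0..1::real}) (simplex_space p)) euclideanreal (\<lambda>z. h z i)"
      unfolding h_def case_prod_beta using 1
      by (intro continuous_map_add continuous_map_real_mult continuous_map_diff continuous_map_const[THEN iffD2]) auto
  qed
  moreover have "h z \<in> standard_simplex p" if "fst z \<in> {0..1}" "snd z \<in> standard_simplex p" for z
    using convex_standard_simplex[OF that(2) , of ?o "fst z"] that by (auto simp: h_def case_prod_beta)
  ultimately have "continuous_map (prod_topology (top_of_set {0..1::real}) (simplex_space p)) (simplex_space p) h"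
    by (auto simp: continuous_map_in_subtopology)
  then have "homotopic_with (\<lambda>_. True) (simplex_space p) (simplex_space p) id (\<lambda>_. ?o)"
    unfolding homotopic_with_def by (intro exI[of _ h]) (auto simp: h_def)
  then show ?thesis
    unfolding contractible_space_def by blast
qed

lemma contractible_cyl_simplex_space: "contractible_space (cyl (simplex_space p))"
proof -
  have "contractible {0..1::real}" by (simp add: convex_imp_contractible)
  then show ?thesis
    by (simp add: contractible_space_prod_topology contractible_simplex_space is_interval_convex_1)
qed

text \<open>The contraction makes c homologous to its image in a one-point space, which bounds in
  positive degree. In degree 0 being a cycle says nothing; the last hypothesis asks instead for
  augmentation 0, expressed by maps to a point.\<close>

lemma contractible_space_acyclic:
  fixes X :: "'a topology"
  assumes "contractible_space X" "singular_chain p X c" "chain_boundary p c = 0"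
    and "p = 0 \<Longrightarrow> (\<And>a::'a. chain_map 0 (\<lambda>_. a) c = 0)"
  obtains d where "singular_chain (Suc p) X d" "chain_boundary (Suc p) d = c"
proof -
  obtain a where a: "homotopic_with (\<lambda>_. True) X X id (\<lambda>_. a)"
    using assms(1) by (auto simp: contractible_space_def)
  then have h: "homotopic_with (\<lambda>h. h \<in> {} \<rightarrow> {}) X X id (\<lambda>_. a)"
    by simp
  have cyc: "singular_relcycle p X {} c"
    using assms by (simp add: singular_cycle)
  have *: "homologous_rel p X {} (chain_map p id c) (chain_map p (\<lambda>_. a) c)"
    by (rule homotopic_imp_homologous_rel_chain_maps[OF h cyc])
  have "singular_relboundary p X {} (chain_map p (\<lambda>_. a) c)"
  proof (cases "p = 0")
    case True then show ?thesis using assms(4)[OF True] by simp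
  next
    case False
    show ?thesis
    proof (cases "topspace X = {}")
      case True
      then have "c = 0" using assms(2) by (simp add: singular_chain_empty)
      then show ?thesis by simp
    next
      case ne: False
      have "continuous_map X X (\<lambda>_. a)"
        using a homotopic_with_imp_continuous_maps by blast
      with ne have aX: "a \<in> topspace X" by (auto simp: continuous_map_def)
      have "singular_relcycle p (subtopology X {a}) {} (chain_map p (\<lambda>_. a) c)"
        by (rule singular_relcycle_chain_map[OF cyc]) (use aX in \<open>auto simp: continuous_map_in_subtopology\<close>)
      then have "singular_relboundary p (subtopology X {a}) {} (chain_map p (\<lambda>_. a) c)"
        using singular_boundary_eq_cycle_singleton[of "subtopology X {a}" a p] aX False by auto
      then show ?thesis
        unfolding singular_boundary by (metis singular_chain_subtopology)
    qed
  qed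
  moreover have "chain_map p id c = c"
    by (rule chain_map_ident[OF assms(2)])
  ultimately have "singular_relboundary p X {} c"
    using * unfolding homologous_rel_def
    by (metis diff_add_cancel singular_relboundary_add)
  then show ?thesis
    using that by (auto simp: singular_boundary)
qed

definition cyl_op :: "nat \<Rightarrow> (((nat \<Rightarrow> real) \<Rightarrow> (nat \<Rightarrow> real) \<times> real) \<Rightarrow>\<^sub>0 int)
    \<Rightarrow> 'a chain \<Rightarrow> ('a \<times> real) chain"
  where "cyl_op p d = frag_extend (\<lambda>f. chain_map (Suc p) (times_id f) d)"

definition cyl_ends :: "nat \<Rightarrow> nat \<Rightarrow> 'a chain \<Rightarrow> ('a \<times> real) chain"
  where "cyl_ends n p c = chain_map p (cyl_end 1) ((singular_subdivision p ^^ n) c) - chain_map p (cyl_end 0) c"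

lemma addit_cyl_op: "addit (cyl_op p d)"
  by (simp add: addit_def cyl_op_def frag_extend_diff)

lemma addit_cyl_ends: "addit (cyl_ends n p)"
  by (simp add: addit_def cyl_ends_def chain_map_diff singular_subdivision_power_diff)

lemma continuous_map_times_id: "continuous_map X Y f \<Longrightarrow> continuous_map (cyl X) (cyl Y) (times_id f)"
  unfolding case_prod_beta
  by (intro continuous_map_pairedI continuous_map_snd continuous_map_compose[OF continuous_map_fst, unfolded comp_def])

lemma continuous_map_cyl_end: "t \<in> {0..1} \<Longrightarrow> continuous_map X (cyl X) (cyl_end t)"
  by (intro continuous_map_pairedI) auto

lemma cyl_op_naturality:
  assumes "singular_chain (Suc p) (cyl (simplex_space p)) d"
  shows "cyl_op p d (chain_map p g c) = chain_map (Suc p) (times_id g) (cyl_op p d c)"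
  using subset_UNIV
proof (induction c rule: frag_induction)
  case (one f)
  have "chain_map (Suc p) (times_id (simplex_map p g f)) d = chain_map (Suc p) (times_id g \<circ> times_id f) d"
    by (rule chain_map_eq[OF assms]) (auto simp: simplex_map_def)
  then show ?case
    unfolding chain_map_compose by (simp add: cyl_op_def)
next
  case (diff a b)
  then show ?case
    by (simp add: chain_map_diff addit_cyl_op[unfolded addit_def, rule_format])
qed (simp add: addit_0[OF addit_cyl_op])

lemma singular_chain_cyl_op:
  assumes "singular_chain (Suc p) (cyl (simplex_space p)) d" "singular_chain p X c"
  shows "singular_chain (Suc p) (cyl X) (cyl_op p d c)"
  unfolding cyl_op_def
proof (rule singular_chain_extend)
  fix f assume "f \<in> keys c"
  with assms(2) have "continuous_map (simplex_space p) X f"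
    by (auto simp: singular_chain_def singular_simplex_def)
  then show "singular_chain (Suc p) (cyl X) (chain_map (Suc p) (times_id f) d)"
    by (rule singular_chain_chain_map[OF assms(1) continuous_map_times_id])
qed

lemma cyl_ends_naturality:
  assumes "singular_chain p X c"
  shows "cyl_ends n p (chain_map p g c) = chain_map p (times_id g) (cyl_ends n p c)"
proof -
  have "chain_map p (cyl_end t) (chain_map p g d) = chain_map p (times_id g) (chain_map p (cyl_end t) d)" for t d
  proof -
    have "cyl_end t \<circ> g = times_id g \<circ> cyl_end t" by auto
    then show ?thesis by (metis chain_map_compose comp_def)
  qed
  then show ?thesis
    unfolding cyl_ends_def naturality_subdivision_power[OF assms] chain_map_diff by metis
qed

lemma singular_chain_cyl_ends:
  "singular_chain p X c \<Longrightarrow> singular_chain p (cyl X) (cyl_ends n p c)"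
  unfolding cyl_ends_def
  by (intro singular_chain_diff singular_chain_chain_map[OF _ continuous_map_cyl_end]
      singular_chain_subdivision_power) auto

lemma chain_boundary_cyl_ends:
  "singular_chain p X c \<Longrightarrow> chain_boundary p (cyl_ends n p c) = cyl_ends n (p - Suc 0) (chain_boundary p c)"
  unfolding cyl_ends_def
  by (simp add: chain_boundary_diff chain_boundary_chain_map[OF singular_chain_subdivision_power]
      chain_boundary_chain_map chain_boundary_subdivision_power)

definition cyl_model_spec where
  "cyl_model_spec n p d r \<longleftrightarrow> singular_chain (Suc p) (cyl (simplex_space p)) d \<and>
    chain_boundary (Suc p) d = cyl_ends n p (fund p) - r"

text \<open>Acyclic models: the value on each standard simplex solves the homotopy equation inside
  the cylinder over that simplex, which is contractible. That the choices exist is shown in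
  \<open>cyl_model_spec\<close>.\<close>

primrec cyl_model :: "nat \<Rightarrow> nat \<Rightarrow> ((nat \<Rightarrow> real) \<Rightarrow> (nat \<Rightarrow> real) \<times> real) \<Rightarrow>\<^sub>0 int" where
  "cyl_model n 0 = (SOME d. cyl_model_spec n 0 d 0)"
| "cyl_model n (Suc p) = (SOME d. cyl_model_spec n (Suc p) d
      (cyl_op p (cyl_model n p) (chain_boundary (Suc p) (fund (Suc p)))))"

text \<open>The natural chain homotopy, inside the cylinder, from the bottom inclusion to the top
  inclusion of the \<open>n\<close>-fold subdivision. With \<open>n = 0\<close> it is a prism
  operator.\<close>

definition cyl_htpy :: "nat \<Rightarrow> nat \<Rightarrow> 'a chain \<Rightarrow> ('a \<times> real) chain"
  where "cyl_htpy n p = cyl_op p (cyl_model n p)"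

lemma cyl_htpy_boundary_step:
  assumes m: "cyl_model_spec n p (cyl_model n p) (cyl_htpy n (p - Suc 0) (chain_boundary p (fund p)))"
    and m': "p \<noteq> 0 \<Longrightarrow> singular_chain (Suc (p - Suc 0)) (cyl (simplex_space (p - Suc 0))) (cyl_model n (p - Suc 0))"
    and c: "singular_chain p X c"
  shows "chain_boundary (Suc p) (cyl_htpy n p c)
    = cyl_ends n p c - cyl_htpy n (p - Suc 0) (chain_boundary p c)"
  using c unfolding singular_chain_def
proof (induction c rule: frag_induction)
  case zero
  then show ?case by (simp add: cyl_htpy_def addit_0[OF addit_cyl_op] addit_0[OF addit_cyl_ends])
next
  case (one f)
  then have f: "singular_simplex p X f" by simp
  note mc = m[unfolded cyl_model_spec_def]
  have fund: "chain_map p f (fund p) = frag_of f"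
    by (rule singular_simplex_chain_map_id[OF f])
  have 1: "cyl_ends n p (frag_of f) = chain_map p (times_id f) (cyl_ends n p (fund p))"
    using cyl_ends_naturality[OF singular_simplex_fund, of n p f] fund by simp
  have 2: "cyl_htpy n (p - Suc 0) (chain_boundary p (frag_of f))
      = chain_map p (times_id f) (cyl_htpy n (p - Suc 0) (chain_boundary p (fund p)))"
  proof (cases "p = 0")
    case True
    then show ?thesis by (simp add: chain_boundary_of cyl_htpy_def addit_0[OF addit_cyl_op])
  next
    case False
    have "chain_boundary p (frag_of f) = chain_map (p - Suc 0) f (chain_boundary p (fund p))"
      using chain_boundary_chain_map[OF singular_simplex_fund, of p f] fund by simp
    then show ?thesis
      unfolding cyl_htpy_def using cyl_op_naturality[OF m'[OF False]] False by simp
  qed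
  have "chain_boundary (Suc p) (cyl_htpy n p (frag_of f))
      = chain_map p (times_id f) (chain_boundary (Suc p) (cyl_model n p))"
    unfolding cyl_htpy_def cyl_op_def using chain_boundary_chain_map[OF mc[THEN conjunct1], of "times_id f"] by simp
  then show ?case
    using mc by (simp add: 1 2 chain_map_diff)
next
  case (diff a b)
  then show ?case
    by (simp add: cyl_htpy_def chain_boundary_diff addit_cyl_op[unfolded addit_def, rule_format]
        addit_cyl_ends[unfolded addit_def, rule_format])
qed

lemma cyl_model_spec:
  "cyl_model_spec n p (cyl_model n p) (cyl_htpy n (p - Suc 0) (chain_boundary p (fund p)))"
proof (induction p rule: less_induct)
  case (less p0)
  show ?case
  proof (cases p0)
  case 0
  have cm: "chain_map 0 (\<lambda>_. a) (cyl_ends n 0 (fund 0)) = 0" for a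
  proof -
    have "chain_map 0 (\<lambda>_. a) (chain_map 0 (cyl_end t) c) = chain_map 0 (\<lambda>_. a) c"
      for t and c :: "(nat \<Rightarrow> real) chain"
      using fun_cong[OF chain_map_compose[of 0 "\<lambda>_. a" "cyl_end t"], of c] by (simp add: comp_def)
    then show ?thesis
      by (simp only: cyl_ends_def chain_map_diff subdivision_power_zero[OF singular_simplex_fund] diff_self)
  qed
  obtain d where "singular_chain (Suc 0) (cyl (simplex_space 0)) d"
      "chain_boundary (Suc 0) d = cyl_ends n 0 (fund 0)"
    by (rule contractible_space_acyclic[OF contractible_cyl_simplex_space[of 0]
          singular_chain_cyl_ends[OF singular_simplex_fund[of 0]], of n])
      (use cm in \<open>auto simp: chain_boundary_def\<close>)
  then have "cyl_model_spec n 0 d 0"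
    by (simp add: cyl_model_spec_def)
  then have "cyl_model_spec n 0 (cyl_model n 0) 0"
    unfolding cyl_model.simps by (rule someI)
  with 0 show ?thesis
    by (simp add: chain_boundary_of cyl_htpy_def addit_0[OF addit_cyl_op])
next
  case (Suc p)
  let ?b = "chain_boundary (Suc p) (fund (Suc p))"
  let ?r = "cyl_htpy n p ?b"
  have IH: "cyl_model_spec n p (cyl_model n p) (cyl_htpy n (p - Suc 0) (chain_boundary p (fund p)))"
    by (rule less) (simp add: Suc)
  have m: "singular_chain (Suc p) (cyl (simplex_space p)) (cyl_model n p)"
    using IH by (simp add: cyl_model_spec_def)
  have m': "singular_chain (Suc (p - Suc 0)) (cyl (simplex_space (p - Suc 0))) (cyl_model n (p - Suc 0))" if "p \<noteq> 0"
    using less[of "p - Suc 0"] Suc that by (simp add: cyl_model_spec_def)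
  have b: "singular_chain p (simplex_space (Suc p)) ?b"
    using singular_chain_boundary[OF singular_simplex_fund, of "Suc p"] by simp
  have r: "singular_chain (Suc p) (cyl (simplex_space (Suc p))) ?r"
    unfolding cyl_htpy_def by (rule singular_chain_cyl_op[OF m b])
  have bb: "chain_boundary p ?b = 0"
    using chain_boundary_boundary_alt[OF singular_simplex_fund[of "Suc p"]] .
  have "chain_boundary (Suc p) (cyl_ends n (Suc p) (fund (Suc p)) - ?r) = 0"
    using chain_boundary_cyl_ends[OF singular_simplex_fund[of "Suc p"], of n]
      cyl_htpy_boundary_step[OF IH m' b] bb
    by (simp add: chain_boundary_diff cyl_htpy_def addit_0[OF addit_cyl_op])
  then obtain d where "cyl_model_spec n (Suc p) d ?r"
    using contractible_space_acyclic[OF contractible_cyl_simplex_space[of "Suc p"]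
        singular_chain_diff[OF singular_chain_cyl_ends[OF singular_simplex_fund[of "Suc p"]] r], of n]
    unfolding cyl_model_spec_def by blast
  then have "cyl_model_spec n (Suc p) (cyl_model n (Suc p)) ?r"
    unfolding cyl_model.simps cyl_htpy_def by (rule someI)
  then show ?thesis unfolding Suc diff_Suc_Suc minus_nat.diff_0 .
qed
qed


lemma singular_chain_cyl_model: "singular_chain (Suc p) (cyl (simplex_space p)) (cyl_model n p)"
  using cyl_model_spec unfolding cyl_model_spec_def by blast

lemma chain_boundary_cyl_htpy:
  "singular_chain p X c \<Longrightarrow> chain_boundary (Suc p) (cyl_htpy n p c)
    = cyl_ends n p c - cyl_htpy n (p - Suc 0) (chain_boundary p c)"
  by (rule cyl_htpy_boundary_step[OF cyl_model_spec singular_chain_cyl_model])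

section \<open>Push-forward, subdivision and cylinders over the field\<close>

subsection \<open>Natural operators on chains over a field\<close>

abbreviation "kmap p g \<equiv> kext (chain_map p g)"
abbreviation "ksd n p \<equiv> kext (singular_subdivision p ^^ n)"
abbreviation "kcyl n p \<equiv> kext (cyl_htpy n p)"

lemma field_chains_iff: "c \<in> field_chains p X \<longleftrightarrow> (\<forall>f\<in>keys c. singular_simplex p X f)"
  by (auto simp: field_chains_def)

lemma field_chains_0 [simp]: "0 \<in> field_chains p X"
  by (simp add: field_chains_def)

lemma field_chains_add: "a \<in> field_chains p X \<Longrightarrow> b \<in> field_chains p X \<Longrightarrow> a + b \<in> field_chains p X"
  using Poly_Mapping.keys_add[of a b] by (auto simp: field_chains_def)

lemma field_chains_diff: "a \<in> field_chains p X \<Longrightarrow> b \<in> field_chains p X \<Longrightarrow> a - b \<in> field_chains p X"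
  using Poly_Mapping.keys_diff[of a b] by (auto simp: field_chains_def)

lemma field_chains_uminus: "a \<in> field_chains p X \<Longrightarrow> - a \<in> field_chains p X"
  by (simp add: field_chains_def)

lemma field_chains_scale: "a \<in> field_chains p X \<Longrightarrow> pm_scale r a \<in> field_chains p X"
  using keys_pm_scale[of r a] by (auto simp: field_chains_def)

lemma field_chains_sum: "(\<And>i. i \<in> I \<Longrightarrow> f i \<in> field_chains p X) \<Longrightarrow> (\<Sum>i\<in>I. f i) \<in> field_chains p X"
  by (induction I rule: infinite_finite_induct) (auto intro: field_chains_add)

lemma field_chains_single [simp]: "singular_simplex p X f \<Longrightarrow> single f r \<in> field_chains p X"
  by (auto simp: field_chains_def split: if_splits)

lemma field_chains_lin:
  "(\<And>x. x \<in> keys c \<Longrightarrow> g x \<in> field_chains p X) \<Longrightarrow> lin g c \<in> field_chains p X"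
  unfolding lin_def by (intro field_chains_sum field_chains_scale)

lemma field_chains_kext:
  assumes "c \<in> field_chains p X"
    and "\<And>f. singular_simplex p X f \<Longrightarrow> singular_chain q Y (G (frag_of f))"
  shows "kext G c \<in> field_chains q Y"
proof -
  have "keys (G (frag_of f)) \<subseteq> singular_simplex_set q Y" if "f \<in> keys c" for f
    using assms that by (auto simp: field_chains_def singular_chain_def)
  then show ?thesis
    unfolding field_chains_def using keys_kext[of G c] by blast
qed

lemma field_boundary_kext: "field_boundary p = kext (chain_boundary p)"
proof
  fix c :: "((nat \<Rightarrow> real) \<Rightarrow> 'a) \<Rightarrow>\<^sub>0 'k::field"
  show "field_boundary p c = kext (chain_boundary p) c"
  proof (cases "p = 0")
    case True
    then show ?thesis by (simp add: field_boundary_def kext_def chain_boundary_of)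
  next
    case False
    have "pm_scale (lookup c f) (iz (chain_boundary p (frag_of f)))
        = (\<Sum>j\<le>p. single (singular_face p j f) ((-1) ^ j * lookup c f))" for f
      using False by (simp add: chain_boundary_of iz_sum iz_frag_cmul pm.scale_sum_right mult.commute)
    then show ?thesis
      using False by (simp add: field_boundary_def kext_def lin_def)
  qed
qed

lemma kext_identity:
  assumes "c \<in> field_chains p X" and "\<And>f. singular_simplex p X f \<Longrightarrow> G (frag_of f) = H (frag_of f)"
  shows "kext G c = kext H c"
  using assms by (intro kext_cong) (auto simp: field_chains_iff)

lemma field_boundary_add: "field_boundary p (a + b) = field_boundary p a + field_boundary p b"
  by (simp add: field_boundary_kext kext_add)

lemma field_boundary_diff: "field_boundary p (a - b) = field_boundary p a - field_boundary p b"
  by (simp add: field_boundary_kext kext_diff)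

lemma field_boundary_uminus: "field_boundary p (- b) = - field_boundary p b"
  by (simp add: field_boundary_kext kext_uminus)

lemma field_boundary_0 [simp]: "field_boundary p 0 = 0" "field_boundary 0 c = 0"
  by (simp_all add: field_boundary_kext kext_def chain_boundary_of)

lemma field_boundary_chains:
  "c \<in> field_chains p X \<Longrightarrow> field_boundary p c \<in> field_chains (p - Suc 0) X"
  unfolding field_boundary_kext
  by (erule field_chains_kext) (simp add: singular_chain_boundary singular_chain_of)

lemma field_boundary_chains_Suc:
  "c \<in> field_chains (Suc p) X \<Longrightarrow> field_boundary (Suc p) c \<in> field_chains p X"
  using field_boundary_chains by fastforce

lemma field_boundary_boundary:
  "c \<in> field_chains p X \<Longrightarrow> field_boundary (p - Suc 0) (field_boundary p c) = 0"
  unfolding field_boundary_kext kext_comp[OF addit_chain_boundary]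
  by (subst kext_identity[where H = "\<lambda>_. 0"])
    (auto simp: chain_boundary_boundary singular_chain_of kext_def)

lemma kmap_chains: "c \<in> field_chains p X \<Longrightarrow> continuous_map X Y g \<Longrightarrow> kmap p g c \<in> field_chains p Y"
  by (erule field_chains_kext) (metis singular_chain_chain_map singular_chain_of)

lemma kmap_boundary:
  "c \<in> field_chains p X \<Longrightarrow> field_boundary p (kmap p g c) = kmap (p - Suc 0) g (field_boundary p c)"
  unfolding field_boundary_kext kext_comp[OF addit_chain_boundary] kext_comp[OF addit_chain_map]
  by (rule kext_identity) (auto simp: chain_boundary_chain_map singular_chain_of simp del: chain_map_of)

lemma kmap_comp:
  fixes g :: "'a \<Rightarrow> 'b"
  shows "kmap p h (kmap p g c) = kmap p (\<lambda>x. h (g x)) c"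
proof -
  have "chain_map p h (chain_map p g x) = chain_map p (\<lambda>x. h (g x)) x" for x :: "'a chain"
    using fun_cong[OF chain_map_compose[of p h g], of x] by (simp add: comp_def)
  then show ?thesis
    unfolding kext_comp[OF addit_chain_map] by simp
qed

lemma kmap_eq:
  "c \<in> field_chains p X \<Longrightarrow> (\<And>x. x \<in> topspace X \<Longrightarrow> f x = g x) \<Longrightarrow> kmap p f c = kmap p g c"
  by (erule kext_identity) (metis chain_map_eq singular_chain_of)

lemma kmap_id: "c \<in> field_chains p X \<Longrightarrow> (\<And>x. x \<in> topspace X \<Longrightarrow> f x = x) \<Longrightarrow> kmap p f c = c"
  unfolding kext_def
  by (subst lin_cong[where g = "\<lambda>x. single x 1"])
    (auto simp: field_chains_iff simplex_map_id_gen)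

lemma keys_kmap: "keys (kmap p g c) \<subseteq> simplex_map p g ` keys c"
  using keys_kext[of "chain_map p g" c] by auto

lemma ksd_chains: "c \<in> field_chains p X \<Longrightarrow> ksd n p c \<in> field_chains p X"
  by (erule field_chains_kext) (simp add: singular_chain_subdivision_power singular_chain_of)

lemma ksd_boundary:
  "c \<in> field_chains p X \<Longrightarrow> field_boundary p (ksd n p c) = ksd n (p - Suc 0) (field_boundary p c)"
  unfolding field_boundary_kext kext_comp[OF addit_chain_boundary] kext_comp[OF addit_subdivision]
  by (rule kext_identity) (auto simp: chain_boundary_subdivision_power singular_chain_of)

lemma ksd_naturality:
  "c \<in> field_chains p X \<Longrightarrow> ksd n p (kmap p g c) = kmap p g (ksd n p c)"
  unfolding kext_comp[OF addit_chain_map] kext_comp[OF addit_subdivision]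
  by (rule kext_identity) (auto simp: naturality_subdivision_power singular_chain_of simp del: chain_map_of)

lemma kcyl_chains: "c \<in> field_chains p X \<Longrightarrow> kcyl n p c \<in> field_chains (Suc p) (cyl X)"
  by (erule field_chains_kext)
    (simp add: cyl_htpy_def singular_chain_cyl_op singular_chain_cyl_model singular_chain_of)

lemma addit_cyl_htpy: "addit (cyl_htpy n p)"
  by (simp add: cyl_htpy_def addit_cyl_op)

lemma kcyl_naturality: "kcyl n p (kmap p g c) = kmap (Suc p) (times_id g) (kcyl n p c)"
proof -
  have "cyl_htpy n p (chain_map p g x) = chain_map (Suc p) (times_id g) (cyl_htpy n p x)" for x
    unfolding cyl_htpy_def by (rule cyl_op_naturality[OF singular_chain_cyl_model])
  then show ?thesis
    unfolding kext_comp[OF addit_chain_map] kext_comp[OF addit_cyl_htpy] by simp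
qed

lemma kcyl_boundary:
  assumes "c \<in> field_chains p X"
  shows "field_boundary (Suc p) (kcyl n p c) = kmap p (cyl_end 1) (ksd n p c) - kmap p (cyl_end 0) c
    - kcyl n (p - Suc 0) (field_boundary p c)"
proof -
  have "field_boundary (Suc p) (kcyl n p c)
      = kext (\<lambda>x. cyl_ends n p x - cyl_htpy n (p - Suc 0) (chain_boundary p x)) c"
    unfolding field_boundary_kext kext_comp[OF addit_chain_boundary]
    by (rule kext_identity[OF assms]) (simp add: chain_boundary_cyl_htpy singular_chain_of)
  then show ?thesis
    unfolding kext_fun_diff cyl_ends_def field_boundary_kext kext_comp[OF addit_chain_map] kext_comp[OF addit_cyl_htpy] .
qed

lemma ksd_0 [simp]: "c \<in> field_chains p X \<Longrightarrow> ksd 0 p c = c"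
  by (simp add: kext_def)

lemma ksd_small:
  assumes c: "c \<in> field_chains p X" and "\<And>U. U \<in> \<C> \<Longrightarrow> openin X U" "topspace X \<subseteq> \<Union>\<C>"
  shows "\<exists>N. \<forall>n\<ge>N. \<forall>f\<in>keys (ksd n p c). \<exists>V\<in>\<C>. f \<in> standard_simplex p \<rightarrow> V"
proof -
  have "\<exists>N. \<forall>n f. N \<le> n \<longrightarrow> f \<in> keys ((singular_subdivision p ^^ n) (frag_of s)) \<longrightarrow> (\<exists>V\<in>\<C>. f \<in> standard_simplex p \<rightarrow> V)"
    if "s \<in> keys c" for s
  proof -
    have "singular_chain p X (frag_of s)" using c that by (auto simp: field_chains_iff singular_chain_of)
    from sufficient_iterated_singular_subdivision_exists[OF assms(2,3) this] show ?thesis by metis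
  qed
  then obtain N where N: "\<And>s n f. s \<in> keys c \<Longrightarrow> N s \<le> n \<Longrightarrow> f \<in> keys ((singular_subdivision p ^^ n) (frag_of s)) \<Longrightarrow>
      (\<exists>V\<in>\<C>. f \<in> standard_simplex p \<rightarrow> V)"
    by metis
  show ?thesis
  proof (intro exI[of _ "\<Sum>s\<in>keys c. N s"] allI impI ballI)
    fix n f assume n: "(\<Sum>s\<in>keys c. N s) \<le> n" and "f \<in> keys (ksd n p c)"
    then obtain s where s: "s \<in> keys c" "f \<in> keys ((singular_subdivision p ^^ n) (frag_of s))"
      using keys_kext by fast
    have "N s \<le> (\<Sum>s\<in>keys c. N s)" by (rule member_le_sum) (use s in auto)
    with n N s show "\<exists>V\<in>\<C>. f \<in> standard_simplex p \<rightarrow> V" by (meson le_trans)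
  qed
qed

lemma field_chains_subtopology:
  "c \<in> field_chains p (subtopology X S) \<longleftrightarrow> c \<in> field_chains p X \<and> (\<forall>f\<in>keys c. f ` standard_simplex p \<subseteq> S)"
  by (auto simp: field_chains_iff singular_simplex_subtopology)

lemma field_chains_mono: "c \<in> field_chains p (top_of_set S) \<Longrightarrow> S \<subseteq> T \<Longrightarrow> c \<in> field_chains p (top_of_set T)"
  by (auto simp: field_chains_iff intro: singular_simplex_mono)


section \<open>Chain homotopies from homotopies, and chains of a cylinder\<close>

subsection \<open>Homotopies on chains\<close>

lemma kext_id [simp]: "kext id c = c"
  by (simp add: kext_def)

abbreviation "fch p S \<equiv> field_chains p (top_of_set S)"

lemma cyl_top_of_set: "cyl (top_of_set S) = top_of_set (S \<times> {0..1})"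
  by simp

lemma kmap_chains_on:
  "c \<in> fch p S \<Longrightarrow> continuous_on S g \<Longrightarrow> g \<in> S \<rightarrow> T \<Longrightarrow> kmap p g c \<in> fch p T"
  by (erule kmap_chains) (auto simp: continuous_map_in_subtopology)

lemma kmap_eq_on: "c \<in> fch p S \<Longrightarrow> (\<And>x. x \<in> S \<Longrightarrow> f x = g x) \<Longrightarrow> kmap p f c = kmap p g c"
  by (erule kmap_eq) simp

lemma kcyl_chains_on: "c \<in> fch p S \<Longrightarrow> kcyl n p c \<in> fch (Suc p) (S \<times> {0..1})"
  using kcyl_chains[of c p "top_of_set S" n] by (simp add: cyl_top_of_set)

lemma chains_image: "c \<in> fch p S \<Longrightarrow> f \<in> keys c \<Longrightarrow> f ` standard_simplex p \<subseteq> S"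
  by (auto simp: field_chains_iff singular_simplex_subtopology)

lemma chains_shrink:
  assumes "c \<in> fch p S" "keys d \<subseteq> keys c" "\<And>f. f \<in> keys d \<Longrightarrow> f ` standard_simplex p \<subseteq> T"
  shows "d \<in> fch p T"
  using assms by (auto simp: field_chains_iff singular_simplex_subtopology)

text \<open>The chain homotopy of a homotopy K, combined with subdivision at time 1. It also serves
  as the sweeping operator that builds lifted cells.\<close>

definition khom :: "nat \<Rightarrow> nat \<Rightarrow> ('a \<times> real \<Rightarrow> 'b) \<Rightarrow> (((nat \<Rightarrow> real) \<Rightarrow> 'a) \<Rightarrow>\<^sub>0 'k::field) \<Rightarrow> _"
  where "khom n p K c = kmap (Suc p) K (kcyl n p c)"

lemma khom_0 [simp]: "khom n p K 0 = 0"
  by (simp add: khom_def)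

lemma khom_add: "khom n p K (a + b) = khom n p K a + khom n p K b"
  by (simp add: khom_def kext_add)

lemma khom_diff: "khom n p K (a - b) = khom n p K a - khom n p K b"
  by (simp add: khom_def kext_diff)

lemma khom_uminus: "khom n p K (- b) = - khom n p K b"
  by (simp add: khom_def kext_uminus)

lemma khom_scale: "khom n p K (pm_scale r b) = pm_scale r (khom n p K b)"
  by (simp add: khom_def kext_scale)

lemma khom_chains:
  "c \<in> fch p S \<Longrightarrow> continuous_on (S \<times> {0..1}) K \<Longrightarrow> K \<in> S \<times> {0..1} \<rightarrow> T \<Longrightarrow> khom n p K c \<in> fch (Suc p) T"
  unfolding khom_def by (erule kmap_chains_on[OF kcyl_chains_on])

lemma khom_eq_on:
  "c \<in> fch p S \<Longrightarrow> (\<And>x t. x \<in> S \<Longrightarrow> t \<in> {0..1} \<Longrightarrow> K (x, t) = K' (x, t)) \<Longrightarrow> khom n p K c = khom n p K' c"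
  unfolding khom_def by (erule kmap_eq_on[OF kcyl_chains_on]) auto

lemma khom_kmap: "khom n p K (kmap p g c) = khom n p (\<lambda>(x, t). K (g x, t)) c"
proof -
  have "(\<lambda>x. K (times_id g x)) = (\<lambda>(x, t). K (g x, t))" by auto
  then show ?thesis unfolding khom_def kcyl_naturality kmap_comp by simp
qed

lemma kmap_khom: "kmap (Suc p) g (khom n p K c) = khom n p (\<lambda>z. g (K z)) c"
  unfolding khom_def kmap_comp ..

lemma khom_boundary:
  assumes "c \<in> fch p S"
  shows "field_boundary (Suc p) (khom n p K c) = kmap p (\<lambda>x. K (x, 1)) (ksd n p c) - kmap p (\<lambda>x. K (x, 0)) c
    - khom n (p - Suc 0) K (field_boundary p c)"
proof -
  have "field_boundary (Suc p) (khom n p K c) = kmap p K (kmap p (cyl_end 1) (ksd n p c) - kmap p (cyl_end 0) c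
      - kcyl n (p - Suc 0) (field_boundary p c))"
    unfolding khom_def using kmap_boundary[OF kcyl_chains_on[OF assms]] kcyl_boundary[OF assms] by simp
  then show ?thesis
    by (cases p) (simp_all add: kext_diff kmap_comp khom_def)
qed

text \<open>A standard simplex is connected, so each singular simplex of the two ends lies in a
  single one.\<close>

lemma chains_two_ends:
  assumes y: "y \<in> fch q (B \<times> {0, 1::real})"
  obtains g0 g1 where "g0 \<in> fch q B" "g1 \<in> fch q B" "y = kmap q (cyl_end 0) g0 + kmap q (cyl_end 1) g1"
proof -
  define S where "S t = {f. f ` standard_simplex q \<subseteq> B \<times> {t::real}}" for t
  define y1 where "y1 = pm_restrict (S 1) y"
  define y0 where "y0 = pm_restrict (- S 1) y"
  have end_S: "f \<in> S 0 \<or> f \<in> S 1" if f: "f \<in> keys y" for f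
  proof -
    have f': "singular_simplex q (top_of_set (B \<times> {0, 1})) f"
      using y f by (auto simp: field_chains_iff)
    then have im: "f ` standard_simplex q \<subseteq> B \<times> {0, 1}"
      by (simp add: singular_simplex_subtopology)
    have "continuous_map (simplex_space q) euclidean f"
      using f' by (simp add: singular_simplex_def continuous_map_in_subtopology)
    then have "continuous_map (simplex_space q) euclidean (\<lambda>x. snd (f x))"
      using continuous_map_compose[of _ _ f euclidean snd] by (simp add: comp_def continuous_on_snd)
    then have "connectedin euclidean ((\<lambda>x. snd (f x)) ` standard_simplex q)"
      by (rule connectedin_continuous_map_image) (simp add: connectedin_subtopology connectedin_standard_simplex)
    then have con: "connected ((\<lambda>x. snd (f x)) ` standard_simplex q)" by simp
    have "(\<lambda>x. snd (f x)) ` standard_simplex q \<subseteq> {0, 1}" using im by auto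
    then have "finite ((\<lambda>x. snd (f x)) ` standard_simplex q)" by (rule finite_subset) simp
    then obtain t where t: "(\<lambda>x. snd (f x)) ` standard_simplex q = {t}"
      using con nonempty_standard_simplex[of q] connected_finite_iff_sing by blast
    have "snd (f x) = t" if "x \<in> standard_simplex q" for x
      using t that by blast
    moreover have "t \<in> {0, 1}"
      using t \<open>(\<lambda>x. snd (f x)) ` standard_simplex q \<subseteq> {0, 1}\<close> by auto
    ultimately show ?thesis
      using im by (auto simp: S_def mem_Times_iff image_subset_iff)
  qed
  have y1: "y1 \<in> fch q (B \<times> {1})"
    by (rule chains_shrink[OF y]) (auto simp: y1_def keys_pm_restrict S_def)
  have y0: "y0 \<in> fch q (B \<times> {0})"
    by (rule chains_shrink[OF y]) (use end_S in \<open>auto simp: y0_def keys_pm_restrict S_def\<close>)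
  have fst: "kmap q (cyl_end t) (kmap q fst c) = c" "kmap q fst c \<in> fch q B"
    if c: "c \<in> fch q (B \<times> {t})" for t c
    using kmap_id[OF c, of "\<lambda>x. (fst x, t)"] c
    by (auto simp: kmap_comp intro!: kmap_chains_on[OF c] continuous_intros)
  have "y = y0 + y1" unfolding y0_def y1_def by (metis add.commute pm_restrict_split)
  then show ?thesis
    using that[of "kmap q fst y0" "kmap q fst y1"] fst[OF y0] fst[OF y1] by simp
qed

lemma cyl_ends_independent:
  assumes "x \<in> fch q B" "y \<in> fch q B" "kmap q (cyl_end 0) x + kmap q (cyl_end 1) y = 0"
  shows "y = 0"
proof -
  let ?S = "{f. f ` standard_simplex q \<subseteq> UNIV \<times> {1::real}}"
  have x: "kmap q (cyl_end 0) x \<in> fch q (B \<times> {0})"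
    by (rule kmap_chains_on[OF assms(1)]) (auto intro!: continuous_intros)
  have y: "kmap q (cyl_end 1) y \<in> fch q (B \<times> {1})"
    by (rule kmap_chains_on[OF assms(2)]) (auto intro!: continuous_intros)
  have *: "f \<notin> ?S" if "f ` standard_simplex q \<subseteq> B \<times> {0::real}" for f
  proof
    assume "f \<in> ?S"
    then have S: "f ` standard_simplex q \<subseteq> UNIV \<times> {1}" by simp
    obtain z where z: "z \<in> standard_simplex q" using nonempty_standard_simplex by blast
    have "f z \<in> B \<times> {0}" "f z \<in> UNIV \<times> {1}"
      using subsetD[OF that imageI[OF z]] subsetD[OF S imageI[OF z]] .
    then show False by auto
  qed
  have "pm_restrict ?S (kmap q (cyl_end 0) x) = 0"
  proof (intro pm_restrict_disjoint equals0I)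
    fix f assume "f \<in> keys (kmap q (cyl_end 0) x) \<inter> ?S"
    then have "f \<in> keys (kmap q (cyl_end 0) x)" "f \<in> ?S" by simp_all
    then show False using *[OF chains_image[OF x]] by metis
  qed
  moreover have "pm_restrict ?S (kmap q (cyl_end 1) y) = kmap q (cyl_end 1) y"
  proof (rule pm_restrict_same, rule subsetI, rule CollectI)
    fix f assume "f \<in> keys (kmap q (cyl_end 1) y)"
    show "f ` standard_simplex q \<subseteq> UNIV \<times> {1}"
      by (rule order_trans[OF chains_image[OF y \<open>f \<in> _\<close>] Sigma_mono]) simp_all
  qed
  moreover have "pm_restrict ?S (kmap q (cyl_end 0) x + kmap q (cyl_end 1) y) = 0"
    unfolding assms(3) by (simp add: pm_restrict_def)
  ultimately have "kmap q (cyl_end 1) y = 0"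
    by (simp add: pm_restrict_add)
  then have "kmap q fst (kmap q (cyl_end 1) y) = 0" by simp
  then show ?thesis
    using kmap_id[OF assms(2), of "\<lambda>x. x"] by (simp add: kmap_comp)
qed

text \<open>The deformation (b, t) to (b, (1 - s) t) pushes the cylinder to its bottom and keeps the
  bottom fixed, so the boundary stays in the bottom throughout.\<close>

lemma cyl_retract_bottom:
  assumes x: "x \<in> fch p (B \<times> {0..1})" and g: "g \<in> fch (p - 1) B"
    and bd: "field_boundary p x = kmap (p - 1) (cyl_end 0) g" and p0: "p = 0 \<Longrightarrow> g = 0"
  obtains x0 d where "x0 \<in> fch p (B \<times> {0})" "d \<in> fch (Suc p) (B \<times> {0..1})"
    "x = x0 + field_boundary (Suc p) d"
proof -
  define J :: "('a \<times> real) \<times> real \<Rightarrow> 'a \<times> real" where "J = (\<lambda>((b, t), s). (b, (1 - s) * t))"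
  have Jc: "continuous_on T J" for T
    unfolding J_def case_prod_beta by (intro continuous_intros)
  have Jim: "J \<in> (B \<times> {0..1}) \<times> {0..1} \<rightarrow> B \<times> {0..1}"
    by (auto simp: J_def mult_le_one)
  have d: "khom 0 p J x \<in> fch (Suc p) (B \<times> {0..1})"
    by (rule khom_chains[OF x Jc Jim])
  let ?k = "khom 0 (p - Suc 0) J (kmap (p - 1) (cyl_end 0) g)"
  have k: "?k \<in> fch p (B \<times> {0})"
  proof (cases p)
    case 0 then show ?thesis by (simp add: p0)
  next
    case (Suc q)
    have "khom 0 q (\<lambda>(x, t). J ((x, 0), t)) g \<in> fch (Suc q) (B \<times> {0})"
      using g Suc by (intro khom_chains) (auto simp: J_def case_prod_beta intro!: continuous_intros)
    then show ?thesis using Suc by (simp add: khom_kmap)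
  qed
  have k2: "kmap p (\<lambda>z. J (z, 1)) x \<in> fch p (B \<times> {0})"
    by (rule kmap_chains_on[OF x]) (auto simp: J_def case_prod_beta intro!: continuous_intros)
  have k3: "kmap p (\<lambda>z. J (z, 0)) x = x"
    by (rule kmap_id[OF x]) (auto simp: J_def)
  have "x = (kmap p (\<lambda>z. J (z, 1)) x - ?k) + field_boundary (Suc p) (- khom 0 p J x)"
    using khom_boundary[OF x, of 0 J] by (simp add: k3 bd field_boundary_uminus)
  then show ?thesis
    using that[OF field_chains_diff[OF k2 k] field_chains_uminus[OF d]] by blast
qed


section \<open>The effect of attaching a cylinder on singular chains\<close>

subsection \<open>Attaching a cylinder\<close>

text \<open>\<open>Y\<close> is obtained from \<open>Y0\<close> by attaching the cylinder over \<open>B\<close> along both ends; \<open>H\<close> deforms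
  \<open>Y\<close> so that a neighbourhood \<open>U\<close> of \<open>Y0\<close> is pushed into \<open>Y0\<close>, and replaces excision by a
  direct comparison of small chains with chains of the cylinder.\<close>

locale cylinder_attachment =
  fixes Y Y0 B U :: "'e::topological_space set"
    and F :: "'e \<times> real \<Rightarrow> 'e" and G :: "'e \<Rightarrow> 'e \<times> real" and H :: "'e \<times> real \<Rightarrow> 'e"
    and \<eta> :: "real \<Rightarrow> real \<Rightarrow> real"
  assumes B_Y0: "B \<subseteq> Y0" and Y0_Y: "Y0 \<subseteq> Y"
    and F_cont: "continuous_on (B \<times> {0..1}) F" and F_im: "F \<in> B \<times> {0..1} \<rightarrow> Y"
    and F_0: "\<And>b. b \<in> B \<Longrightarrow> F (b, 0) = b" and F_1: "\<And>b. b \<in> B \<Longrightarrow> F (b, 1) \<in> B"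
    and F_inner: "\<And>b t. b \<in> B \<Longrightarrow> 0 < t \<Longrightarrow> t < 1 \<Longrightarrow> F (b, t) \<notin> Y0"
    and G_cont: "continuous_on (Y - Y0) G" and G_im: "G \<in> Y - Y0 \<rightarrow> B \<times> {0<..<1}"
    and F_G: "\<And>y. y \<in> Y - Y0 \<Longrightarrow> F (G y) = y"
    and G_F: "\<And>b t. b \<in> B \<Longrightarrow> 0 < t \<Longrightarrow> t < 1 \<Longrightarrow> G (F (b, t)) = (b, t)"
    and H_cont: "continuous_on (Y \<times> {0..1}) H" and H_im: "H \<in> Y \<times> {0..1} \<rightarrow> Y"
    and H_0: "\<And>y. y \<in> Y \<Longrightarrow> H (y, 0) = y"
    and H_Y0: "\<And>y s. y \<in> Y0 \<Longrightarrow> s \<in> {0..1} \<Longrightarrow> H (y, s) \<in> Y0"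
    and H_U: "\<And>y. y \<in> U \<Longrightarrow> H (y, 1) \<in> Y0"
    and H_F: "\<And>b t s. b \<in> B \<Longrightarrow> t \<in> {0..1} \<Longrightarrow> s \<in> {0..1} \<Longrightarrow> H (F (b, t), s) = F (b, \<eta> t s)"
    and \<eta>_cont: "continuous_on ({0..1} \<times> {0..1}) (\<lambda>(t, s). \<eta> t s)"
    and \<eta>_im: "\<And>t s. t \<in> {0..1} \<Longrightarrow> s \<in> {0..1} \<Longrightarrow> \<eta> t s \<in> {0..1}"
    and \<eta>_0: "\<And>t. t \<in> {0..1} \<Longrightarrow> \<eta> t 0 = t"
    and \<eta>_end: "\<And>t s. t \<in> {0, 1} \<Longrightarrow> s \<in> {0..1} \<Longrightarrow> \<eta> t s = t"
    and \<eta>_U: "\<And>b t. b \<in> B \<Longrightarrow> t \<in> {0..1} \<Longrightarrow> F (b, t) \<in> U \<Longrightarrow> \<eta> t 1 \<in> {0, 1}"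
    and U_open: "openin (top_of_set Y) U" and inner_open: "openin (top_of_set Y) (Y - Y0)"
    and Y0_U: "Y0 \<subseteq> U"
begin

lemma G_im': "G \<in> Y - Y0 \<rightarrow> B \<times> {0..1}"
  using G_im by (auto simp: Pi_iff mem_Times_iff less_imp_le)

lemma G_pair: "y \<in> Y - Y0 \<Longrightarrow> G y = (b, t) \<Longrightarrow> b \<in> B \<and> t \<in> {0..1}"
  using funcset_mem[OF G_im'] by (metis mem_Sigma_iff)

abbreviation "P p \<equiv> khom 0 p F"

lemma P_chains: "b \<in> fch p B \<Longrightarrow> P p b \<in> fch (Suc p) Y"
  by (rule khom_chains[OF _ F_cont F_im])

lemma P_boundary:
  assumes "b \<in> fch p B"
  shows "field_boundary (Suc p) (P p b) = kmap p (\<lambda>b. F (b, 1)) b - b - P (p - Suc 0) (field_boundary p b)"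
  using khom_boundary[OF assms, of 0 F] kmap_id[OF assms, of "\<lambda>b. F (b, 0)"] F_0
  by simp

text \<open>Points of the open cylinder slide down to its bottom. This is the degree 0 counterpart
  of \<open>attaching_step\<close>.\<close>

lemma split_chain_0:
  assumes e: "e \<in> fch 0 Y"
  obtains a d where "a \<in> fch 0 Y0" "d \<in> fch 1 Y" "e = a + field_boundary 1 d"
proof -
  let ?S = "{f. f ` standard_simplex 0 \<subseteq> Y0}"
  let ?a = "pm_restrict ?S e" and ?w = "pm_restrict (- ?S) e"
  have a: "?a \<in> fch 0 Y0" by (rule chains_shrink[OF e]) (auto simp: keys_pm_restrict)
  have w: "?w \<in> fch 0 (Y - Y0)"
    by (rule chains_shrink[OF e]) (use chains_image[OF e] in \<open>auto simp: keys_pm_restrict standard_simplex_0\<close>)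
  have Gw: "kmap 0 G ?w \<in> fch 0 (B \<times> {0..1})"
    by (rule kmap_chains_on[OF w G_cont G_im'])
  obtain x0 d where x0: "x0 \<in> fch 0 (B \<times> {0})" and d: "d \<in> fch (Suc 0) (B \<times> {0..1})"
    and eq: "kmap 0 G ?w = x0 + field_boundary (Suc 0) d"
    by (rule cyl_retract_bottom[OF Gw, of 0]) auto
  have Fx0: "kmap 0 F x0 \<in> fch 0 Y0"
    by (rule kmap_chains_on[OF x0]) (use B_Y0 F_0 in \<open>auto intro: continuous_on_subset[OF F_cont]\<close>)
  have Fd: "kmap 1 F d \<in> fch 1 Y"
    using kmap_chains_on[OF d F_cont F_im] by simp
  have "?w = kmap 0 F (kmap 0 G ?w)"
    unfolding kmap_comp using kmap_id[OF w, of "\<lambda>y. F (G y)"] F_G by simp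
  also have "\<dots> = kmap 0 F x0 + field_boundary 1 (kmap 1 F d)"
    unfolding eq kext_add using kmap_boundary[OF d, of F] by simp
  finally have "e = (?a + kmap 0 F x0) + field_boundary 1 (kmap 1 F d)"
    using pm_restrict_split[of e ?S] by (simp add: add.assoc)
  then show ?thesis using that[OF field_chains_add[OF a Fx0] Fd] by blast
qed

text \<open>\<open>rethom\<close> is the deformation \<open>H\<close> in cylinder coordinates and
  \<open>ret1\<close> its final stage, which sends the part of the cylinder over \<open>U\<close> to
  the two ends.\<close>

definition "ret1 = (\<lambda>(b, t). (b, \<eta> t 1))"
definition "rethom = (\<lambda>((b, t), s). (b, \<eta> t s))"

lemma rethom_cont: "T \<subseteq> (B \<times> {0..1}) \<times> {0..1} \<Longrightarrow> continuous_on T rethom"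
  unfolding rethom_def case_prod_beta
  by (intro continuous_intros continuous_on_compose2[OF \<eta>_cont[unfolded case_prod_beta], of _ "\<lambda>x. (snd (fst x), snd x)", simplified]) auto

lemma ret1_cont: "T \<subseteq> B \<times> {0..1} \<Longrightarrow> continuous_on T ret1"
  unfolding ret1_def case_prod_beta
  by (intro continuous_intros continuous_on_compose2[OF \<eta>_cont[unfolded case_prod_beta], of _ "\<lambda>x. (snd x, 1)", simplified]) auto

text \<open>After enough subdivision each simplex of \<open>e\<close> lies in \<open>U\<close> or in
  the open cylinder \<open>Y - Y0\<close>. The final stage of \<open>H\<close> sends the former into
  \<open>Y0\<close>, while the latter are read in cylinder coordinates through \<open>G\<close>. The
  boundary of the cylinder part is that of \<open>qb\<close> up to simplices over \<open>U\<close>,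
  which \<open>ret1\<close> sends to the ends.\<close>

lemma comparison:
  fixes e :: "((nat \<Rightarrow> real) \<Rightarrow> 'e) \<Rightarrow>\<^sub>0 'k::field"
  assumes e: "e \<in> fch (Suc q) Y" and a: "a \<in> fch q Y0"
    and qb: "qb \<in> fch q (B \<times> {0..1})" and bd: "field_boundary (Suc q) e = kmap q F qb + a"
  obtains n u wh y where "u \<in> fch (Suc q) Y0" "wh \<in> fch (Suc q) (B \<times> {0..1})" "y \<in> fch q (B \<times> {0, 1})"
    "kmap (Suc q) (\<lambda>y. H (y, 1)) (ksd n (Suc q) e) = u + kmap (Suc q) F wh"
    "field_boundary (Suc q) wh = kmap q ret1 (ksd n q qb) + y"
proof -
  let ?BU = "(B \<times> {0..1}) \<inter> F -` U"
  have oU: "openin (top_of_set (B \<times> {0..1})) ?BU"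
    by (rule continuous_openin_preimage[OF F_cont F_im U_open])
  have oB: "openin (top_of_set (B \<times> {0..1::real})) (B \<times> {0<..<1})"
    by (rule openin_Times) (auto simp: openin_open intro!: exI[of _ "{0<..<1}"])
  have covY: "\<And>V. V \<in> {U, Y - Y0} \<Longrightarrow> openin (top_of_set Y) V" "topspace (top_of_set Y) \<subseteq> \<Union>{U, Y - Y0}"
    using U_open inner_open Y0_U by auto
  have end_U: "(b, t) \<in> ?BU" if "b \<in> B" "t = 0 \<or> t = 1" for b t
    using that F_0 F_1 B_Y0 Y0_U by auto
  have covB: "\<And>V. V \<in> {?BU, B \<times> {0<..<1}} \<Longrightarrow> openin (top_of_set (B \<times> {0..1})) V"
      "topspace (top_of_set (B \<times> {0..1})) \<subseteq> \<Union>{?BU, B \<times> {0<..<1}}"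
    using oU oB end_U by (auto simp: less_le)
  obtain N1 where N1: "\<And>n f. N1 \<le> n \<Longrightarrow> f \<in> keys (ksd n (Suc q) e) \<Longrightarrow> \<exists>V\<in>{U, Y - Y0}. f \<in> standard_simplex (Suc q) \<rightarrow> V"
    using ksd_small[OF e covY] by auto
  have "\<exists>N2. \<forall>n\<ge>N2. \<forall>f\<in>keys (ksd n q qb). \<exists>V\<in>{?BU, B \<times> {0<..<1}}. f \<in> standard_simplex q \<rightarrow> V"
    by (rule ksd_small[OF qb covB])
  then obtain N2 where N2: "\<forall>n\<ge>N2. \<forall>f\<in>keys (ksd n q qb). \<exists>V\<in>{?BU, B \<times> {0<..<1}}. f \<in> standard_simplex q \<rightarrow> V"
    ..
  define n where "n = max N1 N2"
  have U_Y: "U \<subseteq> Y" using U_open openin_imp_subset by blast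
  let ?V = "\<lambda>p. {f. f ` standard_simplex p \<subseteq> Y - Y0}"
  define se where "se = ksd n (Suc q) e"
  have se: "se \<in> fch (Suc q) Y" unfolding se_def by (rule ksd_chains[OF e])
  define w where "w = pm_restrict (?V (Suc q)) se"
  define u where "u = pm_restrict (- ?V (Suc q)) se"
  have w: "w \<in> fch (Suc q) (Y - Y0)" unfolding w_def by (rule chains_shrink[OF se]) (auto simp: keys_pm_restrict)
  have u: "u \<in> fch (Suc q) U" unfolding u_def
  proof (rule chains_shrink[OF se])
    fix f assume f: "f \<in> keys (pm_restrict (- ?V (Suc q)) se)"
    then obtain V where "V \<in> {U, Y - Y0}" "f \<in> standard_simplex (Suc q) \<rightarrow> V"
      using N1[of n f] by (auto simp: keys_pm_restrict n_def se_def)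
    then show "f ` standard_simplex (Suc q) \<subseteq> U" using f by (auto simp: keys_pm_restrict)
  qed (simp add: keys_pm_restrict)
  have uY: "u \<in> fch (Suc q) Y" by (rule field_chains_mono[OF u U_Y])
  have se_split: "se = u + w" unfolding u_def w_def using pm_restrict_split[of se "?V (Suc q)"] by (simp add: add.commute)
  define sz where "sz = ksd n q qb"
  have sz: "sz \<in> fch q (B \<times> {0..1})" unfolding sz_def by (rule ksd_chains[OF qb])
  let ?W = "{f. f ` standard_simplex q \<subseteq> B \<times> {0<..<1::real}}"
  define z1 where "z1 = pm_restrict ?W sz"
  define z2 where "z2 = pm_restrict (- ?W) sz"
  have sz_split: "sz = z1 + z2" unfolding z1_def z2_def by (rule pm_restrict_split)
  have z1: "z1 \<in> fch q (B \<times> {0<..<1})" unfolding z1_def by (rule chains_shrink[OF sz]) (auto simp: keys_pm_restrict)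
  have z2: "z2 \<in> fch q ?BU" unfolding z2_def
  proof (rule chains_shrink[OF sz])
    fix f assume f: "f \<in> keys (pm_restrict (- ?W) sz)"
    then have k: "f \<in> keys (ksd n q qb)" "\<not> f ` standard_simplex q \<subseteq> B \<times> {0<..<1}"
      by (simp_all only: keys_pm_restrict sz_def Int_iff Compl_iff mem_Collect_eq simp_thms)
    obtain V where "V \<in> {?BU, B \<times> {0<..<1}}" "f ` standard_simplex q \<subseteq> V"
      using N2[rule_format, OF _ k(1)] unfolding n_def image_subset_iff_funcset by auto
    then show "f ` standard_simplex q \<subseteq> ?BU" using k(2) by blast
  qed (simp add: keys_pm_restrict)
  have Fz1: "kmap q F z1 \<in> fch q (Y - Y0)"
    by (rule kmap_chains_on[OF z1 continuous_on_subset[OF F_cont]]) (use F_im F_inner in \<open>auto simp: Pi_iff\<close>)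
  have Fz2: "pm_restrict (?V q) (kmap q F z2) = 0"
  proof (rule pm_restrict_disjoint, rule equals0I)
    fix f assume "f \<in> keys (kmap q F z2) \<inter> ?V q"
    then have fk: "f \<in> keys (kmap q F z2)" and fV: "f ` standard_simplex q \<subseteq> Y - Y0"
      by simp_all
    obtain g where g: "g \<in> keys z2" and f: "f = simplex_map q F g"
      using subsetD[OF keys_kmap fk] by (auto simp only: image_iff)
    have gB: "g ` standard_simplex q \<subseteq> ?BU" by (rule chains_image[OF z2 g])
    have "\<not> g ` standard_simplex q \<subseteq> B \<times> {0<..<1}" using g by (auto simp: z2_def keys_pm_restrict)
    then obtain x where x: "x \<in> standard_simplex q" "g x \<notin> B \<times> {0<..<1}" by blast
    obtain b t where bt: "g x = (b, t)" by force
    have "(b, t) \<in> ?BU" using gB x bt by (metis imageI subsetD)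
    then have "b \<in> B" "t = 0 \<or> t = 1" using x bt by (auto simp: less_le)
    then have "F (b, t) \<in> Y0" using F_0 F_1 B_Y0 by auto
    moreover have "f x \<in> Y - Y0" using fV x by blast
    ultimately show False using x bt by (simp add: f simplex_map_def)
  qed
  have sa: "pm_restrict (?V q) (ksd n q a) = 0"
  proof (rule pm_restrict_disjoint, rule equals0I)
    fix f assume "f \<in> keys (ksd n q a) \<inter> ?V q"
    then have "f ` standard_simplex q \<subseteq> Y0" "f ` standard_simplex q \<subseteq> Y - Y0"
      using chains_image[OF ksd_chains[OF a]] by blast+
    then show False using nonempty_standard_simplex[of q] by fastforce
  qed
  define u1 where "u1 = pm_restrict (?V q) (field_boundary (Suc q) u)"
  have bu: "field_boundary (Suc q) u \<in> fch q U" by (rule field_boundary_chains_Suc[OF u])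
  have u1: "u1 \<in> fch q (U - Y0)" unfolding u1_def
    by (rule chains_shrink[OF bu]) (use chains_image[OF bu] in \<open>auto simp: keys_pm_restrict\<close>)
  have bw: "field_boundary (Suc q) w \<in> fch q (Y - Y0)" by (rule field_boundary_chains_Suc[OF w])
  have V_same: "pm_restrict (?V q) c = c" if "c \<in> fch q (Y - Y0)" for c :: "((nat \<Rightarrow> real) \<Rightarrow> 'e) \<Rightarrow>\<^sub>0 'k"
    by (rule pm_restrict_same) (use chains_image[OF that] in auto)
  have "field_boundary (Suc q) se = ksd n q (kmap q F qb + a)"
    unfolding se_def using ksd_boundary[OF e, of n] bd by simp
  also have "\<dots> = kmap q F sz + ksd n q a"
    unfolding kext_add sz_def using ksd_naturality[OF qb] by simp
  finally have "field_boundary (Suc q) w = kmap q F z1 + kmap q F z2 + ksd n q a - field_boundary (Suc q) u"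
    unfolding se_split sz_split kext_add field_boundary_add by (simp add: algebra_simps)
  \<comment> \<open>Keep only simplices inside the open cylinder. Those of the subdivided
    \<open>a\<close> lie in \<open>Y0\<close>, and those of \<open>kmap q F z2\<close> meet
    \<open>Y0\<close>, because their preimages touch an end.\<close>
  then have "pm_restrict (?V q) (field_boundary (Suc q) w)
      = pm_restrict (?V q) (kmap q F z1 + kmap q F z2 + ksd n q a - field_boundary (Suc q) u)" by simp
  then have bw_eq: "field_boundary (Suc q) w = kmap q F z1 - u1"
    unfolding pm_restrict_add pm_restrict_diff V_same[OF bw] V_same[OF Fz1] Fz2 sa u1_def by simp
  define \<kappa> where "\<kappa> = (\<lambda>y. ret1 (G y))"
  have \<kappa>_cont: "continuous_on (Y - Y0) \<kappa>" unfolding \<kappa>_def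
    by (rule continuous_on_compose2[OF ret1_cont[OF order_refl] G_cont]) (simp add: image_subset_iff_funcset G_im')
  have \<kappa>_im: "\<kappa> \<in> Y - Y0 \<rightarrow> B \<times> {0..1}"
  proof
    fix y assume y: "y \<in> Y - Y0"
    obtain b t where bt: "G y = (b, t)" by force
    show "\<kappa> y \<in> B \<times> {0..1}"
      using G_pair[OF y bt] \<eta>_im[of t 1] by (simp add: \<kappa>_def ret1_def bt)
  qed
  have \<kappa>_U: "\<kappa> \<in> U - Y0 \<rightarrow> B \<times> {0, 1}"
  proof
    fix y assume y: "y \<in> U - Y0"
    obtain b t where bt: "G y = (b, t)" by force
    have yV: "y \<in> Y - Y0" using y U_Y by auto
    have "b \<in> B" "t \<in> {0..1}" using G_pair[OF yV bt] by simp_all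
    moreover have "F (b, t) \<in> U" using F_G[OF yV] y by (simp add: bt)
    ultimately show "\<kappa> y \<in> B \<times> {0, 1}" using \<eta>_U by (auto simp: \<kappa>_def ret1_def bt)
  qed
  have F_\<kappa>: "F (\<kappa> y) = H (y, 1)" if y: "y \<in> Y - Y0" for y
  proof -
    obtain b t where bt: "G y = (b, t)" by force
    have "b \<in> B" "t \<in> {0..1}" using G_pair[OF y bt] by simp_all
    then show ?thesis using H_F[of b t 1] F_G[OF y] by (simp add: \<kappa>_def ret1_def bt)
  qed
  define wh where "wh = kmap (Suc q) \<kappa> w"
  have wh: "wh \<in> fch (Suc q) (B \<times> {0..1})" unfolding wh_def by (rule kmap_chains_on[OF w \<kappa>_cont \<kappa>_im])
  have Fwh: "kmap (Suc q) F wh = kmap (Suc q) (\<lambda>y. H (y, 1)) w"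
    unfolding wh_def kmap_comp by (rule kmap_eq_on[OF w F_\<kappa>])
  have \<kappa>z1: "kmap q \<kappa> (kmap q F z1) = kmap q ret1 z1"
    unfolding kmap_comp by (rule kmap_eq_on[OF z1]) (auto simp: \<kappa>_def G_F)
  define y where "y = - kmap q \<kappa> u1 - kmap q ret1 z2"
  have y1: "kmap q \<kappa> u1 \<in> fch q (B \<times> {0, 1})"
    by (rule kmap_chains_on[OF u1 continuous_on_subset[OF \<kappa>_cont] \<kappa>_U]) (use U_Y in auto)
  have y2: "kmap q ret1 z2 \<in> fch q (B \<times> {0, 1})"
  proof (rule kmap_chains_on[OF z2 ret1_cont])
    show "ret1 \<in> ?BU \<rightarrow> B \<times> {0, 1}"
    proof
      fix z assume z: "z \<in> ?BU"
      obtain b t where bt: "z = (b, t)" by force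
      show "ret1 z \<in> B \<times> {0, 1}" using z \<eta>_U[of b t] by (simp add: ret1_def bt)
    qed
  qed simp
  have y: "y \<in> fch q (B \<times> {0, 1})" unfolding y_def by (intro field_chains_diff field_chains_uminus y1 y2)
  have "field_boundary (Suc q) wh = kmap q \<kappa> (field_boundary (Suc q) w)"
    unfolding wh_def using kmap_boundary[OF w] by simp
  also have "\<dots> = kmap q ret1 sz + y"
    unfolding bw_eq kext_diff \<kappa>z1 sz_split kext_add y_def by simp
  finally have bwh: "field_boundary (Suc q) wh = kmap q ret1 (ksd n q qb) + y" unfolding sz_def .
  have Hu: "kmap (Suc q) (\<lambda>y. H (y, 1)) u \<in> fch (Suc q) Y0"
    by (rule kmap_chains_on[OF u]) (use H_U U_Y in \<open>auto intro!: continuous_on_compose2[OF H_cont] continuous_intros\<close>)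
  show ?thesis
    by (rule that[OF Hu wh y _ bwh]) (use se_split Fwh in \<open>simp add: se_def kext_add\<close>)
qed

text \<open>This is the long exact sequence of the attachment at chain level, with \<open>b\<close>
  the cylinder component of the boundary of \<open>e\<close>. By \<open>comparison\<close>,
  \<open>e\<close> is a chain of the cylinder up to chains of \<open>Y0\<close> and boundaries. The
  top end of the boundary of that chain is the cycle data \<open>b'\<close> over which
  \<open>e\<close> sweeps, and what remains can be pushed to the bottom, hence into
  \<open>Y0\<close>.\<close>

theorem attaching_step:
  assumes e: "e \<in> fch (Suc q) Y" and a: "a \<in> fch q Y0"
    and b: "b \<in> fch (q - 1) B" and bb: "field_boundary (q - 1) b = 0" and q0: "q = 0 \<Longrightarrow> b = 0"
    and bd: "field_boundary (Suc q) e = (if q = 0 then 0 else P (q - 1) b) + a"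
  obtains b' a' d where "b' \<in> fch q B" "field_boundary q b' = - b"
    "a' \<in> fch (Suc q) Y0" "d \<in> fch (Suc (Suc q)) Y"
    "e = P q b' + a' + field_boundary (Suc (Suc q)) d"
proof -
  define qb where "qb = (if q = 0 then 0 else kcyl 0 (q - 1) b)"
  have qb: "qb \<in> fch q (B \<times> {0..1})"
    using kcyl_chains_on[OF b, of 0] by (cases q) (auto simp: qb_def)
  have Fqb: "(if q = 0 then 0 else P (q - 1) b) = kmap q F qb"
    by (cases q) (simp_all add: qb_def khom_def)
  have bqb: "field_boundary q qb = kmap (q - 1) (cyl_end 1) b - kmap (q - 1) (cyl_end 0) b"
    using kcyl_boundary[OF b, of 0] bb q0 by (cases q) (simp_all add: qb_def)
  obtain n u wh y where u: "u \<in> fch (Suc q) Y0" and wh: "wh \<in> fch (Suc q) (B \<times> {0..1})"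
    and y: "y \<in> fch q (B \<times> {0, 1})"
    and He: "kmap (Suc q) (\<lambda>y. H (y, 1)) (ksd n (Suc q) e) = u + kmap (Suc q) F wh"
    and bwh: "field_boundary (Suc q) wh = kmap q ret1 (ksd n q qb) + y"
    by (rule comparison[OF e a qb bd[unfolded Fqb]])
  have rc: "continuous_on ((B \<times> {0..1}) \<times> {0..1}) rethom" by (rule rethom_cont) simp
  have rim: "rethom \<in> (B \<times> {0..1}) \<times> {0..1} \<rightarrow> B \<times> {0..1}"
    using \<eta>_im by (auto simp: rethom_def)
  \<comment> \<open>The homotopy \<open>rethom\<close> undoes subdivision and \<open>ret1\<close> on
    \<open>qb\<close>, so the boundary of f is \<open>qb\<close> itself plus chains over the two
    ends.\<close>
  define f where "f = wh - khom n q rethom qb"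
  have f: "f \<in> fch (Suc q) (B \<times> {0..1})"
    unfolding f_def by (intro field_chains_diff wh khom_chains[OF qb rc rim])
  define k where "k = khom n (q - 1) rethom (field_boundary q qb)"
  have k: "k \<in> fch q (B \<times> {0, 1})"
  proof (cases q)
    case 0 then show ?thesis by (simp add: k_def)
  next
    case (Suc q')
    have "khom n q' (\<lambda>(x, s). rethom ((x, t), s)) b \<in> fch (Suc q') (B \<times> {0, 1})" if "t \<in> {0, 1}" for t
    proof (rule khom_chains)
      show "continuous_on (B \<times> {0..1}) (\<lambda>(x, s). rethom ((x, t), s))"
        unfolding case_prod_beta
        by (rule continuous_on_compose2[OF rc]) (use that in \<open>auto intro!: continuous_intros\<close>)
      show "(\<lambda>(x, s). rethom ((x, t), s)) \<in> B \<times> {0..1} \<rightarrow> B \<times> {0, 1}"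
        using that \<eta>_end by (auto simp: rethom_def)
    qed (use b Suc in simp)
    then show ?thesis
      unfolding k_def bqb khom_diff khom_kmap using Suc by (auto intro: field_chains_diff)
  qed
  have bk: "field_boundary (Suc q) (khom n q rethom qb) = kmap q ret1 (ksd n q qb) - qb - k"
  proof -
    have 1: "kmap q (\<lambda>z. rethom (z, 0)) qb = qb"
      by (rule kmap_id[OF qb]) (auto simp: rethom_def \<eta>_0)
    have 2: "(\<lambda>z. rethom (z, 1)) = ret1" by (auto simp: rethom_def ret1_def)
    show ?thesis
      using khom_boundary[OF qb, of n rethom] unfolding 1 2 k_def by simp
  qed
  have bf: "field_boundary (Suc q) f = qb + (y + k)"
    unfolding f_def field_boundary_diff bwh bk by (simp add: algebra_simps)
  obtain g0 g1 where g0: "g0 \<in> fch q B" and g1: "g1 \<in> fch q B"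
    and yk: "y + k = kmap q (cyl_end 0) g0 + kmap q (cyl_end 1) g1"
    by (rule chains_two_ends[OF field_chains_add[OF y k]]) blast
  \<comment> \<open>Compare the top ends in the equation that the boundary of the boundary of
    \<open>f\<close> is 0.\<close>
  have bg1: "field_boundary q g1 = - b"
  proof (cases q)
    case 0 then show ?thesis by (simp add: q0)
  next
    case (Suc q')
    have "field_boundary q (field_boundary (Suc q) f) = 0"
      using field_boundary_boundary[OF f] by simp
    then have "kmap q' (cyl_end 0) (field_boundary q g0 - b) + kmap q' (cyl_end 1) (field_boundary q g1 + b) = 0"
      unfolding bf yk field_boundary_add bqb kmap_boundary[OF g0] kmap_boundary[OF g1] kext_add kext_diff
      using Suc by (simp add: algebra_simps)
    then have "field_boundary q g1 + b = 0"
      using g0 g1 b Suc field_boundary_chains_Suc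
      by (intro cyl_ends_independent[of "field_boundary q g0 - b" q' B])
        (auto intro!: field_chains_add field_chains_diff)
    then show ?thesis by (simp add: add_eq_0_iff)
  qed
  have kg1: "kcyl 0 q g1 \<in> fch (Suc q) (B \<times> {0..1})" by (rule kcyl_chains_on[OF g1])
  have bkg1: "field_boundary (Suc q) (kcyl 0 q g1) = kmap q (cyl_end 1) g1 - kmap q (cyl_end 0) g1 + qb"
    using kcyl_boundary[OF g1, of 0] bg1 by (cases q) (simp_all add: qb_def kext_uminus q0)
  \<comment> \<open>Subtracting the cylinder over \<open>g1\<close> cancels both \<open>qb\<close>
    and the top end, so the boundary of x lies in the bottom.\<close>
  define x where "x = f - kcyl 0 q g1"
  have x: "x \<in> fch (Suc q) (B \<times> {0..1})" unfolding x_def by (intro field_chains_diff f kg1)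
  have bx: "field_boundary (Suc q) x = kmap (Suc q - 1) (cyl_end 0) (g0 + g1)"
    unfolding x_def field_boundary_diff bf bkg1 yk by (simp add: kext_add)
  obtain x0 d0 where x0: "x0 \<in> fch (Suc q) (B \<times> {0})" and d0: "d0 \<in> fch (Suc (Suc q)) (B \<times> {0..1})"
    and x_eq: "x = x0 + field_boundary (Suc (Suc q)) d0"
    by (rule cyl_retract_bottom[OF x _ bx]) (use g0 g1 in \<open>auto intro: field_chains_add\<close>)
  have Fx0: "kmap (Suc q) F x0 \<in> fch (Suc q) Y0"
    by (rule kmap_chains_on[OF x0]) (use B_Y0 F_0 in \<open>auto intro: continuous_on_subset[OF F_cont]\<close>)
  have Fd0: "kmap (Suc (Suc q)) F d0 \<in> fch (Suc (Suc q)) Y"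
    by (rule kmap_chains_on[OF d0 F_cont F_im])
  have Ha: "khom n q H a \<in> fch (Suc q) Y0"
    by (rule khom_chains[OF a continuous_on_subset[OF H_cont]]) (use Y0_Y H_Y0 in auto)
  have He': "khom n (Suc q) H e \<in> fch (Suc (Suc q)) Y"
    by (rule khom_chains[OF e H_cont H_im])
  have nat: "kmap (Suc q) F (khom n q rethom qb) = khom n q H (kmap q F qb)"
    unfolding kmap_khom khom_kmap
    by (rule khom_eq_on[OF qb]) (auto simp: rethom_def H_F)
  have e_eq: "kmap (Suc q) (\<lambda>y. H (y, 1)) (ksd n (Suc q) e)
      = field_boundary (Suc (Suc q)) (khom n (Suc q) H e) + e + khom n q H (kmap q F qb + a)"
    using khom_boundary[OF e, of n H] kmap_id[OF e, of "\<lambda>y. H (y, 0)"] H_0 bd[unfolded Fqb]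
    by (simp add: algebra_simps)
  have "kmap (Suc q) F wh = kmap (Suc q) F x + P q g1 + khom n q H (kmap q F qb)"
    unfolding nat[symmetric] x_def f_def kext_diff by (simp add: khom_def)
  moreover have "kmap (Suc q) F x = kmap (Suc q) F x0 + field_boundary (Suc (Suc q)) (kmap (Suc (Suc q)) F d0)"
    unfolding x_eq kext_add using kmap_boundary[OF d0, of F] by simp
  ultimately have "e = P q g1 + (u - khom n q H a + kmap (Suc q) F x0)
      + field_boundary (Suc (Suc q)) (kmap (Suc (Suc q)) F d0 - khom n (Suc q) H e)"
    using e_eq unfolding He khom_add field_boundary_diff by (simp add: algebra_simps)
  then show ?thesis
    by (intro that[OF g1 bg1 _ field_chains_diff[OF Fd0 He']]) (auto intro!: field_chains_add field_chains_diff u Ha Fx0)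
qed

end


section \<open>Unique lifting and homotopy lifting\<close>

subsection \<open>Covering spaces with arbitrary total space\<close>

lemma evenly_covered_neighbourhood:
  assumes cov: "covering_space c p S" and y: "y \<in> c"
  obtains T u q where "p y \<in> T" "openin (top_of_set S) T" "y \<in> u" "openin (top_of_set c) u" "homeomorphism u T p q"
proof -
  have "p y \<in> S" using cov y by (auto simp: covering_space_def)
  then obtain T v where T: "p y \<in> T" "openin (top_of_set S) T" and v: "\<Union>v = c \<inter> p -` T"
    "\<forall>u\<in>v. openin (top_of_set c) u" "\<forall>u\<in>v. \<exists>q. homeomorphism u T p q"
    using cov unfolding covering_space_def by metis
  have "y \<in> \<Union>v" using v(1) T y by auto
  then show ?thesis using that T v by (metis UnionE)
qed

lemma covering_fibre_separated:
  assumes cov: "covering_space c p S" and y: "y1 \<in> c" "y2 \<in> c" "p y1 = p y2" "y1 \<noteq> y2"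
  obtains u1 u2 where "openin (top_of_set c) u1" "openin (top_of_set c) u2" "y1 \<in> u1" "y2 \<in> u2" "u1 \<inter> u2 = {}"
proof -
  have "p y1 \<in> S" using cov y by (auto simp: covering_space_def)
  then obtain T v where T: "p y1 \<in> T" and v: "\<Union>v = c \<inter> p -` T"
    "\<forall>u\<in>v. openin (top_of_set c) u" "pairwise disjnt v" "\<forall>u\<in>v. \<exists>q. homeomorphism u T p q"
    using cov unfolding covering_space_def by metis
  have "y1 \<in> \<Union>v" "y2 \<in> \<Union>v" using v(1) T y by auto
  then obtain u1 u2 where u: "u1 \<in> v" "u2 \<in> v" "y1 \<in> u1" "y2 \<in> u2" by blast
  have "u1 \<noteq> u2"
  proof
    assume "u1 = u2"
    moreover obtain q where "homeomorphism u1 T p q" using v u by blast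
    ultimately show False using u y by (metis homeomorphism_apply1)
  qed
  then have "u1 \<inter> u2 = {}" using v(3) u by (auto simp: pairwise_def disjnt_def)
  then show ?thesis using that u v(2) by blast
qed

text \<open>The set where the lifts agree is open because p is injective on a sheet, and closed
  because distinct points of one fibre lie in disjoint open sheets.\<close>

lemma covering_lift_unique:
  assumes cov: "covering_space c p S" and con: "connected T"
    and g1: "continuous_on T g1" "g1 \<in> T \<rightarrow> c" and g2: "continuous_on T g2" "g2 \<in> T \<rightarrow> c"
    and eq: "\<And>x. x \<in> T \<Longrightarrow> p (g1 x) = p (g2 x)" and a: "a \<in> T" "g1 a = g2 a" and x: "x \<in> T"
  shows "g1 x = g2 x"
proof -
  let ?A = "{x \<in> T. g1 x = g2 x}"
  have op: "openin (top_of_set T) (T \<inter> g1 -` u1 \<inter> g2 -` u2)"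
    if "openin (top_of_set c) u1" "openin (top_of_set c) u2" for u1 u2
    using openin_Int[OF continuous_openin_preimage[OF g1 that(1)] continuous_openin_preimage[OF g2 that(2)]]
    by (simp add: Int_ac)
  have "openin (top_of_set T) ?A"
  proof (subst openin_subopen, intro ballI)
    fix z assume z: "z \<in> ?A"
    then have "g1 z \<in> c" using funcset_mem[OF g1(2)] by blast
    from evenly_covered_neighbourhood[OF cov this] obtain W u q where
      u: "g1 z \<in> u" "openin (top_of_set c) u" "homeomorphism u W p q" by metis
    have "g1 w = g2 w" if "w \<in> T" "g1 w \<in> u" "g2 w \<in> u" for w
      using eq[OF that(1)] that u(3) by (metis homeomorphism_apply1)
    then have "T \<inter> g1 -` u \<inter> g2 -` u \<subseteq> ?A" by auto
    moreover have "z \<in> T \<inter> g1 -` u \<inter> g2 -` u" using z u by auto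
    ultimately show "\<exists>V. openin (top_of_set T) V \<and> z \<in> V \<and> V \<subseteq> ?A" using op[OF u(2) u(2)] by blast
  qed
  moreover have "closedin (top_of_set T) ?A"
  proof -
    have "openin (top_of_set T) (T - ?A)"
    proof (subst openin_subopen, intro ballI)
      fix z assume z: "z \<in> T - ?A"
      then have "g1 z \<in> c" "g2 z \<in> c" "p (g1 z) = p (g2 z)" "g1 z \<noteq> g2 z" using g1 g2 eq by auto
      from covering_fibre_separated[OF cov this] obtain u1 u2 where
        u: "openin (top_of_set c) u1" "openin (top_of_set c) u2" "g1 z \<in> u1" "g2 z \<in> u2" "u1 \<inter> u2 = {}" by metis
      have "T \<inter> g1 -` u1 \<inter> g2 -` u2 \<subseteq> T - ?A" using u(5) by auto
      moreover have "z \<in> T \<inter> g1 -` u1 \<inter> g2 -` u2" using z u by auto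
      ultimately show "\<exists>V. openin (top_of_set T) V \<and> z \<in> V \<and> V \<subseteq> T - ?A" using op[OF u(1,2)] by blast
    qed
    then show ?thesis by (auto simp: closedin_def)
  qed
  ultimately have "?A = {} \<or> ?A = T"
    using con unfolding connected_clopen by blast
  then show ?thesis using a x by blast
qed

text \<open>One time step: where the lift at time \<open>a\<close> lies in the sheet
  \<open>u\<close>, it continues up to time \<open>b\<close> by the inverse \<open>q\<close> of p on
  that sheet. The neighbourhood of \<open>y\<close> shrinks accordingly.\<close>

lemma covering_lift_homotopy_extend:
  fixes a b :: real
  assumes cov: "covering_space c p S"
    and h: "continuous_on (U \<times> {0..1}) h" "h \<in> U \<times> {0..1} \<rightarrow> S"
    and V: "openin (top_of_set U) V" "y \<in> V"
    and k: "continuous_on (V \<times> {0..a}) k" "k \<in> V \<times> {0..a} \<rightarrow> c"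
      "\<And>z. z \<in> V \<times> {0..a} \<Longrightarrow> p (k z) = h z" "\<And>z. z \<in> V \<Longrightarrow> k (z, 0) = f z"
    and ab: "0 \<le> a" "a \<le> b" "b \<le> 1"
    and N: "openin (top_of_set U) N" "y \<in> N" and W: "openin (top_of_set S) W"
      "\<And>z t. z \<in> N \<Longrightarrow> t \<in> {a..b} \<Longrightarrow> h (z, t) \<in> W"
    and u: "openin (top_of_set c) u" "k (y, a) \<in> u" "homeomorphism u W p q"
  shows "\<exists>V k. openin (top_of_set U) V \<and> y \<in> V \<and> continuous_on (V \<times> {0..b}) k \<and> k \<in> V \<times> {0..b} \<rightarrow> c \<and>
      (\<forall>z\<in>V \<times> {0..b}. p (k z) = h z) \<and> (\<forall>z\<in>V. k (z, 0) = f z)"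
proof -
  define V' where "V' = (V \<inter> (\<lambda>z. k (z, a)) -` u) \<inter> N"
  have "continuous_on V (\<lambda>z. k (z, a))"
    by (rule continuous_on_compose2[OF k(1)]) (use ab in \<open>auto intro!: continuous_intros\<close>)
  then have "openin (top_of_set V) (V \<inter> (\<lambda>z. k (z, a)) -` u)"
    by (rule continuous_openin_preimage[OF _ _ u(1)]) (use k(2) ab in auto)
  then have oV': "openin (top_of_set U) V'"
    unfolding V'_def using openin_trans V(1) N(1) openin_Int by blast
  have yV': "y \<in> V'" using V N u by (auto simp: V'_def)
  have V'V: "V' \<subseteq> V" "V' \<subseteq> N" by (auto simp: V'_def)
  have VU: "V \<subseteq> U" using V(1) openin_imp_subset by blast
  have u_c: "u \<subseteq> c" using u(1) openin_imp_subset by blast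
  define k' where "k' = (\<lambda>z. if snd z \<le> a then k z else q (h z))"
  have un: "V' \<times> {0..a} \<union> V' \<times> {a..b} = V' \<times> {0..b}" using ab by auto
  have hW: "h z \<in> W" if "z \<in> V' \<times> {a..b}" for z
    using W(2)[of "fst z" "snd z"] that V'V by auto
  have glue: "k (z, a) = q (h (z, a))" if "z \<in> V'" for z
  proof -
    have "k (z, a) \<in> u" using that by (auto simp: V'_def)
    then have "q (p (k (z, a))) = k (z, a)" using u(3) by (simp add: homeomorphism_apply1)
    then show ?thesis using k(3)[of "(z, a)"] that V'V ab by auto
  qed
  have "continuous_on (V' \<times> {0..a} \<union> V' \<times> {a..b}) (\<lambda>z. if snd z \<le> a then k z else q (h z))"
  proof (rule continuous_on_cases_local)
    show "closedin (top_of_set (V' \<times> {0..a} \<union> V' \<times> {a..b})) (V' \<times> {0..a})"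
      "closedin (top_of_set (V' \<times> {0..a} \<union> V' \<times> {a..b})) (V' \<times> {a..b})"
      unfolding un by (rule closedin_Times; use ab in \<open>auto intro: closed_subset\<close>)+
    show "continuous_on (V' \<times> {0..a}) k" by (rule continuous_on_subset[OF k(1)]) (use V'V in auto)
    show "continuous_on (V' \<times> {a..b}) (\<lambda>z. q (h z))"
    proof (rule continuous_on_compose2[of W q])
      show "continuous_on W q" using u(3) by (simp add: homeomorphism_def)
      show "continuous_on (V' \<times> {a..b}) h" by (rule continuous_on_subset[OF h(1)]) (use V'V VU ab in auto)
    qed (use hW in auto)
  qed (use glue in \<open>auto simp: antisym\<close>)
  then have "continuous_on (V' \<times> {0..b}) k'" unfolding un k'_def .
  moreover have "k' z \<in> c \<and> p (k' z) = h z" if z: "z \<in> V' \<times> {0..b}" for z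
  proof (cases "snd z \<le> a")
    case True
    then have "z \<in> V \<times> {0..a}" using z V'V by auto
    then show ?thesis using True k by (auto simp: k'_def)
  next
    case False
    then have "h z \<in> W" using z by (intro hW) auto
    then have "q (h z) \<in> u" "p (q (h z)) = h z" using u(3) by (auto simp: homeomorphism_def)
    then show ?thesis using False u_c by (auto simp: k'_def)
  qed
  moreover have "k' (z, 0) = f z" if "z \<in> V'" for z
    using that V'V k(4) ab by (auto simp: k'_def)
  ultimately show ?thesis using oV' yV' by (intro exI[of _ V'] exI[of _ k']) auto
qed

text \<open>The unit interval is covered by open sets of times during which h stays, near
  \<open>y\<close>, in an evenly covered set. Steps shorter than a Lebesgue number of this cover are
  handled one by one.\<close>

lemma covering_lift_homotopy_local:
  assumes cov: "covering_space c p S"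
    and h: "continuous_on (U \<times> {0..1}) h" "h \<in> U \<times> {0..1} \<rightarrow> S"
    and f: "continuous_on U f" "f \<in> U \<rightarrow> c" "\<And>y. y \<in> U \<Longrightarrow> p (f y) = h (y, 0)" and y: "y \<in> U"
  shows "\<exists>V k. openin (top_of_set U) V \<and> y \<in> V \<and> continuous_on (V \<times> {0..1::real}) k \<and> k \<in> V \<times> {0..1} \<rightarrow> c \<and>
      (\<forall>z\<in>V \<times> {0..1}. p (k z) = h z) \<and> (\<forall>z\<in>V. k (z, 0) = f z)"
proof -
  define Q where "Q t J N W v \<longleftrightarrow> open J \<and> t \<in> J \<and> openin (top_of_set U) N \<and> y \<in> N \<and> openin (top_of_set S) W \<and>
      (\<forall>z\<in>N. \<forall>s\<in>J \<inter> {0..1}. h (z, s) \<in> W) \<and> \<Union>v = c \<inter> p -` W \<and>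
      (\<forall>u\<in>v. openin (top_of_set c) u) \<and> (\<forall>u\<in>v. \<exists>q. homeomorphism u W p q)" for t J N W v
  have "\<exists>J N W v. Q t J N W v" if t: "t \<in> {0..1}" for t
  proof -
    have "h (y, t) \<in> S" using h y t by auto
    then obtain W v where W: "h (y, t) \<in> W" "openin (top_of_set S) W" "\<Union>v = c \<inter> p -` W"
      "\<forall>u\<in>v. openin (top_of_set c) u" "\<forall>u\<in>v. \<exists>q. homeomorphism u W p q"
      using cov unfolding covering_space_def by metis
    have "openin (top_of_set (U \<times> {0..1})) (U \<times> {0..1} \<inter> h -` W)"
      by (rule continuous_openin_preimage[OF h W(2)])
    then obtain O' where O': "open O'" "U \<times> {0..1} \<inter> h -` W = U \<times> {0..1} \<inter> O'"
      by (auto simp: openin_open)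
    have "(y, t) \<in> U \<times> {0..1} \<inter> h -` W" using W(1) y t by simp
    then have "(y, t) \<in> O'" unfolding O'(2) by simp
    then obtain A J where AJ: "open A" "open J" "(y, t) \<in> A \<times> J" "A \<times> J \<subseteq> O'"
      using open_prod_elim[OF O'(1)] by metis
    have "h (z, s) \<in> W" if "z \<in> U \<inter> A" "s \<in> J \<inter> {0..1}" for z s
    proof -
      have "(z, s) \<in> U \<times> {0..1} \<inter> O'" using that subsetD[OF AJ(4), of "(z, s)"] by simp
      then show ?thesis unfolding O'(2)[symmetric] by simp
    qed
    moreover have "openin (top_of_set U) (U \<inter> A)" using AJ(1) by blast
    ultimately show ?thesis using W AJ y unfolding Q_def
      by (intro exI[of _ J] exI[of _ "U \<inter> A"] exI[of _ W] exI[of _ v]) auto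
  qed
  then obtain J N W v where Q: "\<And>t. t \<in> {0..1} \<Longrightarrow> Q t (J t) (N t) (W t) (v t)"
    by metis
  note JN = Q[unfolded Q_def]
  obtain e where e: "e > 0" "\<And>x. x \<in> {0..1::real} \<Longrightarrow> \<exists>G\<in>J ` {0..1}. ball x e \<subseteq> G"
    by (rule Heine_Borel_lemma[of "{0..1::real}" "J ` {0..1}"]) (use JN in auto)
  obtain n :: nat where n: "inverse (Suc n) < e" using e(1) reals_Archimedean by blast
  have step: "i \<le> Suc n \<Longrightarrow> \<exists>V k. openin (top_of_set U) V \<and> y \<in> V \<and>
      continuous_on (V \<times> {0..real i / Suc n}) k \<and> k \<in> V \<times> {0..real i / Suc n} \<rightarrow> c \<and>
      (\<forall>z\<in>V \<times> {0..real i / Suc n}. p (k z) = h z) \<and> (\<forall>z\<in>V. k (z, 0) = f z)" for i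
  proof (induction i)
    case 0
    have "continuous_on (U \<times> {0..real 0 / Suc n}) (\<lambda>z. f (fst z))"
      by (rule continuous_on_compose2[OF f(1)]) (auto intro!: continuous_intros)
    then show ?case using f y
      by (intro exI[of _ U] exI[of _ "\<lambda>z. f (fst z)"]) auto
  next
    case (Suc i)
    let ?a = "real i / Suc n" and ?b = "real (Suc i) / Suc n"
    have ab: "0 \<le> ?a" "?a \<le> ?b" "?b \<le> 1" using Suc.prems by (auto simp: divide_simps)
    obtain V k where V: "openin (top_of_set U) V" "y \<in> V" and k: "continuous_on (V \<times> {0..?a}) k"
      "k \<in> V \<times> {0..?a} \<rightarrow> c" "\<And>z. z \<in> V \<times> {0..?a} \<Longrightarrow> p (k z) = h z" "\<And>z. z \<in> V \<Longrightarrow> k (z, 0) = f z"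
      using Suc by (metis Suc_leD)
    have a01: "?a \<in> {0..1}" using ab by auto
    obtain t where t: "t \<in> {0..1}" "ball ?a e \<subseteq> J t" using e(2)[OF a01] by auto
    have ba: "?b - ?a = inverse (Suc n)" by (simp add: field_simps)
    have J: "s \<in> J t \<inter> {0..1}" if "s \<in> {?a..?b}" for s
    proof -
      have "s \<in> {0..1}" using that ab by (meson atLeastAtMost_iff order_trans)
      moreover have "s \<in> ball ?a e" using that ba n by (auto simp: dist_real_def)
      ultimately show ?thesis using t(2) by blast
    qed
    note Jt = JN[OF t(1)]
    have hW: "h (z, s) \<in> W t" if "z \<in> N t" "s \<in> {?a..?b}" for z s
      using Jt[THEN conjunct2, THEN conjunct2, THEN conjunct2, THEN conjunct2, THEN conjunct2, THEN conjunct1]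
        J[OF that(2)] that(1) by blast
    have yV: "(y, ?a) \<in> V \<times> {0..?a}" using V(2) ab by simp
    have "k (y, ?a) \<in> c" "p (k (y, ?a)) = h (y, ?a)" using funcset_mem[OF k(2) yV] k(3)[OF yV] .
    moreover have "h (y, ?a) \<in> W t" by (rule hW) (use Jt ab in auto)
    ultimately have "k (y, ?a) \<in> \<Union>(v t)" using Jt by auto
    then obtain u where u: "u \<in> v t" "k (y, ?a) \<in> u" by blast
    then obtain q where q: "homeomorphism u (W t) p q" using Jt by blast
    show ?case
      by (rule covering_lift_homotopy_extend[OF cov h V k ab _ _ _ hW _ u(2) q]) (use Jt u in auto)
  qed
  show ?thesis using step[of "Suc n"] by simp
qed

lemma connected_slice: "connected ({y} \<times> {0..1::real})"
  by (intro connected_Times) auto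

text \<open>The local lifts agree on overlaps, since each slice over a point y is connected and they
  share the value \<open>f y\<close> at time 0; hence they paste.\<close>

lemma covering_lift_homotopy:
  assumes cov: "covering_space c p S"
    and h: "continuous_on (U \<times> {0..1::real}) h" "h \<in> U \<times> {0..1} \<rightarrow> S"
    and f: "continuous_on U f" "f \<in> U \<rightarrow> c" "\<And>y. y \<in> U \<Longrightarrow> p (f y) = h (y, 0)"
  obtains k where "continuous_on (U \<times> {0..1}) k" "k \<in> U \<times> {0..1} \<rightarrow> c"
    "\<And>y. y \<in> U \<Longrightarrow> k (y, 0) = f y" "\<And>z. z \<in> U \<times> {0..1} \<Longrightarrow> p (k z) = h z"
proof -
  obtain V k where Vk: "\<And>y. y \<in> U \<Longrightarrow> openin (top_of_set U) (V y) \<and> y \<in> V y \<and> continuous_on (V y \<times> {0..1::real}) (k y) \<and>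
      k y \<in> V y \<times> {0..1} \<rightarrow> c \<and> (\<forall>z\<in>V y \<times> {0..1}. p (k y z) = h z) \<and> (\<forall>z\<in>V y. k y (z, 0) = f z)"
    using covering_lift_homotopy_local[OF cov h f] by metis
  have agree: "k y z = k y' z" if "y \<in> U" "y' \<in> U" "z \<in> V y \<times> {0..1}" "z \<in> V y' \<times> {0..1}" for y y' z
  proof (rule covering_lift_unique[OF cov connected_slice[of "fst z"], where a = "(fst z, 0)"])
    show "continuous_on ({fst z} \<times> {0..1}) (k y)" "continuous_on ({fst z} \<times> {0..1}) (k y')"
      using Vk[OF that(1)] Vk[OF that(2)] that(3,4) by (auto elim!: continuous_on_subset)
  qed (use Vk that in \<open>auto simp: Pi_iff\<close>)
  obtain g where g: "continuous_map (top_of_set (U \<times> {0..1})) (top_of_set c) g"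
    "\<And>x y. y \<in> U \<Longrightarrow> x \<in> topspace (top_of_set (U \<times> {0..1})) \<inter> V y \<times> {0..1} \<Longrightarrow> g x = k y x"
  proof (rule pasting_lemma_exists[of "top_of_set (U \<times> {0..1})" "\<lambda>y. V y \<times> {0..1}" U "top_of_set c" k])
    show "topspace (top_of_set (U \<times> {0..1})) \<subseteq> (\<Union>y\<in>U. V y \<times> {0..1})" using Vk by auto
    fix y assume y: "y \<in> U"
    show "openin (top_of_set (U \<times> {0..1})) (V y \<times> {0..1})" using Vk[OF y] by (intro openin_Times) auto
    have "V y \<subseteq> U" using Vk[OF y] openin_imp_subset by blast
    then have "U \<times> {0..1} \<inter> V y \<times> {0..1::real} = V y \<times> {0..1}" by auto
    then show "continuous_map (subtopology (top_of_set (U \<times> {0..1})) (V y \<times> {0..1})) (top_of_set c) (k y)"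
      using Vk[OF y] by (simp add: subtopology_subtopology)
    fix y' x assume "y' \<in> U" "x \<in> topspace (top_of_set (U \<times> {0..1::real})) \<inter> V y \<times> {0..1} \<inter> V y' \<times> {0..1}"
    then show "k y x = k y' x" using y by (intro agree) simp_all
  qed (erule that, assumption)
  have gk: "g x = k (fst x) x" if "x \<in> U \<times> {0..1}" for x
    using g(2)[of "fst x" x] that Vk by auto
  show ?thesis
  proof
    show "continuous_on (U \<times> {0..1}) g" "g \<in> U \<times> {0..1} \<rightarrow> c"
      using g(1) by (auto simp: continuous_map_in_subtopology)
    show "g (y, 0) = f y" if "y \<in> U" for y using gk[of "(y, 0)"] Vk that by auto
    show "p (g z) = h z" if "z \<in> U \<times> {0..1}" for z using gk[OF that] Vk[of "fst z"] that by auto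
  qed
qed

lemma covering_lift_path:
  assumes cov: "covering_space c p S" and g: "path g" "path_image g \<subseteq> S" and a: "a \<in> c" "p a = g 0"
  obtains k where "path k" "path_image k \<subseteq> c" "k 0 = a" "\<And>t. t \<in> {0..1} \<Longrightarrow> p (k t) = g t"
proof -
  have gc: "continuous_on {0..1} g" using g(1) by (simp add: path_def)
  obtain k where k: "continuous_on ({0::real} \<times> {0..1::real}) k" "k \<in> {0::real} \<times> {0..1} \<rightarrow> c"
    "\<And>y. y \<in> {0::real} \<Longrightarrow> k (y, 0) = a" "\<And>z. z \<in> {0::real} \<times> {0..1} \<Longrightarrow> p (k z) = (\<lambda>z. g (snd z)) z"
  proof (rule covering_lift_homotopy[OF cov, of "{0::real}" "\<lambda>z. g (snd z)" "\<lambda>_. a"])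
    show "continuous_on ({0::real} \<times> {0..1}) (\<lambda>z. g (snd z))"
      by (rule continuous_on_compose2[OF gc]) (auto intro!: continuous_intros)
  qed (use g a in \<open>auto simp: path_image_def\<close>)
  show ?thesis
  proof
    show "path (\<lambda>t. k (0, t))" unfolding path_def
      by (rule continuous_on_compose2[OF k(1)]) (auto intro!: continuous_intros)
  qed (use k in \<open>auto simp: path_image_def\<close>)
qed

lemma covering_lift_path_unique:
  assumes cov: "covering_space c p S" and "path g1" "path_image g1 \<subseteq> c" "path g2" "path_image g2 \<subseteq> c"
    and "\<And>t. t \<in> {0..1} \<Longrightarrow> p (g1 t) = p (g2 t)" and "a \<in> {0..1}" "g1 a = g2 a" "t \<in> {0..1}"
  shows "g1 t = g2 t"
  by (rule covering_lift_unique[OF cov connected_Icc, of _ _ g1 g2 a])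
    (use assms in \<open>auto simp: path_def path_image_def\<close>)

text \<open>In the lifted homotopy the edge of final points lies over a single point, so by
  uniqueness it is constant.\<close>

lemma covering_lift_homotopic_finish:
  assumes cov: "covering_space c p S" and hom: "homotopic_paths S g1 g2"
    and k1: "path k1" "path_image k1 \<subseteq> c" "\<And>t. t \<in> {0..1} \<Longrightarrow> p (k1 t) = g1 t"
    and k2: "path k2" "path_image k2 \<subseteq> c" "\<And>t. t \<in> {0..1} \<Longrightarrow> p (k2 t) = g2 t"
    and st: "k1 0 = k2 0"
  shows "k1 1 = k2 1"
proof -
  obtain h where h: "continuous_on ({0..1::real} \<times> {0..1::real}) h" "h \<in> {0..1} \<times> {0..1} \<rightarrow> S"
    "\<And>x. x \<in> {0..1} \<Longrightarrow> h (0, x) = g1 x" "\<And>x. x \<in> {0..1} \<Longrightarrow> h (1, x) = g2 x"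
    "\<And>t. t \<in> {0..1} \<Longrightarrow> h (t, 0) = g1 0" "\<And>t. t \<in> {0..1} \<Longrightarrow> h (t, 1) = g1 1"
  proof -
    obtain h where "continuous_on ({0..1::real} \<times> {0..1::real}) h" "h \<in> {0..1} \<times> {0..1} \<rightarrow> S"
      "\<forall>x\<in>{0..1}. h (0, x) = g1 x" "\<forall>x\<in>{0..1}. h (1, x) = g2 x"
      "\<forall>t\<in>{0..1}. h (t, 0) = g1 0 \<and> h (t, 1) = g1 1"
      using hom unfolding homotopic_paths by (auto simp: pathstart_def pathfinish_def)
    then show ?thesis by (intro that[of h]) auto
  qed
  have k10: "k1 0 \<in> c" using k1(2) by (auto simp: path_image_def)
  obtain k where k: "continuous_on ({0..1::real} \<times> {0..1::real}) k" "k \<in> {0..1} \<times> {0..1} \<rightarrow> c"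
    "\<And>s. s \<in> {0..1} \<Longrightarrow> k (s, 0) = k1 0" "\<And>z. z \<in> {0..1} \<times> {0..1} \<Longrightarrow> p (k z) = h z"
  proof (rule covering_lift_homotopy[OF cov h(1,2), of "\<lambda>_. k1 0"])
    show "p (k1 0) = h (s, 0)" if "s \<in> {0..1}" for s using h(5)[OF that] k1(3)[of 0] by simp
  qed (use k10 in auto)
  have path_k: "path (\<lambda>t. k (s, t))" "path_image (\<lambda>t. k (s, t)) \<subseteq> c" if "s \<in> {0..1}" for s
    using that k(2) unfolding path_def path_image_def
    by (auto intro!: continuous_on_compose2[OF k(1)] continuous_intros)
  have path_k': "path (\<lambda>s. k (s, 1))" "path_image (\<lambda>s. k (s, 1)) \<subseteq> c"
    using k(2) unfolding path_def path_image_def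
    by (auto intro!: continuous_on_compose2[OF k(1)] continuous_intros)
  have "k (0, 1) = k1 1"
    by (rule covering_lift_path_unique[OF cov path_k k1(1,2), where a = 0]) (use k k1 h in auto)
  moreover have "k (1, 1) = k2 1"
    by (rule covering_lift_path_unique[OF cov path_k k2(1,2), where a = 0]) (use k k2 h st in auto)
  moreover have "k (1, 1) = k (0, 1)"
    by (rule covering_lift_path_unique[OF cov path_k', of "\<lambda>_. k (0, 1)" 0])
      (use k h path_k'(2) in \<open>auto simp: path_image_def path_def\<close>)
  ultimately show ?thesis by simp
qed


section \<open>Lifted coordinate rotations and the cylinder structure of the cover\<close>

subsection \<open>Flows on covers of toric complexes\<close>

definition supp :: "complex ^ 'v \<Rightarrow> 'v set"
  where "supp x = {v. x $ v \<noteq> 1}"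

definition setc :: "'v \<Rightarrow> complex \<Rightarrow> complex ^ 'v \<Rightarrow> complex ^ 'v"
  where "setc v z x = (\<chi> w. if w = v then z else x $ w)"

lemma toric_complex_supp:
  fixes L :: "'v::finite set set"
  shows "toric_complex L = {x \<in> torus. supp x \<in> L}"
proof -
  have "x \<in> torus_cell \<sigma> \<longleftrightarrow> x \<in> torus \<and> supp x = \<sigma>" for x :: "complex ^ 'v" and \<sigma>
    by (auto simp: torus_cell_def supp_def)
  then show ?thesis by (auto simp: toric_complex_def)
qed

lemma setc_nth [simp]: "setc v z x $ w = (if w = v then z else x $ w)"
  by (simp add: setc_def)

lemma setc_setc [simp]: "setc v z (setc v z' x) = setc v z x"
  by (simp add: setc_def vec_eq_iff)

lemma setc_commute: "v \<noteq> w \<Longrightarrow> setc v z (setc w z' x) = setc w z' (setc v z x)"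
  by (auto simp: setc_def vec_eq_iff)

lemma setc_same [simp]: "setc v (x $ v) x = x"
  by (simp add: setc_def vec_eq_iff)

lemma setc_eq: "z = x $ v \<Longrightarrow> setc v z x = x"
  by simp

lemma supp_setc: "supp (setc v z x) = (if z = 1 then supp x - {v} else insert v (supp x))"
  by (auto simp: supp_def)

lemma torus_setc: "x \<in> torus \<Longrightarrow> norm z = 1 \<Longrightarrow> setc v z x \<in> torus"
  by (simp add: torus_def)

lemma continuous_on_setc:
  assumes "continuous_on S f" "continuous_on S g"
  shows "continuous_on S (\<lambda>x. setc v (f x) (g x))"
  unfolding setc_def
proof (rule continuous_on_vec_lambda)
  fix w show "continuous_on S (\<lambda>x. if w = v then f x else g x $ w)"
    using assms by (cases "w = v") (auto intro!: continuous_intros)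
qed

lemma cis_eq_1_iff: "cis (2 * pi * t) = 1 \<longleftrightarrow> t \<in> \<int>"
proof
  assume "cis (2 * pi * t) = 1"
  then have "cos (2 * pi * t) = 1" by (metis cis.sel(1) one_complex.sel(1))
  then obtain n :: int where "2 * pi * t = of_int n * 2 * pi" using cos_one_2pi_int by metis
  then have "t = of_int n" by simp
  then show "t \<in> \<int>" by simp
next
  assume "t \<in> \<int>" then obtain n where "t = of_int n" by (elim Ints_cases)
  then show "cis (2 * pi * t) = 1" using cis_multiple_2pi[of t] by (simp add: mult_ac)
qed

lemma cis_inner_ne_1: "0 < t \<Longrightarrow> t < 1 \<Longrightarrow> cis (2 * pi * t) \<noteq> 1"
  unfolding cis_eq_1_iff by (auto elim!: Ints_cases)

text \<open>The rotation of the circle by \<open>- arcsin (Im z)\<close> collapses the right half circle to \<open>1\<close>.\<close>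

definition turn :: "real \<Rightarrow> real \<Rightarrow> real"
  where "turn t s = t - s * (arcsin (sin (2 * pi * t)) / (2 * pi))"

lemma turn_1_cases:
  assumes "t \<in> {0..1}"
  shows "t \<le> 1/4 \<and> turn t 1 = 0 \<or> 1/4 \<le> t \<and> t \<le> 3/4 \<and> turn t 1 = 2 * t - 1/2 \<or> 3/4 \<le> t \<and> turn t 1 = 1"
proof -
  consider "t \<le> 1/4" | "1/4 \<le> t" "t \<le> 3/4" | "3/4 \<le> t" by linarith
  then show ?thesis
  proof cases
    case 1
    have "arcsin (sin (2 * pi * t)) = 2 * pi * t"
    proof (rule arcsin_sin)
      have "2 * pi * t \<ge> 0" using assms by simp
      then show "- (pi / 2) \<le> 2 * pi * t" using pi_gt_zero by linarith
      show "2 * pi * t \<le> pi / 2" using mult_left_mono[OF 1, of "2 * pi"] by simp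
    qed
    then show ?thesis using 1 by (simp add: turn_def)
  next
    case 2
    have "arcsin (sin (pi - 2 * pi * t)) = pi - 2 * pi * t"
    proof (rule arcsin_sin)
      show "- (pi / 2) \<le> pi - 2 * pi * t" using mult_left_mono[OF 2(2), of "2 * pi"] pi_gt_zero by linarith
      show "pi - 2 * pi * t \<le> pi / 2" using mult_left_mono[OF 2(1), of "2 * pi"] pi_gt_zero by linarith
    qed
    then have "arcsin (sin (2 * pi * t)) = pi - 2 * pi * t" by simp
    then have "turn t 1 = 2 * t - 1/2" by (simp add: turn_def field_simps)
    then show ?thesis using 2 by blast
  next
    case 3
    have "arcsin (sin (2 * pi * t - 2 * pi)) = 2 * pi * t - 2 * pi"
    proof (rule arcsin_sin)
      show "- (pi / 2) \<le> 2 * pi * t - 2 * pi" using mult_left_mono[OF 3, of "2 * pi"] pi_gt_zero by linarith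
      have "2 * pi * t - 2 * pi \<le> 0" using assms by simp
      then show "2 * pi * t - 2 * pi \<le> pi / 2" using pi_gt_zero by linarith
    qed
    moreover have "sin (2 * pi * t - 2 * pi) = sin (2 * pi * t)" by (simp add: sin_diff)
    ultimately have "arcsin (sin (2 * pi * t)) = 2 * pi * t - 2 * pi" by simp
    then have "turn t 1 = 1" by (simp add: turn_def field_simps)
    then show ?thesis using 3 by blast
  qed
qed

lemma turn_convex: "turn t s = (1 - s) * t + s * turn t 1"
  by (simp add: turn_def algebra_simps)

lemma turn_in_unit: "t \<in> {0..1} \<Longrightarrow> s \<in> {0..1} \<Longrightarrow> turn t s \<in> {0..1}"
proof -
  assume t: "t \<in> {0..1}" and s: "s \<in> {0..1}"
  have 1: "turn t 1 \<in> {0..1}" using turn_1_cases[OF t] by auto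
  have "(1 - s) * t + s * turn t 1 \<le> 1"
    using convex_bound_le[of t 1 "turn t 1" "1 - s" s] t s 1 by simp
  moreover have "(1 - s) * t + s * turn t 1 \<ge> 0" using t s 1 by simp
  ultimately show ?thesis unfolding turn_convex[of t s] by simp
qed

lemma turn_ends: "t \<in> {0, 1} \<Longrightarrow> turn t s = t"
  by (auto simp: turn_def)

lemma turn_0 [simp]: "turn t 0 = t"
  by (simp add: turn_def)

lemma continuous_on_turn: "continuous_on S (\<lambda>(t, s). turn t s)"
  unfolding turn_def case_prod_beta by (intro continuous_intros) auto

lemma cis_turn: "cis (2 * pi * turn t s) = cis (2 * pi * t) * cis (- s * arcsin (Im (cis (2 * pi * t))))"
  by (simp add: cis_mult turn_def algebra_simps)

lemma rotate_right_half:
  assumes "norm z = 1" "0 < Re z"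
  shows "z * cis (- arcsin (Im z)) = 1"
proof -
  have Im: "\<bar>Im z\<bar> \<le> 1" using abs_Im_le_cmod[of z] assms by simp
  have "(Re z)\<^sup>2 = 1 - (Im z)\<^sup>2" using cmod_power2[of z] assms by simp
  then have "cos (arcsin (Im z)) = Re z"
    using Im assms by (simp add: cos_arcsin abs_le_iff real_sqrt_unique)
  moreover have "sin (arcsin (Im z)) = Im z" using Im by (simp add: abs_le_iff)
  ultimately have "cis (arcsin (Im z)) = z" by (simp add: complex_eq_iff)
  moreover have "cis (arcsin (Im z)) * cis (- arcsin (Im z)) = 1" by (simp add: cis_mult)
  ultimately show ?thesis by simp
qed

locale toric_cover =
  fixes L :: "'v::finite set set" and E :: "'e::topological_space set" and p :: "'e \<Rightarrow> complex ^ 'v"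
  assumes L: "simplicial_complex L" and cov: "covering_space E p (toric_complex L)"
begin

lemma L_down: "down_closed L"
  using L by (auto simp: simplicial_complex_def down_closed_def)

text \<open>The part of the cover over the cells of K. In particular \<open>EK {{}}\<close> is the
  fibre over the basepoint.\<close>

definition EK :: "'v set set \<Rightarrow> 'e set"
  where "EK K = {y\<in>E. supp (p y) \<in> K}"

lemma EK_mono: "K \<subseteq> K' \<Longrightarrow> EK K \<subseteq> EK K'"
  by (auto simp: EK_def)

lemma p_torus: "y \<in> E \<Longrightarrow> p y \<in> torus" and p_supp: "y \<in> E \<Longrightarrow> supp (p y) \<in> L"
  using covering_space_imp_surjective[OF cov] by (auto simp: toric_complex_supp)

lemma EK_L: "EK L = E"
  by (auto simp: EK_def p_supp)

lemma EK_subset: "EK K \<subseteq> E"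
  by (auto simp: EK_def)

lemma p_norm: "y \<in> E \<Longrightarrow> norm (p y $ v) = 1"
  using p_torus by (auto simp: torus_def)

lemma p_cont: "continuous_on E p"
  by (rule covering_space_imp_continuous[OF cov])

lemma lift_eq:
  assumes "continuous_on {0..1} g1" "\<And>t. t \<in> {0..1} \<Longrightarrow> g1 t \<in> E"
    and "continuous_on {0..1} g2" "\<And>t. t \<in> {0..1} \<Longrightarrow> g2 t \<in> E"
    and "\<And>t. t \<in> {0..1} \<Longrightarrow> p (g1 t) = p (g2 t)" and "g1 a = g2 a" "a \<in> {0..1::real}" "t \<in> {0..1}"
  shows "g1 t = g2 t"
  by (rule covering_lift_unique[OF cov connected_Icc, of _ _ g1 g2 a]) (use assms in auto)

text \<open>A lift of one full turn of coordinate v, started where that coordinate is 1 and v may be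
  added to the support. At time 1 it realises, on the fibre, translation by the generator v (see
  \<open>mu_tau\<close>).\<close>

definition is_flow :: "'v \<Rightarrow> ('e \<times> real \<Rightarrow> 'e) \<Rightarrow> bool"
  where "is_flow v k \<longleftrightarrow> continuous_on (EK (lk L v) \<times> {0..1}) k \<and> (\<forall>y\<in>EK (lk L v). k (y, 0) = y) \<and>
    (\<forall>y\<in>EK (lk L v). \<forall>t\<in>{0..1}. k (y, t) \<in> E \<and> p (k (y, t)) = setc v (cis (2 * pi * t)) (p y))"

lemma lk_mem: "y \<in> EK (lk K v) \<longleftrightarrow> y \<in> E \<and> p y $ v = 1 \<and> insert v (supp (p y)) \<in> K"
  by (auto simp: EK_def lk_def supp_def)

lemma setc_toric:
  assumes "y \<in> E" "insert v (supp (p y)) \<in> L" "norm z = 1"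
  shows "setc v z (p y) \<in> toric_complex L"
proof -
  have "supp (setc v z (p y)) \<subseteq> insert v (supp (p y))" by (auto simp: supp_def)
  then have "supp (setc v z (p y)) \<in> L" using assms(2) down_closedD[OF L_down] by blast
  then show ?thesis using torus_setc[OF p_torus[OF assms(1)] assms(3)] by (simp add: toric_complex_supp)
qed

lemma flow_exists: "\<exists>k. is_flow v k"
proof -
  let ?U = "EK (lk L v)" and ?h = "\<lambda>(y, t). setc v (cis (2 * pi * t)) (p y)"
  obtain k where "continuous_on (?U \<times> {0..1::real}) k" "k \<in> ?U \<times> {0..1} \<rightarrow> E"
    "\<And>y. y \<in> ?U \<Longrightarrow> k (y, 0) = y" "\<And>z. z \<in> ?U \<times> {0..1} \<Longrightarrow> p (k z) = ?h z"
  proof (rule covering_lift_homotopy[OF cov, of ?U ?h "\<lambda>y. y"])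
    show "continuous_on (?U \<times> {0..1}) ?h"
      unfolding case_prod_beta
      by (intro continuous_on_setc continuous_intros continuous_on_compose2[OF p_cont]) (auto simp: EK_def)
    show "?h \<in> ?U \<times> {0..1} \<rightarrow> toric_complex L"
      using setc_toric by (auto simp: lk_mem)
    show "p y = ?h (y, 0)" if "y \<in> ?U" for y
      using that setc_eq[of 1 "p y" v] by (auto simp: lk_mem)
  qed (auto simp: EK_def)
  then show ?thesis unfolding is_flow_def by (intro exI[of _ k]) (auto simp: Pi_iff)
qed

definition flow :: "'v \<Rightarrow> 'e \<times> real \<Rightarrow> 'e"
  where "flow v = (SOME k. is_flow v k)"

lemma flow: "is_flow v (flow v)"
  unfolding flow_def by (rule someI_ex[OF flow_exists])

lemma flow_cont: "S \<subseteq> EK (lk L v) \<Longrightarrow> continuous_on (S \<times> {0..1}) (flow v)"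
  using flow[of v] unfolding is_flow_def by (auto elim: continuous_on_subset)

lemma flow_0: "y \<in> EK (lk L v) \<Longrightarrow> flow v (y, 0) = y"
  and flow_E: "y \<in> EK (lk L v) \<Longrightarrow> t \<in> {0..1} \<Longrightarrow> flow v (y, t) \<in> E"
  and p_flow: "y \<in> EK (lk L v) \<Longrightarrow> t \<in> {0..1} \<Longrightarrow> p (flow v (y, t)) = setc v (cis (2 * pi * t)) (p y)"
  using flow[of v] by (auto simp: is_flow_def)

lemma flow_path_cont: "y \<in> EK (lk L v) \<Longrightarrow> continuous_on S g \<Longrightarrow> g ` S \<subseteq> {0..1} \<Longrightarrow> continuous_on S (\<lambda>s. flow v (y, g s))"
  by (rule continuous_on_compose2[OF flow_cont[of "EK (lk L v)"]]) (auto intro!: continuous_intros)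

lemma lk_mono: "K \<subseteq> K' \<Longrightarrow> lk K v \<subseteq> lk K' v"
  by (auto simp: lk_def)

lemma flow_EK:
  assumes "K \<subseteq> L" "down_closed K" "y \<in> EK (lk K v)" "t \<in> {0..1}"
  shows "flow v (y, t) \<in> EK K"
proof -
  have y: "y \<in> EK (lk L v)" using EK_mono[OF lk_mono[OF assms(1)]] assms(3) by blast
  have "supp (p (flow v (y, t))) \<subseteq> insert v (supp (p y))"
    unfolding p_flow[OF y assms(4)] by (auto simp: supp_def)
  then show ?thesis using flow_E[OF y assms(4)] assms down_closedD[OF assms(2)] by (auto simp: EK_def lk_def)
qed

abbreviation "\<tau> v y \<equiv> flow v (y, 1)"

lemma p_tau: "y \<in> EK (lk L v) \<Longrightarrow> p (\<tau> v y) = p y"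
  using setc_eq[of 1 "p y" v] by (simp add: p_flow lk_mem cis_eq_1_iff[of 1, simplified])

lemma tau_EK: "K \<subseteq> L \<Longrightarrow> y \<in> EK (lk L v) \<Longrightarrow> y \<in> EK K \<Longrightarrow> \<tau> v y \<in> EK K"
  using p_tau flow_E[of y v 1] by (auto simp: EK_def)

text \<open>Both sides are lifts of the same rotation of coordinate w, with the same starting point;
  the face that contains v and w keeps all points in the domain of the flows.\<close>

lemma flow_tau_commute:
  assumes y: "y \<in> E" "p y $ v = 1" "p y $ w = 1" "v \<noteq> w" "insert v (insert w (supp (p y))) \<in> L" and t: "t \<in> {0..1}"
  shows "flow w (\<tau> v y, t) = \<tau> v (flow w (y, t))"
proof -
  have v: "y \<in> EK (lk L v)" "y \<in> EK (lk L w)"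
    using y by (auto simp: lk_mem intro: down_closedD[OF L_down])
  have tw: "\<tau> v y \<in> EK (lk L w)"
    using v p_tau[OF v(1)] flow_E[OF v(1), of 1] by (auto simp: lk_mem)
  have fv: "flow w (y, s) \<in> EK (lk L v)" if s: "s \<in> {0..1}" for s
  proof -
    have "insert v (supp (p (flow w (y, s)))) \<subseteq> insert v (insert w (supp (p y)))"
      unfolding p_flow[OF v(2) s] by (auto simp: supp_def)
    then show ?thesis
      using flow_E[OF v(2) s] y p_flow[OF v(2) s] by (auto simp: lk_mem intro: down_closedD[OF L_down])
  qed
  show ?thesis
  proof (rule lift_eq[of "\<lambda>t. flow w (\<tau> v y, t)" "\<lambda>t. \<tau> v (flow w (y, t))" 0 t])
    show "continuous_on {0..1} (\<lambda>t. flow w (\<tau> v y, t))"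
      by (rule flow_path_cont[OF tw]) (auto intro: continuous_intros)
    show "continuous_on {0..1} (\<lambda>t. \<tau> v (flow w (y, t)))"
      by (rule continuous_on_compose2[OF flow_cont[of "EK (lk L v)"]])
        (use fv in \<open>auto intro!: continuous_intros flow_path_cont[OF v(2)]\<close>)
    show "p (flow w (\<tau> v y, s)) = p (\<tau> v (flow w (y, s)))" if s: "s \<in> {0..1}" for s
      using p_flow[OF tw s] p_tau[OF fv[OF s]] p_flow[OF v(2) s] p_tau[OF v(1)] by simp
  qed (use fv tw v t flow_0 flow_E in auto)
qed

text \<open>A lift of the collapse of the right half circle in coordinate v; it plays the part of
  \<open>H\<close> in \<open>cylinder_attachment\<close>.\<close>

definition is_squeeze :: "'v \<Rightarrow> ('e \<times> real \<Rightarrow> 'e) \<Rightarrow> bool"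
  where "is_squeeze v k \<longleftrightarrow> continuous_on (E \<times> {0..1}) k \<and> (\<forall>y\<in>E. k (y, 0) = y) \<and>
    (\<forall>y\<in>E. \<forall>s\<in>{0..1}. k (y, s) \<in> E \<and> p (k (y, s)) = setc v (p y $ v * cis (- s * arcsin (Im (p y $ v)))) (p y))"

lemma squeeze_supp: "supp (setc v (x $ v * cis (- s * arcsin (Im (x $ v)))) x) \<subseteq> supp x"
  by (auto simp: supp_def)

lemma squeeze_exists: "\<exists>k. is_squeeze v k"
proof -
  let ?h = "\<lambda>(y, s). setc v (p y $ v * cis (- s * arcsin (Im (p y $ v)))) (p y)"
  have pc: "continuous_on (E \<times> {0..1}) (\<lambda>z. p (fst z))"
    by (rule continuous_on_compose2[OF p_cont]) (auto intro!: continuous_intros)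
  have Im: "- 1 \<le> Im (p y $ v) \<and> Im (p y $ v) \<le> 1" if "y \<in> E" for y
    using abs_Im_le_cmod[of "p y $ v"] p_norm[OF that, of v] by (auto simp: abs_le_iff)
  obtain k where "continuous_on (E \<times> {0..1::real}) k" "k \<in> E \<times> {0..1} \<rightarrow> E"
    "\<And>y. y \<in> E \<Longrightarrow> k (y, 0) = y" "\<And>z. z \<in> E \<times> {0..1} \<Longrightarrow> p (k z) = ?h z"
  proof (rule covering_lift_homotopy[OF cov, of E ?h "\<lambda>y. y"])
    show "continuous_on (E \<times> {0..1}) ?h"
      unfolding case_prod_beta
      by (intro continuous_on_setc continuous_intros pc) (use Im in auto)
    show "?h \<in> E \<times> {0..1} \<rightarrow> toric_complex L"
    proof
      fix z assume "z \<in> E \<times> {0..1::real}"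
      then obtain y s where z: "z = (y, s)" and y: "y \<in> E" by auto
      show "?h z \<in> toric_complex L"
        using torus_setc[OF p_torus[OF y], of "p y $ v * cis (- s * arcsin (Im (p y $ v)))" v]
          down_closedD[OF L_down p_supp[OF y] squeeze_supp[of v "p y" s]] p_norm[OF y, of v]
        by (simp add: z toric_complex_supp norm_mult)
    qed
  qed auto
  then show ?thesis unfolding is_squeeze_def by (intro exI[of _ k]) (auto simp: Pi_iff)
qed

definition squeeze :: "'v \<Rightarrow> 'e \<times> real \<Rightarrow> 'e"
  where "squeeze v = (SOME k. is_squeeze v k)"

lemma squeeze: "is_squeeze v (squeeze v)"
  unfolding squeeze_def by (rule someI_ex[OF squeeze_exists])

definition angle :: "'v \<Rightarrow> 'e \<Rightarrow> real"
  where "angle v y = Arg2pi (p y $ v) / (2 * pi)"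

text \<open>Turns coordinate v back to 1. Its end point together with \<open>angle\<close> inverts
  the flow on the open cylinder.\<close>

definition is_unwind :: "'v \<Rightarrow> ('e \<times> real \<Rightarrow> 'e) \<Rightarrow> bool"
  where "is_unwind v k \<longleftrightarrow> continuous_on ({y\<in>E. p y $ v \<noteq> 1} \<times> {0..1}) k \<and>
    (\<forall>y\<in>E. p y $ v \<noteq> 1 \<longrightarrow> k (y, 0) = y \<and>
      (\<forall>s\<in>{0..1}. k (y, s) \<in> E \<and> p (k (y, s)) = setc v (cis (2 * pi * (angle v y * (1 - s)))) (p y)))"

lemma cis_angle: "y \<in> E \<Longrightarrow> cis (2 * pi * angle v y) = p y $ v"
  using p_norm[of y v] complex_norm_eq_1_exp[of "p y $ v"] by (simp add: angle_def cis_conv_exp)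

lemma angle_inner: "y \<in> E \<Longrightarrow> p y $ v \<noteq> 1 \<Longrightarrow> angle v y \<in> {0<..<1}"
proof -
  assume y: "y \<in> E" "p y $ v \<noteq> 1"
  have "0 \<le> Arg2pi (p y $ v)" "Arg2pi (p y $ v) < 2 * pi" using Arg2pi[of "p y $ v"] by auto
  moreover have "angle v y \<noteq> 0" using cis_angle[OF y(1), of v] y(2) by auto
  ultimately show ?thesis by (auto simp: angle_def divide_simps)
qed

lemma angle_cont: "continuous_on {y\<in>E. p y $ v \<noteq> 1} (angle v)"
proof -
  have "continuous_on {z. norm z = 1 \<and> z \<noteq> 1} Arg2pi"
  proof (rule continuous_at_imp_continuous_on, intro ballI)
    fix z :: complex assume z: "z \<in> {z. norm z = 1 \<and> z \<noteq> 1}"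
    have "z \<notin> \<real>\<^sub>\<ge>\<^sub>0"
    proof
      assume "z \<in> \<real>\<^sub>\<ge>\<^sub>0"
      then obtain r where "z = of_real r" "r \<ge> 0" by (rule nonneg_Reals_cases)
      then show False using z by auto
    qed
    then show "isCont Arg2pi z" by (rule continuous_at_Arg2pi)
  qed
  then have "continuous_on {y\<in>E. p y $ v \<noteq> 1} (\<lambda>y. Arg2pi (p y $ v))"
    by (rule continuous_on_compose2)
      (use p_norm in \<open>auto intro!: continuous_intros continuous_on_subset[OF p_cont]\<close>)
  then show ?thesis unfolding angle_def by (intro continuous_intros) auto
qed

lemma unwind_exists: "\<exists>k. is_unwind v k"
proof -
  let ?V = "{y\<in>E. p y $ v \<noteq> 1}" and ?h = "\<lambda>(y, s). setc v (cis (2 * pi * (angle v y * (1 - s)))) (p y)"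
  obtain k where "continuous_on (?V \<times> {0..1::real}) k" "k \<in> ?V \<times> {0..1} \<rightarrow> E"
    "\<And>y. y \<in> ?V \<Longrightarrow> k (y, 0) = y" "\<And>z. z \<in> ?V \<times> {0..1} \<Longrightarrow> p (k z) = ?h z"
  proof (rule covering_lift_homotopy[OF cov, of ?V ?h "\<lambda>y. y"])
    show "continuous_on (?V \<times> {0..1}) ?h"
      unfolding case_prod_beta
      by (intro continuous_on_setc continuous_intros continuous_on_compose2[OF p_cont]
          continuous_on_compose2[OF angle_cont]) auto
    show "?h \<in> ?V \<times> {0..1} \<rightarrow> toric_complex L"
    proof
      fix z assume z: "z \<in> ?V \<times> {0..1::real}"
      then have "insert v (supp (p (fst z))) \<in> L" using p_supp by (auto simp: supp_def insert_absorb)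
      then show "?h z \<in> toric_complex L" using z setc_toric[of "fst z" v] by (auto simp: case_prod_beta)
    qed
    show "p y = ?h (y, 0)" if "y \<in> ?V" for y
      using that cis_angle by simp
  qed auto
  then show ?thesis unfolding is_unwind_def by (intro exI[of _ k]) (auto simp: Pi_iff)
qed

definition unwind :: "'v \<Rightarrow> 'e \<times> real \<Rightarrow> 'e"
  where "unwind v = (SOME k. is_unwind v k)"

lemma unwind: "is_unwind v (unwind v)"
  unfolding unwind_def by (rule someI_ex[OF unwind_exists])

text \<open>The points with coordinate v different from 1 form the open cylinder: unwinding gives
  the base point in the part over the link, and \<open>angle\<close> gives the height. Each identity
  between lifts holds because both sides lift the same path of the torus and agree at one
  time.\<close>

lemma attachment:
  assumes K: "K \<subseteq> L" "down_closed K"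
  shows "cylinder_attachment (EK K) (EK (del K v)) (EK (lk K v)) {y\<in>EK K. 0 < Re (p y $ v)}
    (flow v) (\<lambda>y. (unwind v (y, 1), angle v y)) (squeeze v) turn"
proof -
  let ?Y = "EK K" and ?D = "EK (del K v)" and ?B = "EK (lk K v)"
  have YE: "y \<in> E" if "y \<in> EK K'" for y K' using that by (auto simp: EK_def)
  have BL: "y \<in> EK (lk L v)" if "y \<in> ?B" for y
    using that EK_mono[OF lk_mono[OF K(1)]] by blast
  have Y0: "y \<in> ?D \<longleftrightarrow> y \<in> ?Y \<and> p y $ v = 1" for y
    by (auto simp: EK_def del_def supp_def)
  note fl = flow_0[OF BL] flow_E[OF BL] p_flow[OF BL]
  have sq: "squeeze v (y, 0) = y" "s \<in> {0..1} \<Longrightarrow> squeeze v (y, s) \<in> E"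
    "s \<in> {0..1} \<Longrightarrow> p (squeeze v (y, s)) = setc v (p y $ v * cis (- s * arcsin (Im (p y $ v)))) (p y)"
    if "y \<in> E" for y s
    using squeeze[of v] that by (auto simp: is_squeeze_def)
  have sq_cont: "continuous_on (E \<times> {0..1}) (squeeze v)" using squeeze[of v] by (auto simp: is_squeeze_def)
  have uw: "unwind v (y, 0) = y" "s \<in> {0..1} \<Longrightarrow> unwind v (y, s) \<in> E"
    "s \<in> {0..1} \<Longrightarrow> p (unwind v (y, s)) = setc v (cis (2 * pi * (angle v y * (1 - s)))) (p y)"
    if "y \<in> E" "p y $ v \<noteq> 1" for y s
    using unwind[of v] that by (auto simp: is_unwind_def)
  have uw_cont: "continuous_on ({y\<in>E. p y $ v \<noteq> 1} \<times> {0..1}) (unwind v)"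
    using unwind[of v] by (auto simp: is_unwind_def)
  have coord: "continuous_on ?Y (\<lambda>y. p y $ v)"
    by (intro continuous_intros continuous_on_subset[OF p_cont]) (auto simp: EK_def)
  have uw1: "unwind v (y, 1) \<in> ?B" if y: "y \<in> ?Y" "p y $ v \<noteq> 1" for y
  proof -
    have "insert v (supp (p y)) = supp (p y)" using y by (auto simp: supp_def)
    moreover have "insert v (supp (p y) - {v}) = insert v (supp (p y))" by auto
    ultimately show ?thesis
      using uw(2,3)[OF YE[OF y(1)] y(2), of 1] y(1) by (simp add: supp_setc EK_def lk_def)
  qed
  have sq_Y: "squeeze v (y, s) \<in> ?Y" if y: "y \<in> ?Y" "s \<in> {0..1}" for y s
    using sq(2,3)[OF YE[OF y(1)] y(2)] squeeze_supp[of v "p y" s] y(1) down_closedD[OF K(2)]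
    by (auto simp: EK_def)
  have angle_flow: "angle v (flow v (b, t)) = t" if b: "b \<in> ?B" and t: "0 < t" "t < 1" for b t
  proof -
    have "2 * pi * t < 2 * pi * 1" using t by (intro mult_strict_left_mono) auto
    then have "Arg2pi (cis (2 * pi * t)) = 2 * pi * t"
      using t by (intro Arg2pi_unique[of 1]) (auto simp: cis_conv_exp)
    then show ?thesis using fl(3)[OF b, of t] t by (simp add: angle_def)
  qed
  show ?thesis
  proof
    show "?B \<subseteq> ?D" by (rule EK_mono[OF lk_subset_del[OF K(2)]])
    show "?D \<subseteq> ?Y" using Y0 by auto
    show "continuous_on (?B \<times> {0..1}) (flow v)" using BL by (intro flow_cont) auto
    show "flow v \<in> ?B \<times> {0..1} \<rightarrow> ?Y" using flow_EK[OF K] by auto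
    show "\<tau> v b \<in> ?B" if "b \<in> ?B" for b
      using that p_tau[OF BL[OF that]] fl(2)[OF that, of 1] by (auto simp: EK_def)
    show "flow v (b, 0) = b" if "b \<in> ?B" for b using fl(1)[OF that] .
    show "flow v (b, t) \<notin> ?D" if "b \<in> ?B" "0 < t" "t < 1" for b t
      using fl(3)[OF that(1), of t] that cis_inner_ne_1 by (simp add: Y0)
    have VY: "?Y - ?D = {y\<in>?Y. p y $ v \<noteq> 1}" using Y0 by auto
    have VE: "?Y - ?D \<subseteq> {y\<in>E. p y $ v \<noteq> 1}" using YE by (auto simp: VY)
    show "continuous_on (?Y - ?D) (\<lambda>y. (unwind v (y, 1), angle v y))"
      using VE by (intro continuous_intros continuous_on_compose2[OF uw_cont] continuous_on_subset[OF angle_cont]) auto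
    show "(\<lambda>y. (unwind v (y, 1), angle v y)) \<in> ?Y - ?D \<rightarrow> ?B \<times> {0<..<1}"
    proof
      fix y assume "y \<in> ?Y - ?D"
      then have y: "y \<in> ?Y" "p y $ v \<noteq> 1" by (auto simp: VY)
      show "(unwind v (y, 1), angle v y) \<in> ?B \<times> {0<..<1}"
        using uw1[OF y] angle_inner[OF YE[OF y(1)] y(2)] by blast
    qed
    show "flow v (unwind v (y, 1), angle v y) = y" if "y \<in> ?Y - ?D" for y
    proof -
      have y: "y \<in> ?Y" "p y $ v \<noteq> 1" "y \<in> E" using that YE by (auto simp: VY)
      let ?b = "unwind v (y, 1)"
      have b: "?b \<in> ?B" by (rule uw1[OF y(1,2)])
      have an: "angle v y \<in> {0<..<1}" by (rule angle_inner[OF y(3,2)])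
      have in01: "angle v y * s \<in> {0..1}" if "s \<in> {0..1}" for s
        using an that by (auto simp: mult_le_one)
      have "flow v (?b, angle v y * 1) = unwind v (y, 1 - 1)"
      proof (rule lift_eq[of "\<lambda>s. flow v (?b, angle v y * s)" "\<lambda>s. unwind v (y, 1 - s)" 0 1])
        show "continuous_on {0..1} (\<lambda>s. flow v (?b, angle v y * s))"
          using in01 by (intro flow_path_cont[OF BL[OF b]] continuous_intros) auto
        show "continuous_on {0..1} (\<lambda>s. unwind v (y, 1 - s))"
          by (rule continuous_on_compose2[OF uw_cont]) (use y in \<open>auto intro!: continuous_intros\<close>)
        show "p (flow v (?b, angle v y * s)) = p (unwind v (y, 1 - s))" if s: "s \<in> {0..1}" for s
          using fl(3)[OF b in01[OF s]] uw(3)[OF y(3,2), of 1] uw(3)[OF y(3,2), of "1 - s"] s by simp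
      qed (use in01 fl[OF b] uw(2)[OF y(3,2)] in auto)
      then show ?thesis using uw(1)[OF y(3,2)] by simp
    qed
    show "(unwind v (flow v (b, t), 1), angle v (flow v (b, t))) = (b, t)" if b: "b \<in> ?B" and t: "0 < t" "t < 1" for b t
    proof -
      let ?y = "flow v (b, t)"
      have y: "?y \<in> E" "p ?y $ v \<noteq> 1" using fl(2,3)[OF b, of t] t cis_inner_ne_1 by simp_all
      have in01: "t * (1 - s) \<in> {0..1}" if "s \<in> {0..1}" for s
        using t that by (auto simp: mult_le_one)
      have "unwind v (?y, 1) = flow v (b, t * (1 - 1))"
      proof (rule lift_eq[of "\<lambda>s. unwind v (?y, s)" "\<lambda>s. flow v (b, t * (1 - s))" 0 1])
        show "continuous_on {0..1} (\<lambda>s. unwind v (?y, s))"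
          by (rule continuous_on_compose2[OF uw_cont]) (use y in \<open>auto intro!: continuous_intros\<close>)
        show "continuous_on {0..1} (\<lambda>s. flow v (b, t * (1 - s)))"
          using in01 by (intro flow_path_cont[OF BL[OF b]] continuous_intros) auto
        show "p (unwind v (?y, s)) = p (flow v (b, t * (1 - s)))" if s: "s \<in> {0..1}" for s
          using fl(3)[OF b in01[OF s]] uw(3)[OF y s] fl(3)[OF b, of t] t by (simp add: angle_flow[OF b t])
      qed (use in01 fl[OF b] uw[OF y] in auto)
      then show ?thesis using fl(1)[OF b] angle_flow[OF b t] by simp
    qed
    show "continuous_on (?Y \<times> {0..1}) (squeeze v)"
      by (rule continuous_on_subset[OF sq_cont]) (use YE in auto)
    show "squeeze v \<in> ?Y \<times> {0..1} \<rightarrow> ?Y" using sq_Y by auto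
    show "squeeze v (y, 0) = y" if "y \<in> ?Y" for y using sq(1)[OF YE[OF that]] .
    show "squeeze v (y, s) \<in> ?D" if y: "y \<in> ?D" and s: "s \<in> {0..1}" for y s
      using sq_Y[of y s] y s sq(3)[OF YE[OF y] s] by (simp add: Y0)
    show "squeeze v (y, 1) \<in> ?D" if "y \<in> {y\<in>?Y. 0 < Re (p y $ v)}" for y
      using that sq_Y[of y 1] sq(3)[of y 1] YE[of y K] rotate_right_half[OF p_norm[of y v]] by (simp add: Y0)
    show "squeeze v (flow v (b, t), s) = flow v (b, turn t s)"
      if b: "b \<in> ?B" and t: "t \<in> {0..1}" and s: "s \<in> {0..1}" for b t s
    proof (rule lift_eq[of "\<lambda>s. squeeze v (flow v (b, t), s)" "\<lambda>s. flow v (b, turn t s)" 0 s])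
      show "continuous_on {0..1} (\<lambda>s. squeeze v (flow v (b, t), s))"
        by (rule continuous_on_compose2[OF sq_cont]) (use fl(2)[OF b t] in \<open>auto intro!: continuous_intros\<close>)
      show "continuous_on {0..1} (\<lambda>s. flow v (b, turn t s))"
      proof (rule flow_path_cont[OF BL[OF b]])
        show "continuous_on {0..1} (turn t)" unfolding turn_def by (intro continuous_intros) auto
      qed (use turn_in_unit[OF t] in auto)
      show "p (squeeze v (flow v (b, t), s)) = p (flow v (b, turn t s))" if s: "s \<in> {0..1}" for s
        using sq(3)[OF fl(2)[OF b t] s] fl(3)[OF b t] fl(3)[OF b turn_in_unit[OF t s]]
        by (simp only: cis_turn setc_setc setc_nth if_True simp_thms)
    qed (use s sq fl[OF b] turn_in_unit[OF t] t in auto)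
    show "continuous_on ({0..1} \<times> {0..1}) (\<lambda>(t, s). turn t s)" by (rule continuous_on_turn)
    show "turn t s \<in> {0..1}" if "t \<in> {0..1}" "s \<in> {0..1}" for t s using turn_in_unit[OF that] .
    show "turn t 1 \<in> {0, 1}"
      if b: "b \<in> ?B" and t: "t \<in> {0..1}" and U: "flow v (b, t) \<in> {y\<in>?Y. 0 < Re (p y $ v)}" for b t
    proof -
      have c: "0 < cos (2 * pi * t)" using U fl(3)[OF b t] by simp
      have "\<not> (1/4 \<le> t \<and> t \<le> 3/4)"
      proof
        assume t': "1/4 \<le> t \<and> t \<le> 3/4"
        have "0 \<le> cos (2 * pi * t - pi)"
        proof (rule cos_ge_zero)
          have "2 * pi * (1/4) \<le> 2 * pi * t" "2 * pi * t \<le> 2 * pi * (3/4)"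
            using t' by (intro mult_left_mono; simp)+
          then show "- (pi / 2) \<le> 2 * pi * t - pi" "2 * pi * t - pi \<le> pi / 2"
            using pi_gt_zero by linarith+
        qed
        then show False using c by simp
      qed
      then show ?thesis using turn_1_cases[OF t] by auto
    qed
    have "openin (top_of_set ?Y) (?Y \<inter> (\<lambda>y. p y $ v) -` {z. 0 < Re z})"
      by (rule continuous_openin_preimage_gen[OF coord open_halfspace_Re_gt])
    then show "openin (top_of_set ?Y) {y\<in>?Y. 0 < Re (p y $ v)}"
      by (simp add: Collect_conj_eq vimage_def)
    have "openin (top_of_set ?Y) (?Y \<inter> (\<lambda>y. p y $ v) -` (- {1}))"
      by (rule continuous_openin_preimage_gen[OF coord]) auto
    moreover have "?Y \<inter> (\<lambda>y. p y $ v) -` (- {1}) = ?Y - ?D" by (auto simp: VY)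
    ultimately show "openin (top_of_set ?Y) (?Y - ?D)" by simp
    show "?D \<subseteq> {y\<in>?Y. 0 < Re (p y $ v)}" by (auto simp: Y0)
  qed (auto simp: turn_ends)
qed

end


section \<open>The chain map from cellular to singular chains of the cover\<close>

subsection \<open>Comparison with the singular chains of a cover\<close>

locale toric_cover_fibre = toric_cover L E p for L :: "'v::finite set set"
    and E :: "'e::topological_space set" and p :: "'e \<Rightarrow> complex ^ 'v" +
  fixes X :: "'x set" and T :: "'v \<Rightarrow> 'x \<Rightarrow> 'x" and fib :: "'x \<Rightarrow> 'e"
    and field_type :: "'k::field itself"
  assumes fib: "bij_betw fib X (EK {{}})"
    and T_X: "\<And>x v. x \<in> X \<Longrightarrow> T v x \<in> X"
    and T_comm: "\<And>x v w. x \<in> X \<Longrightarrow> T v (T w x) = T w (T v x)"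
    and fib_T: "\<And>x v. x \<in> X \<Longrightarrow> fib (T v x) = \<tau> v (fib x)"
begin

definition first :: "'v set \<Rightarrow> 'v"
  where "first \<sigma> = (ARG_MIN to_nat v. v \<in> \<sigma>)"

lemma first: "\<sigma> \<noteq> {} \<Longrightarrow> first \<sigma> \<in> \<sigma>" "u \<in> \<sigma> \<Longrightarrow> to_nat (first \<sigma>) \<le> to_nat u"
  unfolding first_def by (auto intro: arg_min_natI arg_min_nat_le)

lemma first_eqI: "v \<in> \<sigma> \<Longrightarrow> (\<And>u. u \<in> \<sigma> \<Longrightarrow> to_nat v \<le> to_nat u) \<Longrightarrow> first \<sigma> = v"
  using first(1)[of \<sigma>] first(2)[of _ \<sigma>] by (metis empty_iff inj_eq inj_to_nat le_antisym)

lemma first_less: "u \<in> \<sigma> \<Longrightarrow> u \<noteq> first \<sigma> \<Longrightarrow> to_nat (first \<sigma>) < to_nat u"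
  using first(2)[of u \<sigma>] by (metis inj_eq inj_to_nat le_neq_implies_less)

text \<open>The lifted cell of \<sigma> at \<open>fib x\<close>: the point is swept along the flows
  of the vertices of \<sigma>, the smallest vertex last.\<close>

primrec phin :: "nat \<Rightarrow> 'v set \<Rightarrow> 'x \<Rightarrow> ((nat \<Rightarrow> real) \<Rightarrow> 'e) \<Rightarrow>\<^sub>0 'k" where
  "phin 0 \<sigma> x = single (restrict (\<lambda>_. fib x) (standard_simplex 0)) 1"
| "phin (Suc n) \<sigma> x = khom 0 n (flow (first \<sigma>)) (phin n (\<sigma> - {first \<sigma>}) x)"

definition phi :: "'v set \<Rightarrow> 'x \<Rightarrow> ((nat \<Rightarrow> real) \<Rightarrow> 'e) \<Rightarrow>\<^sub>0 'k"
  where "phi \<sigma> = phin (card \<sigma>) \<sigma>"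

lemma phi_empty: "phi {} x = single (restrict (\<lambda>_. fib x) (standard_simplex 0)) 1"
  by (simp add: phi_def)

lemma phi_insert:
  assumes "v \<notin> \<sigma>" "\<And>u. u \<in> \<sigma> \<Longrightarrow> to_nat v < to_nat u"
  shows "phi (insert v \<sigma>) x = khom 0 (card \<sigma>) (flow v) (phi \<sigma> x)"
proof -
  have "first (insert v \<sigma>) = v" using assms by (intro first_eqI) (auto simp: less_imp_le)
  moreover have "insert v \<sigma> - {v} = \<sigma>" using assms by auto
  ultimately show ?thesis using assms by (simp add: phi_def)
qed

text \<open>Adding a vertex below all present ones corresponds to one outermost sweep of
  \<open>phin\<close> and to the situation of \<open>cbd_join\<close>.\<close>

lemma face_induct [case_names empty insert]:
  assumes "P {}" and "\<And>v \<sigma>. v \<notin> \<sigma> \<Longrightarrow> (\<And>u. u \<in> \<sigma> \<Longrightarrow> to_nat v < to_nat u) \<Longrightarrow> P \<sigma> \<Longrightarrow> P (insert v \<sigma>)"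
  shows "P (\<sigma> :: 'v set)"
proof (induction "card \<sigma>" arbitrary: \<sigma>)
  case 0 then show ?case using assms(1) by simp
next
  case (Suc n)
  then have ne: "\<sigma> \<noteq> {}" by auto
  let ?v = "first \<sigma>"
  have "P (insert ?v (\<sigma> - {?v}))"
  proof (rule assms(2))
    show "P (\<sigma> - {?v})" using Suc first(1)[OF ne] by simp
  qed (use first_less in auto)
  then show ?case using first(1)[OF ne] by (simp add: insert_absorb)
qed

lemma EK_Pow: "y \<in> EK (Pow \<sigma>) \<longleftrightarrow> y \<in> E \<and> supp (p y) \<subseteq> \<sigma>"
  by (auto simp: EK_def)

lemma EK_Pow_lk: "v \<notin> \<sigma> \<Longrightarrow> insert v \<sigma> \<in> L \<Longrightarrow> EK (Pow \<sigma>) \<subseteq> EK (lk L v)"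
proof
  fix y assume \<sigma>: "v \<notin> \<sigma>" "insert v \<sigma> \<in> L" and "y \<in> EK (Pow \<sigma>)"
  then have y: "y \<in> E" "supp (p y) \<subseteq> \<sigma>" by (simp_all add: EK_Pow)
  then have "insert v (supp (p y)) \<in> L" by (intro down_closedD[OF L_down \<sigma>(2)]) auto
  moreover have "p y $ v = 1" using y(2) \<sigma>(1) by (auto simp: supp_def)
  ultimately show "y \<in> EK (lk L v)" using y(1) by (simp add: lk_mem)
qed

lemma phi_chains: "\<sigma> \<in> L \<Longrightarrow> x \<in> X \<Longrightarrow> phi \<sigma> x \<in> fch (card \<sigma>) (EK (Pow \<sigma>))"
proof (induction \<sigma> rule: face_induct)
  case empty
  have "fib x \<in> EK {{}}" using empty fib by (auto simp: bij_betw_def)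
  then show ?case
    unfolding phi_empty by (intro field_chains_single) (simp add: singular_simplex_def)
next
  case (insert v \<sigma>)
  have \<sigma>: "\<sigma> \<in> L" using insert down_closedD[OF L_down] by blast
  have sub: "EK (Pow \<sigma>) \<subseteq> EK (lk L v)" by (rule EK_Pow_lk) fact+
  have "khom 0 (card \<sigma>) (flow v) (phi \<sigma> x) \<in> fch (Suc (card \<sigma>)) (EK (Pow (insert v \<sigma>)))"
  proof (rule khom_chains[OF insert.IH[OF \<sigma> insert.prems(2)] flow_cont[OF sub]])
    show "flow v \<in> EK (Pow \<sigma>) \<times> {0..1} \<rightarrow> EK (Pow (insert v \<sigma>))"
    proof (clarify)
      fix y t assume y: "y \<in> EK (Pow \<sigma>)" and t: "t \<in> {0..1::real}"
      have "y \<in> EK (lk L v)" using y sub by blast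
      from flow_E[OF this t] p_flow[OF this t] y show "flow v (y, t) \<in> EK (Pow (insert v \<sigma>))"
        by (auto simp: EK_Pow supp_setc split: if_splits)
    qed
  qed
  then show ?case using phi_insert[of v \<sigma> x] insert.hyps by simp
qed

lemma phi_tau:
  "insert w \<sigma> \<in> L \<Longrightarrow> w \<notin> \<sigma> \<Longrightarrow> x \<in> X \<Longrightarrow> kmap (card \<sigma>) (\<tau> w) (phi \<sigma> x) = phi \<sigma> (T w x)"
proof (induction \<sigma> rule: face_induct)
  case empty
  have "simplex_map 0 (\<tau> w) (restrict (\<lambda>_. fib x) (standard_simplex 0)) = restrict (\<lambda>_. fib (T w x)) (standard_simplex 0)"
    by (auto simp: simplex_map_def fib_T[OF empty(3)])
  then show ?case by (simp add: phi_empty)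
next
  case (insert v \<sigma>)
  have ins: "insert w \<sigma> \<in> L" "insert v \<sigma> \<in> L" "\<sigma> \<in> L"
    using insert.prems(1) by (auto intro: down_closedD[OF L_down])
  have ph: "phi \<sigma> x \<in> fch (card \<sigma>) (EK (Pow \<sigma>))" by (rule phi_chains[OF ins(3) insert.prems(3)])
  have "kmap (Suc (card \<sigma>)) (\<tau> w) (khom 0 (card \<sigma>) (flow v) (phi \<sigma> x))
      = khom 0 (card \<sigma>) (\<lambda>(y, t). flow v (\<tau> w y, t)) (phi \<sigma> x)"
    unfolding kmap_khom
  proof (rule khom_eq_on[OF ph])
    fix y and t :: real assume y: "y \<in> EK (Pow \<sigma>)" and t: "t \<in> {0..1}"
    have "insert w (insert v (supp (p y))) \<in> L"
      by (rule down_closedD[OF L_down insert.prems(1)]) (use y in \<open>auto simp: EK_Pow\<close>)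
    moreover have "p y $ w = 1" "p y $ v = 1" "w \<noteq> v"
      using y insert.hyps(1) insert.prems(2) by (auto simp: EK_Pow supp_def)
    ultimately show "\<tau> w (flow v (y, t)) = (case (y, t) of (y, t) \<Rightarrow> flow v (\<tau> w y, t))"
      using flow_tau_commute[of y w v t] y t by (simp add: EK_Pow)
  qed
  also have "\<dots> = khom 0 (card \<sigma>) (flow v) (kmap (card \<sigma>) (\<tau> w) (phi \<sigma> x))"
    by (simp add: khom_kmap)
  also have "kmap (card \<sigma>) (\<tau> w) (phi \<sigma> x) = phi \<sigma> (T w x)"
    using insert.IH[OF ins(1) _ insert.prems(3)] insert.prems(2) by simp
  finally show ?case using phi_insert[of v \<sigma>] insert.hyps by simp
qed

lemma khom_sg: "khom n q K (sg m c) = sg m (khom n q K c)"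
  by (simp add: sg_def khom_uminus)

lemma khom_sum: "khom n q K (\<Sum>i\<in>I. f i) = (\<Sum>i\<in>I. khom n q K (f i))"
  by (induction I rule: infinite_finite_induct) (simp_all add: khom_add)

text \<open>The two ends of the outermost sweep contribute the terms of the first vertex v, with
  exponent 0. The other terms come from the boundary of the inner chain; their sign changes because
  of the sweep, as it should since v now precedes w.\<close>

lemma phi_boundary:
  "\<sigma> \<in> L \<Longrightarrow> x \<in> X \<Longrightarrow> field_boundary (card \<sigma>) (phi \<sigma> x)
    = (\<Sum>w\<in>\<sigma>. sg (below w \<sigma>) (phi (\<sigma> - {w}) (T w x) - phi (\<sigma> - {w}) x))"
proof (induction \<sigma> arbitrary: x rule: face_induct)
  case empty then show ?case by simp
next
  case (insert v \<sigma>)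
  have \<sigma>: "\<sigma> \<in> L" using insert down_closedD[OF L_down] by blast
  note x = insert.prems(2)
  have sub: "EK (Pow \<sigma>) \<subseteq> EK (lk L v)" by (rule EK_Pow_lk) fact+
  have ph: "phi \<sigma> x \<in> fch (card \<sigma>) (EK (Pow \<sigma>))" by (rule phi_chains[OF \<sigma> x])
  have 0: "kmap (card \<sigma>) (\<lambda>y. flow v (y, 0)) (phi \<sigma> x) = phi \<sigma> x"
    by (rule kmap_id[OF ph]) (use sub flow_0 in auto)
  have tm: "khom 0 (card \<sigma> - Suc 0) (flow v) (sg (below w \<sigma>) (phi (\<sigma> - {w}) (T w x) - phi (\<sigma> - {w}) x))
      = - sg (below w (insert v \<sigma>)) (phi (insert v \<sigma> - {w}) (T w x) - phi (insert v \<sigma> - {w}) x)" if w: "w \<in> \<sigma>" for w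
  proof -
    have "insert v \<sigma> - {w} = insert v (\<sigma> - {w})" using w insert.hyps by auto
    then have "phi (insert v \<sigma> - {w}) y = khom 0 (card \<sigma> - Suc 0) (flow v) (phi (\<sigma> - {w}) y)" for y
      using phi_insert[of v "\<sigma> - {w}" y] insert.hyps w by simp
    moreover have "below w (insert v \<sigma>) = Suc (below w \<sigma>)"
      using below_insert[of v \<sigma> w] insert.hyps w by simp
    ultimately show ?thesis by (simp add: khom_sg khom_diff)
  qed
  have "khom 0 (card \<sigma> - Suc 0) (flow v) (field_boundary (card \<sigma>) (phi \<sigma> x))
      = - (\<Sum>w\<in>\<sigma>. sg (below w (insert v \<sigma>)) (phi (insert v \<sigma> - {w}) (T w x) - phi (insert v \<sigma> - {w}) x))"
    unfolding insert.IH[OF \<sigma> x] khom_sum sum_negf[symmetric] by (intro sum.cong) (auto simp: tm)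
  then have "field_boundary (Suc (card \<sigma>)) (khom 0 (card \<sigma>) (flow v) (phi \<sigma> x)) = phi \<sigma> (T v x) - phi \<sigma> x
      + (\<Sum>w\<in>\<sigma>. sg (below w (insert v \<sigma>)) (phi (insert v \<sigma> - {w}) (T w x) - phi (insert v \<sigma> - {w}) x))"
    using khom_boundary[OF ph, of 0 "flow v"] 0 phi_tau[of v \<sigma> x] insert.prems insert.hyps by simp
  moreover have "below v (insert v \<sigma>) = 0"
    using insert.hyps by (force simp: below_def)
  moreover have "insert v \<sigma> - {v} = \<sigma>" using insert.hyps by auto
  ultimately show ?case
    using phi_insert[of v \<sigma> x] insert.hyps by (simp add: sum.insert)
qed

definition Phi :: "('v set \<Rightarrow> ('x \<Rightarrow>\<^sub>0 'k)) \<Rightarrow> ((nat \<Rightarrow> real) \<Rightarrow> 'e) \<Rightarrow>\<^sub>0 'k"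
  where "Phi c = (\<Sum>\<sigma>\<in>UNIV. lin (phi \<sigma>) (c \<sigma>))"

lemma Phi_0 [simp]: "Phi (\<lambda>_. 0) = 0"
  by (simp add: Phi_def)

lemma Phi_add: "Phi (\<lambda>\<sigma>. a \<sigma> + b \<sigma>) = Phi a + Phi b"
  by (simp add: Phi_def lin_add sum.distrib)

lemma Phi_minus: "Phi (\<lambda>\<sigma>. - a \<sigma>) = - Phi a"
  by (simp add: Phi_def lin_uminus sum_negf)

lemma Phi_diff: "Phi (\<lambda>\<sigma>. a \<sigma> - b \<sigma>) = Phi a - Phi b"
  by (simp add: Phi_def lin_diff sum_subtractf)

lemma Phi_chains:
  assumes K: "K \<subseteq> L" "down_closed K" and c: "c \<in> kchains K i (pm_on X)"
  shows "Phi c \<in> fch i (EK K)"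
  unfolding Phi_def
proof (intro field_chains_sum)
  fix \<sigma> :: "'v set"
  show "lin (phi \<sigma>) (c \<sigma>) \<in> fch i (EK K)"
  proof (cases "c \<sigma> = 0")
    case False
    then have \<sigma>: "\<sigma> \<in> K" "card \<sigma> = i" "keys (c \<sigma>) \<subseteq> X" using c by (auto simp: kchains_def pm_on_def)
    have "EK (Pow \<sigma>) \<subseteq> EK K" using \<sigma> down_closedD[OF K(2)] by (intro EK_mono) auto
    then show ?thesis
      using \<sigma> K(1) by (intro field_chains_lin field_chains_mono[OF phi_chains[of \<sigma>, unfolded \<sigma>(2)]]) auto
  qed simp
qed

lemma lin_sg: "lin f (sg m c) = sg m (lin f c)"
  by (simp add: sg_def lin_uminus)

lemma lin_fun_sg: "lin (\<lambda>x. sg m (f x)) c = sg m (lin f c)"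
  by (simp add: sg_def lin_fun_uminus)

lemma Phi_boundary:
  assumes c: "c \<in> kchains L i (pm_on X)"
  shows "field_boundary i (Phi c) = Phi (cbd (shift_op T) c)"
proof -
  have single: "field_boundary i (lin (phi \<sigma>) (c \<sigma>))
      = (\<Sum>w\<in>\<sigma>. sg (below w \<sigma>) (lin (phi (\<sigma> - {w})) (shift_op T w (c \<sigma>))))" for \<sigma>
  proof (cases "c \<sigma> = 0")
    case True then show ?thesis by (simp add: additive_ops_0[OF additive_shift_op])
  next
    case False
    then have \<sigma>: "\<sigma> \<in> L" "card \<sigma> = i" "keys (c \<sigma>) \<subseteq> X" using c by (auto simp: kchains_def pm_on_def)
    have "field_boundary i (lin (phi \<sigma>) (c \<sigma>)) = lin (\<lambda>x. field_boundary i (phi \<sigma> x)) (c \<sigma>)"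
      unfolding field_boundary_kext kext_def by (rule lin_lin)
    also have "\<dots> = lin (\<lambda>x. \<Sum>w\<in>\<sigma>. sg (below w \<sigma>) (phi (\<sigma> - {w}) (T w x) - phi (\<sigma> - {w}) x)) (c \<sigma>)"
      using phi_boundary[OF \<sigma>(1), unfolded \<sigma>(2)] \<sigma>(3) by (intro lin_cong) auto
    finally show ?thesis
      by (simp add: lin_fun_sum lin_fun_sg lin_fun_diff shift_op_def lin_diff lin_lin)
  qed
  have "field_boundary i (Phi c) = (\<Sum>\<sigma>\<in>UNIV. field_boundary i (lin (phi \<sigma>) (c \<sigma>)))"
    unfolding Phi_def field_boundary_kext kext_sum ..
  also have "\<dots> = (\<Sum>\<sigma>\<in>UNIV. \<Sum>w\<in>\<sigma>. sg (below w \<sigma>) (lin (phi (\<sigma> - {w})) (shift_op T w (c \<sigma>))))"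
    by (simp add: single)
  also have "\<dots> = (\<Sum>(\<sigma>, w)\<in>(SIGMA \<sigma>:UNIV. \<sigma>). sg (below w \<sigma>) (lin (phi (\<sigma> - {w})) (shift_op T w (c \<sigma>))))"
    by (rule sum.Sigma) auto
  also have "\<dots> = (\<Sum>(\<tau>, w)\<in>(SIGMA \<tau>:UNIV. - \<tau>). sg (below w \<tau>) (lin (phi \<tau>) (shift_op T w (c (insert w \<tau>)))))"
    by (rule sum.reindex_bij_witness[where i = "\<lambda>(\<tau>, w). (insert w \<tau>, w)" and j = "\<lambda>(\<sigma>, w). (\<sigma> - {w}, w)"])
      (auto simp: below_self insert_absorb)
  also have "\<dots> = (\<Sum>\<tau>\<in>UNIV. \<Sum>w\<in>-\<tau>. sg (below w \<tau>) (lin (phi \<tau>) (shift_op T w (c (insert w \<tau>)))))"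
    by (rule sum.Sigma[symmetric]) auto
  also have "\<dots> = Phi (cbd (shift_op T) c)"
    by (simp add: Phi_def cbd_def lin_sum lin_sg)
  finally show ?thesis .
qed

lemma kmap_lin: "kmap q g (lin f c) = lin (\<lambda>x. kmap q g (f x)) c"
  unfolding kext_def by (rule lin_lin)

lemma khom_lin: "khom n q K (lin f c) = lin (\<lambda>x. khom n q K (f x)) c"
  unfolding khom_def kext_def lin_lin ..

lemma Phi_tau:
  assumes c: "c \<in> kchains (lk L v) i (pm_on X)"
  shows "kmap i (\<tau> v) (Phi c) - Phi c = Phi (\<lambda>\<sigma>. shift_op T v (c \<sigma>))"
proof -
  have "kmap i (\<tau> v) (lin (phi \<sigma>) (c \<sigma>)) - lin (phi \<sigma>) (c \<sigma>) = lin (phi \<sigma>) (shift_op T v (c \<sigma>))" for \<sigma>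
  proof (cases "c \<sigma> = 0")
    case True then show ?thesis by (simp add: additive_ops_0[OF additive_shift_op])
  next
    case False
    then have \<sigma>: "insert v \<sigma> \<in> L" "v \<notin> \<sigma>" "card \<sigma> = i" "keys (c \<sigma>) \<subseteq> X"
      using c by (auto simp: kchains_def pm_on_def lk_def)
    have "kmap i (\<tau> v) (lin (phi \<sigma>) (c \<sigma>)) = lin (\<lambda>x. phi \<sigma> (T v x)) (c \<sigma>)"
      unfolding kmap_lin using phi_tau[OF \<sigma>(1,2), unfolded \<sigma>(3)] \<sigma>(4) by (intro lin_cong) auto
    then show ?thesis by (simp add: shift_op_def lin_diff lin_lin)
  qed
  then show ?thesis
    by (simp add: Phi_def kext_sum sum_subtractf[symmetric])
qed

lemma Phi_join:
  assumes S: "v \<notin> S" "\<And>u. u \<in> S \<Longrightarrow> to_nat v < to_nat u"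
    and c: "supported c0 S" "supported c1 S" and i: "\<And>\<sigma>. c1 \<sigma> \<noteq> 0 \<Longrightarrow> card \<sigma> = i"
  shows "Phi (join v c0 c1) = Phi c0 + khom 0 i (flow v) (Phi c1)"
proof -
  have UN: "UNIV = {\<sigma>. v \<notin> \<sigma>} \<union> insert v ` {\<sigma>. v \<notin> \<sigma>}"
  proof -
    have "\<sigma> \<in> insert v ` {\<sigma>. v \<notin> \<sigma>}" if "v \<in> \<sigma>" for \<sigma> :: "'v set"
      using that by (intro image_eqI[of _ _ "\<sigma> - {v}"]) auto
    then show ?thesis by blast
  qed
  have inj: "inj_on (insert v) {\<sigma>. v \<notin> \<sigma>}" by (rule inj_onI) (metis insert_ident mem_Collect_eq)
  have split: "(\<Sum>\<sigma>\<in>UNIV. f \<sigma>) = (\<Sum>\<sigma> | v \<notin> \<sigma>. f \<sigma>) + (\<Sum>\<sigma> | v \<notin> \<sigma>. f (insert v \<sigma>))"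
    for f :: "'v set \<Rightarrow> ((nat \<Rightarrow> real) \<Rightarrow> 'e) \<Rightarrow>\<^sub>0 'k"
  proof -
    have "sum f UNIV = sum f {\<sigma>. v \<notin> \<sigma>} + sum f (insert v ` {\<sigma>. v \<notin> \<sigma>})"
      by (subst UN, rule sum.union_disjoint) auto
    then show ?thesis by (simp add: sum.reindex[OF inj])
  qed
  have z: "c0 (insert v \<sigma>) = 0" "c1 (insert v \<sigma>) = 0" for \<sigma> using c S(1) by (auto simp: supported_def)
  have P: "lin (phi (insert v \<sigma>)) (c1 \<sigma>) = khom 0 i (flow v) (lin (phi \<sigma>) (c1 \<sigma>))" if "v \<notin> \<sigma>" for \<sigma>
  proof (cases "c1 \<sigma> = 0")
    case False
    then have "\<sigma> \<subseteq> S" "card \<sigma> = i" using c i by (auto simp: supported_def)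
    then show ?thesis unfolding khom_lin using phi_insert[of v \<sigma>] that S(2) by (intro lin_cong) auto
  qed simp
  have "Phi (join v c0 c1) = (\<Sum>\<sigma> | v \<notin> \<sigma>. lin (phi \<sigma>) (c0 \<sigma>)) + (\<Sum>\<sigma> | v \<notin> \<sigma>. lin (phi (insert v \<sigma>)) (c1 \<sigma>))"
    unfolding Phi_def split by (intro arg_cong2[where f = "(+)"] sum.cong) (auto simp: join_def)
  also have "(\<Sum>\<sigma> | v \<notin> \<sigma>. lin (phi (insert v \<sigma>)) (c1 \<sigma>)) = khom 0 i (flow v) (\<Sum>\<sigma> | v \<notin> \<sigma>. lin (phi \<sigma>) (c1 \<sigma>))"
    unfolding khom_sum by (intro sum.cong) (auto simp: P)
  finally show ?thesis unfolding Phi_def split z by simp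
qed

end


section \<open>Acyclicity of the mapping cone, by induction over vertices\<close>

context toric_cover_fibre
begin

abbreviation "N \<equiv> (pm_on X :: ('x \<Rightarrow>\<^sub>0 'k) set)"
abbreviation "xo \<equiv> (shift_op T :: 'v \<Rightarrow> ('x \<Rightarrow>\<^sub>0 'k) \<Rightarrow> ('x \<Rightarrow>\<^sub>0 'k))"

lemma xo_N: "m \<in> N \<Longrightarrow> xo v m \<in> N"
  by (rule pm_on_shift) (use T_X in auto)

lemma cbd_kchains_N: "down_closed K \<Longrightarrow> c \<in> kchains K i N \<Longrightarrow> cbd xo c \<in> kchains K (i - 1) N"
  by (rule cbd_kchains) (auto intro: additive_shift_op xo_N pm_on_closed)

text \<open>The mapping cone of \<open>Phi\<close> over \<open>K\<close> is acyclic.\<close>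

definition QI :: "'v set set \<Rightarrow> bool"
  where "QI K \<longleftrightarrow> (\<forall>i e d. e \<in> fch i (EK K) \<longrightarrow> d \<in> kchains K (i - 1) N \<longrightarrow> cbd xo d = (\<lambda>_. 0) \<longrightarrow>
    (i = 0 \<longrightarrow> d = (\<lambda>_. 0)) \<longrightarrow> field_boundary i e = Phi d \<longrightarrow>
    (\<exists>d'\<in>kchains K i N. cbd xo d' = d \<and> (\<exists>f\<in>fch (Suc i) (EK K). e - Phi d' = field_boundary (Suc i) f)))"

lemma QI_D:
  assumes "QI K" "e \<in> fch i (EK K)" "d \<in> kchains K (i - 1) N" "cbd xo d = (\<lambda>_. 0)"
    "i = 0 \<Longrightarrow> d = (\<lambda>_. 0)" "field_boundary i e = Phi d"
  obtains d' f where "d' \<in> kchains K i N" "cbd xo d' = d" "f \<in> fch (Suc i) (EK K)" "e - Phi d' = field_boundary (Suc i) f"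
  using assms unfolding QI_def by metis

abbreviation "vtx \<equiv> (\<lambda>j::nat. if j = 0 then 1 else (0::real))"
abbreviation "cs n y \<equiv> restrict (\<lambda>_. y) (standard_simplex n)"

text \<open>The projection is constant on the fibre, so the simplex and a constant map lift the same
  map from a connected space.\<close>

lemma fibre_simplex_const:
  assumes s: "singular_simplex i (top_of_set (EK {{}})) s"
  shows "s = cs i (s vtx) \<and> s vtx \<in> EK {{}}"
proof -
  have eu: "powertop_real UNIV = (euclidean :: (nat \<Rightarrow> real) topology)" by (simp add: euclidean_product_topology)
  have cont: "continuous_on (standard_simplex i) s" "s \<in> standard_simplex i \<rightarrow> EK {{}}"
    using s unfolding singular_simplex_def eu by (auto simp: continuous_map_in_subtopology)
  have con: "connected (standard_simplex i)"
    using connectedin_standard_simplex[of i] unfolding eu by simp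
  have v: "vtx \<in> standard_simplex i" by simp
  have sv: "s vtx \<in> EK {{}}" using cont(2) v by (metis PiE)
  have p1: "p y = (\<chi> v. 1)" if "y \<in> EK {{}}" for y
    using that by (auto simp: EK_def supp_def vec_eq_iff)
  have c: "s z = s vtx" if z: "z \<in> standard_simplex i" for z
  proof (rule covering_lift_unique[OF cov con, of s "\<lambda>_. s vtx" vtx z])
    show "p (s w) = p (s vtx)" if "w \<in> standard_simplex i" for w
      using p1[of "s w"] p1[of "s vtx"] cont(2) that v by (metis PiE)
  qed (use cont sv z EK_subset in auto)
  have "s w = cs i (s vtx) w" for w
  proof (cases "w \<in> standard_simplex i")
    case True
    from c[OF this] True show ?thesis by simp
  next
    case False
    then show ?thesis using s extensional_arb[of s "standard_simplex i" w] by (simp add: singular_simplex_def)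
  qed
  then have "s = cs i (s vtx)" by (rule ext)
  then show ?thesis using sv by blast
qed

lemma const_boundary:
  "field_boundary n (single (cs n y) r :: ((nat \<Rightarrow> real) \<Rightarrow> 'e) \<Rightarrow>\<^sub>0 'k) = (if n = 0 \<or> odd n then 0 else single (cs (n - 1) y) r)"
proof -
  have top: "topspace (top_of_set {y}) = {y}" by simp
  have "singular_chain n (top_of_set {y}) (frag_of (cs n y))"
    by (simp add: singular_chain_of singular_simplex_def)
  from chain_boundary_of_singleton[OF top this] show ?thesis
    by (simp add: field_boundary_kext)
qed

text \<open>The fibre has one singular simplex per point and dimension, and its boundary is
  alternately 0 and the constant simplex one dimension lower. Only degree 0 survives, and there
  \<open>phi {}\<close> identifies fibre points with constant simplices.\<close>

lemma QI_base:
  assumes K: "K \<subseteq> {{}}"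
  shows "QI K"
proof (cases "K = {}")
  case True
  have "topspace (top_of_set (EK K)) = {}" by (simp add: EK_def True)
  then have e0: "e = 0" if "e \<in> fch i (EK K)" for e :: "((nat \<Rightarrow> real) \<Rightarrow> 'e) \<Rightarrow>\<^sub>0 'k" and i
    using that singular_simplex_empty[of "top_of_set (EK K)"] unfolding field_chains_iff
    by (metis all_not_in_conv keys_eq_empty)
  have d0: "d = (\<lambda>_. 0)" if "d \<in> kchains K i N" for d i using that by (auto simp: kchains_def True)
  show ?thesis unfolding QI_def
  proof (intro allI impI)
    fix i and e :: "((nat \<Rightarrow> real) \<Rightarrow> 'e) \<Rightarrow>\<^sub>0 'k" and d
    assume e: "e \<in> fch i (EK K)" and d: "d \<in> kchains K (i - 1) N" and cd: "cbd xo d = (\<lambda>_. 0)"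
    have "(\<lambda>_. 0) \<in> kchains K i N" by (rule kchains_0) (simp add: pm_on_def)
    moreover have "cbd xo (\<lambda>_. 0) = d" using cd d0[OF d] by simp
    moreover have "(0 :: ((nat \<Rightarrow> real) \<Rightarrow> 'e) \<Rightarrow>\<^sub>0 'k) \<in> fch (Suc i) (EK K)" by simp
    ultimately show "\<exists>d'\<in>kchains K i N. cbd xo d' = d \<and> (\<exists>f\<in>fch (Suc i) (EK K). e - Phi d' = field_boundary (Suc i) f)"
      using e0[OF e] by (metis Phi_0 diff_zero field_boundary_0(1))
  qed
next
  case False
  with K have K: "K = {{}}" by auto
  show ?thesis unfolding QI_def K
  proof (intro allI impI)
    fix i and e :: "((nat \<Rightarrow> real) \<Rightarrow> 'e) \<Rightarrow>\<^sub>0 'k" and d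
    assume e: "e \<in> fch i (EK {{}})" and d: "d \<in> kchains {{}} (i - 1) N" and cd: "cbd xo d = (\<lambda>_. 0)"
      and d0: "i = 0 \<longrightarrow> d = (\<lambda>_. 0)" and bd: "field_boundary i e = Phi d"
    have const: "s = cs i (s vtx) \<and> s vtx \<in> EK {{}}" if "s \<in> keys e" for s
      using fibre_simplex_const that e by (auto simp: field_chains_iff)
    \<comment> \<open>\<open>up n\<close> replaces a constant simplex by the constant simplex of
      dimension n at the same point; it inverts the nonzero boundary maps.\<close>
    define up :: "nat \<Rightarrow> (((nat \<Rightarrow> real) \<Rightarrow> 'e) \<Rightarrow>\<^sub>0 'k) \<Rightarrow> ((nat \<Rightarrow> real) \<Rightarrow> 'e) \<Rightarrow>\<^sub>0 'k" where "up n = lin (\<lambda>s. single (cs n (s vtx)) 1)" for n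
    have up_e: "up i e = e"
    proof -
      have "up i e = lin (\<lambda>s. single s 1) e" unfolding up_def using const by (intro lin_cong) metis
      then show ?thesis by simp
    qed
    have up_up: "up m (up n c) = up m c" for m n c
      unfolding up_def lin_lin by simp
    have bup: "field_boundary n (up n c) = (if n = 0 \<or> odd n then 0 else up (n - 1) c)" for n c
    proof -
      have "field_boundary n (up n c) = lin (\<lambda>s. field_boundary n (single (cs n (s vtx)) 1)) c"
        unfolding field_boundary_kext kext_def up_def lin_lin ..
      then show ?thesis unfolding const_boundary by (simp add: up_def)
    qed
    show "\<exists>d'\<in>kchains {{}} i N. cbd xo d' = d \<and> (\<exists>f\<in>fch (Suc i) (EK {{}}). e - Phi d' = field_boundary (Suc i) f)"
    proof (cases "i = 0")
      case True
      define g where "g = (\<lambda>y. inv_into X fib y)"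
      have g: "g y \<in> X" "fib (g y) = y" if "y \<in> EK {{}}" for y
        using that fib by (auto simp: g_def bij_betw_def inv_into_into f_inv_into_f)
      define d' where "d' = (\<lambda>\<sigma>::'v set. if \<sigma> = {} then lin (\<lambda>s. single (g (s vtx)) 1) e else 0)"
      have "lin (\<lambda>s. single (g (s vtx)) 1) e \<in> N"
        by (rule pm_on_lin) (use const g in \<open>auto simp: pm_on_def\<close>)
      then have d': "d' \<in> kchains {{}} i N" by (auto simp: kchains_def d'_def True pm_on_def)
      have "Phi d' = lin (phi {}) (d' {})"
        unfolding Phi_def by (rule sum.mono_neutral_cong_right[of _ "{{}}", simplified]) (auto simp: d'_def)
      also have "\<dots> = lin (\<lambda>s. phi {} (g (s vtx))) e" by (simp add: d'_def lin_lin)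
      also have "\<dots> = lin (\<lambda>s. single s 1) e"
      proof (rule lin_cong)
        fix s assume s: "s \<in> keys e"
        then have "cs 0 (s vtx) = s" using const[OF s] True by simp
        then show "phi {} (g (s vtx)) = single s 1" using g(2) const[OF s] by (simp add: phi_empty)
      qed
      finally have "Phi d' = e" by simp
      moreover have "cbd xo d' = d"
        using cbd_degree_0[OF additive_shift_op, of d' "{{}}" N] d' d0 True by simp
      ultimately show ?thesis using d' by (intro bexI[of _ d'] conjI bexI[of _ 0]) auto
    next
      case False
      have be: "field_boundary i e = (if odd i then 0 else up (i - 1) e)"
        using bup[of i e] up_e False by simp
      have dz: "d = (\<lambda>_. 0)"
      proof (cases "i = 1")
        case True
        define g where "g = (\<lambda>y. inv_into X fib y)"
        have dX: "keys (d {}) \<subseteq> X" using d by (auto simp: kchains_def pm_on_def)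
        have gx: "g (fib x) = x" if "x \<in> X" for x using that fib by (simp add: g_def bij_betw_def)
        have dn: "d \<sigma> = 0" if "\<sigma> \<noteq> {}" for \<sigma> using d that by (auto simp: kchains_def)
        have "Phi d = lin (phi {}) (d {})"
          unfolding Phi_def
          by (rule sum.mono_neutral_cong_right[of _ "{{}}", simplified]) (auto simp: dn)
        then have "lin (phi {}) (d {}) = 0" using bd be True by simp
        then have "lin (\<lambda>s. single (g (s vtx)) 1) (lin (phi {}) (d {})) = 0" by simp
        moreover have "lin (\<lambda>s. single (g (s vtx)) 1) (lin (phi {}) (d {})) = lin (\<lambda>x. single x 1) (d {})"
          unfolding lin_lin using dX gx by (intro lin_cong) (auto simp: phi_empty)
        ultimately have "d {} = 0" by simp
        then have "d \<sigma> = 0" for \<sigma> using dn[of \<sigma>] by (cases "\<sigma> = {}") auto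
        then show ?thesis by blast
      next
        case i1: False
        have "d \<sigma> = 0" for \<sigma>
          using d False i1 by (cases "d \<sigma> = 0") (auto simp: kchains_def)
        then show ?thesis by blast
      qed
      have cyc: "field_boundary i e = 0" using bd dz by simp
      have upX: "up (Suc i) e \<in> fch (Suc i) (EK {{}})"
        unfolding up_def by (intro field_chains_lin field_chains_single) (use const in \<open>auto simp: singular_simplex_def\<close>)
      have "\<exists>f\<in>fch (Suc i) (EK {{}}). e = field_boundary (Suc i) f"
      proof (cases "odd i")
        case True
        then show ?thesis using bup[of "Suc i" e] up_e upX by (intro bexI[of _ "up (Suc i) e"]) auto
      next
        case ev: False
        have "up i (up (i - 1) e) = 0" using cyc be ev by (simp add: up_def)
        then have "e = 0" unfolding up_up up_e .
        then show ?thesis by (intro bexI[of _ 0]) auto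
      qed
      moreover have "(\<lambda>_. 0) \<in> kchains {{}} i N" by (rule kchains_0) (simp add: pm_on_def)
      ultimately show ?thesis using dz cd by (intro bexI[of _ "\<lambda>_. 0"]) auto
    qed
  qed
qed

lemma join_split: "c = join v (\<lambda>\<sigma>. if v \<in> \<sigma> then 0 else c \<sigma>) (\<lambda>\<sigma>. if v \<in> \<sigma> then 0 else c (insert v \<sigma>))"
  by (rule ext) (auto simp: join_def insert_absorb)

text \<open>A five lemma argument on elements. Both sides are mapping cones over v: by
  \<open>cbd_join\<close> algebraically and by \<open>attaching_step\<close> for singular chains.
  First the link component of \<open>e\<close> is corrected through \<open>QI (lk K v)\<close>. What
  is left is a chain over the deletion, handled by \<open>QI (del K v)\<close>.\<close>

lemma QI_step:
  assumes K: "K \<subseteq> L" "down_closed K" and S: "v \<notin> S" "\<And>u. u \<in> S \<Longrightarrow> to_nat v < to_nat u"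
    and KS: "\<And>\<sigma>. \<sigma> \<in> K \<Longrightarrow> \<sigma> \<subseteq> insert v S"
    and IH: "QI (del K v)" "QI (lk K v)"
  shows "QI K"
  unfolding QI_def
proof (intro allI impI)
  interpret A: cylinder_attachment "EK K" "EK (del K v)" "EK (lk K v)" "{y\<in>EK K. 0 < Re (p y $ v)}"
    "flow v" "\<lambda>y. (unwind v (y, 1), angle v y)" "squeeze v" turn
    by (rule attachment[OF K])
  have x: "additive_ops xo" by (rule additive_shift_op)
  have delL: "del K v \<subseteq> L" "down_closed (del K v)" using K(1) down_closed_del[OF K(2)] by (auto simp: del_def)
  have lkL: "lk K v \<subseteq> L" "down_closed (lk K v)" "lk K v \<subseteq> lk L v"
    using K lk_subset_del[OF K(2), of v] down_closed_lk[OF K(2)] lk_mono[OF K(1)] by (auto simp: del_def)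
  have delS: "\<sigma> \<subseteq> S" if "\<sigma> \<in> del K v" for \<sigma> using that KS by (fastforce simp: del_def)
  have lkS: "\<sigma> \<subseteq> S" if "\<sigma> \<in> lk K v" for \<sigma> using that lk_subset_del[OF K(2)] delS by blast
  have lk_del: "c \<in> kchains (lk K v) j N \<Longrightarrow> c \<in> kchains (del K v) j N" for c j
    by (rule kchains_mono[OF lk_subset_del[OF K(2)]])
  have joinK: "join v c0 c1 \<in> kchains K (Suc j) N" if "c0 \<in> kchains (del K v) (Suc j) N" "c1 \<in> kchains (lk K v) j N" for c0 c1 j
    using that card_Suc_Diff1[of "\<sigma>::'v set" v for \<sigma>]
    by (auto simp: kchains_def join_def del_def lk_def insert_absorb) 
  fix i and e :: "((nat \<Rightarrow> real) \<Rightarrow> 'e) \<Rightarrow>\<^sub>0 'k" and d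
  assume e: "e \<in> fch i (EK K)" and d: "d \<in> kchains K (i - 1) N" and cd: "cbd xo d = (\<lambda>_. 0)"
    and d0: "i = 0 \<longrightarrow> d = (\<lambda>_. 0)" and bd: "field_boundary i e = Phi d"
  show "\<exists>d'\<in>kchains K i N. cbd xo d' = d \<and> (\<exists>f\<in>fch (Suc i) (EK K). e - Phi d' = field_boundary (Suc i) f)"
  proof (cases i)
    case 0
    obtain a dd where a: "a \<in> fch 0 (EK (del K v))" and dd: "dd \<in> fch 1 (EK K)" "e = a + field_boundary 1 dd"
      using A.split_chain_0 e 0 by metis
    have z: "(\<lambda>_. 0) \<in> kchains (del K v) (0 - 1) N" by (rule kchains_0) (simp add: pm_on_def)
    obtain d' f where d': "d' \<in> kchains (del K v) 0 N" "cbd xo d' = (\<lambda>_. 0)" and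
      f: "f \<in> fch (Suc 0) (EK (del K v))" "a - Phi d' = field_boundary (Suc 0) f"
      by (rule QI_D[OF IH(1) a z]) (auto simp: cbd_0[OF x])
    have "f + dd \<in> fch (Suc 0) (EK K)"
      using field_chains_mono[OF f(1) EK_mono[of "del K v" K]] dd by (auto simp: del_def intro: field_chains_add)
    moreover have "e - Phi d' = field_boundary (Suc 0) (f + dd)"
      using f(2) dd(2) by (simp add: field_boundary_add algebra_simps)
    moreover have "d' \<in> kchains K 0 N" by (rule kchains_mono[OF _ d'(1)]) (auto simp: del_def)
    ultimately show ?thesis using d' d0 0 by auto
  next
    case (Suc q)
    define c0 where "c0 = (\<lambda>\<sigma>. if v \<in> \<sigma> then 0 else d \<sigma>)"
    define c1 where "c1 = (\<lambda>\<sigma>. if v \<in> \<sigma> then 0 else d (insert v \<sigma>))"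
    have dj: "d = join v c0 c1" unfolding c0_def c1_def by (rule join_split)
    have c0: "c0 \<in> kchains (del K v) q N" using d Suc by (auto simp: kchains_def c0_def del_def pm_on_def)
    have c1: "c1 \<in> kchains (lk K v) (q - 1) N"
      using d Suc by (auto simp: kchains_def c1_def lk_def pm_on_def)
    have c1z: "c1 = (\<lambda>_. 0)" if "q = 0"
    proof
      fix \<sigma> show "c1 \<sigma> = 0"
        using d Suc that by (cases "d (insert v \<sigma>) = 0") (auto simp: kchains_def c1_def)
    qed
    have s0: "supported c0 S" and s1: "supported c1 S"
      by (rule kchains_supported[OF c0]; erule delS) (rule kchains_supported[OF c1]; erule lkS)
    have bj: "join v (\<lambda>\<tau>. cbd xo c0 \<tau> + xo v (c1 \<tau>)) (\<lambda>\<tau>. - cbd xo c1 \<tau>) = (\<lambda>_. 0)"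
      using cd cbd_join[OF x S s0 s1] unfolding dj by simp
    have cc1: "cbd xo c1 = (\<lambda>_. 0)"
    proof
      fix \<tau>
      show "cbd xo c1 \<tau> = 0"
      proof (cases "v \<in> \<tau>")
        case True
        then show ?thesis using cbd_supported[OF x s1] S(1) by (auto simp: supported_def)
      next
        case False
        then show ?thesis using fun_cong[OF bj, of "insert v \<tau>"] by (simp add: join_def)
      qed
    qed
    have cc0: "cbd xo c0 \<tau> + xo v (c1 \<tau>) = 0" for \<tau>
    proof (cases "v \<in> \<tau>")
      case True
      then have "cbd xo c0 \<tau> = 0" "c1 \<tau> = 0"
        using cbd_supported[OF x s0] s1 S(1) by (auto simp: supported_def)
      then show ?thesis by (simp add: additive_ops_0[OF x])
    next
      case False
      then show ?thesis using fun_cong[OF bj, of \<tau>] by (simp add: join_def)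
    qed
    have Phi_d: "Phi d = (if q = 0 then 0 else khom 0 (q - 1) (flow v) (Phi c1)) + Phi c0"
    proof -
      have "Phi d = Phi c0 + khom 0 (q - 1) (flow v) (Phi c1)"
        unfolding dj by (rule Phi_join[OF S s0 s1]) (use c1 in \<open>auto simp: kchains_def\<close>)
      then show ?thesis using c1z by simp
    qed
    have P1: "Phi c1 \<in> fch (q - 1) (EK (lk K v))" by (rule Phi_chains[OF lkL(1,2) c1])
    have P0: "Phi c0 \<in> fch q (EK (del K v))" by (rule Phi_chains[OF delL c0])
    have bP1: "field_boundary (q - 1) (Phi c1) = 0"
      using Phi_boundary[OF kchains_mono[OF lkL(1) c1]] cc1 by simp
    obtain b' a' dd where b': "b' \<in> fch q (EK (lk K v))" and bb': "field_boundary q b' = - Phi c1"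
      and a': "a' \<in> fch (Suc q) (EK (del K v))" and dd: "dd \<in> fch (Suc (Suc q)) (EK K)"
      and e_eq: "e = khom 0 q (flow v) b' + a' + field_boundary (Suc (Suc q)) dd"
      by (rule A.attaching_step[OF e[unfolded Suc] P0 P1 bP1 _ bd[unfolded Suc Phi_d]]) (use c1z in auto)
    \<comment> \<open>The sign: \<open>b'\<close> has boundary - \<open>Phi c1\<close>, so the
      hypothesis on the link is applied to - \<open>b'\<close>, and \<open>d1\<close> will enter the
      result negatively.\<close>
    obtain d1 b2 where d1: "d1 \<in> kchains (lk K v) q N" "cbd xo d1 = c1"
      and b2: "b2 \<in> fch (Suc q) (EK (lk K v))" "- b' - Phi d1 = field_boundary (Suc q) b2"
      by (rule QI_D[OF IH(2) field_chains_uminus[OF b'] c1 cc1]) (use c1z bb' in \<open>auto simp: field_boundary_uminus\<close>)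
    have d1L: "d1 \<in> kchains L q N" "d1 \<in> kchains (lk L v) q N"
      using kchains_mono[OF lkL(1) d1(1)] kchains_mono[OF lkL(3) d1(1)] .
    have s1': "supported d1 S" by (rule kchains_supported[OF d1(1)]; erule lkS)
    have Pd1: "Phi d1 \<in> fch q (EK (lk K v))" by (rule Phi_chains[OF lkL(1,2) d1(1)])
    have bPd1: "field_boundary q (Phi d1) = Phi c1" using Phi_boundary[OF d1L(1)] d1(2) by simp
    define a2 where "a2 = a' - kmap (Suc q) (\<tau> v) b2 + b2"
    have tb2: "kmap (Suc q) (\<tau> v) b2 \<in> fch (Suc q) (EK (lk K v))"
      by (rule kmap_chains_on[OF b2(1)]) (use A.F_1 in \<open>auto intro!: continuous_on_compose2[OF A.F_cont] continuous_intros\<close>)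
    have a2: "a2 \<in> fch (Suc q) (EK (del K v))"
      unfolding a2_def using tb2 b2(1) a' A.B_Y0
      by (intro field_chains_add field_chains_diff) (auto intro: field_chains_mono)
    have "b' = - Phi d1 - (- b' - Phi d1)" by simp
    then have b'_eq: "b' = - Phi d1 - field_boundary (Suc q) b2" unfolding b2(2) .
    have e_eq2: "e = - khom 0 q (flow v) (Phi d1) + a2 + field_boundary (Suc (Suc q)) (dd + khom 0 (Suc q) (flow v) b2)"
      unfolding e_eq b'_eq a2_def khom_diff khom_uminus field_boundary_add
      using A.P_boundary[OF b2(1)] by (simp add: algebra_simps)
    \<comment> \<open>The sweep of \<open>Phi d1\<close> leaves its ends in the deletion; they add
      x_v \<open>d1\<close> to the deletion part \<open>c0\<close> of the prescribed
      boundary.\<close>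
    define d2 where "d2 = (\<lambda>\<sigma>. c0 \<sigma> + xo v (d1 \<sigma>))"
    have d2: "d2 \<in> kchains (del K v) q N"
      unfolding d2_def by (intro kchains_add c0 lk_del kchains_op[OF x] xo_N d1)
    have cd2: "cbd xo d2 = (\<lambda>_. 0)"
    proof
      fix \<tau>
      have com: "xo w (xo v m) = xo v (xo w m)" if "m \<in> N" for w m
        using shift_op_commute[of m X T] that T_comm by (simp add: pm_on_def)
      have "cbd xo (\<lambda>\<sigma>. xo v (d1 \<sigma>)) \<tau> = xo v (cbd xo d1 \<tau>)"
        unfolding cbd_def additive_ops_sum[OF x] additive_ops_sg[OF x]
        using com d1(1) by (intro sum.cong) (auto simp: kchains_def)
      then show "cbd xo d2 \<tau> = 0" using cc0[of \<tau>] unfolding d2_def cbd_add[OF x] d1(2) by simp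
    qed
    have "field_boundary (Suc q) (khom 0 q (flow v) (Phi d1)) = Phi (\<lambda>\<sigma>. xo v (d1 \<sigma>)) - khom 0 (q - 1) (flow v) (Phi c1)"
      using A.P_boundary[OF Pd1] Phi_tau[OF d1L(2)] bPd1 by (simp add: algebra_simps)
    moreover have "field_boundary (Suc q) e = - field_boundary (Suc q) (khom 0 q (flow v) (Phi d1)) + field_boundary (Suc q) a2"
    proof -
      have "dd + khom 0 (Suc q) (flow v) b2 \<in> fch (Suc (Suc q)) (EK K)"
        by (intro field_chains_add dd A.P_chains b2)
      from field_boundary_boundary[OF this]
      have "field_boundary (Suc q) (field_boundary (Suc (Suc q)) (dd + khom 0 (Suc q) (flow v) b2)) = 0" by simp
      then show ?thesis
        by (subst e_eq2) (simp add: field_boundary_add[of "Suc q"] field_boundary_diff[of "Suc q"] field_boundary_uminus)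
    qed
    ultimately have "field_boundary (Suc q) a2 = Phi c0 + Phi (\<lambda>\<sigma>. xo v (d1 \<sigma>))"
      using bd Suc Phi_d c1z by (cases "q = 0") (auto simp: algebra_simps)
    then have ba2: "field_boundary (Suc q) a2 = Phi d2" unfolding d2_def Phi_add .
    obtain d3 f3 where d3: "d3 \<in> kchains (del K v) (Suc q) N" "cbd xo d3 = d2"
      and f3: "f3 \<in> fch (Suc (Suc q)) (EK (del K v))" "a2 - Phi d3 = field_boundary (Suc (Suc q)) f3"
      by (rule QI_D[OF IH(1) a2 _ cd2 _ ba2]) (use d2 in auto)
    define d' where "d' = join v d3 (\<lambda>\<sigma>. - d1 \<sigma>)"
    have md1: "(\<lambda>\<sigma>. - d1 \<sigma>) \<in> kchains (lk K v) q N" by (rule kchains_minus[OF d1(1)])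
    have s3: "supported d3 S" and sm: "supported (\<lambda>\<sigma>. - d1 \<sigma>) S"
      by (rule kchains_supported[OF d3(1)]; erule delS) (rule kchains_supported[OF md1]; erule lkS)
    have d': "d' \<in> kchains K (Suc q) N" unfolding d'_def by (rule joinK[OF d3(1) md1])
    have "cbd xo d' = d"
    proof -
      have "cbd xo d' = join v (\<lambda>\<tau>. cbd xo d3 \<tau> + xo v (- d1 \<tau>)) (\<lambda>\<tau>. - cbd xo (\<lambda>\<sigma>. - d1 \<sigma>) \<tau>)"
        unfolding d'_def by (rule cbd_join[OF x S s3 sm])
      also have "\<dots> = join v c0 c1"
        by (simp add: cbd_minus[OF x] d1(2) d3(2) d2_def additive_ops_minus[OF x])
      finally show ?thesis using dj by simp
    qed
    moreover have "Phi d' = Phi d3 - khom 0 q (flow v) (Phi d1)"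
      unfolding d'_def using Phi_join[OF S s3 sm, of q] md1 by (auto simp: kchains_def Phi_minus khom_uminus)
    then have "e - Phi d' = field_boundary (Suc (Suc q)) (dd + khom 0 (Suc q) (flow v) b2 + f3)"
    proof -
      assume P: "Phi d' = Phi d3 - khom 0 q (flow v) (Phi d1)"
      have "a2 = Phi d3 + field_boundary (Suc (Suc q)) f3" using f3(2) by (simp add: algebra_simps)
      then show ?thesis unfolding P by (subst e_eq2) (simp add: field_boundary_add algebra_simps)
    qed
    moreover have "dd + khom 0 (Suc q) (flow v) b2 + f3 \<in> fch (Suc (Suc q)) (EK K)"
      by (intro field_chains_add dd A.P_chains b2 field_chains_mono[OF f3(1) A.Y0_Y])
    ultimately show ?thesis using d' Suc by blast
  qed
qed

lemma QI_faces: "K \<subseteq> L \<Longrightarrow> down_closed K \<Longrightarrow> (\<And>\<sigma>. \<sigma> \<in> K \<Longrightarrow> \<sigma> \<subseteq> S) \<Longrightarrow> QI K"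
proof (induction S arbitrary: K rule: face_induct)
  case empty
  then show ?case by (intro QI_base) auto
next
  case (insert v S)
  have delL: "del K v \<subseteq> L" "down_closed (del K v)"
    using insert.prems down_closed_del by (auto simp: del_def)
  have delS: "\<sigma> \<subseteq> S" if "\<sigma> \<in> del K v" for \<sigma>
    using that insert.prems(3)[of \<sigma>] by (auto simp: del_def)
  have lk: "lk K v \<subseteq> del K v" by (rule lk_subset_del[OF insert.prems(2)])
  show ?case
  proof (rule QI_step[OF insert.prems(1,2) insert.hyps insert.prems(3)])
    show "QI (del K v)" by (rule insert.IH[OF delL delS])
    show "QI (lk K v)"
      by (rule insert.IH[OF _ down_closed_lk[OF insert.prems(2)]]) (use lk delL delS in blast)+
  qed
qed

lemma QI_L: "QI L"
  by (rule QI_faces[OF _ L_down, of UNIV]) auto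

text \<open>The case of the mapping cone with d = 0: surjectivity on homology.\<close>

lemma Phi_cycles_onto:
  assumes e: "e \<in> fch i E" and be: "field_boundary i e = 0"
  shows "\<exists>d\<in>kchains L i N. cbd xo d = (\<lambda>_. 0) \<and> (\<exists>f\<in>fch (Suc i) E. e - Phi d = field_boundary (Suc i) f)"
proof -
  have 1: "(\<lambda>_. 0) \<in> kchains L (i - 1) N" by (rule kchains_0) (simp add: pm_on_def)
  have 2: "cbd xo (\<lambda>_. 0) = (\<lambda>_. 0)" by (rule ext) (rule cbd_0[OF additive_shift_op])
  have 3: "field_boundary i e = Phi (\<lambda>_. 0)" unfolding be Phi_0 ..
  note Q = QI_L[unfolded QI_def EK_L, THEN spec[of _ i], THEN spec[of _ e], THEN spec[of _ "\<lambda>_. 0"], THEN mp, OF e, THEN mp, OF 1,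
      THEN mp, OF 2, THEN mp, OF _, THEN mp, OF _ 3]
  show ?thesis by (rule Q) (rule impI, rule refl)
qed

text \<open>Here the singular chain f bounding \<open>Phi d\<close> is the other component of a
  cycle of the mapping cone; this gives injectivity on homology.\<close>

lemma Phi_boundaries_reflect:
  assumes d: "d \<in> kchains L i N" and cd: "cbd xo d = (\<lambda>_. 0)"
    and f: "Phi d = field_boundary (Suc i) f" "f \<in> fch (Suc i) E"
  shows "\<exists>b\<in>kchains L (Suc i) N. cbd xo b = d"
proof -
  have 1: "d \<in> kchains L (Suc i - 1) N" using d by simp
  note Q = QI_L[unfolded QI_def EK_L, THEN spec[of _ "Suc i"], THEN spec[of _ f], THEN spec[of _ d], THEN mp, OF f(2), THEN mp, OF 1,
      THEN mp, OF cd, THEN mp, OF _, THEN mp, OF _ f(1)[symmetric]]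
  have "\<exists>b\<in>kchains L (Suc i) N. cbd xo b = d \<and> (\<exists>g\<in>fch (Suc (Suc i)) E. f - Phi b = field_boundary (Suc (Suc i)) g)"
    by (rule Q) simp
  then show ?thesis by blast
qed

end


section \<open>Finite-dimensionality of a subspace modulo another\<close>

subsection \<open>Finite-dimensional quotients\<close>

text \<open>The finitely many spanning vectors may lie outside \<open>U\<close>, which makes the
  property easy to inherit by subspaces. For linear subspaces it agrees with the version inside
  \<open>U\<close> (\<open>fin_quot_within_iff\<close>).\<close>

definition fin_quot :: "('k \<Rightarrow> 'c \<Rightarrow> 'c) \<Rightarrow> 'c::ab_group_add set \<Rightarrow> 'c set \<Rightarrow> bool"
  where "fin_quot sc U B \<longleftrightarrow> (\<exists>(n::nat) f. \<forall>u\<in>U. \<exists>a. u - (\<Sum>i<n. sc (a i) (f i)) \<in> B)"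

definition fin_quot_within :: "('k \<Rightarrow> 'c \<Rightarrow> 'c) \<Rightarrow> 'c::ab_group_add set \<Rightarrow> 'c set \<Rightarrow> bool"
  where "fin_quot_within sc U B \<longleftrightarrow>
    (\<exists>(n::nat) f. (\<forall>i<n. f i \<in> U) \<and> (\<forall>u\<in>U. \<exists>a. u - (\<Sum>i<n. sc (a i) (f i)) \<in> B))"

lemma fin_quot_withinD: "fin_quot_within sc U B \<Longrightarrow> fin_quot sc U B"
  unfolding fin_quot_def fin_quot_within_def by metis

lemma fin_quot_within_trivial: "U \<subseteq> B \<Longrightarrow> fin_quot_within sc U B"
  unfolding fin_quot_within_def by (intro exI[of _ 0]) auto

lemma fin_quotI:
  assumes "finite I" "\<And>u. u \<in> U \<Longrightarrow> \<exists>a. u - (\<Sum>i\<in>I. sc (a i) (f i)) \<in> B"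
  shows "fin_quot sc U B"
proof -
  obtain h where h: "bij_betw h {..<card I} I"
    using ex_bij_betw_nat_finite[OF assms(1)] by (auto simp: atLeast0LessThan)
  have "\<exists>a. u - (\<Sum>i<card I. sc (a i) (f (h i))) \<in> B" if u: "u \<in> U" for u
  proof -
    obtain a where a: "u - (\<Sum>i\<in>I. sc (a i) (f i)) \<in> B" using assms(2)[OF u] by blast
    moreover have "(\<Sum>i<card I. sc (a (h i)) (f (h i))) = (\<Sum>i\<in>I. sc (a i) (f i))"
      by (rule sum.reindex_bij_betw[OF h])
    ultimately show ?thesis by (intro exI[of _ "\<lambda>i. a (h i)"]) simp
  qed
  then show ?thesis unfolding fin_quot_def by (intro exI[of _ "card I"] exI[of _ "\<lambda>i. f (h i)"]) blast
qed

definition lin_closed :: "('k \<Rightarrow> 'c \<Rightarrow> 'c) \<Rightarrow> 'c::ab_group_add set \<Rightarrow> bool"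
  where "lin_closed sc U \<longleftrightarrow> 0 \<in> U \<and> (\<forall>a\<in>U. \<forall>b\<in>U. a + b \<in> U) \<and> (\<forall>r. \<forall>a\<in>U. sc r a \<in> U)"

lemma lin_closedD: "lin_closed sc U \<Longrightarrow> 0 \<in> U" "lin_closed sc U \<Longrightarrow> a \<in> U \<Longrightarrow> b \<in> U \<Longrightarrow> a + b \<in> U"
  "lin_closed sc U \<Longrightarrow> a \<in> U \<Longrightarrow> sc r a \<in> U"
  by (auto simp: lin_closed_def)

lemma lin_closed_diff:
  assumes "vector_space sc" "lin_closed sc U" "a \<in> U" "b \<in> U"
  shows "a - b \<in> U"
proof -
  interpret vector_space sc by fact
  have "a + sc (- 1) b \<in> U" using lin_closedD[OF assms(2)] assms by blast
  then show ?thesis by simp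
qed

lemma lin_closed_sum:
  "lin_closed sc U \<Longrightarrow> (\<And>i. i \<in> I \<Longrightarrow> f i \<in> U) \<Longrightarrow> (\<Sum>i\<in>I. f i) \<in> U"
  by (induction I rule: infinite_finite_induct) (auto simp: lin_closedD)

text \<open>An extension of finite-dimensional spaces: the kernel of U -> U'/B' is finite modulo B
  and the image is finite. The induction is on the number of vectors spanning the image; each step
  enlarges U by at most one dimension.\<close>

lemma fin_quot_extension:
  fixes sc :: "'k::field \<Rightarrow> 'c::ab_group_add \<Rightarrow> 'c" and sc' :: "'k \<Rightarrow> 'd::ab_group_add \<Rightarrow> 'd"
  assumes vs: "vector_space sc" "vector_space sc'"
    and U: "lin_closed sc U" and B': "lin_closed sc' B'"
    and \<phi>: "\<And>a b. a \<in> U \<Longrightarrow> b \<in> U \<Longrightarrow> \<phi> (a + b) = \<phi> a + \<phi> b" "\<And>r a. a \<in> U \<Longrightarrow> \<phi> (sc r a) = sc' r (\<phi> a)"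
    and fin: "fin_quot sc' U' B'" "\<And>u. u \<in> U \<Longrightarrow> \<phi> u \<in> U'" and ker: "fin_quot_within sc {u\<in>U. \<phi> u \<in> B'} B"
  shows "fin_quot_within sc U B"
proof -
  interpret V: vector_space sc by fact
  interpret V': vector_space sc' by fact
  obtain n :: nat and f where nf: "\<forall>u\<in>U'. \<exists>a. u - (\<Sum>i<n. sc' (a i) (f i)) \<in> B'"
    using fin(1) unfolding fin_quot_def by blast
  have "fin_quot_within sc U B" if "lin_closed sc U" "\<And>a b. a \<in> U \<Longrightarrow> b \<in> U \<Longrightarrow> \<phi> (a + b) = \<phi> a + \<phi> b"
    "\<And>r a. a \<in> U \<Longrightarrow> \<phi> (sc r a) = sc' r (\<phi> a)"
    "\<And>u. u \<in> U \<Longrightarrow> \<exists>a. \<phi> u - (\<Sum>i<n. sc' (a i) (f i)) \<in> B'" "fin_quot_within sc {u\<in>U. \<phi> u \<in> B'} B" for n U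
    using that
  proof (induction n arbitrary: U)
    case 0
    then have "{u\<in>U. \<phi> u \<in> B'} = U" by auto
    then show ?case using 0 by simp
  next
    case (Suc n)
    note U = Suc.prems(1) and \<phi> = Suc.prems(2,3)
    define U1 where "U1 = {u\<in>U. \<exists>a. \<phi> u - (\<Sum>i<n. sc' (a i) (f i)) \<in> B'}"
    have \<phi>0: "\<phi> 0 = 0" using \<phi>(1)[of 0 0] lin_closedD(1)[OF U] by simp
    have U1: "lin_closed sc U1"
      unfolding lin_closed_def
    proof (intro conjI ballI allI)
      show "0 \<in> U1" using lin_closedD(1)[OF U] lin_closedD(1)[OF B'] \<phi>0
        by (auto simp: U1_def intro!: exI[of _ "\<lambda>_. 0"])
      fix u assume "u \<in> U1"
      then obtain a where u: "u \<in> U" and a: "\<phi> u - (\<Sum>i<n. sc' (a i) (f i)) \<in> B'" by (auto simp: U1_def)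
      show "sc r u \<in> U1" for r
      proof -
        have "\<phi> (sc r u) - (\<Sum>i<n. sc' (r * a i) (f i)) = sc' r (\<phi> u - (\<Sum>i<n. sc' (a i) (f i)))"
          using \<phi>(2)[OF u] by (simp add: V'.scale_right_diff_distrib V'.scale_sum_right)
        then show ?thesis using lin_closedD(3)[OF B' a, of r] lin_closedD(3)[OF U u]
          unfolding U1_def by (auto intro!: exI[of _ "\<lambda>i. r * a i"])
      qed
      fix w assume "w \<in> U1"
      then obtain b where w: "w \<in> U" and b: "\<phi> w - (\<Sum>i<n. sc' (b i) (f i)) \<in> B'" by (auto simp: U1_def)
      have "\<phi> (u + w) - (\<Sum>i<n. sc' (a i + b i) (f i))
          = (\<phi> u - (\<Sum>i<n. sc' (a i) (f i))) + (\<phi> w - (\<Sum>i<n. sc' (b i) (f i)))"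
        using \<phi>(1)[OF u w] by (simp add: V'.scale_left_distrib sum.distrib)
      then show "u + w \<in> U1" using lin_closedD(2)[OF B' a b] lin_closedD(2)[OF U u w]
        unfolding U1_def by (auto intro!: exI[of _ "\<lambda>i. a i + b i"])
    qed
    have "{u\<in>U1. \<phi> u \<in> B'} = {u\<in>U. \<phi> u \<in> B'}" by (auto simp: U1_def intro!: exI[of _ "\<lambda>_. 0"])
    then have fin1: "fin_quot_within sc U1 B"
      using Suc.prems by (intro Suc.IH[OF U1]) (auto simp: U1_def)
    show ?case
    proof (cases "U1 = U")
      case True then show ?thesis using fin1 by simp
    next
      case False
      \<comment> \<open>Any u differs from a multiple of \<open>u0\<close> by an element of
        \<open>U1\<close>, the multiple being chosen to cancel the last coefficient.\<close>
      then obtain u0 where u0: "u0 \<in> U" "u0 \<notin> U1" by (auto simp: U1_def)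
      then obtain a0 where a0: "\<phi> u0 - (\<Sum>i<Suc n. sc' (a0 i) (f i)) \<in> B'" using Suc.prems(4) by blast
      have a0n: "a0 n \<noteq> 0" using a0 u0 by (auto simp: U1_def)
      obtain m :: nat and g where g: "\<forall>i<m. g i \<in> U1" "\<forall>u\<in>U1. \<exists>a. u - (\<Sum>i<m. sc (a i) (g i)) \<in> B"
        using fin1 unfolding fin_quot_within_def by blast
      define g' where "g' = g(m := u0)"
      have "\<exists>a. u - (\<Sum>i<Suc m. sc (a i) (g' i)) \<in> B" if u: "u \<in> U" for u
      proof -
        obtain a where a: "\<phi> u - (\<Sum>i<Suc n. sc' (a i) (f i)) \<in> B'" using Suc.prems(4)[OF u] by blast
        define c where "c = a n / a0 n"
        have cu0: "sc c u0 \<in> U" by (rule lin_closedD(3)[OF U u0(1)])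
        have du: "u - sc c u0 \<in> U" by (rule lin_closed_diff[OF vs(1) U u cu0])
        have "\<phi> u = \<phi> (u - sc c u0) + \<phi> (sc c u0)" using \<phi>(1)[OF du cu0] by simp
        then have "\<phi> (u - sc c u0) - (\<Sum>i<n. sc' (a i - c * a0 i) (f i))
            = (\<phi> u - (\<Sum>i<Suc n. sc' (a i) (f i))) - sc' c (\<phi> u0 - (\<Sum>i<Suc n. sc' (a0 i) (f i)))"
          using \<phi>(2)[OF u0(1)] a0n
          by (simp add: V'.scale_right_diff_distrib V'.scale_left_diff_distrib V'.scale_sum_right sum_subtractf
              V'.scale_right_distrib c_def algebra_simps)
        also have "\<dots> \<in> B'" by (intro lin_closed_diff[OF vs(2) B'] a lin_closedD(3)[OF B'] a0)
        finally have "u - sc c u0 \<in> U1" using du by (auto simp: U1_def)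
        then obtain b where b: "(u - sc c u0) - (\<Sum>i<m. sc (b i) (g i)) \<in> B" using g(2) by blast
        have "(\<Sum>i<m. sc ((b(m := c)) i) (g' i)) = (\<Sum>i<m. sc (b i) (g i))"
          by (rule sum.cong) (auto simp: g'_def)
        then have "u - (\<Sum>i<Suc m. sc ((b(m := c)) i) (g' i)) = (u - sc c u0) - (\<Sum>i<m. sc (b i) (g i))"
          by (simp add: g'_def algebra_simps)
        then show ?thesis using b by metis
      qed
      moreover have "\<forall>i<Suc m. g' i \<in> U" using g(1) u0 by (auto simp: g'_def U1_def less_Suc_eq)
      ultimately show ?thesis unfolding fin_quot_within_def by blast
    qed
  qed
  then show ?thesis using U \<phi> nf fin(2) ker by blast
qed

lemma fin_quot_within_iff:
  fixes sc :: "'k::field \<Rightarrow> 'c::ab_group_add \<Rightarrow> 'c"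
  assumes "vector_space sc" "lin_closed sc U" "lin_closed sc B"
  shows "fin_quot_within sc U B \<longleftrightarrow> fin_quot sc U B"
proof
  assume f: "fin_quot sc U B"
  show "fin_quot_within sc U B"
    by (rule fin_quot_extension[OF assms(1,1,2,3), where \<phi> = "\<lambda>u. u", OF _ _ f]) (auto intro: fin_quot_within_trivial)
qed (rule fin_quot_withinD)

lemma fin_quot_injective:
  fixes sc :: "'k::field \<Rightarrow> 'c::ab_group_add \<Rightarrow> 'c" and sc' :: "'k \<Rightarrow> 'd::ab_group_add \<Rightarrow> 'd"
  assumes "vector_space sc" "vector_space sc'" "lin_closed sc U" "lin_closed sc' B'"
    and "\<And>a b. a \<in> U \<Longrightarrow> b \<in> U \<Longrightarrow> \<phi> (a + b) = \<phi> a + \<phi> b" "\<And>r a. a \<in> U \<Longrightarrow> \<phi> (sc r a) = sc' r (\<phi> a)"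
    and "fin_quot sc' U' B'" "\<And>u. u \<in> U \<Longrightarrow> \<phi> u \<in> U'" and "\<And>u. u \<in> U \<Longrightarrow> \<phi> u \<in> B' \<Longrightarrow> u \<in> B"
  shows "fin_quot sc U B"
  by (rule fin_quot_withinD, rule fin_quot_extension[OF assms(1-8)]) (use assms(9) in \<open>auto intro: fin_quot_within_trivial\<close>)

lemma fin_quot_surjective:
  fixes sc :: "'k::field \<Rightarrow> 'c::ab_group_add \<Rightarrow> 'c" and sc' :: "'k \<Rightarrow> 'd::ab_group_add \<Rightarrow> 'd"
  assumes "vector_space sc" and B': "\<And>a b. a \<in> B' \<Longrightarrow> b \<in> B' \<Longrightarrow> a + b \<in> B'"
    and \<phi>: "\<And>a b. \<phi> (a + b) = \<phi> a + \<phi> b" "\<And>r a. \<phi> (sc r a) = sc' r (\<phi> a)"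
    and fin: "fin_quot sc U B" and B: "\<And>b. b \<in> B \<Longrightarrow> \<phi> b \<in> B'"
    and onto: "\<And>u'. u' \<in> U' \<Longrightarrow> \<exists>u\<in>U. u' - \<phi> u \<in> B'"
  shows "fin_quot sc' U' B'"
proof -
  have \<phi>0: "\<phi> 0 = 0" using \<phi>(1)[of 0 0] by simp
  have \<phi>sum: "\<phi> (\<Sum>i<n. g i) = (\<Sum>i<n. \<phi> (g i))" for g and n :: nat
    by (induction n) (simp_all add: \<phi>0 \<phi>(1))
  have \<phi>diff: "\<phi> (a - b) = \<phi> a - \<phi> b" for a b using \<phi>(1)[of "a - b" b] by simp
  obtain n :: nat and f where nf: "\<forall>u\<in>U. \<exists>a. u - (\<Sum>i<n. sc (a i) (f i)) \<in> B" using fin unfolding fin_quot_def by blast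
  have "\<exists>a. u' - (\<Sum>i<n. sc' (a i) (\<phi> (f i))) \<in> B'" if u': "u' \<in> U'" for u'
  proof -
    obtain u where u: "u \<in> U" "u' - \<phi> u \<in> B'" using onto[OF u'] by blast
    obtain a where "u - (\<Sum>i<n. sc (a i) (f i)) \<in> B" using nf u by blast
    then have "\<phi> u - (\<Sum>i<n. sc' (a i) (\<phi> (f i))) \<in> B'" using B by (fastforce simp: \<phi>diff \<phi>sum \<phi>(2))
    from B'[OF u(2) this] show ?thesis by (intro exI[of _ a]) simp
  qed
  then show ?thesis unfolding fin_quot_def by (intro exI[of _ n] exI[of _ "\<lambda>i. \<phi> (f i)"]) blast
qed

text \<open>Gaussian elimination on the spanning vectors: if the last one occurs in some
  \<open>u j0\<close>, multiples of \<open>u j0\<close> remove it from all later terms, and these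
  are dependent by induction.\<close>

lemma fin_quot_dependent:
  fixes sc :: "'k::field \<Rightarrow> 'c::ab_group_add \<Rightarrow> 'c" and u :: "nat \<Rightarrow> 'c"
  assumes vs: "vector_space sc" and B: "lin_closed sc B" and fin: "fin_quot sc U B" and u: "\<And>i. u i \<in> U"
  obtains n a where "\<exists>i<n. a i \<noteq> 0" "(\<Sum>i<n. sc (a i) (u i)) \<in> B"
proof -
  interpret V: vector_space sc by fact
  obtain m :: nat and f where mf: "\<forall>u\<in>U. \<exists>a. u - (\<Sum>i<m. sc (a i) (f i)) \<in> B" using fin unfolding fin_quot_def by blast
  have "\<exists>n a. (\<exists>i<n. a i \<noteq> 0) \<and> (\<Sum>i<n. sc (a i) (u i)) \<in> B"
    if "\<And>j. \<exists>a. u j - (\<Sum>i<m. sc (a i) (f i)) \<in> B" for m and u :: "nat \<Rightarrow> 'c"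
    using that
  proof (induction m arbitrary: u)
    case 0
    then have "u 0 \<in> B" by simp
    then show ?case by (intro exI[of _ 1] exI[of _ "\<lambda>_. 1"]) auto
  next
    case (Suc m)
    then obtain a where a: "\<And>j. u j - (\<Sum>i<Suc m. sc (a j i) (f i)) \<in> B" by metis
    show ?case
    proof (cases "\<forall>j. a j m = 0")
      case True
      then have "\<exists>a. u j - (\<Sum>i<m. sc (a i) (f i)) \<in> B" for j using a[of j] by auto
      then show ?thesis by (rule Suc.IH)
    next
      case False
      then obtain j0 where j0: "a j0 m \<noteq> 0" by blast
      define c where "c j = a (Suc j0 + j) m / a j0 m" for j
      define w where "w j = u (Suc j0 + j) - sc (c j) (u j0)" for j
      have "\<exists>b. w j - (\<Sum>i<m. sc (b i) (f i)) \<in> B" for j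
      proof -
        have "w j - (\<Sum>i<m. sc (a (Suc j0 + j) i - c j * a j0 i) (f i))
          = (u (Suc j0 + j) - (\<Sum>i<Suc m. sc (a (Suc j0 + j) i) (f i))) - sc (c j) (u j0 - (\<Sum>i<Suc m. sc (a j0 i) (f i)))"
          using j0 by (simp add: w_def V.scale_right_diff_distrib V.scale_left_diff_distrib V.scale_sum_right
              sum_subtractf V.scale_right_distrib c_def algebra_simps)
        also have "\<dots> \<in> B" by (intro lin_closed_diff[OF vs B] a lin_closedD(3)[OF B])
        finally show ?thesis by (intro exI[of _ "\<lambda>i. a (Suc j0 + j) i - c j * a j0 i"])
      qed
      then have "\<exists>n b. (\<exists>i<n. b i \<noteq> 0) \<and> (\<Sum>i<n. sc (b i) (w i)) \<in> B" by (rule Suc.IH)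
      then obtain n :: nat and b where nb: "(\<exists>i<n. b i \<noteq> 0) \<and> (\<Sum>i<n. sc (b i) (w i)) \<in> B"
        by (elim exE) (rule that)
      note b = nb[THEN conjunct1] nb[THEN conjunct2]
      define b' where "b' i = (if i < j0 then 0 else if i = j0 then - (\<Sum>j<n. b j * c j) else b (i - Suc j0))" for i
      have "(\<Sum>i<Suc j0 + n. sc (b' i) (u i)) = (\<Sum>i<Suc j0. sc (b' i) (u i)) + (\<Sum>i<n. sc (b' (Suc j0 + i)) (u (Suc j0 + i)))"
      proof (induction n)
        case (Suc n) then show ?case by (simp add: algebra_simps)
      qed simp
      also have "(\<Sum>i<Suc j0. sc (b' i) (u i)) = - sc (\<Sum>j<n. b j * c j) (u j0)"
        by (simp add: b'_def)
      also have "(\<Sum>i<n. sc (b' (Suc j0 + i)) (u (Suc j0 + i))) = (\<Sum>i<n. sc (b i) (u (Suc j0 + i)))"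
        by (rule sum.cong) (auto simp: b'_def)
      finally have "(\<Sum>i<Suc j0 + n. sc (b' i) (u i)) = (\<Sum>i<n. sc (b i) (w i))"
        by (simp add: w_def V.scale_right_diff_distrib sum_subtractf V.scale_sum_left)
      moreover have "\<exists>i<Suc j0 + n. b' i \<noteq> 0"
      proof -
        obtain i where "i < n" "b i \<noteq> 0" using b(1) by blast
        then show ?thesis by (intro exI[of _ "Suc j0 + i"]) (auto simp: b'_def)
      qed
      ultimately show ?thesis using b(2) by metis
    qed
  qed
  then show ?thesis using that mf u by metis
qed

lemma pm_subspace_iff: "pm.subspace U \<longleftrightarrow> lin_closed pm_scale U"
  by (auto simp: pm.subspace_def lin_closed_def)

lemma pm_vector_space: "vector_space pm_scale"
  by unfold_locales

lemma pm_span_finite_iff: "finite F \<Longrightarrow> x \<in> pm.span F \<longleftrightarrow> (\<exists>a. x = (\<Sum>f\<in>F. pm_scale (a f) f))"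
  by (auto simp: pm.span_finite)

lemma quotient_basis_finite:
  assumes U: "lin_closed pm_scale U" and B: "lin_closed pm_scale B" "B \<subseteq> U"
  shows "(\<exists>F. finite F \<and> quotient_basis U B F) \<longleftrightarrow> fin_quot pm_scale U B"
proof
  assume "\<exists>F. finite F \<and> quotient_basis U B F"
  then obtain F where F: "finite F" "quotient_basis U B F" by blast
  show "fin_quot pm_scale U B"
  proof (rule fin_quotI[OF F(1)])
    fix u assume "u \<in> U"
    then obtain f b where "u = f + b" "f \<in> pm.span F" "b \<in> B" using F(2) by (auto simp: quotient_basis_def)
    then show "\<exists>a. u - (\<Sum>f\<in>F. pm_scale (a f) f) \<in> B"
      unfolding pm_span_finite_iff[OF F(1)] by (metis add_diff_cancel_left')
  qed
next
  assume "fin_quot pm_scale U B"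
  then have w: "fin_quot_within pm_scale U B" using fin_quot_within_iff[OF pm_vector_space U B(1)] by blast
  define Q where "Q n \<longleftrightarrow> (\<exists>F. finite F \<and> card F = n \<and> F \<subseteq> U \<and> (\<forall>u\<in>U. \<exists>s\<in>pm.span F. u - s \<in> B))" for n
  obtain n :: nat and f where f: "\<forall>i<n. f i \<in> U" "\<forall>u\<in>U. \<exists>a. u - (\<Sum>i<n. pm_scale (a i) (f i)) \<in> B"
    using w unfolding fin_quot_within_def by blast
  have "\<exists>s\<in>pm.span (f ` {..<n}). u - s \<in> B" if u: "u \<in> U" for u
  proof -
    obtain a where "u - (\<Sum>i<n. pm_scale (a i) (f i)) \<in> B" using f(2) u by blast
    moreover have "(\<Sum>i<n. pm_scale (a i) (f i)) \<in> pm.span (f ` {..<n})"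
      by (intro pm.span_sum pm.span_scale pm.span_base) auto
    ultimately show ?thesis by blast
  qed
  then have "Q (card (f ` {..<n}))" unfolding Q_def using f(1) by (intro exI[of _ "f ` {..<n}"]) auto
  \<comment> \<open>A spanning set of least cardinality is a basis modulo B, for a relation modulo B
    would allow dropping an element.\<close>
  then obtain m where m: "Q m" "\<And>k. k < m \<Longrightarrow> \<not> Q k" using exists_least_iff[of Q] by blast
  then obtain F where F: "finite F" "card F = m" "F \<subseteq> U" "\<forall>u\<in>U. \<exists>s\<in>pm.span F. u - s \<in> B" unfolding Q_def by blast
  have key: "(\<Sum>g\<in>F. pm_scale (a g) g) \<in> B \<Longrightarrow> \<forall>g\<in>F. a g = 0" for a
  proof (rule ccontr)
    assume s: "(\<Sum>g\<in>F. pm_scale (a g) g) \<in> B" and "\<not> (\<forall>g\<in>F. a g = 0)"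
    then obtain g where g: "g \<in> F" "a g \<noteq> 0" by blast
    let ?F = "F - {g}"
    have "Q (card ?F)"
      unfolding Q_def
    proof (intro exI[of _ ?F] conjI ballI refl)
      fix u assume "u \<in> U"
      then obtain t where t: "t \<in> pm.span F" "u - t \<in> B" using F(4) by blast
      then obtain b where b: "t = (\<Sum>f\<in>F. pm_scale (b f) f)" unfolding pm_span_finite_iff[OF F(1)] by blast
      define r where "r = b g / a g"
      have "t - pm_scale r (\<Sum>f\<in>F. pm_scale (a f) f) = (\<Sum>f\<in>F. pm_scale (b f - r * a f) f)"
        unfolding b by (simp add: pm.scale_sum_right pm.scale_left_diff_distrib sum_subtractf)
      also have "\<dots> = (\<Sum>f\<in>?F. pm_scale (b f - r * a f) f)"
        using g F(1) by (subst sum.remove[OF F(1) g(1)]) (simp add: r_def)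
      also have "\<dots> \<in> pm.span ?F" by (intro pm.span_sum pm.span_scale pm.span_base) auto
      finally have sp: "t - pm_scale r (\<Sum>f\<in>F. pm_scale (a f) f) \<in> pm.span ?F" .
      have "u - (t - pm_scale r (\<Sum>f\<in>F. pm_scale (a f) f)) = (u - t) + pm_scale r (\<Sum>f\<in>F. pm_scale (a f) f)"
        by simp
      also have "\<dots> \<in> B" using lin_closedD(2,3)[OF B(1)] t(2) s by blast
      finally show "\<exists>s\<in>pm.span ?F. u - s \<in> B" using sp by blast
    qed (use F in auto)
    moreover have "card ?F < m" using F g by (metis card_Diff1_less)
    ultimately show False using m(2) by blast
  qed
  have sU: "pm.span F \<subseteq> U" using F(3) U pm.span_minimal[of F U] by (simp add: pm_subspace_iff)
  have "quotient_basis U B F"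
    unfolding quotient_basis_def
  proof (intro conjI)
    show "pm.independent F"
      using key[of "a" for a] lin_closedD(1)[OF B(1)] F(1) unfolding pm.dependent_finite[OF F(1)] by metis
    show "pm.span F \<inter> B = {0}"
    proof -
      have "x = 0" if x: "x \<in> pm.span F" "x \<in> B" for x
      proof -
        obtain a where a: "x = (\<Sum>f\<in>F. pm_scale (a f) f)" using x(1) unfolding pm_span_finite_iff[OF F(1)] by blast
        then show ?thesis using key[of a] x(2) by simp
      qed
      then show ?thesis using lin_closedD(1)[OF B(1)] pm.span_zero by blast
    qed
    show "U = {f + b |f b. f \<in> pm.span F \<and> b \<in> B}"
    proof (rule equalityI; rule subsetI)
      fix u assume "u \<in> U"
      then obtain s where "s \<in> pm.span F" "u - s \<in> B" using F(4) by blast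
      then show "u \<in> {f + b |f b. f \<in> pm.span F \<and> b \<in> B}" by (intro CollectI exI[of _ s] exI[of _ "u - s"]) simp
    next
      fix u assume "u \<in> {f + b |f b. f \<in> pm.span F \<and> b \<in> B}"
      then show "u \<in> U" using sU B(2) lin_closedD(2)[OF U] by blast
    qed
  qed
  then show "\<exists>F. finite F \<and> quotient_basis U B F" using F(1) by blast
qed

lemma quotient_dim_finite_iff:
  assumes "lin_closed pm_scale U" "lin_closed pm_scale B" "B \<subseteq> U"
  shows "quotient_dim U B < \<infinity> \<longleftrightarrow> fin_quot pm_scale U B"
  using quotient_basis_finite[OF assms] by (auto simp: quotient_dim_def)

lemma quotient_dim_zero_iff:
  assumes U: "lin_closed pm_scale U" and B: "lin_closed pm_scale B" "B \<subseteq> U"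
  shows "quotient_dim U B = 0 \<longleftrightarrow> U = B"
proof
  assume UB: "U = B"
  have e: "quotient_basis U B {}" using UB lin_closedD(1)[OF U] pm.independent_empty by (auto simp: quotient_basis_def)
  have "F = {}" if "quotient_basis U B F" for F
  proof -
    have "pm.span F \<subseteq> B"
    proof
      fix x assume "x \<in> pm.span F"
      then have "x + 0 \<in> U" using that lin_closedD(1)[OF B(1)] unfolding quotient_basis_def by blast
      then show "x \<in> B" using UB by simp
    qed
    then have "pm.span F = {0}" using that pm.span_zero[of F] unfolding quotient_basis_def by blast
    then have "F \<subseteq> {0}" using pm.span_superset by blast
    moreover have "0 \<notin> F" using that pm.dependent_zero unfolding quotient_basis_def by blast
    ultimately show ?thesis by blast
  qed
  then have "(SOME F. quotient_basis U B F) = {}" using e by (metis someI)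
  then show "quotient_dim U B = 0" using e by (auto simp: quotient_dim_def zero_enat_def)
next
  assume q: "quotient_dim U B = 0"
  then have ex: "\<exists>F. finite F \<and> quotient_basis U B F" by (auto simp: quotient_dim_def split: if_splits)
  define F where "F = (SOME F. quotient_basis U B F)"
  have F: "quotient_basis U B F" unfolding F_def using ex by (metis someI)
  have cF: "card F = 0" using q ex by (auto simp: quotient_dim_def F_def zero_enat_def split: if_splits)
  have fin: "fin_quot pm_scale U B" using ex quotient_basis_finite[OF assms] by blast
  have FU: "F \<subseteq> U"
  proof
    fix x assume "x \<in> F"
    then have "x + 0 \<in> U" using F lin_closedD(1)[OF B(1)] pm.span_base unfolding quotient_basis_def by blast
    then show "x \<in> U" by simp
  qed
  \<comment> \<open>Cardinality 0 alone would also allow an infinite set. An infinite F inside U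
    would be dependent modulo B, against the directness of the sum.\<close>
  have "finite F"
  proof (rule ccontr)
    assume "infinite F"
    then obtain u :: "nat \<Rightarrow> _" where u: "inj u" "range u \<subseteq> F" using infinite_countable_subset by blast
    obtain n :: nat and a where a: "\<exists>i<n. a i \<noteq> 0" "(\<Sum>i<n. pm_scale (a i) (u i)) \<in> B"
      by (rule fin_quot_dependent[OF pm_vector_space B(1) fin, of u]) (use u(2) FU in blast)+
    have "(\<Sum>i<n. pm_scale (a i) (u i)) \<in> pm.span F"
      using u by (intro pm.span_sum pm.span_scale pm.span_base) auto
    then have z: "(\<Sum>i<n. pm_scale (a i) (u i)) = 0" using a(2) F unfolding quotient_basis_def by blast
    have inj: "inj_on u {..<n}" using u(1) by (rule inj_on_subset) auto
    have "(\<Sum>x\<in>u ` {..<n}. pm_scale (a (inv_into {..<n} u x)) x) = 0"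
      using z inj by (simp add: sum.reindex)
    moreover have "pm.independent (u ` {..<n})" using F u unfolding quotient_basis_def
      by (meson image_mono pm.independent_mono subset_UNIV subset_trans)
    moreover have "finite (u ` {..<n})" by simp
    ultimately have "\<not> (\<exists>x\<in>u ` {..<n}. a (inv_into {..<n} u x) \<noteq> 0)"
      using pm.dependent_finite[of "u ` {..<n}"] by auto
    then have "\<forall>i<n. a i = 0" using inj by auto
    then show False using a(1) by blast
  qed
  then have "F = {}" using cF by simp
  then show "U = B" using F unfolding quotient_basis_def by simp
qed

text \<open>A linear functional that is 0 on the span and 1 at u, recorded by its values g on the
  basis of single points.\<close>

lemma functional_exists:
  fixes S :: "('b \<Rightarrow>\<^sub>0 'k::field) set"
  assumes "u \<notin> pm.span S"
  obtains g where "\<And>s. s \<in> S \<Longrightarrow> (\<Sum>x\<in>keys s. lookup s x * g x) = 0" "(\<Sum>x\<in>keys u. lookup u x * g x) \<noteq> 0"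
proof -
  interpret vp: vector_space_pair "pm_scale :: 'k \<Rightarrow> ('b \<Rightarrow>\<^sub>0 'k) \<Rightarrow> _" "(*) :: 'k \<Rightarrow> 'k \<Rightarrow> 'k"
    by unfold_locales (auto simp: algebra_simps)
  obtain B where B: "B \<subseteq> S" "pm.independent B" "pm.span B = pm.span S"
    using pm.maximal_independent_subset[of S] pm.span_minimal pm.span_mono by (metis pm.subspace_span pm.span_span subset_antisym)
  have ind: "pm.independent (insert u B)"
    using B assms by (intro pm.independent_insertI) auto
  obtain f where f: "Vector_Spaces.linear pm_scale (*) f" "\<forall>x\<in>insert u B. f x = (if x = u then 1 else 0)"
    using vp.linear_independent_extend[OF ind, of "\<lambda>x. if x = u then 1 else 0"] by auto
  interpret f: Vector_Spaces.linear pm_scale "(*)" f by fact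
  have fz: "f s = 0" if "s \<in> pm.span S" for s
  proof -
    have "s \<in> pm.span B" using that B by simp
    then show ?thesis
    proof (induction rule: pm.span_induct_alt)
      case base show ?case by (rule f.zero)
    next
      case (step c x y)
      have "x \<noteq> u" using step(1) assms B(3) pm.span_base by blast
      then show ?case using step f(2) by (simp add: f.add f.scale)
    qed
  qed
  have fsum: "f s = (\<Sum>x\<in>keys s. lookup s x * f (single x 1))" for s
  proof -
    have "s = (\<Sum>x\<in>keys s. pm_scale (lookup s x) (single x 1))"
      using lin_ident[of s] unfolding lin_def by simp
    then have "f s = (\<Sum>x\<in>keys s. f (pm_scale (lookup s x) (single x 1)))" by (metis f.sum)
    then show ?thesis by (simp add: f.scale del: pm_scale_single)
  qed
  show ?thesis
  proof (rule that[of "\<lambda>x. f (single x 1)"])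
    show "(\<Sum>x\<in>keys s. lookup s x * f (single x 1)) = 0" if "s \<in> S" for s
      using fz[OF pm.span_base[OF that]] fsum[of s] by simp
    show "(\<Sum>x\<in>keys u. lookup u x * f (single x 1)) \<noteq> 0"
      using f(2) fsum[of u] by simp
  qed
qed


section \<open>Null-homotopies from cone vertices, and exactness of the unit complexes\<close>

subsection \<open>Homotopies and cones\<close>

definition hc :: "'v::finite \<Rightarrow> ('v set \<Rightarrow> 'm) \<Rightarrow> 'v set \<Rightarrow> 'm::ab_group_add"
  where "hc v b = (\<lambda>\<sigma>. if v \<in> \<sigma> then sg (below v \<sigma>) (b (\<sigma> - {v})) else 0)"

definition rest :: "'v::finite \<Rightarrow> ('v set \<Rightarrow> 'm) \<Rightarrow> 'v set \<Rightarrow> 'm::ab_group_add"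
  where "rest v c = (\<lambda>\<sigma>. if v \<in> \<sigma> then 0 else sg (below v \<sigma>) (c (insert v \<sigma>)))"

definition base :: "'v::finite \<Rightarrow> ('v set \<Rightarrow> 'm) \<Rightarrow> 'v set \<Rightarrow> 'm::ab_group_add"
  where "base v c = (\<lambda>\<sigma>. if v \<in> \<sigma> then 0 else c \<sigma>)"

lemma sg_twice [simp]: "sg n (sg n a) = a"
  by (simp add: sg_def)

lemma base_rest_split: "c \<sigma> = base v c \<sigma> + hc v (rest v c) \<sigma>"
  by (auto simp: base_def hc_def rest_def insert_absorb below_self)

text \<open>Removing a vertex different from v anticommutes with inserting v; only the removal of v
  itself survives. Hence x_v is null-homotopic on complexes in which v is a cone vertex.\<close>

lemma hc_homotopy:
  assumes x: "additive_ops x"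
  shows "cbd x (hc v b) \<tau> + hc v (cbd x b) \<tau> = x v (b \<tau>)"
proof (cases "v \<in> \<tau>")
  case True
  define \<tau>' where "\<tau>' = \<tau> - {v}"
  have cmp: "- \<tau>' = insert v (- \<tau>)" using True by (auto simp: \<tau>'_def)
  have t: "sg (below w \<tau>) (x w (hc v b (insert w \<tau>))) = - sg (below v \<tau>) (sg (below w \<tau>') (x w (b (insert w \<tau>'))))"
    if w: "w \<in> - \<tau>" for w
  proof -
    have wv: "w \<noteq> v" using w True by auto
    then have ne: "to_nat w \<noteq> to_nat v" by simp
    have eq: "insert w \<tau> - {v} = insert w \<tau>'" using wv by (auto simp: \<tau>'_def)
    have 1: "below w \<tau> = below w \<tau>' + (if to_nat v < to_nat w then 1 else 0)"
      unfolding \<tau>'_def by (rule below_remove[OF True])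
    have 2: "below v (insert w \<tau>) = below v \<tau> + (if to_nat w < to_nat v then 1 else 0)"
      by (rule below_insert) (use w in simp)
    show ?thesis
      using True ne unfolding hc_def additive_ops_sg[OF x] sg_sg by (auto simp: eq 1 2 sg_def additive_ops_sg[OF x] additive_ops_minus[OF x])
  qed
  have "hc v (cbd x b) \<tau> = sg (below v \<tau>) (cbd x b \<tau>')" using True by (simp add: hc_def \<tau>'_def)
  also have "cbd x b \<tau>' = sg (below v \<tau>') (x v (b (insert v \<tau>'))) + (\<Sum>w\<in>-\<tau>. sg (below w \<tau>') (x w (b (insert w \<tau>'))))"
    unfolding cbd_def cmp using True by (subst sum.insert) auto
  also have "sg (below v \<tau>) (\<dots>) = x v (b \<tau>) + (\<Sum>w\<in>-\<tau>. sg (below v \<tau>) (sg (below w \<tau>') (x w (b (insert w \<tau>')))))"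
    using True by (simp add: sg_add sg_sum \<tau>'_def below_self insert_absorb)
  finally have "hc v (cbd x b) \<tau> = x v (b \<tau>) + (\<Sum>w\<in>-\<tau>. sg (below v \<tau>) (sg (below w \<tau>') (x w (b (insert w \<tau>')))))" .
  moreover have "cbd x (hc v b) \<tau> = - (\<Sum>w\<in>-\<tau>. sg (below v \<tau>) (sg (below w \<tau>') (x w (b (insert w \<tau>')))))"
    unfolding cbd_def sum_negf[symmetric] by (rule sum.cong) (auto simp: t)
  ultimately show ?thesis by simp
next
  case False
  have "cbd x (hc v b) \<tau> = (\<Sum>w\<in>{v}. sg (below w \<tau>) (x w (hc v b (insert w \<tau>))))"
    unfolding cbd_def using False
    by (intro sum.mono_neutral_right) (auto simp: hc_def additive_ops_0[OF x])
  then show ?thesis using False by (simp add: hc_def additive_ops_sg[OF x] below_self)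
qed

lemma cbd_cbd:
  assumes x: "additive_ops x" and com: "\<And>v w m. x v (x w m) = x w (x v m)"
  shows "cbd x (cbd x c) \<tau> = 0"
proof -
  define f where "f v w = sg (below v \<tau>) (x v (sg (below w (insert v \<tau>)) (x w (c (insert w (insert v \<tau>))))))" for v w
  have anti: "f v w = - f w v" if "v \<noteq> w" "v \<notin> \<tau>" "w \<notin> \<tau>" for v w
  proof -
    have ne: "to_nat v \<noteq> to_nat w" using that by simp
    show ?thesis
      using that ne com[of v w] unfolding f_def additive_ops_sg[OF x] sg_sg
      by (auto simp: below_insert sg_def insert_commute)
  qed
  have "cbd x (cbd x c) \<tau> = (\<Sum>v\<in>-\<tau>. \<Sum>w\<in>-insert v \<tau>. f v w)"
    unfolding cbd_def[of x "cbd x c"] f_def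
    by (simp add: cbd_def additive_ops_sum[OF x] sg_sum)
  also have "\<dots> = (\<Sum>(v, w)\<in>(SIGMA v:-\<tau>. -insert v \<tau>). f v w)" by (rule sum.Sigma) auto
  also have "(SIGMA v:-\<tau>. -insert v \<tau>)
      = {(v, w). v \<notin> \<tau> \<and> w \<notin> \<tau> \<and> to_nat v < to_nat w} \<union> {(v, w). v \<notin> \<tau> \<and> w \<notin> \<tau> \<and> to_nat w < to_nat v}"
    by auto (metis inj_eq inj_to_nat linorder_neqE_nat)
  also have "(\<Sum>(v, w)\<in>\<dots>. f v w) = (\<Sum>(v, w)\<in>{(v, w). v \<notin> \<tau> \<and> w \<notin> \<tau> \<and> to_nat v < to_nat w}. f v w)
      + (\<Sum>(v, w)\<in>{(v, w). v \<notin> \<tau> \<and> w \<notin> \<tau> \<and> to_nat w < to_nat v}. f v w)"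
    by (rule sum.union_disjoint) auto
  also have "(\<Sum>(v, w)\<in>{(v, w). v \<notin> \<tau> \<and> w \<notin> \<tau> \<and> to_nat w < to_nat v}. f v w)
      = (\<Sum>(v, w)\<in>{(v, w). v \<notin> \<tau> \<and> w \<notin> \<tau> \<and> to_nat v < to_nat w}. f w v)"
    by (rule sum.reindex_bij_witness[of _ "\<lambda>(v, w). (w, v)" "\<lambda>(v, w). (w, v)"]) auto
  also have "(\<Sum>(v, w)\<in>{(v, w). v \<notin> \<tau> \<and> w \<notin> \<tau> \<and> to_nat v < to_nat w}. f v w)
      + (\<Sum>(v, w)\<in>{(v, w). v \<notin> \<tau> \<and> w \<notin> \<tau> \<and> to_nat v < to_nat w}. f w v)
      = (\<Sum>(v, w)\<in>{(v, w). v \<notin> \<tau> \<and> w \<notin> \<tau> \<and> to_nat v < to_nat w}. f v w + f w v)"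
    by (simp add: sum.distrib[symmetric] case_prod_beta)
  also have "\<dots> = 0"
  proof (intro sum.neutral ballI)
    fix z assume "z \<in> {(v, w). v \<notin> \<tau> \<and> w \<notin> \<tau> \<and> to_nat v < to_nat w}"
    then obtain a b where z: "z = (a, b)" "a \<notin> \<tau>" "b \<notin> \<tau>" "to_nat a < to_nat b" by auto
    then have "f a b = - f b a" by (intro anti) auto
    then show "(case z of (v, w) \<Rightarrow> f v w + f w v) = 0" by (simp add: z)
  qed
  finally show ?thesis .
qed

definition add_closed :: "'m::ab_group_add set \<Rightarrow> bool"
  where "add_closed N \<longleftrightarrow> 0 \<in> N \<and> (\<forall>a\<in>N. \<forall>b\<in>N. a + b \<in> N) \<and> (\<forall>a\<in>N. - a \<in> N)"

lemma add_closedD: "add_closed N \<Longrightarrow> 0 \<in> N" "add_closed N \<Longrightarrow> a \<in> N \<Longrightarrow> b \<in> N \<Longrightarrow> a + b \<in> N"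
  "add_closed N \<Longrightarrow> a \<in> N \<Longrightarrow> - a \<in> N" "add_closed N \<Longrightarrow> a \<in> N \<Longrightarrow> sg n a \<in> N"
  by (auto simp: add_closed_def sg_def)

lemma add_closed_diff: "add_closed N \<Longrightarrow> a \<in> N \<Longrightarrow> b \<in> N \<Longrightarrow> a - b \<in> N"
  using add_closedD(2)[of N a "-b"] add_closedD(3) by fastforce

lemma add_closed_pm_on: "add_closed (pm_on X)"
  by (simp add: add_closed_def pm_on_closed)

lemma kchains_plus:
  assumes "add_closed N" "a \<in> kchains K i N" "b \<in> kchains K i N"
  shows "(\<lambda>\<sigma>. a \<sigma> + b \<sigma>) \<in> kchains K i N"
  unfolding kchains_def
proof (intro CollectI allI conjI impI)
  fix \<sigma>
  show "a \<sigma> + b \<sigma> \<in> N" using assms by (auto simp: kchains_def intro: add_closedD)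
  assume "a \<sigma> + b \<sigma> \<noteq> 0"
  then have "a \<sigma> \<noteq> 0 \<or> b \<sigma> \<noteq> 0" by auto
  then show "\<sigma> \<in> K" "card \<sigma> = i" using assms by (auto simp: kchains_def)
qed

lemma kchains_neg: "add_closed N \<Longrightarrow> a \<in> kchains K i N \<Longrightarrow> (\<lambda>\<sigma>. - a \<sigma>) \<in> kchains K i N"
  by (auto simp: kchains_def intro: add_closedD)

lemma kchains_sub:
  assumes "add_closed N" "a \<in> kchains K i N" "b \<in> kchains K i N"
  shows "(\<lambda>\<sigma>. a \<sigma> - b \<sigma>) \<in> kchains K i N"
  using kchains_plus[OF assms(1,2) kchains_neg[OF assms(1,3)]] by simp

lemma hc_kchains:
  assumes "add_closed N" "b \<in> kchains K i N" "\<And>\<sigma>. \<sigma> \<in> K \<Longrightarrow> v \<notin> \<sigma> \<Longrightarrow> insert v \<sigma> \<in> K'"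
  shows "hc v b \<in> kchains K' (Suc i) N"
  unfolding kchains_def
proof (intro CollectI allI conjI impI)
  fix \<sigma>
  show "hc v b \<sigma> \<in> N" using assms by (auto simp: hc_def kchains_def intro: add_closedD)
  assume "hc v b \<sigma> \<noteq> 0"
  then have v: "v \<in> \<sigma>" and "b (\<sigma> - {v}) \<noteq> 0" by (auto simp: hc_def sg_def split: if_splits)
  then have mem: "\<sigma> - {v} \<in> K" and cd: "card (\<sigma> - {v}) = i" using assms(2) by (auto simp: kchains_def)
  show "\<sigma> \<in> K'" using assms(3)[OF mem] v by (simp add: insert_absorb)
  have "card \<sigma> = Suc (card (\<sigma> - {v}))" using v by (intro card.remove) auto
  then show "card \<sigma> = Suc i" unfolding cd .
qed

lemma rest_kchains:
  assumes "add_closed N" "c \<in> kchains K (Suc i) N"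
  shows "rest v c \<in> kchains (lk K v) i N"
  unfolding kchains_def
proof (intro CollectI allI conjI impI)
  fix \<sigma>
  show "rest v c \<sigma> \<in> N" using assms by (auto simp: rest_def kchains_def intro: add_closedD)
  assume "rest v c \<sigma> \<noteq> 0"
  then have "v \<notin> \<sigma>" "c (insert v \<sigma>) \<noteq> 0" by (auto simp: rest_def sg_def split: if_splits)
  then show "\<sigma> \<in> lk K v" "card \<sigma> = i" using assms(2) by (auto simp: kchains_def lk_def)
qed

lemma rest_0: "c \<in> kchains K 0 N \<Longrightarrow> rest v c = (\<lambda>_. 0)"
proof
  fix \<sigma> assume "c \<in> kchains K 0 N"
  then have "c (insert v \<sigma>) = 0" by (auto simp: kchains_def)
  then show "rest v c \<sigma> = 0" by (simp add: rest_def)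
qed

lemma base_kchains: "0 \<in> N \<Longrightarrow> c \<in> kchains K i N \<Longrightarrow> base v c \<in> kchains (del K v) i N"
  by (auto simp: base_def kchains_def del_def)

lemma cbd_avoid:
  assumes "additive_ops x" "\<And>\<sigma>. v \<in> \<sigma> \<Longrightarrow> c \<sigma> = 0" "v \<in> \<tau>"
  shows "cbd x c \<tau> = 0"
  unfolding cbd_def using assms by (intro sum.neutral) (auto simp: additive_ops_0)

definition kexact :: "('v \<Rightarrow> 'm \<Rightarrow> 'm) \<Rightarrow> 'm::ab_group_add set \<Rightarrow> 'v::finite set set \<Rightarrow> nat \<Rightarrow> bool"
  where "kexact x N K i \<longleftrightarrow>
    (\<forall>c\<in>kchains K i N. cbd x c = (\<lambda>_. 0) \<longrightarrow> (\<exists>b\<in>kchains K (Suc i) N. cbd x b = c))"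

text \<open>The complex of a cone with apex v is the mapping cone of x_v acting on the complex of
  the base, so exactness of the base in all degrees up to q is inherited.\<close>

lemma exact_cone:
  assumes x: "additive_ops x" "\<And>v m. m \<in> N \<Longrightarrow> x v m \<in> N" and com: "\<And>v w m. x v (x w m) = x w (x v m)"
    and N: "add_closed N"
    and K: "\<And>\<sigma>. \<sigma> \<in> K \<Longrightarrow> insert v \<sigma> \<in> K" "down_closed K"
    and ex: "\<And>j. j \<le> q \<Longrightarrow> kexact x N (del K v) j" and i: "i \<le> q"
  shows "kexact x N K i"
  unfolding kexact_def
proof (intro ballI impI)
  fix c assume c: "c \<in> kchains K i N" and cyc: "cbd x c = (\<lambda>_. 0)"
  let ?r = "rest v c" and ?b = "base v c"
  have c_split: "c = (\<lambda>\<sigma>. ?b \<sigma> + hc v ?r \<sigma>)" by (rule ext) (rule base_rest_split)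
  have eq: "cbd x ?b \<tau> + (x v (?r \<tau>) - hc v (cbd x ?r) \<tau>) = 0" for \<tau>
  proof -
    have "cbd x ?b \<tau> + cbd x (hc v ?r) \<tau> = 0"
      using fun_cong[OF cyc, of \<tau>] cbd_add[OF x(1), of ?b "hc v ?r" \<tau>] c_split by simp
    moreover have "cbd x (hc v ?r) \<tau> = x v (?r \<tau>) - hc v (cbd x ?r) \<tau>"
      using hc_homotopy[OF x(1), of v ?r \<tau>] by (simp add: eq_diff_eq)
    ultimately show ?thesis by simp
  qed
  have r_cyc: "cbd x ?r = (\<lambda>_. 0)"
  proof
    fix \<tau> show "cbd x ?r \<tau> = 0"
    proof (cases "v \<in> \<tau>")
      case True
      show ?thesis by (rule cbd_avoid[OF x(1) _ True]) (simp add: rest_def)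
    next
      case False
      have "cbd x ?b (insert v \<tau>) = 0" by (rule cbd_avoid[OF x(1)]) (auto simp: base_def)
      then have "hc v (cbd x ?r) (insert v \<tau>) = 0"
        using eq[of "insert v \<tau>"] by (simp add: rest_def additive_ops_0[OF x(1)])
      then show ?thesis using False by (auto simp: hc_def sg_def split: if_splits)
    qed
  qed
  have "\<exists>b1. b1 \<in> kchains (del K v) i N \<and> cbd x b1 = ?r"
  proof (cases i)
    case 0
    have "(\<lambda>_. 0) \<in> kchains (del K v) i N" by (rule kchains_0[OF add_closedD(1)[OF N]])
    then show ?thesis using rest_0[of c K N v] c 0 cbd_0[OF x(1)] by fastforce
  next
    case (Suc j)
    have "?r \<in> kchains (del K v) j N"
      by (rule kchains_mono[OF lk_subset_del[OF K(2)] rest_kchains[OF N]]) (use c Suc in simp)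
    then show ?thesis using ex[of j] i Suc r_cyc by (auto simp: kexact_def)
  qed
  then obtain b1 where b1: "b1 \<in> kchains (del K v) i N" "cbd x b1 = ?r" by blast
  have hb1: "hc v b1 \<in> kchains K (Suc i) N" by (rule hc_kchains[OF N b1(1)]) (use K in \<open>auto simp: del_def\<close>)
  \<comment> \<open>Adding the boundary of \<open>hc v b1\<close> removes from c all faces that
    contain v.\<close>
  define c' where "c' = (\<lambda>\<sigma>. ?b \<sigma> + x v (b1 \<sigma>))"
  have c'_eq: "c' \<sigma> = c \<sigma> + cbd x (hc v b1) \<sigma>" for \<sigma>
    using hc_homotopy[OF x(1), of v b1 \<sigma>] base_rest_split[of c \<sigma> v] unfolding b1(2) c'_def
    by (simp add: algebra_simps)
  have c'_fun: "c' = (\<lambda>\<sigma>. c \<sigma> + cbd x (hc v b1) \<sigma>)" by (rule ext) (rule c'_eq)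
  have c': "c' \<in> kchains (del K v) i N"
    unfolding c'_def
    by (intro kchains_plus[OF N] base_kchains add_closedD(1)[OF N] c kchains_op[OF x(1)] b1 x(2))
  have "cbd x c' = (\<lambda>_. 0)"
  proof
    fix \<tau>
    have "cbd x c' \<tau> = cbd x c \<tau> + cbd x (cbd x (hc v b1)) \<tau>"
      unfolding c'_fun by (rule cbd_add[OF x(1)])
    then show "cbd x c' \<tau> = 0" using cyc cbd_cbd[OF x(1) com] by simp
  qed
  then obtain b0 where b0: "b0 \<in> kchains (del K v) (Suc i) N" "cbd x b0 = c'"
    using ex[OF i] c' by (auto simp: kexact_def)
  have b0K: "b0 \<in> kchains K (Suc i) N" by (rule kchains_mono[OF _ b0(1)]) (auto simp: del_def)
  have "cbd x (\<lambda>\<sigma>. b0 \<sigma> - hc v b1 \<sigma>) = c"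
    by (rule ext) (simp add: cbd_diff[OF x(1)] b0(2) c'_eq)
  then show "\<exists>b\<in>kchains K (Suc i) N. cbd x b = c" using kchains_sub[OF N b0K hb1] by blast
qed


definition unit_ops :: "'v set \<Rightarrow> 'v \<Rightarrow> 'm \<Rightarrow> 'm::ab_group_add"
  where "unit_ops W v m = (if v \<in> W then m else 0)"

lemma additive_unit_ops: "additive_ops (unit_ops W)"
  by (simp add: additive_ops_def unit_ops_def)

lemma cbd_cong_ops:
  assumes "\<And>v m. v \<notin> \<tau> \<Longrightarrow> x v (c (insert v \<tau>)) = x' v (c (insert v \<tau>))"
  shows "cbd x c \<tau> = cbd x' c \<tau>"
  unfolding cbd_def using assms by (intro sum.cong) auto

text \<open>While x_w = 0, the complex is the direct sum of the deletion of w and the shifted link,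
  so exactness in degree i holds for the deletion in degree i and for the link in degree i - 1.
  Putting x_w = 1 turns it into the mapping cone of the inclusion of the link, whose degree i
  homology lies between these two.\<close>

lemma kexact_unit_ops_insert:
  fixes K :: "'v::finite set set"
  assumes w: "w \<notin> W" and K: "down_closed K" and ex: "kexact (unit_ops W) (UNIV :: 'm::ab_group_add set) K i"
  shows "kexact (unit_ops (insert w W)) (UNIV :: 'm set) K i"
  unfolding kexact_def
proof (intro ballI impI)
  fix c :: "'v set \<Rightarrow> 'm"
  let ?x = "unit_ops W" and ?y = "unit_ops (insert w W)"
  note ax = additive_unit_ops[of W] and ay = additive_unit_ops[of "insert w W"]
  have N: "add_closed (UNIV :: 'm set)" by (simp add: add_closed_def)
  have same: "cbd ?y a = cbd ?x a" if "\<And>\<sigma>. w \<in> \<sigma> \<Longrightarrow> a \<sigma> = 0" for a :: "'v set \<Rightarrow> 'm"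
    by (rule ext, rule cbd_cong_ops) (use that in \<open>auto simp: unit_ops_def\<close>)
  have hy: "cbd ?y (hc w a) \<tau> = a \<tau> - hc w (cbd ?y a) \<tau>" for a :: "'v set \<Rightarrow> 'm" and \<tau>
    using hc_homotopy[OF ay, of w a \<tau>] by (simp add: unit_ops_def eq_diff_eq)
  have hx: "cbd ?x (hc w a) \<tau> = - hc w (cbd ?x a) \<tau>" for a :: "'v set \<Rightarrow> 'm" and \<tau>
    using hc_homotopy[OF ax, of w a \<tau>] w by (simp add: unit_ops_def eq_neg_iff_add_eq_0)
  have cc: "cbd ?y (cbd ?y a) \<tau> = 0" for a :: "'v set \<Rightarrow> 'm" and \<tau>
    by (rule cbd_cbd[OF ay]) (simp add: unit_ops_def)
  have rest_free: "rest w a \<sigma> = 0" "base w a \<sigma> = 0" if "w \<in> \<sigma>" for a :: "'v set \<Rightarrow> 'm" and \<sigma>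
    using that by (auto simp: rest_def base_def)
  have hc_zero: "a = (\<lambda>_. 0)" if "\<And>\<sigma>. hc w a \<sigma> = 0" "\<And>\<sigma>. w \<in> \<sigma> \<Longrightarrow> a \<sigma> = 0" for a :: "'v set \<Rightarrow> 'm"
  proof
    fix \<sigma> show "a \<sigma> = 0"
      using that(1)[of "insert w \<sigma>"] that(2)[of \<sigma>] by (cases "w \<in> \<sigma>") (auto simp: hc_def sg_def split: if_splits)
  qed
  have free_cbd: "cbd z a \<sigma> = 0" if "additive_ops z" "\<And>\<sigma>. w \<in> \<sigma> \<Longrightarrow> a \<sigma> = 0" "w \<in> \<sigma>" for z a \<sigma>
    by (rule cbd_avoid[OF that(1) _ that(3)]) (rule that(2))
  assume c: "c \<in> kchains K i UNIV" and cyc: "cbd ?y c = (\<lambda>_. 0)"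
  let ?r = "rest w c" and ?b = "base w c"
  have eq: "cbd ?y ?b \<tau> + (?r \<tau> - hc w (cbd ?y ?r) \<tau>) = 0" for \<tau>
  proof -
    have "c = (\<lambda>\<sigma>. ?b \<sigma> + hc w ?r \<sigma>)" by (rule ext) (rule base_rest_split)
    then have "cbd ?y ?b \<tau> + cbd ?y (hc w ?r) \<tau> = 0"
      using cbd_add[OF ay, of ?b "hc w ?r" \<tau>] fun_cong[OF cyc, of \<tau>] by simp
    then show ?thesis unfolding hy .
  qed
  have r_cyc: "cbd ?y ?r = (\<lambda>_. 0)"
  proof (rule hc_zero)
    fix \<sigma> show "hc w (cbd ?y ?r) \<sigma> = 0"
      using eq[of \<sigma>] free_cbd[OF ay, of ?b \<sigma>] rest_free by (cases "w \<in> \<sigma>") (auto simp: hc_def)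
  qed (rule free_cbd[OF ay], auto simp: rest_free)
  have bb: "cbd ?y ?b \<tau> = - ?r \<tau>" for \<tau>
    using eq[of \<tau>] by (cases "w \<in> \<tau>") (simp_all add: r_cyc hc_def eq_neg_iff_add_eq_0)
  have hr: "hc w ?r \<in> kchains K i UNIV" using c by (auto simp: kchains_def hc_def rest_def insert_absorb below_self)
  \<comment> \<open>The link component of c is a cycle by itself for the old operators, so it
    bounds; \<open>?rb\<close> is the link component of the bounding chain.\<close>
  have "cbd ?x (hc w ?r) = (\<lambda>_. 0)"
  proof
    fix \<tau>
    have "cbd ?x ?r = (\<lambda>_. 0)" using r_cyc same[of ?r] by (simp add: rest_free)
    then have "hc w (cbd ?x ?r) \<tau> = 0" by (cases "w \<in> \<tau>") (simp_all add: hc_def)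
    then show "cbd ?x (hc w ?r) \<tau> = 0" unfolding hx by simp
  qed
  then obtain b where b: "b \<in> kchains K (Suc i) UNIV" "cbd ?x b = hc w ?r"
    using ex hr by (auto simp: kexact_def)
  let ?rb = "rest w b" and ?sb = "base w b"
  have beq: "hc w ?r \<tau> = cbd ?x ?sb \<tau> - hc w (cbd ?x ?rb) \<tau>" for \<tau>
  proof -
    have "b = (\<lambda>\<sigma>. ?sb \<sigma> + hc w ?rb \<sigma>)" by (rule ext) (rule base_rest_split)
    then have "cbd ?x b \<tau> = cbd ?x ?sb \<tau> + cbd ?x (hc w ?rb) \<tau>" using cbd_add[OF ax, of ?sb "hc w ?rb" \<tau>] by simp
    then show ?thesis unfolding b(2) hx by simp
  qed
  have b1r: "cbd ?x ?rb \<tau> = - ?r \<tau>" for \<tau>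
  proof -
    have "(\<lambda>\<tau>. cbd ?x ?rb \<tau> + ?r \<tau>) = (\<lambda>_. 0)"
    proof (rule hc_zero)
      fix \<sigma>
      have "hc w (\<lambda>\<tau>. cbd ?x ?rb \<tau> + ?r \<tau>) \<sigma> = hc w (cbd ?x ?rb) \<sigma> + hc w ?r \<sigma>"
        by (simp add: hc_def sg_add)
      also have "\<dots> = cbd ?x ?sb \<sigma>" unfolding beq by simp
      also have "\<dots> = 0"
        using free_cbd[OF ax, of ?sb \<sigma>] rest_free beq[of \<sigma>] by (cases "w \<in> \<sigma>") (simp_all add: hc_def)
      finally show "hc w (\<lambda>\<tau>. cbd ?x ?rb \<tau> + ?r \<tau>) \<sigma> = 0" .
    next
      fix \<sigma> assume "w \<in> \<sigma>"
      then show "cbd ?x ?rb \<sigma> + ?r \<sigma> = 0" using free_cbd[OF ax, of ?rb \<sigma>] rest_free by simp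
    qed
    from fun_cong[OF this, of \<tau>] have "cbd ?x ?rb \<tau> + ?r \<tau> = 0" .
    then show ?thesis by (simp add: eq_neg_iff_add_eq_0)
  qed
  have b1K: "?rb \<in> kchains (del K w) i UNIV"
    by (rule kchains_mono[OF lk_subset_del[OF K] rest_kchains[OF N b(1)]])
  have hb1: "hc w ?rb \<in> kchains K (Suc i) UNIV"
    by (rule hc_kchains[OF N rest_kchains[OF N b(1)]]) (auto simp: lk_def)
  define c' where "c' = (\<lambda>\<sigma>. ?b \<sigma> - ?rb \<sigma>)"
  have c'_eq: "c' \<sigma> = c \<sigma> - cbd ?y (hc w ?rb) \<sigma>" for \<sigma>
  proof -
    have "cbd ?y ?rb = (\<lambda>\<tau>. - ?r \<tau>)" using same[of ?rb] b1r rest_free by auto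
    then have "hc w (cbd ?y ?rb) \<sigma> = - hc w ?r \<sigma>" by (simp add: hc_def sg_minus)
    then show ?thesis unfolding hy c'_def using base_rest_split[of c \<sigma> w] by simp
  qed
  have c'free: "c' \<sigma> = 0" if "w \<in> \<sigma>" for \<sigma> using that by (simp add: c'_def rest_free)
  have c': "c' \<in> kchains K i UNIV"
    unfolding c'_def
    by (rule kchains_mono[of "del K w"]) (auto simp: del_def intro!: kchains_sub[OF N] base_kchains[unfolded del_def] c b1K[unfolded del_def])
  have "cbd ?x c' = (\<lambda>_. 0)"
  proof
    fix \<tau>
    have "cbd ?y c' \<tau> = cbd ?y ?b \<tau> - cbd ?y ?rb \<tau>" unfolding c'_def by (rule cbd_diff[OF ay])
    also have "\<dots> = 0" using bb[of \<tau>] b1r[of \<tau>] same[of ?rb] rest_free by simp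
    finally show "cbd ?x c' \<tau> = 0" using same[of c'] c'free by simp
  qed
  then obtain d where d: "d \<in> kchains K (Suc i) UNIV" "cbd ?x d = c'" using ex c' by (auto simp: kexact_def)
  have d0: "cbd ?x (base w d) = c'"
  proof
    fix \<tau>
    have "d = (\<lambda>\<sigma>. base w d \<sigma> + hc w (rest w d) \<sigma>)" by (rule ext) (rule base_rest_split)
    then have "cbd ?x d \<tau> = cbd ?x (base w d) \<tau> + cbd ?x (hc w (rest w d)) \<tau>"
      using cbd_add[OF ax, of "base w d" "hc w (rest w d)" \<tau>] by simp
    then have *: "c' \<tau> = cbd ?x (base w d) \<tau> - hc w (cbd ?x (rest w d)) \<tau>" unfolding d(2) hx by simp
    show "cbd ?x (base w d) \<tau> = c' \<tau>"
    proof (cases "w \<in> \<tau>")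
      case True
      then show ?thesis using c'free free_cbd[OF ax, of "base w d" \<tau>] rest_free by simp
    next
      case False
      then show ?thesis using * by (simp add: hc_def)
    qed
  qed
  have d0K: "base w d \<in> kchains K (Suc i) UNIV"
    using d(1) by (auto simp: kchains_def base_def)
  have "cbd ?y (\<lambda>\<sigma>. base w d \<sigma> + hc w ?rb \<sigma>) = c"
  proof
    fix \<tau>
    have "cbd ?y (\<lambda>\<sigma>. base w d \<sigma> + hc w ?rb \<sigma>) \<tau> = cbd ?y (base w d) \<tau> + cbd ?y (hc w ?rb) \<tau>" by (rule cbd_add[OF ay])
    also have "cbd ?y (base w d) = c'" using same[of "base w d"] rest_free d0 by simp
    finally show "cbd ?y (\<lambda>\<sigma>. base w d \<sigma> + hc w ?rb \<sigma>) \<tau> = c \<tau>" using c'_eq[of \<tau>] by simp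
  qed
  then show "\<exists>b\<in>kchains K (Suc i) UNIV. cbd ?y b = c" using kchains_plus[OF N d0K hb1] by blast
qed

lemma kexact_unit_ops_mono:
  assumes "down_closed K" "W' \<subseteq> W" "kexact (unit_ops W') (UNIV :: 'm::ab_group_add set) K i"
  shows "kexact (unit_ops (W :: 'v::finite set)) (UNIV :: 'm set) K i"
proof -
  have "kexact (unit_ops (W' \<union> A)) (UNIV :: 'm set) K i" if A: "A \<subseteq> W - W'" for A
    using finite[of A] A
  proof (induction A rule: finite_induct)
    case empty then show ?case using assms(3) by simp
  next
    case (insert a A)
    then have "kexact (unit_ops (insert a (W' \<union> A))) (UNIV :: 'm set) K i"
      by (intro kexact_unit_ops_insert[OF _ assms(1)]) auto
    then show ?case by simp
  qed
  from this[of "W - W'"] show ?thesis using assms(2) by (simp add: Un_absorb1)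
qed

text \<open>Faces inside \<open>W\<close> form a direct summand, since \<open>unit_ops W\<close> never removes a vertex outside \<open>W\<close>.\<close>

lemma kexact_induced:
  assumes ex: "kexact (unit_ops W) N K i" and N: "0 \<in> N"
  shows "kexact (unit_ops W) N {\<sigma>\<in>K. \<sigma> \<subseteq> W} i"
  unfolding kexact_def
proof (intro ballI impI)
  fix c assume c: "c \<in> kchains {\<sigma>\<in>K. \<sigma> \<subseteq> W} i N" and cyc: "cbd (unit_ops W) c = (\<lambda>_. 0)"
  have "c \<in> kchains K i N" by (rule kchains_mono[OF _ c]) auto
  then obtain b where b: "b \<in> kchains K (Suc i) N" "cbd (unit_ops W) b = c" using ex cyc by (auto simp: kexact_def)
  define b' where "b' = (\<lambda>\<sigma>. if \<sigma> \<subseteq> W then b \<sigma> else 0)"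
  have "b' \<in> kchains {\<sigma>\<in>K. \<sigma> \<subseteq> W} (Suc i) N" using b(1) N by (auto simp: kchains_def b'_def)
  moreover have "cbd (unit_ops W) b' = c"
  proof
    fix \<tau>
    show "cbd (unit_ops W) b' \<tau> = c \<tau>"
    proof (cases "\<tau> \<subseteq> W")
      case True
      have "cbd (unit_ops W) b' \<tau> = cbd (unit_ops W) b \<tau>"
        unfolding cbd_def using True by (intro sum.cong) (auto simp: b'_def unit_ops_def)
      then show ?thesis using b(2) by simp
    next
      case False
      have "cbd (unit_ops W) b' \<tau> = 0"
        unfolding cbd_def using False by (intro sum.neutral) (auto simp: b'_def unit_ops_def)
      moreover have "c \<tau> = 0" using c False by (auto simp: kchains_def)
      ultimately show ?thesis by simp
    qed
  qed
  ultimately show "\<exists>b\<in>kchains {\<sigma>\<in>K. \<sigma> \<subseteq> W} (Suc i) N. cbd (unit_ops W) b = c" by blast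
qed

lemma lookup_sg: "lookup (sg n a) g = sg n (lookup a g)"
  by (simp add: sg_def)

lemma lookup_cbd_unit: "lookup (cbd (unit_ops W) c \<tau>) g = cbd (unit_ops W) (\<lambda>\<sigma>. lookup (c \<sigma>) g) \<tau>"
  unfolding cbd_def lookup_sum lookup_sg by (intro sum.cong) (auto simp: unit_ops_def)

text \<open>The operators are scalars, so the equation is solved separately at each basis element;
  only the finitely many in the support of c are used to form the solution.\<close>

lemma kexact_coefficients:
  fixes K :: "'v::finite set set"
  assumes ex: "kexact (unit_ops W) (UNIV :: 'k::field set) K i"
  shows "kexact (unit_ops W) (pm_on X :: ('x \<Rightarrow>\<^sub>0 'k) set) K i"
  unfolding kexact_def
proof (intro ballI impI)
  fix c :: "'v set \<Rightarrow> 'x \<Rightarrow>\<^sub>0 'k"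
  assume c: "c \<in> kchains K i (pm_on X)" and cyc: "cbd (unit_ops W) c = (\<lambda>_. 0)"
  have "\<exists>b\<in>kchains K (Suc i) UNIV. cbd (unit_ops W) b = (\<lambda>\<sigma>. lookup (c \<sigma>) g)" for g
  proof -
    have "(\<lambda>\<sigma>. lookup (c \<sigma>) g) \<in> kchains K i UNIV"
      using c by (auto simp: kchains_def) (metis lookup_zero)+
    moreover have "cbd (unit_ops W) (\<lambda>\<sigma>. lookup (c \<sigma>) g) = (\<lambda>_. 0)"
      by (rule ext) (simp add: lookup_cbd_unit[symmetric] cyc)
    ultimately show ?thesis using ex by (auto simp: kexact_def)
  qed
  then obtain b where b: "\<And>g. b g \<in> kchains K (Suc i) UNIV" "\<And>g. cbd (unit_ops W) (b g) = (\<lambda>\<sigma>. lookup (c \<sigma>) g)" by metis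
  define G where "G = (\<Union>\<sigma>. keys (c \<sigma>))"
  have G: "finite G" "G \<subseteq> X" using c by (auto simp: G_def kchains_def pm_on_def)
  define B where "B = (\<lambda>\<sigma>. \<Sum>g\<in>G. single g (b g \<sigma>))"
  have lB: "lookup (B \<sigma>) g = (if g \<in> G then b g \<sigma> else 0)" for \<sigma> g
    using G(1) by (simp add: B_def lookup_sum lookup_single when_def)
  have "B \<in> kchains K (Suc i) (pm_on X)"
    unfolding kchains_def
  proof (intro CollectI allI conjI impI)
    fix \<sigma>
    have "keys (B \<sigma>) \<subseteq> G" by (auto simp: in_keys_iff lB split: if_splits)
    then show "B \<sigma> \<in> pm_on X" using G by (auto simp: pm_on_def)
    assume "B \<sigma> \<noteq> 0"
    then obtain g where "lookup (B \<sigma>) g \<noteq> 0" by (metis lookup_zero poly_mapping_eqI)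
    then have "b g \<sigma> \<noteq> 0" by (auto simp: lB split: if_splits)
    then show "\<sigma> \<in> K" "card \<sigma> = Suc i" using b(1)[of g] by (auto simp: kchains_def)
  qed
  moreover have "cbd (unit_ops W) B = c"
  proof (rule ext, rule poly_mapping_eqI)
    fix \<tau> g
    have "lookup (cbd (unit_ops W) B \<tau>) g = cbd (unit_ops W) (\<lambda>\<sigma>. lookup (B \<sigma>) g) \<tau>" by (rule lookup_cbd_unit)
    also have "\<dots> = (if g \<in> G then cbd (unit_ops W) (b g) \<tau> else 0)"
      by (simp add: lB cbd_0[OF additive_unit_ops])
    also have "\<dots> = lookup (c \<tau>) g" using b(2)[of g] by (auto simp: G_def in_keys_iff)
    finally show "lookup (cbd (unit_ops W) B \<tau>) g = lookup (c \<tau>) g" .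
  qed
  ultimately show "\<exists>b\<in>kchains K (Suc i) (pm_on X). cbd (unit_ops W) b = c" by blast
qed


section \<open>Finite-dimensional homology of Koszul-type complexes\<close>

subsection \<open>Finiteness of the homology\<close>

definition fsc :: "'k::field \<Rightarrow> ('s \<Rightarrow> 'x \<Rightarrow>\<^sub>0 'k) \<Rightarrow> 's \<Rightarrow> 'x \<Rightarrow>\<^sub>0 'k"
  where "fsc r c = (\<lambda>\<sigma>. pm_scale r (c \<sigma>))"

lemma vector_space_fsc: "vector_space fsc"
  by unfold_locales (auto simp: fsc_def plus_fun_def fun_eq_iff pm.scale_right_distrib pm.scale_left_distrib)

definition cyc :: "('v \<Rightarrow> ('x \<Rightarrow>\<^sub>0 'k) \<Rightarrow> 'x \<Rightarrow>\<^sub>0 'k) \<Rightarrow> 'x set \<Rightarrow> 'v::finite set set \<Rightarrow> nat \<Rightarrow> ('v set \<Rightarrow> 'x \<Rightarrow>\<^sub>0 'k::field) set"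
  where "cyc x X K i = {c \<in> kchains K i (pm_on X). cbd x c = (\<lambda>_. 0)}"

definition bds :: "('v \<Rightarrow> ('x \<Rightarrow>\<^sub>0 'k) \<Rightarrow> 'x \<Rightarrow>\<^sub>0 'k) \<Rightarrow> 'x set \<Rightarrow> 'v::finite set set \<Rightarrow> nat \<Rightarrow> ('v set \<Rightarrow> 'x \<Rightarrow>\<^sub>0 'k::field) set"
  where "bds x X K i = cbd x ` kchains K (Suc i) (pm_on X)"

definition hfin :: "('v \<Rightarrow> ('x \<Rightarrow>\<^sub>0 'k::field) \<Rightarrow> 'x \<Rightarrow>\<^sub>0 'k) \<Rightarrow> 'x set \<Rightarrow> 'v::finite set set \<Rightarrow> nat \<Rightarrow> bool"
  where "hfin x X K i \<longleftrightarrow> fin_quot fsc (cyc x X K i) (bds x X K i)"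

lemma pm_on_scale: "m \<in> pm_on X \<Longrightarrow> pm_scale r m \<in> pm_on X"
  using keys_pm_scale[of r m] by (auto simp: pm_on_def)

lemma pm_scale_sg: "pm_scale r (sg n a) = sg n (pm_scale r a)"
  by (simp add: sg_def)

lemma additive_sum:
  assumes "\<And>a b. f (a + b) = f a + (f b :: 'b::ab_group_add)"
  shows "f (\<Sum>i\<in>I. g i) = (\<Sum>i\<in>I. f (g i :: 'a::ab_group_add))" "f 0 = 0" "f (- a) = - f a" "f (a - b) = f a - f b"
proof -
  show z: "f 0 = 0" using assms[of 0 0] by simp
  show "f (\<Sum>i\<in>I. g i) = (\<Sum>i\<in>I. f (g i))"
    by (induction I rule: infinite_finite_induct) (simp_all add: z assms)
  have m: "f (- a) = - f a" for a using assms[of a "-a"] z by (simp add: add_eq_0_iff)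
  then show "f (- a) = - f a" .
  show "f (a - b) = f a - f b" using assms[of a "-b"] m by simp
qed

lemma cbd_map:
  assumes \<Lambda>: "\<And>a b. \<Lambda> (a + b) = \<Lambda> a + \<Lambda> b" and ops: "\<And>v m. \<Lambda> (x v m) = x' v (\<Lambda> m)"
  shows "cbd x' (\<lambda>\<sigma>. \<Lambda> (c \<sigma>)) \<tau> = \<Lambda> (cbd x c \<tau>)"
proof -
  note s = additive_sum[of \<Lambda>, OF \<Lambda>]
  have "\<Lambda> (sg n a) = sg n (\<Lambda> a)" for n a by (simp add: sg_def s)
  then show ?thesis unfolding cbd_def s(1) by (simp add: ops)
qed

lemma kchains_map:
  assumes "\<Lambda> 0 = 0" "\<And>m. m \<in> N \<Longrightarrow> \<Lambda> m \<in> N'" "c \<in> kchains K i N"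
  shows "(\<lambda>\<sigma>. \<Lambda> (c \<sigma>)) \<in> kchains K i N'"
  unfolding kchains_def
proof (intro CollectI allI conjI impI)
  fix \<sigma>
  show "\<Lambda> (c \<sigma>) \<in> N'" using assms(2,3) by (simp add: kchains_def)
  assume "\<Lambda> (c \<sigma>) \<noteq> 0"
  then have "c \<sigma> \<noteq> 0" using assms(1) by auto
  then show "\<sigma> \<in> K" "card \<sigma> = i" using assms(3) by (auto simp: kchains_def)
qed

text \<open>K with v made a cone vertex: its join with the simplex v when v is not yet in K.\<close>

definition cplus :: "'v set set \<Rightarrow> 'v \<Rightarrow> 'v set set"
  where "cplus K v = {\<sigma>. \<sigma> - {v} \<in> K}"

lemma subset_cplus: "down_closed K \<Longrightarrow> K \<subseteq> cplus K v"
  by (auto simp: cplus_def intro: down_closedD)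

lemma down_closed_cplus: "down_closed K \<Longrightarrow> down_closed (cplus K v)"
proof -
  assume K: "down_closed K"
  show ?thesis
    unfolding down_closed_def cplus_def
  proof safe
    fix \<sigma> \<tau> assume *: "\<sigma> - {v} \<in> K" "\<tau> \<subseteq> \<sigma>"
    show "\<tau> - {v} \<in> K" by (rule down_closedD[OF K *(1)]) (use *(2) in auto)
  qed
qed

locale koszul =
  fixes x :: "'v::finite \<Rightarrow> ('x \<Rightarrow>\<^sub>0 'k::field) \<Rightarrow> 'x \<Rightarrow>\<^sub>0 'k" and X :: "'x set"
  assumes add: "additive_ops x" and scale: "\<And>v r m. x v (pm_scale r m) = pm_scale r (x v m)"
    and closed: "\<And>v m. m \<in> pm_on X \<Longrightarrow> x v m \<in> pm_on X" and comm: "\<And>v w m. x v (x w m) = x w (x v m)"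
begin

lemma cbd_plus: "cbd x (a + b) = cbd x a + cbd x b"
  by (simp add: fun_eq_iff plus_fun_def cbd_add[OF add])

lemma cbd_fsc: "cbd x (fsc r c) = fsc r (cbd x c)"
  by (simp add: fun_eq_iff cbd_def fsc_def scale pm.scale_sum_right pm_scale_sg)

lemma lin_closed_kchains: "lin_closed fsc (kchains K i (pm_on X) :: ('v set \<Rightarrow> 'x \<Rightarrow>\<^sub>0 'k) set)"
  unfolding lin_closed_def
proof (intro conjI ballI allI)
  show "0 \<in> kchains K i (pm_on X)" by (simp add: zero_fun_def kchains_0 pm_on_closed)
next
  fix a b :: "'v set \<Rightarrow> 'x \<Rightarrow>\<^sub>0 'k" assume "a \<in> kchains K i (pm_on X)" "b \<in> kchains K i (pm_on X)"
  then show "a + b \<in> kchains K i (pm_on X)" unfolding plus_fun_def by (rule kchains_add)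
next
  fix r :: 'k and a :: "'v set \<Rightarrow> 'x \<Rightarrow>\<^sub>0 'k" assume "a \<in> kchains K i (pm_on X)"
  then show "fsc r a \<in> kchains K i (pm_on X)" unfolding fsc_def by (rule kchains_map[rotated 2]) (auto intro: pm_on_scale)
qed

lemma lin_closed_cyc: "lin_closed fsc (cyc x X K i)"
proof -
  have "cbd x 0 = 0" by (simp add: fun_eq_iff zero_fun_def cbd_0[OF add])
  moreover have "fsc r (0 :: 'v set \<Rightarrow> 'x \<Rightarrow>\<^sub>0 'k) = 0" for r by (simp add: fsc_def zero_fun_def)
  ultimately show ?thesis
    using lin_closed_kchains[of K i] unfolding lin_closed_def cyc_def zero_fun_def[symmetric]
    by (simp add: cbd_plus cbd_fsc)
qed

lemma lin_closed_bds: "lin_closed fsc (bds x X K i)"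
  unfolding lin_closed_def bds_def
proof (intro conjI ballI allI)
  note k = lin_closedD[OF lin_closed_kchains[of K "Suc i"]]
  have "cbd x 0 = 0" by (simp add: fun_eq_iff zero_fun_def cbd_0[OF add])
  then show "0 \<in> cbd x ` kchains K (Suc i) (pm_on X)" using k(1) by (metis imageI)
  fix a :: "'v set \<Rightarrow> 'x \<Rightarrow>\<^sub>0 'k" and r assume a: "a \<in> cbd x ` kchains K (Suc i) (pm_on X)"
  then show "fsc r a \<in> cbd x ` kchains K (Suc i) (pm_on X)" using k(3) by (auto simp: cbd_fsc[symmetric])
  fix b :: "'v set \<Rightarrow> 'x \<Rightarrow>\<^sub>0 'k" assume b: "b \<in> cbd x ` kchains K (Suc i) (pm_on X)"
  with a show "a + b \<in> cbd x ` kchains K (Suc i) (pm_on X)" using k(2) by (auto simp: cbd_plus[symmetric])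
qed

lemma cbd_in: "down_closed K \<Longrightarrow> c \<in> kchains K i (pm_on X) \<Longrightarrow> cbd x c \<in> kchains K (i - 1) (pm_on X)"
  by (rule cbd_kchains[OF add]) (auto intro: closed pm_on_closed)

lemma bds_subset_cyc: "down_closed K \<Longrightarrow> bds x X K i \<subseteq> cyc x X K i"
  using cbd_in[of K _ "Suc i"] by (auto simp: bds_def cyc_def fun_eq_iff cbd_cbd[OF add comm])

lemma koszul_id: "koszul (x(v := \<lambda>m. m)) X"
  using add by unfold_locales (auto simp: additive_ops_def scale closed comm)

text \<open>Multiplying by x_v on faces without v is a chain map \<open>\<alpha>\<close> from the
  complex with x_v = 1 to the given one. A class of K that dies after v is made a cone vertex comes
  from there, so the homology of K is an extension of two finite pieces: the kernel of the map to
  the cone and the image in its homology.\<close>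

lemma hfin_cone_step:
  assumes K: "down_closed K" and id: "hfin (x(v := \<lambda>m. m)) X K i" and cone: "hfin x X (cplus K v) i"
  shows "hfin x X K i"
proof -
  let ?y = "x(v := \<lambda>m. m)"
  interpret y: koszul ?y X by (rule koszul_id)
  define \<alpha> where "\<alpha> = (\<lambda>(c :: 'v set \<Rightarrow> 'x \<Rightarrow>\<^sub>0 'k) \<sigma>. if v \<in> \<sigma> then c \<sigma> else x v (c \<sigma>))"
  have \<alpha>_cbd: "cbd x (\<alpha> c) = \<alpha> (cbd ?y c)" for c
  proof
    fix \<tau>
    show "cbd x (\<alpha> c) \<tau> = \<alpha> (cbd ?y c) \<tau>"
    proof (cases "v \<in> \<tau>")
      case True
      then show ?thesis by (auto simp: cbd_def \<alpha>_def intro!: sum.cong)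
    next
      case False
      then show ?thesis
        by (auto simp: cbd_def \<alpha>_def additive_ops_sum[OF add] additive_ops_sg[OF add] comm[of _ v] intro!: sum.cong)
    qed
  qed
  have \<alpha>_in: "\<alpha> c \<in> kchains K j (pm_on X)" if "c \<in> kchains K j (pm_on X)" for c j
    unfolding kchains_def
  proof (intro CollectI allI conjI impI)
    fix \<sigma>
    have *: "c \<sigma> \<in> pm_on X" "c \<sigma> \<noteq> 0 \<Longrightarrow> \<sigma> \<in> K \<and> card \<sigma> = j" using that by (auto simp: kchains_def)
    then show "\<alpha> c \<sigma> \<in> pm_on X" by (simp add: \<alpha>_def closed)
    assume "\<alpha> c \<sigma> \<noteq> 0"
    then have "c \<sigma> \<noteq> 0" by (auto simp: \<alpha>_def additive_ops_0[OF add] split: if_splits)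
    then show "\<sigma> \<in> K" "card \<sigma> = j" using * by auto
  qed
  let ?ker = "{c \<in> cyc x X K i. c \<in> bds x X (cplus K v) i}"
  have "fin_quot fsc ?ker (bds x X K i)"
  proof (rule fin_quot_surjective[where \<phi> = \<alpha>, OF vector_space_fsc _ _ _ id[unfolded hfin_def]])
    fix a b assume "a \<in> bds x X K i" "b \<in> bds x X K i"
    then show "a + b \<in> bds x X K i" by (rule lin_closedD(2)[OF lin_closed_bds])
  next
    fix a b show "\<alpha> (a + b) = \<alpha> a + \<alpha> b" by (auto simp: \<alpha>_def fun_eq_iff additive_opsD[OF add])
  next
    fix r a show "\<alpha> (fsc r a) = fsc r (\<alpha> a)" by (auto simp: \<alpha>_def fun_eq_iff fsc_def scale)
  next
    fix b assume "b \<in> bds ?y X K i"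
    then show "\<alpha> b \<in> bds x X K i" using \<alpha>_in unfolding bds_def by (auto simp: \<alpha>_cbd[symmetric])
  next
    fix c assume "c \<in> ?ker"
    then obtain e where c: "c \<in> kchains K i (pm_on X)" "cbd x e = c" and e: "e \<in> kchains (cplus K v) (Suc i) (pm_on X)"
      by (auto simp: cyc_def bds_def)
    note N = add_closed_pm_on[of X]
    define e1 where "e1 = rest v e"
    define e0 where "e0 = base v e"
    have e1: "e1 \<in> kchains K i (pm_on X)"
      by (rule kchains_mono[OF _ rest_kchains[OF N e, of v, folded e1_def]]) (auto simp: lk_def cplus_def)
    have e0: "e0 \<in> kchains K (Suc i) (pm_on X)"
      by (rule kchains_mono[OF _ base_kchains[OF _ e, of v, folded e0_def]]) (auto simp: del_def cplus_def pm_on_closed)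
    have e_eq: "e = (\<lambda>\<sigma>. e0 \<sigma> + hc v e1 \<sigma>)" by (rule ext) (simp add: e0_def e1_def base_rest_split[symmetric])
    have free: "e1 \<sigma> = 0" if "v \<in> \<sigma>" for \<sigma> using that by (simp add: e1_def rest_def)
    have same: "cbd ?y e1 \<tau> = cbd x e1 \<tau>" for \<tau>
      by (rule cbd_cong_ops) (auto simp: free additive_ops_0[OF add])
    \<comment> \<open>The part \<open>hc v e1\<close> of the bounding chain leaves K, but its
      boundary with x_v = 1 stays in K and is sent by \<open>\<alpha>\<close> to c up to the
      boundary of \<open>e0\<close>.\<close>
    define c' where "c' = cbd ?y (hc v e1)"
    have c'_eq: "c' \<tau> = e1 \<tau> - hc v (cbd x e1) \<tau>" for \<tau>
    proof -
      have "hc v (cbd ?y e1) = hc v (cbd x e1)" by (simp add: hc_def same fun_eq_iff)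
      then show ?thesis using hc_homotopy[OF y.add, of v e1 \<tau>] unfolding c'_def by (simp add: eq_diff_eq)
    qed
    have c_eq: "c \<tau> = cbd x e0 \<tau> + (x v (e1 \<tau>) - hc v (cbd x e1) \<tau>)" for \<tau>
    proof -
      have "cbd x (hc v e1) \<tau> = x v (e1 \<tau>) - hc v (cbd x e1) \<tau>"
        using hc_homotopy[OF add, of v e1 \<tau>] by (simp add: eq_diff_eq)
      then show ?thesis using fun_cong[OF c(2), of \<tau>] unfolding e_eq by (simp add: cbd_add[OF add])
    qed
    have "c' = (\<lambda>\<tau>. e1 \<tau> - (x v (e1 \<tau>) - (c \<tau> - cbd x e0 \<tau>)))"
      by (rule ext) (simp add: c_eq c'_eq)
    moreover have "(\<lambda>\<tau>. e1 \<tau> - (x v (e1 \<tau>) - (c \<tau> - cbd x e0 \<tau>))) \<in> kchains K i (pm_on X)"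
      using cbd_in[OF K e0] by (intro kchains_sub[OF N] e1 c kchains_op[OF add] closed) auto
    ultimately have "c' \<in> kchains K i (pm_on X)" by simp
    moreover have "cbd ?y c' = (\<lambda>_. 0)" unfolding c'_def by (rule ext) (rule cbd_cbd[OF y.add y.comm])
    ultimately have "c' \<in> cyc ?y X K i" by (simp add: cyc_def)
    moreover have "c - \<alpha> c' = cbd x e0"
    proof
      fix \<tau>
      show "(c - \<alpha> c') \<tau> = cbd x e0 \<tau>"
        by (cases "v \<in> \<tau>") (auto simp: \<alpha>_def c_eq c'_eq free additive_ops_0[OF add] hc_def fun_diff_def)
    qed
    ultimately show "\<exists>u\<in>cyc ?y X K i. c - \<alpha> u \<in> bds x X K i" using e0 by (auto simp: bds_def)
  qed
  moreover have "lin_closed fsc ?ker"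
    using lin_closed_cyc[of K i] lin_closed_bds[of "cplus K v" i] unfolding lin_closed_def by auto
  ultimately have w: "fin_quot_within fsc ?ker (bds x X K i)"
    using fin_quot_within_iff[OF vector_space_fsc _ lin_closed_bds] by blast
  have "fin_quot_within fsc (cyc x X K i) (bds x X K i)"
    by (rule fin_quot_extension[where \<phi> = "\<lambda>c. c", OF vector_space_fsc vector_space_fsc lin_closed_cyc lin_closed_bds _ _ cone[unfolded hfin_def] _ w])
      (auto simp: cyc_def intro: kchains_mono[OF subset_cplus[OF K]])
  then show ?thesis unfolding hfin_def by (rule fin_quot_withinD)
qed

end

section \<open>Reducing a free coordinate of the lattice modulo M\<close>

subsection \<open>Quotients of the lattice by multiples of basis vectors\<close>

definition push :: "('x \<Rightarrow> 'y) \<Rightarrow> ('x \<Rightarrow>\<^sub>0 'k::field) \<Rightarrow> ('y \<Rightarrow>\<^sub>0 'k)"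
  where "push h = lin (\<lambda>g. single (h g) 1)"

lemma push_simps: "push h (a + b) = push h a + push h b" "push h (a - b) = push h a - push h b"
  "push h 0 = 0" "push h (pm_scale r a) = pm_scale r (push h a)" "push h (single g r) = single (h g) r"
  by (simp_all add: push_def lin_add lin_diff lin_scale)

lemma push_push: "push h (push h' m) = push (\<lambda>g. h (h' g)) m"
  by (simp add: push_def lin_lin)

lemma push_cong: "(\<And>g. g \<in> keys m \<Longrightarrow> h g = h' g) \<Longrightarrow> push h m = push h' m"
  unfolding push_def by (rule lin_cong) simp

lemma push_ident: "(\<And>g. g \<in> keys m \<Longrightarrow> h g = g) \<Longrightarrow> push h m = m"
  using push_cong[of m h "\<lambda>g. g"] by (simp add: push_def)

lemma keys_push: "keys (push h m) \<subseteq> h ` keys m"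
  unfolding push_def by (rule keys_lin_subset) auto

lemma push_in: "(\<And>g. g \<in> X \<Longrightarrow> h g \<in> Y) \<Longrightarrow> m \<in> pm_on X \<Longrightarrow> push h m \<in> pm_on Y"
  using keys_push[of h m] by (fastforce simp: pm_on_def)

text \<open>The support is finite, so it has an element with least f; this element is the image of
  another support element, for which f would be still smaller.\<close>

lemma push_fixed:
  assumes "push h m = m" and less: "\<And>g. g \<in> keys m \<Longrightarrow> f g < (f (h g) :: int)"
  shows "m = 0"
proof (rule ccontr)
  assume "m \<noteq> 0"
  then have ne: "keys m \<noteq> {}" by simp
  define g where "g = arg_min_on f (keys m)"
  have g: "g \<in> keys m" "\<And>g'. g' \<in> keys m \<Longrightarrow> \<not> f g' < f g"
    using arg_min_if_finite[OF _ ne, of f] by (auto simp: g_def)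
  then obtain g' where "g' \<in> keys m" "g = h g'" using keys_push[of h m] assms(1) by auto
  then show False using less[of g'] g(2)[of g'] by simp
qed

text \<open>Reduced representatives of a product of cyclic groups. Because g mod 0 = g, modulus 0
  gives a free coordinate; modulus 1 removes a coordinate.\<close>

definition grp :: "(nat \<Rightarrow> int) \<Rightarrow> (nat \<Rightarrow> int) set"
  where "grp n = {g. \<forall>j. g j mod n j = g j}"

definition tr :: "(nat \<Rightarrow> int) \<Rightarrow> (nat \<Rightarrow> int) \<Rightarrow> (nat \<Rightarrow> int) \<Rightarrow> nat \<Rightarrow> int"
  where "tr n a g = (\<lambda>j. (g j + a j) mod n j)"

text \<open>The operators t_v - 1 of the cover, except that the vertices in W have already been
  resolved by putting x_v = 1.\<close>

definition qops :: "(nat \<Rightarrow> int) \<Rightarrow> 'v set \<Rightarrow> ('v \<Rightarrow> nat \<Rightarrow> int) \<Rightarrow> 'v \<Rightarrow> ((nat \<Rightarrow> int) \<Rightarrow>\<^sub>0 'k::field) \<Rightarrow> (nat \<Rightarrow> int) \<Rightarrow>\<^sub>0 'k"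
  where "qops n W a v m = (if v \<in> W then m else push (tr n (a v)) m - m)"

lemma tr_grp: "tr n a g \<in> grp n"
  by (simp add: tr_def grp_def)

lemma tr_tr: "tr n a (tr n b g) = tr n (\<lambda>j. a j + b j) g"
  by (simp add: tr_def mod_simps fun_eq_iff algebra_simps)

lemma tr_commute: "tr n a (tr n b g) = tr n b (tr n a g)"
  by (simp add: tr_tr add.commute)

lemma qops_push_commute:
  assumes "\<And>v g. h (tr n (a v) g) = tr n' (a' v) (h g)"
  shows "push h (qops n W a v m) = qops n' W a' v (push h m)"
  by (simp add: qops_def push_simps push_push assms)

lemma additive_qops: "additive_ops (qops n W a)"
  by (simp add: additive_ops_def qops_def push_simps)

lemma koszul_qops: "koszul (qops n W a) (grp n)"
proof
  show "additive_ops (qops n W a)" by (rule additive_qops)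
  show "qops n W a v (pm_scale r m) = pm_scale r (qops n W a v m)" for v r m
    by (simp add: qops_def push_simps pm.scale_right_diff_distrib)
  show "qops n W a v m \<in> pm_on (grp n)" if "m \<in> pm_on (grp n)" for v m
    using that by (auto simp: qops_def intro!: pm_on_closed push_in[of "grp n"] tr_grp)
  show "qops n W a v (qops n W a w m) = qops n W a w (qops n W a v m)" for v w m
  proof (cases "v \<in> W")
    case False
    have "push (tr n (a v)) (qops n W a w m) = qops n W a w (push (tr n (a v)) m)"
      by (rule qops_push_commute) (rule tr_commute)
    then show ?thesis using False by (simp add: qops_def[of n W a v] additive_ops_diff[OF additive_qops])
  qed (simp add: qops_def[of n W a v])
qed

lemma qops_insert: "qops n (insert v W) a = (qops n W a)(v := \<lambda>m. m)"
  by (auto simp: qops_def fun_eq_iff)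

lemma shift_injective:
  assumes "n j = 0" "a j \<noteq> 0" "push (tr n a) m = m"
  shows "m = 0"
proof (rule push_fixed[OF assms(3), where f = "\<lambda>g. g j * a j"])
  fix g
  have "0 < a j * a j" using assms(2) by (simp add: zero_less_mult_iff linorder_neq_iff disj_commute)
  then show "g j * a j < tr n a g j * a j" using assms(1) by (simp add: tr_def algebra_simps)
qed

text \<open>Setting of the short exact sequence k[G] -> k[G] -> k[G'], in which the first map
  \<open>sh\<close> is the difference of translation by M in coordinate j and the identity, and the
  second is reduction modulo M.\<close>

locale quotient_step =
  fixes n :: "nat \<Rightarrow> int" and j :: nat and M :: int and W :: "'v::finite set" and a :: "'v \<Rightarrow> nat \<Rightarrow> int" and fld :: "'k::field itself"
  assumes nj: "n j = 0" and M: "M > 0"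
begin

abbreviation "n' \<equiv> n(j := M)"
abbreviation "ev \<equiv> (\<lambda>i. if i = j then M else 0)"
abbreviation "rd \<equiv> (\<lambda>g::nat \<Rightarrow> int. g(j := g j mod M))"
abbreviation "x \<equiv> (qops n W a :: 'v \<Rightarrow> ((nat \<Rightarrow> int) \<Rightarrow>\<^sub>0 'k) \<Rightarrow> _)"
abbreviation "x' \<equiv> (qops n' W a :: 'v \<Rightarrow> ((nat \<Rightarrow> int) \<Rightarrow>\<^sub>0 'k) \<Rightarrow> _)"

definition sh :: "((nat \<Rightarrow> int) \<Rightarrow>\<^sub>0 'k) \<Rightarrow> (nat \<Rightarrow> int) \<Rightarrow>\<^sub>0 'k"
  where "sh m = push (tr n ev) m - m"

sublocale k: koszul x "grp n" by (rule koszul_qops)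
sublocale k': koszul x' "grp n'" by (rule koszul_qops)

lemma grp_mono: "grp n' \<subseteq> grp n"
proof
  fix g assume g: "g \<in> grp n'"
  have "g i mod n i = g i" for i using g nj unfolding grp_def by (cases "i = j") (auto dest: spec[of _ i])
  then show "g \<in> grp n" by (simp add: grp_def)
qed

lemma pm_on_mono: "m \<in> pm_on (grp n') \<Longrightarrow> m \<in> pm_on (grp n)"
  using grp_mono by (auto simp: pm_on_def)

lemma kchains_lift: "c \<in> kchains K i (pm_on (grp n')) \<Longrightarrow> c \<in> kchains K i (pm_on (grp n))"
  using pm_on_mono by (auto simp: kchains_def)

lemma rd_grp: "g \<in> grp n \<Longrightarrow> rd g \<in> grp n'"
  by (auto simp: grp_def)

lemma push_rd_in: "m \<in> pm_on (grp n) \<Longrightarrow> push rd m \<in> pm_on (grp n')"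
  by (rule push_in) (auto intro: rd_grp)

lemma push_rd_same: "m \<in> pm_on (grp n') \<Longrightarrow> push rd m = m"
proof (rule push_ident)
  fix g assume "m \<in> pm_on (grp n')" "g \<in> keys m"
  then have "g \<in> grp n'" by (auto simp: pm_on_def)
  then have "g j mod M = g j" by (auto simp: grp_def dest: spec[of _ j])
  then show "rd g = g" by simp
qed

lemma sh_add: "sh (b + c) = sh b + sh c"
  by (simp add: sh_def push_simps)

lemmas sh_additive = additive_sum[of sh, OF sh_add]

lemma sh_scale: "sh (pm_scale r m) = pm_scale r (sh m)"
  by (simp add: sh_def push_simps pm.scale_right_diff_distrib)

lemma sh_in: "m \<in> pm_on (grp n) \<Longrightarrow> sh m \<in> pm_on (grp n)"
  unfolding sh_def by (intro pm_on_closed push_in[of "grp n"] tr_grp)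

lemma sh_inj: "sh m = 0 \<Longrightarrow> m = 0"
  using shift_injective[of n j ev m] nj M by (simp add: sh_def)

lemma sh_inj': "sh m = sh m' \<Longrightarrow> m = m'"
  using sh_inj[of "m - m'"] by (simp add: sh_additive)

lemma sh_ops: "sh (x v m) = x v (sh m)"
proof -
  have "push (tr n ev) (x v m) = x v (push (tr n ev) m)" by (rule qops_push_commute) (rule tr_commute)
  then show ?thesis by (simp add: sh_def additive_ops_diff[OF k.add])
qed

lemma rd_ops: "push rd (x v m) = x' v (push rd m)"
proof (rule qops_push_commute)
  fix v g
  show "rd (tr n (a v) g) = tr n' (a v) (rd g)"
    using nj by (auto simp: fun_eq_iff tr_def mod_simps)
qed


lemma rd_sh: "m \<in> pm_on (grp n) \<Longrightarrow> push rd (sh m) = 0"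
proof -
  assume m: "m \<in> pm_on (grp n)"
  have eq: "rd (tr n ev g) = rd g" if "g \<in> grp n" for g
    using that nj by (auto simp: fun_eq_iff tr_def grp_def)
  have "push (\<lambda>g. rd (tr n ev g)) m = push rd m"
    by (rule push_cong) (use m eq in \<open>auto simp: pm_on_def\<close>)
  then show ?thesis by (simp add: sh_def push_simps push_push)
qed

text \<open>The difference of g and its reduction telescopes into translates by M, each difference
  being a value of \<open>sh\<close>; these are summed with the coefficients of m.\<close>

lemma rd_kernel:
  assumes m: "m \<in> pm_on (grp n)" "push rd m = 0"
  obtains u where "u \<in> pm_on (grp n)" "sh u = m"
proof -
  have up: "\<exists>u\<in>pm_on (grp n). sh u = single (g(j := g j + int k * M)) 1 - single g 1" if g: "g \<in> grp n" for g k
  proof (induction k)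
    case 0
    then show ?case by (intro bexI[of _ 0]) (auto simp: sh_additive pm_on_closed)
  next
    case (Suc k)
    then obtain u where u: "u \<in> pm_on (grp n)" "sh u = single (g(j := g j + int k * M)) 1 - single g 1" by blast
    let ?g = "g(j := g j + int k * M)"
    have gg: "?g \<in> grp n" using g nj by (auto simp: grp_def)
    have "tr n ev ?g = g(j := g j + int (Suc k) * M)"
      using g nj by (auto simp: fun_eq_iff tr_def grp_def algebra_simps)
    then have "sh (u + single ?g 1) = single (g(j := g j + int (Suc k) * M)) 1 - single g 1"
      unfolding sh_add u(2) by (simp add: sh_def push_simps)
    moreover have "u + single ?g 1 \<in> pm_on (grp n)" using u(1) gg by (intro pm_on_closed) (auto simp: pm_on_def)
    ultimately show ?case by blast
  qed
  have "\<exists>u\<in>pm_on (grp n). sh u = single g 1 - single (rd g) 1" if g: "g \<in> grp n" for g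
  proof (cases "g j div M \<ge> 0")
    case True
    define k where "k = nat (g j div M)"
    have "rd g j + int k * M = g j" using True by (simp add: k_def)
    then have "(rd g)(j := rd g j + int k * M) = g" by (auto simp: fun_eq_iff)
    then show ?thesis using up[OF subsetD[OF grp_mono rd_grp[OF g]], of k] by simp
  next
    case False
    define k where "k = nat (- (g j div M))"
    have "g j + int k * M = g j mod M" using False by (simp add: k_def minus_div_mult_eq_mod[symmetric])
    then have "g(j := g j + int k * M) = rd g" by (auto simp: fun_eq_iff)
    then obtain u where "u \<in> pm_on (grp n)" "sh u = single (rd g) 1 - single g 1" using up[OF g, of k] by auto
    then show ?thesis by (intro bexI[of _ "- u"]) (auto simp: sh_additive pm_on_closed)
  qed
  then obtain U where U: "\<And>g. g \<in> grp n \<Longrightarrow> U g \<in> pm_on (grp n)" "\<And>g. g \<in> grp n \<Longrightarrow> sh (U g) = single g 1 - single (rd g) 1"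
    by metis
  have mk: "g \<in> grp n" if "g \<in> keys m" for g using that m(1) by (auto simp: pm_on_def)
  have "sh (lin U m) = lin (\<lambda>g. sh (U g)) m"
    by (simp add: sh_def push_def lin_lin lin_fun_diff)
  also have "\<dots> = lin (\<lambda>g. single g 1 - single (rd g) 1) m" by (rule lin_cong) (use U mk in auto)
  also have "\<dots> = m" using m(2) by (simp add: lin_fun_diff push_def)
  finally show ?thesis using that[of "lin U m"] pm_on_lin[of m U "grp n"] U(1) mk by blast
qed

lemma rd_kernel_chain:
  assumes c: "c \<in> kchains K i (pm_on (grp n))" and z: "\<And>\<sigma>. push rd (c \<sigma>) = 0"
  obtains d where "d \<in> kchains K i (pm_on (grp n))" "\<And>\<sigma>. sh (d \<sigma>) = c \<sigma>"
proof -
  have "\<exists>u\<in>pm_on (grp n). sh u = c \<sigma>" for \<sigma>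
  proof -
    have "c \<sigma> \<in> pm_on (grp n)" using c by (simp add: kchains_def)
    from rd_kernel[OF this z] show ?thesis by blast
  qed
  then obtain d where d: "\<And>\<sigma>. d \<sigma> \<in> pm_on (grp n)" "\<And>\<sigma>. sh (d \<sigma>) = c \<sigma>" by metis
  have "d \<sigma> = 0" if "c \<sigma> = 0" for \<sigma> using d(2)[of \<sigma>] that sh_inj by simp
  then have "d \<in> kchains K i (pm_on (grp n))" using c d(1) unfolding kchains_def by auto
  then show ?thesis using d(2) that by blast
qed

lemma cbd_sh: "cbd x (\<lambda>\<sigma>. sh (c \<sigma>)) \<tau> = sh (cbd x c \<tau>)"
  by (rule cbd_map) (auto simp: sh_add sh_ops)

lemma cbd_rd: "cbd x' (\<lambda>\<sigma>. push rd (c \<sigma>)) \<tau> = push rd (cbd x c \<tau>)"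
  by (rule cbd_map[where \<Lambda> = "push rd" and x = x and x' = x'], rule push_simps(1), rule rd_ops)

text \<open>If \<open>sh\<close> is zero on the homology of G, the long exact sequence makes
  reduction to G' injective there.\<close>

lemma hfin_of_quotient:
  assumes K: "down_closed K" and fin: "hfin x' (grp n') K i"
    and triv: "\<And>c. c \<in> cyc x (grp n) K i \<Longrightarrow> (\<lambda>\<sigma>. sh (c \<sigma>)) \<in> bds x (grp n) K i"
  shows "hfin x (grp n) K i"
  unfolding hfin_def
proof (rule fin_quot_injective[where \<phi> = "\<lambda>c \<sigma>. push rd (c \<sigma>)", OF vector_space_fsc vector_space_fsc k.lin_closed_cyc k'.lin_closed_bds _ _ fin[unfolded hfin_def]])
  fix c assume c: "c \<in> cyc x (grp n) K i"
  have "(\<lambda>\<sigma>. push rd (c \<sigma>)) \<in> kchains K i (pm_on (grp n'))"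
    using c unfolding cyc_def
    by (intro kchains_map[where \<Lambda> = "push rd" and N = "pm_on (grp n)"]) (auto intro: push_simps(3) push_rd_in simp del: fun_upd_apply)
  moreover have "cbd x' (\<lambda>\<sigma>. push rd (c \<sigma>)) = (\<lambda>_. 0)"
    using c by (intro ext) (simp add: cbd_rd cyc_def push_simps)
  ultimately show "(\<lambda>\<sigma>. push rd (c \<sigma>)) \<in> cyc x' (grp n') K i" by (simp add: cyc_def)
  assume "(\<lambda>\<sigma>. push rd (c \<sigma>)) \<in> bds x' (grp n') K i"
  then obtain b where b: "b \<in> kchains K (Suc i) (pm_on (grp n'))" "cbd x' b = (\<lambda>\<sigma>. push rd (c \<sigma>))"
    by (auto simp: bds_def)
  note bn = kchains_lift[OF b(1)]
  have ck: "c \<in> kchains K i (pm_on (grp n))" "cbd x c = (\<lambda>_. 0)" using c by (auto simp: cyc_def)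
  define e where "e = (\<lambda>\<sigma>. c \<sigma> - cbd x b \<sigma>)"
  have ek: "e \<in> kchains K i (pm_on (grp n))" unfolding e_def using k.cbd_in[OF K bn] ck by (intro kchains_diff) auto
  have e0: "push rd (e \<sigma>) = 0" for \<sigma>
  proof -
    have "(\<lambda>\<sigma>. push rd (b \<sigma>)) = b" using b(1) by (auto simp: kchains_def push_rd_same)
    then have "push rd (cbd x b \<sigma>) = cbd x' b \<sigma>" using cbd_rd[of b \<sigma>] by simp
    then show ?thesis unfolding e_def by (simp add: push_simps b(2))
  qed
  obtain d where d: "d \<in> kchains K i (pm_on (grp n))" "\<And>\<sigma>. sh (d \<sigma>) = e \<sigma>" using rd_kernel_chain[OF ek e0] by blast
  have "cbd x d = (\<lambda>_. 0)"
  proof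
    fix \<tau>
    have "sh (cbd x d \<tau>) = cbd x e \<tau>" unfolding cbd_sh[symmetric] by (simp add: d(2))
    also have "\<dots> = 0" unfolding e_def by (simp add: cbd_diff[OF k.add] ck cbd_cbd[OF k.add k.comm])
    finally show "cbd x d \<tau> = 0" by (rule sh_inj)
  qed
  then have "(\<lambda>\<sigma>. sh (d \<sigma>)) \<in> bds x (grp n) K i" using d(1) by (intro triv) (auto simp: cyc_def)
  moreover have "c = (\<lambda>\<sigma>. sh (d \<sigma>)) + cbd x b" by (auto simp: fun_eq_iff d(2) e_def)
  ultimately show "c \<in> bds x (grp n) K i"
    using lin_closedD(2)[OF k.lin_closed_bds] bn unfolding bds_def by blast
qed (auto simp: push_simps fsc_def fun_eq_iff)

text \<open>The long exact sequence places the degree i homology of G' between that of G in degrees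
  i and i - 1.\<close>

lemma hfin_quotient:
  assumes K: "down_closed K" and fin: "hfin x (grp n) K i" "hfin x (grp n) K (i - 1)"
  shows "hfin x' (grp n') K i"
proof -
  \<comment> \<open>The connecting map: a cycle over G' is itself a chain over G by means of reduced
    representatives, its boundary over G is a value of \<open>sh\<close>, and \<open>sh\<close> is
    injective.\<close>
  define \<phi> where "\<phi> = (\<lambda>c \<sigma>. THE u. sh u = cbd x c \<sigma>)"
  have lift: "sh (\<phi> c \<sigma>) = cbd x c \<sigma>" "\<phi> c \<in> cyc x (grp n) K (i - 1)" if c: "c \<in> cyc x' (grp n') K i" for c \<sigma>
  proof -
    have ck: "c \<in> kchains K i (pm_on (grp n'))" "cbd x' c = (\<lambda>_. 0)" using c by (auto simp: cyc_def)
    have "push rd (cbd x c \<sigma>) = 0" for \<sigma>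
    proof -
      have "(\<lambda>\<sigma>. push rd (c \<sigma>)) = c" using ck(1) by (auto simp: kchains_def push_rd_same)
      then show ?thesis using cbd_rd[of c \<sigma>] ck(2) by simp
    qed
    then obtain d where d: "d \<in> kchains K (i - 1) (pm_on (grp n))" "\<And>\<sigma>. sh (d \<sigma>) = cbd x c \<sigma>"
      using rd_kernel_chain[OF k.cbd_in[OF K kchains_lift[OF ck(1)]]] by blast
    have \<phi>d: "\<phi> c = d" unfolding \<phi>_def by (rule ext, rule the_equality) (auto simp: d(2)[symmetric] dest: sh_inj')
    show "sh (\<phi> c \<sigma>) = cbd x c \<sigma>" by (simp add: \<phi>d d(2))
    have "sh (cbd x d \<tau>) = 0" for \<tau>
      unfolding cbd_sh[symmetric] by (simp add: d(2) cbd_cbd[OF k.add k.comm])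
    then have "cbd x d \<tau> = 0" for \<tau> by (rule sh_inj)
    then show "\<phi> c \<in> cyc x (grp n) K (i - 1)" unfolding \<phi>d cyc_def using d(1) by auto
  qed
  have cyc_lin: "lin_closed fsc (cyc x' (grp n') K i)" by (rule k'.lin_closed_cyc)
  let ?ker = "{c \<in> cyc x' (grp n') K i. \<phi> c \<in> bds x (grp n) K (i - 1)}"
  have \<phi>_add: "\<phi> (b + c) = \<phi> b + \<phi> c" if "b \<in> cyc x' (grp n') K i" "c \<in> cyc x' (grp n') K i" for b c
  proof
    fix \<sigma>
    have "sh (\<phi> (b + c) \<sigma>) = sh (\<phi> b \<sigma> + \<phi> c \<sigma>)"
      using lift(1)[OF lin_closedD(2)[OF cyc_lin that]] lift(1)[OF that(1)] lift(1)[OF that(2)]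
      by (simp add: sh_add k.cbd_plus)
    then show "\<phi> (b + c) \<sigma> = (\<phi> b + \<phi> c) \<sigma>" by (auto dest: sh_inj')
  qed
  have \<phi>_scale: "\<phi> (fsc r c) = fsc r (\<phi> c)" if "c \<in> cyc x' (grp n') K i" for r c
  proof
    fix \<sigma>
    have "sh (\<phi> (fsc r c) \<sigma>) = sh (fsc r (\<phi> c) \<sigma>)"
      using lift(1)[OF lin_closedD(3)[OF cyc_lin that]] lift(1)[OF that]
      unfolding k.cbd_fsc by (simp add: fsc_def sh_scale)
    then show "\<phi> (fsc r c) \<sigma> = fsc r (\<phi> c) \<sigma>" by (auto dest: sh_inj')
  qed
  have "fin_quot fsc ?ker (bds x' (grp n') K i)"
  proof (rule fin_quot_surjective[where \<phi> = "\<lambda>c \<sigma>. push rd (c \<sigma>)", OF vector_space_fsc _ _ _ fin(1)[unfolded hfin_def]])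
    fix b assume "b \<in> bds x (grp n) K i"
    then obtain e where e: "e \<in> kchains K (Suc i) (pm_on (grp n))" "b = cbd x e" by (auto simp: bds_def)
    have "(\<lambda>\<sigma>. push rd (b \<sigma>)) = cbd x' (\<lambda>\<sigma>. push rd (e \<sigma>))" by (auto simp: fun_eq_iff cbd_rd e(2))
    moreover have "(\<lambda>\<sigma>. push rd (e \<sigma>)) \<in> kchains K (Suc i) (pm_on (grp n'))"
      by (rule kchains_map[where \<Lambda> = "push rd", OF push_simps(3) push_rd_in e(1)])
    ultimately show "(\<lambda>\<sigma>. push rd (b \<sigma>)) \<in> bds x' (grp n') K i" by (auto simp: bds_def)
  next
    fix c assume "c \<in> ?ker"
    then have c: "c \<in> cyc x' (grp n') K i" and "\<phi> c \<in> bds x (grp n) K (i - 1)" by auto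
    then obtain b where b: "b \<in> kchains K (Suc (i - 1)) (pm_on (grp n))" "cbd x b = \<phi> c" by (auto simp: bds_def)
    have ck: "c \<in> kchains K i (pm_on (grp n'))" using c by (auto simp: cyc_def)
    note rs = push_rd_same
    have cs: "push rd (c \<sigma>) = c \<sigma>" for \<sigma> using ck by (auto simp: kchains_def push_rd_same)
    show "\<exists>u\<in>cyc x (grp n) K i. c - (\<lambda>\<sigma>. push rd (u \<sigma>)) \<in> bds x' (grp n') K i"
    proof (cases "i = 0")
      \<comment> \<open>Here i - 1 is also 0, so \<open>b\<close> has degree 1 and cannot correct c;
        but in degree 0 the chain c is already a cycle over G.\<close>
      case True
      have "c \<in> cyc x (grp n) K i"
        using kchains_lift[OF ck] cbd_degree_0[OF k.add, of c K] True by (auto simp: cyc_def)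
      moreover have "c - (\<lambda>\<sigma>. push rd (c \<sigma>)) = 0" by (auto simp: fun_eq_iff cs)
      ultimately show ?thesis using lin_closedD(1)[OF k'.lin_closed_bds] by (intro bexI[of _ c]) auto
    next
      case False
      then have bi: "b \<in> kchains K i (pm_on (grp n))" using b(1) by simp
      define u where "u = (\<lambda>\<sigma>. c \<sigma> - sh (b \<sigma>))"
      have "u \<in> kchains K i (pm_on (grp n))"
        unfolding u_def by (intro kchains_diff kchains_lift[OF ck] kchains_map[OF _ _ bi]) (auto simp: sh_additive sh_in)
      moreover have "cbd x u \<tau> = 0" for \<tau>
        unfolding u_def cbd_diff[OF k.add] cbd_sh b(2) lift(1)[OF c] by simp
      ultimately have "u \<in> cyc x (grp n) K i" by (auto simp: cyc_def)
      moreover have "c - (\<lambda>\<sigma>. push rd (u \<sigma>)) = 0"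
        using bi by (auto simp: fun_eq_iff u_def push_simps cs rd_sh kchains_def)
      ultimately show ?thesis using lin_closedD(1)[OF k'.lin_closed_bds] by (intro bexI[of _ u]) auto
    qed
  next
    fix b c assume "b \<in> bds x' (grp n') K i" "c \<in> bds x' (grp n') K i"
    then show "b + c \<in> bds x' (grp n') K i" by (rule lin_closedD(2)[OF k'.lin_closed_bds])
  qed (auto simp: push_simps fsc_def fun_eq_iff)
  moreover have kl: "lin_closed fsc ?ker"
    unfolding lin_closed_def
  proof (intro conjI ballI allI)
    have "\<phi> 0 = fsc 0 (\<phi> 0)" using \<phi>_scale[OF lin_closedD(1)[OF cyc_lin], of 0] by (simp add: fsc_def zero_fun_def)
    also have "\<dots> = 0" by (simp add: fsc_def zero_fun_def)
    finally show "0 \<in> ?ker" using lin_closedD(1)[OF cyc_lin] lin_closedD(1)[OF k.lin_closed_bds] by simp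
  qed (use lin_closedD[OF cyc_lin] lin_closedD[OF k.lin_closed_bds] \<phi>_add \<phi>_scale in auto)
  ultimately have w: "fin_quot_within fsc ?ker (bds x' (grp n') K i)"
    using fin_quot_within_iff[OF vector_space_fsc kl k'.lin_closed_bds] by blast
  show ?thesis
    unfolding hfin_def
    by (rule fin_quot_withinD, rule fin_quot_extension[where \<phi> = \<phi>, OF vector_space_fsc vector_space_fsc cyc_lin k.lin_closed_bds \<phi>_add \<phi>_scale fin(2)[unfolded hfin_def] lift(2) w])
qed

end


context koszul
begin

lemma hfin_kexact: "kexact x (pm_on X) K i \<Longrightarrow> hfin x X K i"
  unfolding hfin_def
  by (rule fin_quot_withinD, rule fin_quot_within_trivial) (auto simp: kexact_def cyc_def bds_def)

lemma hfin_finite: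
  assumes "finite X"
  shows "hfin x X K i"
  unfolding hfin_def
proof (rule fin_quotI[where I = "UNIV \<times> X" and f = "\<lambda>(\<sigma>, g) \<tau>. if \<tau> = \<sigma> then single g 1 else 0"])
  show "finite ((UNIV :: 'v set set) \<times> X)" using assms by simp
  fix c assume "c \<in> cyc x X K i"
  then have c: "keys (c \<sigma>) \<subseteq> X" for \<sigma> by (auto simp: cyc_def kchains_def pm_on_def)
  define S where "S = (\<Sum>p\<in>UNIV \<times> X. fsc (lookup (c (fst p)) (snd p)) (case p of (\<sigma>, g) \<Rightarrow> \<lambda>\<tau>. if \<tau> = \<sigma> then single g (1::'k) else 0))"
  have "S \<tau> = c \<tau>" for \<tau>
  proof -
    have app: "(\<Sum>p\<in>I. F p) \<tau> = (\<Sum>p\<in>I. F p \<tau>)" for I :: "('v set \<times> 'x) set" and F :: "_ \<Rightarrow> 'v set \<Rightarrow> 'x \<Rightarrow>\<^sub>0 'k"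
      by (induction I rule: infinite_finite_induct) auto
    have "S \<tau> = (\<Sum>\<sigma>\<in>UNIV. \<Sum>g\<in>X. if \<tau> = \<sigma> then single g (lookup (c \<tau>) g) else 0)"
      unfolding S_def app sum.cartesian_product by (rule sum.cong) (auto simp: fsc_def)
    also have "\<dots> = (\<Sum>g\<in>X. \<Sum>\<sigma>\<in>UNIV. if \<tau> = \<sigma> then single g (lookup (c \<tau>) g) else 0)" by (rule sum.swap)
    also have "\<dots> = (\<Sum>g\<in>X. single g (lookup (c \<tau>) g))" by (intro sum.cong refl) simp
    also have "\<dots> = lin (\<lambda>g. single g 1) (c \<tau>)" using lin_superset[OF assms c[of \<tau>], of "\<lambda>g. single g 1"] by simp
    finally show ?thesis by simp
  qed
  then have "c - S = 0" by (auto simp: fun_eq_iff)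
  then show "\<exists>a. c - (\<Sum>p\<in>UNIV \<times> X. fsc (a p) (case p of (\<sigma>, g) \<Rightarrow> \<lambda>\<tau>. if \<tau> = \<sigma> then single g 1 else 0)) \<in> bds x X K i"
    using lin_closedD(1)[OF lin_closed_bds] unfolding S_def by (intro exI[of _ "\<lambda>p. lookup (c (fst p)) (snd p)"]) auto
qed

end

lemma finite_grp:
  assumes "\<And>j. j < r \<Longrightarrow> n j = M" "\<And>j. j \<ge> r \<Longrightarrow> n j = 1" "M > 0"
  shows "finite (grp n)"
proof (rule finite_subset)
  show "finite {g. \<forall>j. (j \<in> {..<r} \<longrightarrow> g j \<in> {0..<M}) \<and> (j \<notin> {..<r} \<longrightarrow> g j = 0)}"
    by (rule finite_set_of_finite_funs) auto
  show "grp n \<subseteq> {g. \<forall>j. (j \<in> {..<r} \<longrightarrow> g j \<in> {0..<M}) \<and> (j \<notin> {..<r} \<longrightarrow> g j = 0)}"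
  proof (intro subsetI CollectI allI conjI impI)
    fix g j assume g: "g \<in> grp n"
    then have *: "g j mod n j = g j" by (simp add: grp_def)
    show "g j \<in> {0..<M}" if "j \<in> {..<r}"
    proof -
      have "g j mod M = g j" using * that assms(1) by simp
      then show ?thesis by (metis pos_mod_bound pos_mod_sign assms(3) atLeastLessThan_iff)
    qed
    show "g j = 0" if "j \<notin> {..<r}" using * that assms(2)[of j] by auto
  qed
qed

section \<open>Trivially acting translations, and finiteness from the spanning condition\<close>

subsection \<open>Translations that act trivially on homology\<close>

definition trivial_on :: "'k::field itself \<Rightarrow> (nat \<Rightarrow> int) \<Rightarrow> 'v::finite set \<Rightarrow> ('v \<Rightarrow> nat \<Rightarrow> int) \<Rightarrow> 'v set set \<Rightarrow> nat \<Rightarrow> (nat \<Rightarrow> int) \<Rightarrow> bool"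
  where "trivial_on _ n W a K i g \<longleftrightarrow>
    (\<forall>c\<in>cyc (qops n W a :: _ \<Rightarrow> (_ \<Rightarrow>\<^sub>0 'k) \<Rightarrow> _) (grp n) K i. (\<lambda>\<sigma>. push (tr n g) (c \<sigma>) - c \<sigma>) \<in> bds (qops n W a) (grp n) K i)"

lemma bds_push:
  assumes "b \<in> bds (qops n W a) (grp n) K i"
  shows "(\<lambda>\<sigma>. push (tr n g) (b \<sigma>)) \<in> bds (qops n W a :: _ \<Rightarrow> (_ \<Rightarrow>\<^sub>0 'k::field) \<Rightarrow> _) (grp n) K i"
proof -
  obtain e where e: "e \<in> kchains K (Suc i) (pm_on (grp n))" "b = cbd (qops n W a) e" using assms by (auto simp: bds_def)
  have "(\<lambda>\<sigma>. push (tr n g) (b \<sigma>)) = cbd (qops n W a) (\<lambda>\<sigma>. push (tr n g) (e \<sigma>))"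
    unfolding e(2)
    by (rule ext, rule sym, rule cbd_map[where \<Lambda> = "push (tr n g)"], rule push_simps(1), rule qops_push_commute, rule tr_commute)
  moreover have "(\<lambda>\<sigma>. push (tr n g) (e \<sigma>)) \<in> kchains K (Suc i) (pm_on (grp n))"
    by (rule kchains_map[where \<Lambda> = "push (tr n g)", OF push_simps(3) _ e(1)]) (rule push_in[OF tr_grp])
  ultimately show ?thesis by (auto simp: bds_def)
qed

lemma trivial_on_add:
  assumes "trivial_on TYPE('k::field) n W a K i g" "trivial_on TYPE('k) n W a K i h"
  shows "trivial_on TYPE('k) n W a K i (\<lambda>j. g j + h j)"
  unfolding trivial_on_def
proof
  interpret koszul "qops n W a :: _ \<Rightarrow> (_ \<Rightarrow>\<^sub>0 'k) \<Rightarrow> _" "grp n" by (rule koszul_qops)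
  fix c :: "_ \<Rightarrow> _ \<Rightarrow>\<^sub>0 'k" assume c: "c \<in> cyc (qops n W a) (grp n) K i"
  have "(\<lambda>\<sigma>. push (tr n g) (push (tr n h) (c \<sigma>) - c \<sigma>)) + (\<lambda>\<sigma>. push (tr n g) (c \<sigma>) - c \<sigma>) \<in> bds (qops n W a) (grp n) K i"
    using assms c unfolding trivial_on_def by (intro lin_closedD(2)[OF lin_closed_bds] bds_push) auto
  also have "(\<lambda>\<sigma>. push (tr n g) (push (tr n h) (c \<sigma>) - c \<sigma>)) + (\<lambda>\<sigma>. push (tr n g) (c \<sigma>) - c \<sigma>)
    = (\<lambda>\<sigma>. push (tr n (\<lambda>j. g j + h j)) (c \<sigma>) - c \<sigma>)"
    by (auto simp: fun_eq_iff push_simps push_push tr_tr add.commute)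
  finally show "(\<lambda>\<sigma>. push (tr n (\<lambda>j. g j + h j)) (c \<sigma>) - c \<sigma>) \<in> bds (qops n W a) (grp n) K i" .
qed

lemma push_tr_0: "m \<in> pm_on (grp n) \<Longrightarrow> (\<And>j. g j = 0) \<Longrightarrow> push (tr n g) m = m"
  by (rule push_ident) (auto simp: pm_on_def tr_def grp_def)

lemma trivial_on_0: "trivial_on TYPE('k::field) n W a K i (\<lambda>_. 0)"
  unfolding trivial_on_def
proof
  interpret koszul "qops n W a :: _ \<Rightarrow> (_ \<Rightarrow>\<^sub>0 'k) \<Rightarrow> _" "grp n" by (rule koszul_qops)
  fix c :: "_ \<Rightarrow> _ \<Rightarrow>\<^sub>0 'k" assume c: "c \<in> cyc (qops n W a) (grp n) K i"
  then have "c \<sigma> \<in> pm_on (grp n)" for \<sigma> by (auto simp: cyc_def kchains_def)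
  then have "(\<lambda>\<sigma>. push (tr n (\<lambda>_. 0)) (c \<sigma>) - c \<sigma>) = 0" by (auto simp: fun_eq_iff push_tr_0)
  then show "(\<lambda>\<sigma>. push (tr n (\<lambda>_. 0)) (c \<sigma>) - c \<sigma>) \<in> bds (qops n W a) (grp n) K i"
    using lin_closedD(1)[OF lin_closed_bds] by metis
qed

lemma trivial_on_minus:
  assumes "trivial_on TYPE('k::field) n W a K i g"
  shows "trivial_on TYPE('k) n W a K i (\<lambda>j. - g j)"
  unfolding trivial_on_def
proof
  interpret koszul "qops n W a :: _ \<Rightarrow> (_ \<Rightarrow>\<^sub>0 'k) \<Rightarrow> _" "grp n" by (rule koszul_qops)
  fix c :: "_ \<Rightarrow> _ \<Rightarrow>\<^sub>0 'k" assume c: "c \<in> cyc (qops n W a) (grp n) K i"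
  then have cN: "c \<sigma> \<in> pm_on (grp n)" for \<sigma> by (auto simp: cyc_def kchains_def)
  have z: "0 \<in> bds (qops n W a :: _ \<Rightarrow> (_ \<Rightarrow>\<^sub>0 'k) \<Rightarrow> _) (grp n) K i" by (rule lin_closedD(1)[OF lin_closed_bds])
  have "0 - (\<lambda>\<sigma>. push (tr n (\<lambda>j. - g j)) (push (tr n g) (c \<sigma>) - c \<sigma>)) \<in> bds (qops n W a) (grp n) K i"
    using assms c unfolding trivial_on_def
    by (intro lin_closed_diff[OF vector_space_fsc lin_closed_bds z] bds_push) auto
  also have "0 - (\<lambda>\<sigma>. push (tr n (\<lambda>j. - g j)) (push (tr n g) (c \<sigma>) - c \<sigma>)) = (\<lambda>\<sigma>. push (tr n (\<lambda>j. - g j)) (c \<sigma>) - c \<sigma>)"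
    using cN by (auto simp: fun_eq_iff push_simps push_push tr_tr push_tr_0)
  finally show "(\<lambda>\<sigma>. push (tr n (\<lambda>j. - g j)) (c \<sigma>) - c \<sigma>) \<in> bds (qops n W a) (grp n) K i" .
qed

lemma trivial_on_scale:
  assumes g: "trivial_on TYPE('k::field) n W a K i g"
  shows "trivial_on TYPE('k) n W a K i (\<lambda>j. m * g j)"
proof -
  have nat: "trivial_on TYPE('k) n W a K i (\<lambda>j. int k * g j)" for k
  proof (induction k)
    case 0 then show ?case using trivial_on_0 by simp
  next
    case (Suc k) from trivial_on_add[OF g Suc] show ?case by (simp add: algebra_simps)
  qed
  show ?thesis
  proof (cases "m \<ge> 0")
    case True then show ?thesis using nat[of "nat m"] by simp
  next
    case False then show ?thesis using trivial_on_minus[OF nat[of "nat (- m)"]] by simp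
  qed
qed

lemma trivial_on_span:
  assumes "finite A" "\<And>v. v \<in> A \<Longrightarrow> trivial_on TYPE('k::field) n W a K i (b v)"
  shows "trivial_on TYPE('k) n W a K i (\<lambda>j. \<Sum>v\<in>A. m v * b v j)"
  using assms
proof (induction A rule: finite_induct)
  case empty then show ?case using trivial_on_0 by simp
next
  case (insert w A)
  have "trivial_on TYPE('k) n W a K i (\<lambda>j. m w * b w j + (\<Sum>v\<in>A. m v * b v j))"
    using insert by (intro trivial_on_add trivial_on_scale) auto
  then show ?case using insert.hyps by simp
qed

text \<open>By \<open>hc_homotopy\<close> the chain \<open>hc v c\<close> bounds the difference of
  the translate of c and c.\<close>

lemma trivial_on_cone_vertex:
  assumes v: "v \<notin> W" and cone: "\<And>\<sigma>. \<sigma> \<in> K \<Longrightarrow> insert v \<sigma> \<in> K"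
  shows "trivial_on TYPE('k::field) n W a K i (a v)"
  unfolding trivial_on_def
proof
  let ?x = "qops n W a :: _ \<Rightarrow> (_ \<Rightarrow>\<^sub>0 'k) \<Rightarrow> _"
  interpret koszul ?x "grp n" by (rule koszul_qops)
  fix c :: "_ \<Rightarrow> _ \<Rightarrow>\<^sub>0 'k" assume c: "c \<in> cyc ?x (grp n) K i"
  have "cbd ?x (hc v c) \<tau> = push (tr n (a v)) (c \<tau>) - c \<tau>" for \<tau>
  proof -
    have "hc v (cbd ?x c) = (\<lambda>_. 0)" using c by (auto simp: cyc_def hc_def)
    then show ?thesis using hc_homotopy[OF add, of v c \<tau>] v by (simp add: qops_def[of n W a v])
  qed
  then have "(\<lambda>\<sigma>. push (tr n (a v)) (c \<sigma>) - c \<sigma>) = cbd ?x (hc v c)" by auto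
  moreover have "hc v c \<in> kchains K (Suc i) (pm_on (grp n))"
    by (rule hc_kchains[OF add_closed_pm_on]) (use c cone in \<open>auto simp: cyc_def\<close>)
  ultimately show "(\<lambda>\<sigma>. push (tr n (a v)) (c \<sigma>) - c \<sigma>) \<in> bds ?x (grp n) K i" by (auto simp: bds_def)
qed

abbreviation lattice_mod :: "nat \<Rightarrow> nat \<Rightarrow> int"
  where "lattice_mod r \<equiv> (\<lambda>j. if j < r then 0 else 1)"

text \<open>Translations by the a_v with v in A act trivially on homology, hence so do the integral
  combinations M e_j. Coordinates can then be freed one at a time with
  \<open>hfin_of_quotient\<close>.\<close>

lemma hfin_cone_spanning:
  assumes K: "down_closed K" and cone: "\<And>v \<sigma>. v \<in> A \<Longrightarrow> \<sigma> \<in> K \<Longrightarrow> insert v \<sigma> \<in> K" and A: "A \<inter> W = {}"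
    and M: "M > 0" and span: "\<And>j. j < r \<Longrightarrow> (\<lambda>i. if i = j then M else 0) = (\<lambda>i. \<Sum>v\<in>A. m j v * a v i)"
  shows "hfin (qops (lattice_mod r) (W :: 'v::finite set) a :: _ \<Rightarrow> (_ \<Rightarrow>\<^sub>0 'k::field) \<Rightarrow> _) (grp (lattice_mod r)) K i"
proof -
  \<comment> \<open>The first s coordinates are free and the remaining ones are taken modulo M; for
    s = 0 the group is finite.\<close>
  define nn where "nn = (\<lambda>s i. if i < s then 0 else if i < r then M else (1::int))"
  have "hfin (qops (nn s) W a :: _ \<Rightarrow> (_ \<Rightarrow>\<^sub>0 'k) \<Rightarrow> _) (grp (nn s)) K i" if "s \<le> r" for s
    using that
  proof (induction s)
    case 0
    have "finite (grp (nn 0))" by (rule finite_grp[of r _ M]) (use M in \<open>auto simp: nn_def\<close>)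
    then show ?case by (rule koszul.hfin_finite[OF koszul_qops])
  next
    case (Suc s)
    interpret quotient_step "nn (Suc s)" s M W a "TYPE('k)"
      by unfold_locales (use M in \<open>auto simp: nn_def\<close>)
    have eq: "(nn (Suc s))(s := M) = nn s" using Suc.prems by (auto simp: fun_eq_iff nn_def)
    have "trivial_on TYPE('k) (nn (Suc s)) W a K i (\<lambda>i. if i = s then M else 0)"
      unfolding span[OF Suc_le_lessD[OF Suc.prems]]
      by (rule trivial_on_span) (use A cone in \<open>auto intro: trivial_on_cone_vertex\<close>)
    then show ?case
      using Suc by (intro hfin_of_quotient K) (auto simp: eq trivial_on_def sh_def)
  qed
  from this[OF order_refl] have "hfin (qops (nn r) W a :: _ \<Rightarrow> (_ \<Rightarrow>\<^sub>0 'k) \<Rightarrow> _) (grp (nn r)) K i" .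
  moreover have "nn r = lattice_mod r" by (auto simp: nn_def fun_eq_iff)
  ultimately show ?thesis by simp
qed

text \<open>Spanning of Q^r, in dual form: only the zero functional vanishes on all vectors of the
  family.\<close>

definition rat_spans :: "nat \<Rightarrow> ('v \<Rightarrow> nat \<Rightarrow> int) \<Rightarrow> 'v set \<Rightarrow> bool"
  where "rat_spans r a A \<longleftrightarrow> (\<forall>\<phi> :: nat \<Rightarrow> rat. (\<forall>v\<in>A. (\<Sum>j<r. \<phi> j * of_int (a v j)) = 0) \<longrightarrow> (\<forall>j<r. \<phi> j = 0))"

lemma common_denominator:
  assumes "finite A"
  shows "\<exists>M>0. \<forall>v\<in>A. \<exists>k::int. c v * of_int M = (of_int k :: rat)"
  using assms
proof (induction A rule: finite_induct)
  case empty then show ?case by (intro exI[of _ 1]) auto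
next
  case (insert w A)
  then obtain M where M: "M > 0" "\<And>v. v \<in> A \<Longrightarrow> \<exists>k::int. c v * of_int M = of_int k" by blast
  obtain p q where pq: "quotient_of (c w) = (p, q)" by fastforce
  have q: "q > 0" "c w = of_int p / of_int q" using quotient_of_denom_pos[OF pq] quotient_of_div[OF pq] by auto
  show ?case
  proof (rule exI[of _ "M * q"], intro conjI ballI)
    show "0 < M * q" using M q by simp
    fix v assume v: "v \<in> insert w A"
    show "\<exists>k::int. c v * of_int (M * q) = of_int k"
    proof (cases "v = w")
      case True
      have "c v * of_int (M * q) = of_int (p * M)" using q True by (simp add: field_simps)
      then show ?thesis by blast
    next
      case False
      then obtain k where "c v * of_int M = of_int k" using v M by blast
      then have "c v * of_int (M * q) = of_int (k * q)" by (simp add: mult.assoc[symmetric])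
      then show ?thesis by blast
    qed
  qed
qed

lemma span_image_sum:
  assumes "x \<in> pm.span (f ` A)" "finite A"
  shows "\<exists>c. x = (\<Sum>v\<in>A. pm_scale (c v) (f v))"
  using assms(1)
proof (induction rule: pm.span_induct_alt)
  case base
  show ?case by (intro exI[of _ "\<lambda>_. 0"]) simp
next
  case (step r y z)
  then obtain v c where v: "v \<in> A" "y = f v" and c: "z = (\<Sum>v\<in>A. pm_scale (c v) (f v))" by blast
  have "(\<Sum>w\<in>A. pm_scale (if w = v then r else 0) (f w)) = pm_scale r (f v)"
    using v(1) assms(2) by (subst sum.remove[of _ v]) (auto intro!: sum.neutral)
  then have "pm_scale r y + z = (\<Sum>w\<in>A. pm_scale ((if w = v then r else 0) + c w) (f w))"
    unfolding v(2) c by (simp add: pm.scale_left_distrib sum.distrib)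
  then show ?case by (rule exI[of _ "\<lambda>w. (if w = v then r else 0) + c w"])
qed

text \<open>If a unit vector were not a rational combination, a functional would separate it from
  the span. A common denominator M of all coefficients makes the combinations integral.\<close>

lemma rat_spans_integral:
  assumes sp: "rat_spans r a A" and fin: "finite A" and a: "\<And>v j. j \<ge> r \<Longrightarrow> a v j = 0"
  obtains M m where "M > 0" "\<And>j. j < r \<Longrightarrow> (\<lambda>i. if i = j then M else 0) = (\<lambda>i. \<Sum>v\<in>A. m j v * a v i)"
proof -
  define f where "f = (\<lambda>v. \<Sum>j<r. single j (of_int (a v j) :: rat))"
  have lf: "lookup (f v) j = of_int (a v j)" for v j
    using a by (auto simp: f_def lookup_sum lookup_single when_def)
  have pair: "(\<Sum>j\<in>keys (f v). lookup (f v) j * g j) = (\<Sum>j<r. g j * of_int (a v j))" for v and g :: "nat \<Rightarrow> rat"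
  proof (rule sum.mono_neutral_cong_left)
    show "keys (f v) \<subseteq> {..<r}"
    proof
      fix j assume "j \<in> keys (f v)"
      then have "a v j \<noteq> 0" by (simp add: in_keys_iff lf)
      then show "j \<in> {..<r}" using a[of j v] by (cases "j < r") auto
    qed
  qed (auto simp: lf in_keys_iff)
  have "single j 1 \<in> pm.span (f ` A)" if j: "j < r" for j
  proof (rule ccontr)
    assume "single j 1 \<notin> pm.span (f ` A)"
    from functional_exists[OF this] obtain g where g: "\<And>s. s \<in> f ` A \<Longrightarrow> (\<Sum>x\<in>keys s. lookup s x * g x) = 0"
        "(\<Sum>x\<in>keys (single j (1::rat)). lookup (single j 1) x * g x) \<noteq> 0"
      by blast
    have "\<forall>v\<in>A. (\<Sum>j<r. g j * of_int (a v j)) = 0" using g(1) by (simp add: pair[symmetric])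
    then have "g j = 0" using sp j by (auto simp: rat_spans_def)
    then show False using g(2) by simp
  qed
  then have "\<exists>c. single j 1 = (\<Sum>v\<in>A. pm_scale (c v) (f v))" if "j < r" for j
    using span_image_sum[OF _ fin] that by blast
  then obtain c where c: "\<And>j. j < r \<Longrightarrow> single j 1 = (\<Sum>v\<in>A. pm_scale (c j v) (f v))" by metis
  obtain M where M: "M > 0" "\<And>p. p \<in> {..<r} \<times> A \<Longrightarrow> \<exists>k::int. c (fst p) (snd p) * of_int M = of_int k"
    using common_denominator[of "{..<r} \<times> A" "\<lambda>p. c (fst p) (snd p)"] fin by auto
  have "\<exists>k::int. c j v * of_int M = of_int k" if "j < r" "v \<in> A" for j v
    using M(2)[of "(j, v)"] that by simp
  then obtain m where m: "\<And>j v. j < r \<Longrightarrow> v \<in> A \<Longrightarrow> c j v * of_int M = of_int (m j v)" by metis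
  have "(\<lambda>i. if i = j then M else 0) = (\<lambda>i. \<Sum>v\<in>A. m j v * a v i)" if j: "j < r" for j
  proof
    fix i
    have "(if j = i then 1 else 0) = (\<Sum>v\<in>A. c j v * of_int (a v i))"
      using arg_cong[OF c[OF j], of "\<lambda>s. lookup s i"]
      by (simp add: lookup_sum lookup_pm_scale lf lookup_single when_def)
    then have "of_int M * (if j = i then 1 else 0) = (\<Sum>v\<in>A. of_int M * (c j v * of_int (a v i)))"
      by (simp only: sum_distrib_left)
    also have "\<dots> = (\<Sum>v\<in>A. (of_int (m j v * a v i) :: rat))"
    proof (rule sum.cong)
      fix v assume "v \<in> A"
      then show "of_int M * (c j v * of_int (a v i)) = (of_int (m j v * a v i) :: rat)"
        using m[OF j, of v] by (simp add: mult.commute mult.left_commute mult.assoc[symmetric])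
    qed simp
    also have "\<dots> = of_int (\<Sum>v\<in>A. m j v * a v i)" by simp
    finally have "(of_int (M * (if j = i then 1 else 0)) :: rat) = of_int (\<Sum>v\<in>A. m j v * a v i)" by auto
    then have "M * (if j = i then 1 else 0) = (\<Sum>v\<in>A. m j v * a v i)" by (simp only: of_int_eq_iff)
    then show "(if i = j then M else 0) = (\<Sum>v\<in>A. m j v * a v i)" by auto
  qed
  then show ?thesis using that M(1) by blast
qed

text \<open>On faces inside W the operators x_v that matter are identities, so the unit complex
  decides exactness there. The vertices outside W are then added one by one as apexes by
  \<open>exact_cone\<close>.\<close>

lemma kexact_join_simplex:
  fixes L :: "'v::finite set set"
  assumes L: "down_closed L" and ex: "\<And>j. j \<le> q \<Longrightarrow> kexact (unit_ops W) (UNIV :: 'k::field set) {\<sigma>\<in>L. \<sigma> \<subseteq> W} j" and i: "i \<le> q"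
  shows "kexact (qops n W a :: _ \<Rightarrow> (_ \<Rightarrow>\<^sub>0 'k) \<Rightarrow> _) (pm_on (grp n)) {\<sigma>. \<sigma> - (- W) \<in> L} i"
proof -
  let ?x = "qops n W a :: _ \<Rightarrow> (_ \<Rightarrow>\<^sub>0 'k) \<Rightarrow> _" and ?L = "{\<sigma>\<in>L. \<sigma> \<subseteq> W}"
  interpret koszul ?x "grp n" by (rule koszul_qops)
  have dL: "down_closed ?L" using L by (auto simp: down_closed_def)
  have base: "kexact ?x (pm_on (grp n)) ?L j" if j: "j \<le> q" for j
  proof -
    have same: "cbd ?x c = cbd (unit_ops W) c" if c: "c \<in> kchains ?L l (pm_on (grp n))" for c l
    proof (rule ext, rule cbd_cong_ops)
      fix \<tau> v
      show "?x v (c (insert v \<tau>)) = unit_ops W v (c (insert v \<tau>))"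
      proof (cases "v \<in> W")
        case True then show ?thesis by (simp add: qops_def unit_ops_def)
      next
        case False
        then have "c (insert v \<tau>) = 0" using c by (auto simp: kchains_def)
        then show ?thesis by (simp add: additive_ops_0[OF add] unit_ops_def)
      qed
    qed
    show ?thesis
      unfolding kexact_def
    proof (intro ballI impI)
      fix c :: "'v set \<Rightarrow> (nat \<Rightarrow> int) \<Rightarrow>\<^sub>0 'k"
      assume c: "c \<in> kchains ?L j (pm_on (grp n))" "cbd ?x c = (\<lambda>_. 0)"
      then obtain b where "b \<in> kchains ?L (Suc j) (pm_on (grp n))" "cbd (unit_ops W) b = c"
        using kexact_coefficients[OF ex[OF j], of "grp n"] same[OF c(1)] by (auto simp: kexact_def)
      then show "\<exists>b\<in>kchains ?L (Suc j) (pm_on (grp n)). cbd ?x b = c" using same by (intro bexI[of _ b]) simp_all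
    qed
  qed
  have "kexact ?x (pm_on (grp n)) {\<sigma>. \<sigma> - B \<in> ?L} j" if "B \<subseteq> - W" "j \<le> q" for B j
    using finite[of B] that
  proof (induction B arbitrary: j rule: finite_induct)
    case empty then show ?case using base by simp
  next
    case (insert b B)
    show ?case
    proof (rule exact_cone[where v = b and q = q, OF add closed comm add_closed_pm_on])
      show "down_closed {\<sigma>. \<sigma> - insert b B \<in> ?L}"
        unfolding down_closed_def
      proof safe
        fix \<sigma> \<tau> u assume *: "\<tau> \<subseteq> \<sigma>" "\<sigma> - insert b B \<in> L"
        show "\<tau> - insert b B \<in> L" by (rule down_closedD[OF L *(2)]) (use *(1) in auto)
      qed auto
      have "del {\<sigma>. \<sigma> - insert b B \<in> ?L} b = {\<sigma>. \<sigma> - B \<in> ?L}"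
      proof -
        have "\<sigma> - insert b B = \<sigma> - B" if "b \<notin> \<sigma>" for \<sigma> using that by auto
        moreover have "b \<notin> \<sigma>" if "\<sigma> - B \<subseteq> W" for \<sigma> using that insert.hyps insert.prems by auto
        ultimately show ?thesis by (auto simp: del_def)
      qed
      then show "kexact ?x (pm_on (grp n)) (del {\<sigma>. \<sigma> - insert b B \<in> ?L} b) l" if "l \<le> q" for l
        using insert.IH[of l] insert.prems(1) that by simp
    qed (use insert.prems in auto)
  qed
  from this[of "- W" i] have "kexact ?x (pm_on (grp n)) {\<sigma>. \<sigma> - (- W) \<in> ?L} i" using i by simp
  moreover have "{\<sigma>. \<sigma> - (- W) \<in> ?L} = {\<sigma>. \<sigma> - (- W) \<in> L}" by auto
  ultimately show ?thesis by simp
qed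

text \<open>Induction on the number of unresolved vertices, those neither in W (where x_v = 1) nor
  in A (cone vertices). For W and A empty this is the complex of the cover.\<close>

theorem hfin_of_spanning:
  fixes L :: "'v::finite set set"
  assumes L: "down_closed L" and a: "\<And>v j. j \<ge> r \<Longrightarrow> a v j = 0"
    and sp: "\<And>W i. i \<le> q \<Longrightarrow> \<not> kexact (unit_ops W) (UNIV :: 'k::field set) L i \<Longrightarrow> rat_spans r a (- W)"
    and i: "i \<le> q"
  shows "hfin (qops (lattice_mod r) {} a :: _ \<Rightarrow> (_ \<Rightarrow>\<^sub>0 'k) \<Rightarrow> _) (grp (lattice_mod r)) L i"
proof -
  let ?n = "lattice_mod r"
  have "hfin (qops ?n W a :: _ \<Rightarrow> (_ \<Rightarrow>\<^sub>0 'k) \<Rightarrow> _) (grp ?n) {\<sigma>. \<sigma> - A \<in> L} i" if "W \<inter> A = {}" for W A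
    using that
  proof (induction "card (- (W \<union> A))" arbitrary: W A rule: less_induct)
    case less
    have dK: "down_closed {\<sigma>. \<sigma> - A \<in> L}"
      unfolding down_closed_def
    proof safe
      fix \<sigma> \<tau> assume *: "\<sigma> - A \<in> L" "\<tau> \<subseteq> \<sigma>"
      show "\<tau> - A \<in> L" by (rule down_closedD[OF L *(1)]) (use *(2) in auto)
    qed
    show ?case
    proof (cases "W \<union> A = UNIV")
      case False
      then obtain v where v: "v \<notin> W" "v \<notin> A" by auto
      interpret koszul "qops ?n W a :: _ \<Rightarrow> (_ \<Rightarrow>\<^sub>0 'k) \<Rightarrow> _" "grp ?n" by (rule koszul_qops)
      have "card (- (insert v W \<union> A)) < card (- (W \<union> A))" "card (- (W \<union> insert v A)) < card (- (W \<union> A))"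
        using v by (auto intro!: psubset_card_mono)
      moreover have "insert v W \<inter> A = {}" "W \<inter> insert v A = {}" using less.prems v by auto
      ultimately have *: "hfin (qops ?n (insert v W) a :: _ \<Rightarrow> (_ \<Rightarrow>\<^sub>0 'k) \<Rightarrow> _) (grp ?n) {\<sigma>. \<sigma> - A \<in> L} i"
        "hfin (qops ?n W a :: _ \<Rightarrow> (_ \<Rightarrow>\<^sub>0 'k) \<Rightarrow> _) (grp ?n) {\<sigma>. \<sigma> - insert v A \<in> L} i"
        using less.hyps by blast+
      have "cplus {\<sigma>. \<sigma> - A \<in> L} v = {\<sigma>. \<sigma> - insert v A \<in> L}"
      proof -
        have "\<sigma> - {v} - A = \<sigma> - insert v A" for \<sigma> by blast
        then show ?thesis by (simp add: cplus_def)
      qed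
      then show ?thesis using hfin_cone_step[OF dK, of v i] * unfolding qops_insert by simp
    next
      case True
      then have A: "A = - W" using less.prems by auto
      show ?thesis
      proof (cases "\<forall>j\<le>q. kexact (unit_ops W) (UNIV :: 'k set) {\<sigma>\<in>L. \<sigma> \<subseteq> W} j")
        case True
        then have "kexact (qops ?n W a :: _ \<Rightarrow> (_ \<Rightarrow>\<^sub>0 'k) \<Rightarrow> _) (pm_on (grp ?n)) {\<sigma>. \<sigma> - A \<in> L} i"
          unfolding A using kexact_join_simplex[OF L _ i, of W] by blast
        then show ?thesis by (rule koszul.hfin_kexact[OF koszul_qops])
      next
        case False
        then obtain j where "j \<le> q" "\<not> kexact (unit_ops W) (UNIV :: 'k set) {\<sigma>\<in>L. \<sigma> \<subseteq> W} j" by blast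
        then have "\<not> kexact (unit_ops W) (UNIV :: 'k set) L j" using kexact_induced[of W "UNIV :: 'k set" L j] by auto
        then have "rat_spans r a A" unfolding A using sp \<open>j \<le> q\<close> by blast
        from rat_spans_integral[OF this finite a] obtain M m
          where Mm: "M > 0" "\<And>j. j < r \<Longrightarrow> (\<lambda>i. if i = j then M else 0) = (\<lambda>i. \<Sum>v\<in>A. m j v * a v i)"
          by blast
        show ?thesis
        proof (rule hfin_cone_spanning[OF dK _ _ Mm])
          fix v \<sigma> assume "v \<in> A" "\<sigma> \<in> {\<sigma>. \<sigma> - A \<in> L}"
          then show "insert v \<sigma> \<in> {\<sigma>. \<sigma> - A \<in> L}" by (simp add: insert_Diff_if)
        qed (use less.prems in auto)
      qed
    qed
  qed
  from this[of "{}" "{}"] show ?thesis by simp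
qed


section \<open>Comparison with the unit complex by products of operators\<close>

subsection \<open>Products of the operators\<close>

context koszul
begin

definition xp :: "'v set \<Rightarrow> ('x \<Rightarrow>\<^sub>0 'k) \<Rightarrow> 'x \<Rightarrow>\<^sub>0 'k"
  where "xp S m = Finite_Set.fold x m S"

sublocale cf: comp_fun_commute x
  by unfold_locales (auto simp: fun_eq_iff comm)

lemma xp_insert: "v \<notin> S \<Longrightarrow> xp (insert v S) m = x v (xp S m)"
  unfolding xp_def by (rule cf.fold_insert) auto

lemma xp_empty [simp]: "xp {} m = m"
  by (simp add: xp_def)

lemma xp_commute: "xp S (x v m) = x v (xp S m)"
  using finite[of S] by (induction S rule: finite_induct) (simp_all add: xp_insert comm)

lemma xp_add: "xp S (a + b) = xp S a + xp S b"
  using finite[of S] by (induction S rule: finite_induct) (simp_all add: xp_insert additive_opsD[OF add])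

lemmas xp_additive = additive_sum[of "xp S" for S, OF xp_add]

lemma xp_sg: "xp S (sg n a) = sg n (xp S a)"
  by (simp add: sg_def xp_additive)

lemma xp_scale: "xp S (pm_scale r m) = pm_scale r (xp S m)"
  using finite[of S] by (induction S rule: finite_induct) (simp_all add: xp_insert scale)

lemma xp_in: "m \<in> pm_on X \<Longrightarrow> xp S m \<in> pm_on X"
  using finite[of S] by (induction S rule: finite_induct) (simp_all add: xp_insert closed)

lemma xp_union: "S \<inter> S' = {} \<Longrightarrow> xp S (xp S' m) = xp (S \<union> S') m"
  using finite[of S] by (induction S rule: finite_induct) (simp_all add: xp_insert)

lemma xp_nonzero:
  assumes "\<And>v m. v \<in> S \<Longrightarrow> m \<in> pm_on X \<Longrightarrow> x v m = 0 \<Longrightarrow> m = 0" "m \<in> pm_on X" "xp S m = 0"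
  shows "m = 0"
  using finite[of S] assms
proof (induction S rule: finite_induct)
  case (insert v S)
  then have "x v (xp S m) = 0" by (simp add: xp_insert)
  then have "xp S m = 0" using insert.prems(1)[of v] xp_in insert.prems(2) by blast
  then show ?case using insert by blast
qed simp

context
  fixes W :: "'v set"
  assumes zero: "\<And>v m. v \<notin> W \<Longrightarrow> m \<in> pm_on X \<Longrightarrow> x v m = 0"
begin

text \<open>Multiplying at \<sigma> by the x_v with v in W - \<sigma>, respectively in the
  intersection of W and \<sigma>, gives chain maps from the unit complex to the x complex and back.
  Their composite is multiplication by the product over all of W.\<close>

definition "cofac c \<sigma> = xp (W - \<sigma>) (c \<sigma>)"
definition "fac c \<sigma> = xp (W \<inter> \<sigma>) (c \<sigma>)"

lemma cbd_cofac:
  assumes c: "\<And>\<sigma>. c \<sigma> \<in> pm_on X"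
  shows "cbd x (cofac c) = cofac (cbd (unit_ops W) c)"
proof
  fix \<tau>
  show "cbd x (cofac c) \<tau> = cofac (cbd (unit_ops W) c) \<tau>"
    unfolding cbd_def cofac_def xp_additive(1) xp_sg
  proof (intro sum.cong refl arg_cong[where f = "sg _"])
    fix v assume v: "v \<in> - \<tau>"
    show "x v (xp (W - insert v \<tau>) (c (insert v \<tau>))) = xp (W - \<tau>) (unit_ops W v (c (insert v \<tau>)))"
    proof (cases "v \<in> W")
      case True
      then have "W - \<tau> = insert v (W - insert v \<tau>)" using v by auto
      then show ?thesis using True by (simp add: unit_ops_def xp_insert)
    next
      case False
      then show ?thesis using zero xp_in c by (simp add: unit_ops_def xp_additive)
    qed
  qed
qed

lemma cbd_fac:
  assumes c: "\<And>\<sigma>. c \<sigma> \<in> pm_on X"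
  shows "cbd (unit_ops W) (fac c) = fac (cbd x c)"
proof
  fix \<tau>
  show "cbd (unit_ops W) (fac c) \<tau> = fac (cbd x c) \<tau>"
    unfolding cbd_def fac_def xp_additive(1) xp_sg
  proof (intro sum.cong refl arg_cong[where f = "sg _"])
    fix v assume v: "v \<in> - \<tau>"
    show "unit_ops W v (xp (W \<inter> insert v \<tau>) (c (insert v \<tau>))) = xp (W \<inter> \<tau>) (x v (c (insert v \<tau>)))"
    proof (cases "v \<in> W")
      case True
      then have "W \<inter> insert v \<tau> = insert v (W \<inter> \<tau>)" by auto
      then show ?thesis using True v by (simp add: unit_ops_def xp_insert xp_commute)
    next
      case False
      then show ?thesis using zero c by (simp add: unit_ops_def xp_additive)
    qed
  qed
qed

lemma fac_cofac: "fac (cofac c) \<sigma> = xp W (c \<sigma>)"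
proof -
  have "W \<inter> \<sigma> \<union> (W - \<sigma>) = W" by auto
  then show ?thesis unfolding fac_def cofac_def by (subst xp_union) auto
qed

text \<open>A scalar cycle c0 yields an x cycle \<open>cofac (z f)\<close> for each element f of the
  group ring. Since homology is finite-dimensional and X infinite, this is a boundary for some f
  other than 0. Applying \<open>fac\<close> shows that (\<open>xp W f\<close>) c0 is a boundary of
  the unit complex, and \<open>xp W f\<close> is nonzero.\<close>

lemma kexact_of_hfin:
  assumes inj: "\<And>v m. v \<in> W \<Longrightarrow> m \<in> pm_on X \<Longrightarrow> x v m = 0 \<Longrightarrow> m = 0"
    and X: "\<And>i::nat. g i \<in> X" "inj g" and fin: "hfin x X K i"
  shows "kexact (unit_ops W) (UNIV :: 'k set) K i"
  unfolding kexact_def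
proof (intro ballI impI)
  fix c0 :: "'v set \<Rightarrow> 'k" assume c0: "c0 \<in> kchains K i UNIV" and cy: "cbd (unit_ops W) c0 = (\<lambda>_. 0)"
  have zero_cofac: "cofac (\<lambda>_. 0) = (\<lambda>_. 0)" by (auto simp: cofac_def xp_additive)
  define z :: "('x \<Rightarrow>\<^sub>0 'k) \<Rightarrow> 'v set \<Rightarrow> 'x \<Rightarrow>\<^sub>0 'k" where "z = (\<lambda>f \<sigma>. pm_scale (c0 \<sigma>) f)"
  have zN: "z f \<sigma> \<in> pm_on X" if "f \<in> pm_on X" for f \<sigma> using that by (auto simp: z_def intro: pm_on_scale)
  have lookup_z: "lookup (z f \<sigma>) h = lookup f h * c0 \<sigma>" for f \<sigma> h by (simp add: z_def lookup_pm_scale)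
  have z_cyc: "cofac (z f) \<in> cyc x X K i" if f: "f \<in> pm_on X" for f
  proof -
    have "cbd (unit_ops W) (z f) = (\<lambda>_. 0)"
    proof (rule ext, rule poly_mapping_eqI)
      fix \<tau> h
      have "lookup (cbd (unit_ops W) (z f) \<tau>) h = cbd (unit_ops W) (\<lambda>\<sigma>. lookup f h * c0 \<sigma>) \<tau>"
        by (simp add: lookup_cbd_unit lookup_z)
      also have "\<dots> = lookup f h * cbd (unit_ops W) c0 \<tau>"
        by (rule cbd_map) (auto simp: algebra_simps unit_ops_def)
      finally show "lookup (cbd (unit_ops W) (z f) \<tau>) h = lookup 0 h" by (simp add: cy)
    qed
    then have "cbd x (cofac (z f)) = (\<lambda>_. 0)" using cbd_cofac[of "z f"] zN[OF f] zero_cofac by simp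
    moreover have "cofac (z f) \<in> kchains K i (pm_on X)"
      unfolding kchains_def
    proof (intro CollectI allI conjI impI)
      fix \<sigma>
      show "cofac (z f) \<sigma> \<in> pm_on X" unfolding cofac_def by (rule xp_in[OF zN[OF f]])
      assume "cofac (z f) \<sigma> \<noteq> 0"
      then have "c0 \<sigma> \<noteq> 0" by (auto simp: cofac_def z_def xp_additive)
      then show "\<sigma> \<in> K" "card \<sigma> = i" using c0 by (auto simp: kchains_def)
    qed
    ultimately show ?thesis by (simp add: cyc_def)
  qed
  have g1: "single (g j) 1 \<in> pm_on X" for j using X(1) by (simp add: pm_on_def)
  obtain n :: nat and a where a: "\<exists>j<n. a j \<noteq> 0" "(\<Sum>j<n. fsc (a j) (cofac (z (single (g j) 1)))) \<in> bds x X K i"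
    using fin_quot_dependent[OF vector_space_fsc lin_closed_bds fin[unfolded hfin_def], of "\<lambda>j. cofac (z (single (g j) 1))"] z_cyc[OF g1]
    by blast
  define f where "f = (\<Sum>j<n. single (g j) (a j))"
  have fN: "f \<in> pm_on X" unfolding f_def
    using X(1) by (intro sum_closed[of "pm_on X"] pm_on_closed) (auto simp: pm_on_def)
  have "(\<Sum>j<n. fsc (a j) (cofac (z (single (g j) 1)))) = cofac (z f)"
  proof
    fix \<sigma>
    have "(\<Sum>j\<in>J. fsc (a j) (cofac (z (single (g j) 1)))) \<sigma> = cofac (z (\<Sum>j\<in>J. single (g j) (a j))) \<sigma>" for J
      by (induction J rule: infinite_finite_induct)
        (simp_all add: cofac_def z_def fsc_def xp_additive xp_add pm.scale_right_distrib xp_scale[symmetric] mult.commute)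
    then show "(\<Sum>j<n. fsc (a j) (cofac (z (single (g j) 1)))) \<sigma> = cofac (z f) \<sigma>" by (simp add: f_def)
  qed
  with a(2) obtain b where b: "b \<in> kchains K (Suc i) (pm_on X)" "cbd x b = cofac (z f)" by (auto simp: bds_def)
  have bN: "b \<sigma> \<in> pm_on X" for \<sigma> using b(1) by (simp add: kchains_def)
  have e: "cbd (unit_ops W) (fac b) \<sigma> = pm_scale (c0 \<sigma>) (xp W f)" for \<sigma>
    unfolding cbd_fac[OF bN] b(2) by (simp add: fac_cofac z_def xp_scale)
  obtain j where j: "j < n" "a j \<noteq> 0" using a(1) by blast
  have "lookup f (g j) = (\<Sum>l<n. if l = j then a j else 0)"
    unfolding f_def lookup_sum using X(2) by (intro sum.cong) (auto simp: lookup_single when_def inj_def)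
  then have "f \<noteq> 0" using j by auto
  then have "xp W f \<noteq> 0" using xp_nonzero[of W f] inj fN by blast
  \<comment> \<open>A basis element with nonzero coefficient in \<open>xp W f\<close>; comparing
    coefficients there and dividing turns the relation into one for c0.\<close>
  then obtain h where h: "lookup (xp W f) h \<noteq> 0" by (metis lookup_zero poly_mapping_eqI)
  define b0 where "b0 = (\<lambda>\<sigma>. inverse (lookup (xp W f) h) * lookup (fac b \<sigma>) h)"
  have "cbd (unit_ops W) b0 \<sigma> = c0 \<sigma>" for \<sigma>
  proof -
    have "cbd (unit_ops W) b0 \<sigma> = inverse (lookup (xp W f) h) * cbd (unit_ops W) (\<lambda>\<sigma>. lookup (fac b \<sigma>) h) \<sigma>"
      unfolding b0_def by (rule cbd_map) (auto simp: algebra_simps unit_ops_def)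
    also have "cbd (unit_ops W) (\<lambda>\<sigma>. lookup (fac b \<sigma>) h) \<sigma> = c0 \<sigma> * lookup (xp W f) h"
      unfolding lookup_cbd_unit[symmetric] e by (simp add: lookup_pm_scale)
    finally show ?thesis using h by simp
  qed
  then have "cbd (unit_ops W) b0 = c0" by (rule ext)
  moreover have "b0 \<in> kchains K (Suc i) UNIV"
    unfolding kchains_def
  proof (intro CollectI allI conjI impI)
    fix \<sigma> assume "b0 \<sigma> \<noteq> 0"
    then have "b \<sigma> \<noteq> 0" by (auto simp: b0_def fac_def xp_additive)
    then show "\<sigma> \<in> K" "card \<sigma> = Suc i" using b(1) by (auto simp: kchains_def)
  qed simp
  ultimately show "\<exists>b\<in>kchains K (Suc i) UNIV. cbd (unit_ops W) b = c0" by blast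
qed

end

end

section \<open>Passing to the infinite cyclic quotient given by a functional\<close>

subsection \<open>Finite index sublattices\<close>

text \<open>A group ring is a finite direct sum of translates of the group ring of a finite index subgroup,
  so that one coordinate may be replaced by any functional not vanishing on it.\<close>

lemma hfin_sublattice:
  fixes W :: "'v::finite set" and \<phi> :: "nat \<Rightarrow> int"
  assumes j0: "j0 < r" "\<phi> j0 \<noteq> 0" and K: "down_closed K"
    and a': "\<And>v. a' v = (a v)(j0 := \<Sum>j<r. \<phi> j * a v j)"
    and fin: "hfin (qops (lattice_mod r) W a :: _ \<Rightarrow> (_ \<Rightarrow>\<^sub>0 'k::field) \<Rightarrow> _) (grp (lattice_mod r)) K i"
  shows "hfin (qops (lattice_mod r) W a' :: _ \<Rightarrow> (_ \<Rightarrow>\<^sub>0 'k) \<Rightarrow> _) (grp (lattice_mod r)) K i"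
proof -
  let ?n = "lattice_mod r"
  let ?x = "qops ?n W a :: _ \<Rightarrow> (_ \<Rightarrow>\<^sub>0 'k) \<Rightarrow> _" and ?y = "qops ?n W a' :: _ \<Rightarrow> (_ \<Rightarrow>\<^sub>0 'k) \<Rightarrow> _"
  interpret kx: koszul ?x "grp ?n" by (rule koszul_qops)
  interpret ky: koszul ?y "grp ?n" by (rule koszul_qops)
  define d where "d = \<phi> j0"
  have d: "d \<noteq> 0" using j0 by (simp add: d_def)
  define R where "R = (\<lambda>g::nat \<Rightarrow> int. \<Sum>j\<in>{..<r} - {j0}. \<phi> j * g j)"
  have full: "(\<Sum>j<r. \<phi> j * g j) = d * g j0 + R g" for g
    using j0 by (simp add: sum.remove[of "{..<r}" j0] d_def R_def)
  \<comment> \<open>With k = 0 this is the change of coordinates that replaces coordinate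
    \<open>j0\<close> by the value of \<phi>; its image has index |d|, and k runs through the
    cosets. \<open>\<kappa>\<close> reads off the coset and \<open>\<eta>\<close> inverts
    \<open>emb\<close> on it.\<close>
  define emb where "emb = (\<lambda>k (h::nat \<Rightarrow> int). h(j0 := d * h j0 + R h + k))"
  define \<kappa> where "\<kappa> = (\<lambda>g. (g j0 - R g) mod d)"
  define \<eta> where "\<eta> = (\<lambda>g::nat \<Rightarrow> int. g(j0 := (g j0 - R g) div d))"
  have R_upd: "R (g(j0 := t)) = R g" for g t unfolding R_def by (intro sum.cong) auto
  have R_tr: "R (tr ?n b g) = R g + R b" for b g
    unfolding R_def sum.distrib[symmetric] by (intro sum.cong) (auto simp: tr_def algebra_simps)
  have R_a: "R (a' v) = R (a v)" for v by (simp add: a' R_upd)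
  have emb_tr: "emb k (tr ?n (a v) h) = tr ?n (a' v) (emb k h)" for k v h
    unfolding emb_def R_tr a' full using j0 by (auto simp: fun_eq_iff tr_def algebra_simps)
  have y_tr: "tr ?n (a' v) g j0 - R (tr ?n (a' v) g) = (g j0 - R g) + a v j0 * d" for v g
    unfolding R_tr R_a using j0 by (simp add: tr_def a' full algebra_simps)
  have \<kappa>_tr: "\<kappa> (tr ?n (a' v) g) = \<kappa> g" for v g unfolding \<kappa>_def y_tr by simp
  have \<eta>_tr: "\<eta> (tr ?n (a' v) g) = tr ?n (a v) (\<eta> g)" for v g
  proof
    fix j
    have "(g j0 - R g + a v j0 * d) div d = (g j0 - R g) div d + a v j0" using d by simp
    then show "\<eta> (tr ?n (a' v) g) j = tr ?n (a v) (\<eta> g) j"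
      unfolding \<eta>_def y_tr using j0 by (cases "j = j0") (auto simp: tr_def a')
  qed
  have emb_eta: "emb (\<kappa> g) (\<eta> g) = g" for g
    unfolding emb_def \<eta>_def R_upd by (auto simp: fun_eq_iff \<kappa>_def)
  have grp: "emb k h \<in> grp ?n" "\<eta> h \<in> grp ?n" if "h \<in> grp ?n" for k h
    using that j0 by (auto simp: emb_def \<eta>_def grp_def)
  \<comment> \<open>The component of a group ring element on the coset k, pulled back along
    \<open>emb k\<close>; it intertwines the two kinds of operators.\<close>
  define pr where "pr = (\<lambda>k. lin (\<lambda>g. if \<kappa> g = k then single (\<eta> g) (1::'k) else 0))"
  have pr_add: "pr k (b + c) = pr k b + pr k c" for k b c by (simp add: pr_def lin_add)
  have pr_0: "pr k 0 = 0" for k by (simp add: pr_def)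
  have pr_ops: "pr k (?y v m) = ?x v (pr k m)" for k v m
  proof -
    have "pr k (push (tr ?n (a' v)) m) = push (tr ?n (a v)) (pr k m)"
      unfolding pr_def push_def lin_lin by (rule lin_cong) (simp add: \<kappa>_tr \<eta>_tr)
    then show ?thesis by (simp add: qops_def pr_def lin_diff)
  qed
  have pr_in: "pr k m \<in> pm_on (grp ?n)" if "m \<in> pm_on (grp ?n)" for k m
    unfolding pr_def using that grp(2) by (intro pm_on_lin) (auto simp: pm_on_def)
  \<comment> \<open>The interval contains all residues modulo d for either sign of d; values that
    are not residues contribute 0.\<close>
  define Y where "Y = {- \<bar>d\<bar>..\<bar>d\<bar>}"
  have \<kappa>_Y: "\<kappa> g \<in> Y" for g
    using abs_mod_less[OF d, of "g j0 - R g"] unfolding \<kappa>_def Y_def by auto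
  have recon: "(\<Sum>k\<in>Y. push (emb k) (pr k m)) = m" for m
  proof -
    have "(\<Sum>k\<in>Y. push (emb k) (pr k m)) = lin (\<lambda>g. \<Sum>k\<in>Y. if \<kappa> g = k then single (emb k (\<eta> g)) 1 else 0) m"
      unfolding lin_fun_sum pr_def push_def lin_lin by (intro sum.cong refl lin_cong) simp
    also have "\<dots> = lin (\<lambda>g. single g 1) m"
      by (rule lin_cong) (use \<kappa>_Y emb_eta in \<open>simp add: Y_def\<close>)
    finally show ?thesis by simp
  qed
  have fin': "fin_quot fsc (cyc ?x (grp ?n) K i) (bds ?x (grp ?n) K i)" using fin by (simp add: hfin_def)
  then obtain N :: nat and f where f: "\<And>u. u \<in> cyc ?x (grp ?n) K i \<Longrightarrow> \<exists>b. u - (\<Sum>l<N. fsc (b l) (f l)) \<in> bds ?x (grp ?n) K i"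
    unfolding fin_quot_def by blast
  show ?thesis
    unfolding hfin_def
  proof (rule fin_quotI[where I = "Y \<times> {..<N}" and f = "\<lambda>(k, l) \<sigma>. push (emb k) (f l \<sigma>)"])
    show "finite (Y \<times> {..<N})" by (simp add: Y_def)
    fix c assume c: "c \<in> cyc ?y (grp ?n) K i"
    have "(\<lambda>\<sigma>. pr k (c \<sigma>)) \<in> cyc ?x (grp ?n) K i" for k
    proof -
      have "cbd ?x (\<lambda>\<sigma>. pr k (c \<sigma>)) \<tau> = pr k (cbd ?y c \<tau>)" for \<tau>
        by (rule cbd_map[where \<Lambda> = "pr k" and x = ?y and x' = ?x], rule pr_add, rule pr_ops)
      then have "cbd ?x (\<lambda>\<sigma>. pr k (c \<sigma>)) = (\<lambda>_. 0)" using c by (auto simp: cyc_def pr_0)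
      moreover have "(\<lambda>\<sigma>. pr k (c \<sigma>)) \<in> kchains K i (pm_on (grp ?n))"
        using c unfolding cyc_def
        by (intro kchains_map[where \<Lambda> = "pr k" and N = "pm_on (grp ?n)"] pr_0 pr_in) simp_all
      ultimately show ?thesis by (simp add: cyc_def)
    qed
    then have "\<exists>b. (\<lambda>\<sigma>. pr k (c \<sigma>)) - (\<Sum>l<N. fsc (b l) (f l)) \<in> bds ?x (grp ?n) K i" for k by (rule f)
    then have "\<forall>k. \<exists>b. (\<lambda>\<sigma>. pr k (c \<sigma>)) - (\<Sum>l<N. fsc (b l) (f l)) \<in> bds ?x (grp ?n) K i" by (rule allI)
    from choice[OF this] obtain b
      where b: "\<And>k. (\<lambda>\<sigma>. pr k (c \<sigma>)) - (\<Sum>l<N. fsc (b k l) (f l)) \<in> bds ?x (grp ?n) K i" by auto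
    define D where "D = (\<lambda>k. (\<lambda>\<sigma>. pr k (c \<sigma>)) - (\<Sum>l<N. fsc (b k l) (f l)))"
    have "(\<lambda>\<sigma>. push (emb k) (D k \<sigma>)) \<in> bds ?y (grp ?n) K i" for k
    proof -
      obtain e where e: "e \<in> kchains K (Suc i) (pm_on (grp ?n))" "D k = cbd ?x e" using b[of k] by (auto simp: bds_def D_def)
      have "cbd ?y (\<lambda>\<sigma>. push (emb k) (e \<sigma>)) \<tau> = push (emb k) (cbd ?x e \<tau>)" for \<tau>
        by (rule cbd_map[where \<Lambda> = "push (emb k)" and x = ?x and x' = ?y], rule push_simps(1), rule qops_push_commute, rule emb_tr)
      then have "(\<lambda>\<sigma>. push (emb k) (D k \<sigma>)) = cbd ?y (\<lambda>\<sigma>. push (emb k) (e \<sigma>))" by (auto simp: e(2))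
      moreover have "(\<lambda>\<sigma>. push (emb k) (e \<sigma>)) \<in> kchains K (Suc i) (pm_on (grp ?n))"
        by (rule kchains_map[where \<Lambda> = "push (emb k)", OF push_simps(3) _ e(1)]) (rule push_in[OF grp(1)])
      ultimately show ?thesis by (auto simp: bds_def)
    qed
    then have "(\<Sum>k\<in>Y. (\<lambda>\<sigma>. push (emb k) (D k \<sigma>))) \<in> bds ?y (grp ?n) K i"
      by (intro lin_closed_sum[OF ky.lin_closed_bds])
    also have "(\<Sum>k\<in>Y. (\<lambda>\<sigma>. push (emb k) (D k \<sigma>)))
        = c - (\<Sum>p\<in>Y \<times> {..<N}. fsc (b (fst p) (snd p)) (case p of (k, l) \<Rightarrow> \<lambda>\<sigma>. push (emb k) (f l \<sigma>)))"
    proof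
      fix \<sigma>
      have app: "(\<Sum>p\<in>I. F p) \<tau> = (\<Sum>p\<in>I. F p \<tau>)" for I :: "'i set" and F :: "_ \<Rightarrow> 'v set \<Rightarrow> (nat \<Rightarrow> int) \<Rightarrow>\<^sub>0 'k" and \<tau>
        by (induction I rule: infinite_finite_induct) auto
      have app2: "(\<Sum>p\<in>I. F p) \<tau> = (\<Sum>p\<in>I. F p \<tau>)" for I :: "nat set" and F :: "_ \<Rightarrow> 'v set \<Rightarrow> (nat \<Rightarrow> int) \<Rightarrow>\<^sub>0 'k" and \<tau>
        by (induction I rule: infinite_finite_induct) auto
      have app3: "(\<Sum>p\<in>I. F p) \<tau> = (\<Sum>p\<in>I. F p \<tau>)" for I :: "int set" and F :: "_ \<Rightarrow> 'v set \<Rightarrow> (nat \<Rightarrow> int) \<Rightarrow>\<^sub>0 'k" and \<tau>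
        by (induction I rule: infinite_finite_induct) auto
      have app4: "(\<Sum>p\<in>I. F p) \<tau> = (\<Sum>p\<in>I. F p \<tau>)" for I :: "(int \<times> nat) set" and F :: "_ \<Rightarrow> 'v set \<Rightarrow> (nat \<Rightarrow> int) \<Rightarrow>\<^sub>0 'k" and \<tau>
        by (induction I rule: infinite_finite_induct) auto
      have push_sum: "push h (\<Sum>l<N. F l) = (\<Sum>l<N. push h (F l))" for h :: "(nat \<Rightarrow> int) \<Rightarrow> nat \<Rightarrow> int" and F :: "nat \<Rightarrow> (nat \<Rightarrow> int) \<Rightarrow>\<^sub>0 'k"
        by (simp add: push_def lin_sum)
      have "(\<Sum>k\<in>Y. (\<lambda>\<sigma>. push (emb k) (D k \<sigma>))) \<sigma> = (\<Sum>k\<in>Y. push (emb k) (pr k (c \<sigma>)) - (\<Sum>l<N. pm_scale (b k l) (push (emb k) (f l \<sigma>))))"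
        unfolding app3 D_def by (intro sum.cong) (auto simp: app2 fsc_def push_simps push_sum)
      also have "\<dots> = c \<sigma> - (\<Sum>k\<in>Y. \<Sum>l<N. pm_scale (b k l) (push (emb k) (f l \<sigma>)))"
        by (simp add: sum_subtractf recon)
      also have "\<dots> = (c - (\<Sum>p\<in>Y \<times> {..<N}. fsc (b (fst p) (snd p)) (case p of (k, l) \<Rightarrow> \<lambda>\<sigma>. push (emb k) (f l \<sigma>)))) \<sigma>"
        by (simp add: app4 sum.cartesian_product fsc_def case_prod_unfold)
      finally show "(\<Sum>k\<in>Y. (\<lambda>\<sigma>. push (emb k) (D k \<sigma>))) \<sigma>
        = (c - (\<Sum>p\<in>Y \<times> {..<N}. fsc (b (fst p) (snd p)) (case p of (k, l) \<Rightarrow> \<lambda>\<sigma>. push (emb k) (f l \<sigma>)))) \<sigma>" .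
    qed
    finally show "\<exists>b. c - (\<Sum>p\<in>Y \<times> {..<N}. fsc (b p) (case p of (k, l) \<Rightarrow> \<lambda>\<sigma>. push (emb k) (f l \<sigma>))) \<in> bds ?y (grp ?n) K i"
      by (rule exI[of _ "\<lambda>p. b (fst p) (snd p)"])
  qed
qed

text \<open>If \<phi> were nonzero at \<open>j0\<close>, it could replace that coordinate, and
  killing all others would leave finite homology over Z with translations \<phi>(a_v). Then
  \<open>kexact_of_hfin\<close> gives exactness for the set of v with nonzero translation, which
  lies in W, and exactness for W follows.\<close>

theorem functional_zero_of_hfin:
  fixes L :: "'v::finite set set" and \<phi> :: "nat \<Rightarrow> int"
  assumes L: "down_closed L"
    and fin: "\<And>j. j \<le> i \<Longrightarrow> hfin (qops (lattice_mod r) {} a :: _ \<Rightarrow> (_ \<Rightarrow>\<^sub>0 'k::field) \<Rightarrow> _) (grp (lattice_mod r)) L j"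
    and W: "\<not> kexact (unit_ops W) (UNIV :: 'k set) L i"
    and \<phi>: "\<And>v. v \<notin> W \<Longrightarrow> (\<Sum>j<r. \<phi> j * a v j) = 0"
    and j0: "j0 < r"
  shows "\<phi> j0 = 0"
proof (rule ccontr)
  assume nz: "\<phi> j0 \<noteq> 0"
  define a' where "a' = (\<lambda>v. (a v)(j0 := \<Sum>j<r. \<phi> j * a v j))"
  have fin': "hfin (qops (lattice_mod r) {} a' :: _ \<Rightarrow> (_ \<Rightarrow>\<^sub>0 'k) \<Rightarrow> _) (grp (lattice_mod r)) L j" if "j \<le> i" for j
    using hfin_sublattice[of j0 r \<phi> L a' a, OF j0 nz L _ fin[OF that]] by (simp add: a'_def)
  \<comment> \<open>The coordinates in J are removed by reducing them modulo 1, one application of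
    \<open>hfin_quotient\<close> each. It needs two adjacent degrees, so all degrees up to i are
    carried along.\<close>
  define nn where "nn = (\<lambda>J j. if j \<in> J then 1 else lattice_mod r j)"
  have kill: "\<forall>j\<le>i. hfin (qops (nn J) {} a' :: _ \<Rightarrow> (_ \<Rightarrow>\<^sub>0 'k) \<Rightarrow> _) (grp (nn J)) L j" if "J \<subseteq> {..<r}" for J
    using finite_subset[OF that finite_lessThan] that
  proof (induction J rule: finite_induct)
    case empty
    have "nn {} = lattice_mod r" by (auto simp: nn_def)
    then show ?case using fin' by simp
  next
    case (insert s J)
    interpret quotient_step "nn J" s 1 "{}" a' "TYPE('k)"
      by unfold_locales (use insert in \<open>auto simp: nn_def\<close>)
    have eq: "(nn J)(s := 1) = nn (insert s J)" by (auto simp: nn_def fun_eq_iff)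
    show ?case
    proof (intro allI impI)
      fix j assume "j \<le> i"
      then show "hfin (qops (nn (insert s J)) {} a' :: _ \<Rightarrow> (_ \<Rightarrow>\<^sub>0 'k) \<Rightarrow> _) (grp (nn (insert s J))) L j"
        using hfin_quotient[OF L, of j] insert by (simp add: eq)
    qed
  qed
  define m where "m = nn ({..<r} - {j0})"
  have m: "m j0 = 0" "\<And>j. j \<noteq> j0 \<Longrightarrow> m j = 1" using j0 by (auto simp: m_def nn_def)
  have hf: "hfin (qops m {} a' :: _ \<Rightarrow> (_ \<Rightarrow>\<^sub>0 'k) \<Rightarrow> _) (grp m) L i" using kill[of "{..<r} - {j0}"] by (auto simp: m_def)
  interpret koszul "qops m {} a' :: _ \<Rightarrow> (_ \<Rightarrow>\<^sub>0 'k) \<Rightarrow> _" "grp m" by (rule koszul_qops)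
  define W' where "W' = {v. a' v j0 \<noteq> 0}"
  have "kexact (unit_ops W') (UNIV :: 'k set) L i"
  proof (rule kexact_of_hfin[where g = "\<lambda>l j. if j = j0 then int l else 0", OF _ _ _ _ hf])
    fix v and mm :: "_ \<Rightarrow>\<^sub>0 'k" assume v: "v \<notin> W'" and mm: "mm \<in> pm_on (grp m)"
    have "tr m (a' v) g = g" if "g \<in> grp m" for g
    proof
      fix j
      have gj: "g j mod m j = g j" using that by (simp add: grp_def)
      show "tr m (a' v) g j = g j" using v gj m by (cases "j = j0") (auto simp: tr_def W'_def)
    qed
    then have "push (tr m (a' v)) mm = mm" by (intro push_ident) (use mm in \<open>auto simp: pm_on_def\<close>)
    then show "qops m {} a' v mm = 0" by (simp add: qops_def)
  next
    fix v and mm :: "_ \<Rightarrow>\<^sub>0 'k" assume "v \<in> W'" "qops m {} a' v mm = 0"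
    then show "mm = 0" using shift_injective[of m j0 "a' v" mm] m by (simp add: qops_def W'_def)
  next
    fix l :: nat show "(\<lambda>j. if j = j0 then int l else 0) \<in> grp m" using m by (auto simp: grp_def)
  next
    show "inj (\<lambda>(l::nat) j. if j = j0 then int l else 0)"
    proof (rule injI)
      fix l l' :: nat assume "(\<lambda>j. if j = j0 then int l else 0) = (\<lambda>j. if j = j0 then int l' else 0)"
      from fun_cong[OF this, of j0] show "l = l'" by simp
    qed
  qed
  moreover have "W' \<subseteq> W" using \<phi> by (auto simp: W'_def a'_def)
  ultimately show False using kexact_unit_ops_mono[OF L] W by blast
qed


section \<open>Transposing multiplication by z, and the Betti numbers\<close>

subsection \<open>Duality with the exterior Stanley-Reisner ring\<close>

definition pairing :: "('s::finite \<Rightarrow>\<^sub>0 'k::field) \<Rightarrow> ('s \<Rightarrow> 'k) \<Rightarrow> 'k"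
  where "pairing a c = (\<Sum>\<sigma>\<in>UNIV. lookup a \<sigma> * c \<sigma>)"

lemma pairing_keys: "pairing a c = (\<Sum>\<sigma>\<in>keys a. lookup a \<sigma> * c \<sigma>)"
  unfolding pairing_def by (rule sum.mono_neutral_right) (auto simp: in_keys_iff)

lemma pairing_add: "pairing (a + b) c = pairing a c + pairing b c"
  by (simp add: pairing_def lookup_add algebra_simps sum.distrib)

lemma pairing_scale: "pairing (pm_scale r a) c = r * pairing a c"
  by (simp add: pairing_def lookup_pm_scale sum_distrib_left mult.assoc)

lemma pairing_0: "pairing 0 c = 0"
  by (simp add: pairing_def)

lemma pairing_sum: "pairing (\<Sum>i\<in>I. f i) c = (\<Sum>i\<in>I. pairing (f i) c)"
  by (induction I rule: infinite_finite_induct) (simp_all add: pairing_0 pairing_add)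

lemma pairing_single [simp]: "pairing (single \<sigma> r) c = r * c \<sigma>"
proof -
  have "pairing (single \<sigma> r) c = (\<Sum>\<tau>\<in>UNIV. if \<tau> = \<sigma> then r * c \<sigma> else 0)"
    unfolding pairing_def by (intro sum.cong) (auto simp: lookup_single when_def)
  then show ?thesis by simp
qed

abbreviation delta :: "'s \<Rightarrow> 's \<Rightarrow> 'k::field"
  where "delta \<tau> \<equiv> (\<lambda>\<sigma>. if \<sigma> = \<tau> then 1 else 0)"

lemma pairing_delta: "pairing a (delta \<tau>) = lookup a \<tau>"
proof -
  have "pairing a (delta \<tau>) = (\<Sum>\<sigma>\<in>UNIV. if \<sigma> = \<tau> then lookup a \<tau> else 0)"
    unfolding pairing_def by (intro sum.cong) auto
  then show ?thesis by simp
qed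

lemma pairing_cong: "(\<And>\<sigma>. lookup a \<sigma> \<noteq> 0 \<Longrightarrow> c \<sigma> = c' \<sigma>) \<Longrightarrow> pairing a c = pairing a c'"
  unfolding pairing_def by (intro sum.cong) auto

lemma pairing_disjoint: "(\<And>\<sigma>. lookup a \<sigma> \<noteq> 0 \<Longrightarrow> c \<sigma> = 0) \<Longrightarrow> pairing a c = 0"
  using pairing_cong[of a c "\<lambda>_. 0"] by (simp add: pairing_def)

definition pm_of :: "('s::finite \<Rightarrow> 'k::field) \<Rightarrow> 's \<Rightarrow>\<^sub>0 'k"
  where "pm_of c = (\<Sum>\<sigma>\<in>UNIV. single \<sigma> (c \<sigma>))"

lemma lookup_pm_of [simp]: "lookup (pm_of c) \<sigma> = c \<sigma>"
  by (simp add: pm_of_def lookup_sum lookup_single when_def)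

lemma pairing_functional:
  fixes a :: "'s::finite \<Rightarrow>\<^sub>0 'k::field"
  assumes "lin_closed pm_scale B" "a \<notin> B"
  obtains g where "\<And>b. b \<in> B \<Longrightarrow> pairing b g = 0" "pairing a g \<noteq> 0"
proof -
  have "pm.span B \<subseteq> B" using assms(1) pm.span_minimal[of B B] by (simp add: pm_subspace_iff)
  then have "a \<notin> pm.span B" using assms(2) by blast
  from functional_exists[OF this] show ?thesis using that unfolding pairing_keys by blast
qed

lemma ext_sign_vertex: "ext_sign {v} \<tau> * a = (if v \<in> \<tau> then 0 else sg (below v \<tau>) (a :: 'k::field))"
proof -
  have "{(s, t). s \<in> {v} \<and> t \<in> \<tau> \<and> to_nat t < to_nat s} = Pair v ` {t\<in>\<tau>. to_nat t < to_nat v}" by auto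
  then have "card {(s, t). s \<in> {v} \<and> t \<in> \<tau> \<and> to_nat t < to_nat s} = below v \<tau>"
    by (simp add: below_def card_image inj_on_def)
  then show ?thesis by (auto simp: ext_sign_def sg_def)
qed

lemma z_elem_mult:
  "z_elem W \<odot> a = (\<Sum>v\<in>W. \<Sum>\<tau>\<in>keys a. single (insert v \<tau>) (ext_sign {v} \<tau> * lookup a \<tau> :: 'k::field))"
proof -
  have l: "lookup (z_elem W :: 'v set \<Rightarrow>\<^sub>0 'k) \<sigma> = (if \<exists>v\<in>W. \<sigma> = {v} then 1 else 0)" for \<sigma> and W :: "'v::finite set"
  proof -
    have "lookup (z_elem W :: 'v set \<Rightarrow>\<^sub>0 'k) \<sigma> = (\<Sum>v\<in>W. if {v} = \<sigma> then 1 else 0)"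
      by (simp add: z_elem_def lookup_sum ext_monomial_def lookup_single when_def)
    also have "\<dots> = (if \<exists>v\<in>W. \<sigma> = {v} then 1 else 0)"
    proof (cases "\<exists>v\<in>W. \<sigma> = {v}")
      case True
      then obtain v where v: "v \<in> W" "\<sigma> = {v}" by blast
      then have "(\<Sum>w\<in>W. if {w} = \<sigma> then (1::'k) else 0) = (\<Sum>w\<in>W. if w = v then 1 else 0)" by (intro sum.cong) auto
      then show ?thesis using v by simp
    next
      case False
      then have "(\<Sum>w\<in>W. if {w} = \<sigma> then (1::'k) else 0) = 0" by (intro sum.neutral) auto
      then show ?thesis using False by simp
    qed
    finally show ?thesis .
  qed
  have k: "keys (z_elem W :: 'a set \<Rightarrow>\<^sub>0 'k) = (\<lambda>v. {v}) ` W" by (auto simp: in_keys_iff l split: if_splits)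
  show ?thesis
    unfolding ext_mult_def k by (subst sum.reindex) (auto simp: l inj_on_def intro!: sum.cong)
qed

text \<open>Multiplication by \<open>z_elem W\<close> is the transpose of \<open>cbd (unit_ops W)\<close>.\<close>

lemma pairing_z_elem: "pairing (z_elem W \<odot> a) c = pairing a (cbd (unit_ops W) c)"
proof -
  have "pairing (z_elem W \<odot> a) c = (\<Sum>v\<in>W. \<Sum>\<tau>\<in>keys a. ext_sign {v} \<tau> * lookup a \<tau> * c (insert v \<tau>))"
    by (simp add: z_elem_mult pairing_sum)
  also have "\<dots> = (\<Sum>\<tau>\<in>keys a. \<Sum>v\<in>W. ext_sign {v} \<tau> * lookup a \<tau> * c (insert v \<tau>))" by (rule sum.swap)
  also have "\<dots> = (\<Sum>\<tau>\<in>keys a. lookup a \<tau> * cbd (unit_ops W) c \<tau>)"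
  proof (rule sum.cong)
    fix \<tau>
    have "(\<Sum>v\<in>W. ext_sign {v} \<tau> * lookup a \<tau> * c (insert v \<tau>))
        = (\<Sum>v\<in>UNIV. if v \<in> W \<and> v \<notin> \<tau> then lookup a \<tau> * sg (below v \<tau>) (c (insert v \<tau>)) else 0)"
      by (rule sum.mono_neutral_cong_left) (auto simp: ext_sign_vertex mult.assoc sg_def)
    also have "\<dots> = (\<Sum>v\<in>-\<tau>. lookup a \<tau> * sg (below v \<tau>) (unit_ops W v (c (insert v \<tau>))))"
      by (rule sum.mono_neutral_cong_right) (auto simp: unit_ops_def)
    also have "\<dots> = lookup a \<tau> * cbd (unit_ops W) c \<tau>" by (simp add: cbd_def sum_distrib_left)
    finally show "(\<Sum>v\<in>W. ext_sign {v} \<tau> * lookup a \<tau> * c (insert v \<tau>)) = lookup a \<tau> * cbd (unit_ops W) c \<tau>" .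
  qed simp
  finally show ?thesis by (simp add: pairing_keys)
qed

lemma lookup_z_elem_mult: "lookup (z_elem W \<odot> a) \<tau> = pairing a (cbd (unit_ops W) (delta \<tau>))"
  using pairing_z_elem[of W a "delta \<tau>"] by (simp add: pairing_delta)

lemma z_elem_mult_add: "z_elem W \<odot> (a + b) = z_elem W \<odot> a + z_elem W \<odot> b"
  by (rule poly_mapping_eqI) (simp add: lookup_z_elem_mult lookup_add pairing_add)

lemma z_elem_mult_scale: "z_elem W \<odot> (pm_scale r a) = pm_scale r (z_elem W \<odot> a)"
  by (rule poly_mapping_eqI) (simp add: lookup_z_elem_mult lookup_pm_scale pairing_scale)

lemma z_elem_mult_0: "z_elem W \<odot> 0 = 0"
  by (simp add: ext_mult_def)

lemma cbd_unit_squared: "cbd (unit_ops W) (cbd (unit_ops W) c) \<tau> = 0"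
  by (rule cbd_cbd[OF additive_unit_ops]) (auto simp: unit_ops_def)

lemma z_elem_mult_twice: "z_elem W \<odot> (z_elem W \<odot> a) = 0"
proof (rule poly_mapping_eqI)
  fix \<tau>
  have "lookup (z_elem W \<odot> (z_elem W \<odot> a)) \<tau> = pairing a (cbd (unit_ops W) (cbd (unit_ops W) (delta \<tau>)))"
    unfolding lookup_z_elem_mult pairing_z_elem ..
  also have "\<dots> = 0" by (rule pairing_disjoint) (rule cbd_unit_squared)
  finally show "lookup (z_elem W \<odot> (z_elem W \<odot> a)) \<tau> = lookup 0 \<tau>" by (simp add: pairing_def)
qed

lemma keys_ext_mult: "keys (a \<odot> b) \<subseteq> {\<sigma> \<union> \<tau> |\<sigma> \<tau>. \<sigma> \<in> keys a \<and> \<tau> \<in> keys b}"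
proof -
  have "keys (a \<odot> b) \<subseteq> (\<Union>\<sigma>\<in>keys a. \<Union>\<tau>\<in>keys b. keys (single (\<sigma> \<union> \<tau>) (ext_sign \<sigma> \<tau> * lookup a \<sigma> * lookup b \<tau>)))"
    unfolding ext_mult_def by (rule order_trans[OF keys_sum_subset], rule UN_mono[OF subset_refl], rule keys_sum_subset)
  also have "\<dots> \<subseteq> {\<sigma> \<union> \<tau> |\<sigma> \<tau>. \<sigma> \<in> keys a \<and> \<tau> \<in> keys b}" by (auto split: if_splits)
  finally show ?thesis .
qed

lemma keys_z_elem_mult: "a \<in> ext_degree i \<Longrightarrow> z_elem W \<odot> a \<in> ext_degree (Suc i)"
proof -
  assume a: "a \<in> ext_degree i"
  show ?thesis
    unfolding ext_degree_def
  proof (intro CollectI ballI)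
    fix \<tau> assume t: "\<tau> \<in> keys (z_elem W \<odot> a)"
    show "card \<tau> = Suc i"
    proof (rule ccontr)
      assume ne: "card \<tau> \<noteq> Suc i"
      have "lookup (z_elem W \<odot> a) \<tau> = 0"
        unfolding lookup_z_elem_mult
      proof (rule pairing_disjoint)
        fix \<sigma> assume "lookup a \<sigma> \<noteq> 0"
        then have "card \<sigma> = i" using a by (auto simp: ext_degree_def in_keys_iff)
        then have "insert v \<sigma> \<noteq> \<tau>" if "v \<notin> \<sigma>" for v using ne that by auto
        then show "cbd (unit_ops W) (delta \<tau>) \<sigma> = 0"
          unfolding cbd_def by (intro sum.neutral) (auto simp: unit_ops_def)
      qed
      then show False using t by (simp add: in_keys_iff)
    qed
  qed
qed

text \<open>The product of monomials is supported on the union, and a set containing a non-face is a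
  non-face; so the ideal is spanned by the monomials of the non-faces.\<close>

lemma SR_ideal_iff:
  assumes L: "down_closed L"
  shows "SR_ideal L = {a :: 'v::finite set \<Rightarrow>\<^sub>0 'k::field. keys a \<inter> L = {}}"
proof (rule subset_antisym; rule subsetI)
  have sub: "pm.subspace {a :: 'v set \<Rightarrow>\<^sub>0 'k. keys a \<inter> L = {}}"
    unfolding pm.subspace_def
  proof (intro conjI ballI allI)
    fix a b :: "'v set \<Rightarrow>\<^sub>0 'k" assume "a \<in> {a. keys a \<inter> L = {}}" "b \<in> {a. keys a \<inter> L = {}}"
    then show "a + b \<in> {a. keys a \<inter> L = {}}" using Poly_Mapping.keys_add[of a b] by auto
  next
    fix r and a :: "'v set \<Rightarrow>\<^sub>0 'k" assume "a \<in> {a. keys a \<inter> L = {}}"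
    then show "pm_scale r a \<in> {a. keys a \<inter> L = {}}" using keys_pm_scale[of r a] by auto
  qed simp
  have gen: "{a \<odot> ext_monomial \<sigma> \<odot> b |a b \<sigma>. \<sigma> \<notin> L} \<subseteq> {a :: 'v set \<Rightarrow>\<^sub>0 'k. keys a \<inter> L = {}}"
  proof safe
    fix a b :: "'v set \<Rightarrow>\<^sub>0 'k" and \<sigma> \<rho> assume s: "\<sigma> \<notin> L" and k: "\<rho> \<in> keys (a \<odot> ext_monomial \<sigma> \<odot> b)" and r: "\<rho> \<in> L"
    from subsetD[OF keys_ext_mult k] obtain \<rho>1 \<rho>2 where 1: "\<rho> = \<rho>1 \<union> \<rho>2" "\<rho>1 \<in> keys (a \<odot> ext_monomial \<sigma>)" by auto
    from subsetD[OF keys_ext_mult 1(2)] obtain \<rho>3 \<rho>4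
      where 2: "\<rho>1 = \<rho>3 \<union> \<rho>4" "\<rho>4 \<in> keys (ext_monomial \<sigma> :: 'v set \<Rightarrow>\<^sub>0 'k)" by auto
    have "\<rho>4 = \<sigma>" using 2(2) by (simp add: ext_monomial_def)
    then have "\<sigma> \<subseteq> \<rho>" using 1 2 by auto
    then have "\<sigma> \<in> L" using down_closedD[OF L r] by blast
    then show "\<rho> \<in> {}" using s by simp
  qed
  fix a :: "'v set \<Rightarrow>\<^sub>0 'k"
  show "a \<in> {a. keys a \<inter> L = {}}" if "a \<in> SR_ideal L"
    using pm.span_minimal[OF gen sub] that unfolding SR_ideal_def by blast
  assume "a \<in> {a. keys a \<inter> L = {}}"
  then have ka: "\<sigma> \<notin> L" if "\<sigma> \<in> keys a" for \<sigma> using that by auto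
  have unit: "ext_monomial {} \<odot> ext_monomial \<sigma> \<odot> ext_monomial {} = (ext_monomial \<sigma> :: 'v set \<Rightarrow>\<^sub>0 'k)" for \<sigma>
    by (simp add: ext_mult_def ext_monomial_def ext_sign_def)
  have "ext_monomial \<sigma> \<in> pm.span {a \<odot> ext_monomial \<sigma> \<odot> b |(a :: 'v set \<Rightarrow>\<^sub>0 'k) b \<sigma>. \<sigma> \<notin> L}" if "\<sigma> \<in> keys a" for \<sigma>
    by (rule pm.span_base) (rule CollectI, rule exI[of _ "ext_monomial {}"], rule exI[of _ "ext_monomial {}"], rule exI[of _ \<sigma>], use unit ka[OF that] in simp)
  then have "lin (\<lambda>\<sigma>. ext_monomial \<sigma>) a \<in> SR_ideal L"
    unfolding lin_def SR_ideal_def by (intro pm.span_sum pm.span_scale)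
  then show "a \<in> SR_ideal L" by (simp add: ext_monomial_def)
qed

lemma ext_degree_lin_closed: "lin_closed pm_scale (ext_degree i :: ('v::finite set \<Rightarrow>\<^sub>0 'k::field) set)"
  unfolding lin_closed_def
proof (intro conjI ballI allI)
  fix a b :: "'v set \<Rightarrow>\<^sub>0 'k" assume "a \<in> ext_degree i" "b \<in> ext_degree i"
  then show "a + b \<in> ext_degree i" using Poly_Mapping.keys_add[of a b] by (auto simp: ext_degree_def)
next
  fix r and a :: "'v set \<Rightarrow>\<^sub>0 'k" assume "a \<in> ext_degree i"
  then show "pm_scale r a \<in> ext_degree i" using keys_pm_scale[of r a] by (auto simp: ext_degree_def)
qed (simp add: ext_degree_def)

lemma SR_ideal_lin_closed: "lin_closed pm_scale (SR_ideal L)"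
  unfolding SR_ideal_def by (simp add: pm_subspace_iff[symmetric])

lemma z_image_0: "0 \<in> (\<lambda>a. z_elem W \<odot> a) ` ext_degree m"
  by (rule image_eqI[of _ _ 0]) (simp_all add: z_elem_mult_0 ext_degree_def)

lemma SR_cohomology_closed:
  fixes L :: "'v::finite set set"
  assumes L: "down_closed L"
  shows "lin_closed pm_scale (SR_cocycles L (z_elem W :: 'v set \<Rightarrow>\<^sub>0 'k::field) i)" (is "lin_closed _ ?Z")
    and "lin_closed pm_scale (SR_coboundaries L (z_elem W :: 'v set \<Rightarrow>\<^sub>0 'k) i)" (is "lin_closed _ ?B")
    and "SR_coboundaries L (z_elem W :: 'v set \<Rightarrow>\<^sub>0 'k) i \<subseteq> SR_cocycles L (z_elem W) i"
proof -
  note e = lin_closedD[OF ext_degree_lin_closed] and s = lin_closedD[OF SR_ideal_lin_closed]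
  show "lin_closed pm_scale ?Z"
    unfolding lin_closed_def SR_cocycles_def using e s by (auto simp: z_elem_mult_add z_elem_mult_scale z_elem_mult_0)
  define D :: "('v set \<Rightarrow>\<^sub>0 'k) set" where "D = (case i of 0 \<Rightarrow> {0} | Suc m \<Rightarrow> (\<lambda>a. z_elem W \<odot> a) ` ext_degree m)"
  have D: "0 \<in> D" "a \<in> D \<Longrightarrow> b \<in> D \<Longrightarrow> a + b \<in> D" "a \<in> D \<Longrightarrow> pm_scale r a \<in> D" for a b r
    unfolding D_def using e z_image_0
    by (auto split: nat.splits simp: z_elem_mult_add[symmetric] z_elem_mult_scale[symmetric] intro!: image_eqI[OF refl])
  have B: "?B = {d + j |d j. d \<in> D \<and> j \<in> SR_ideal L \<inter> ext_degree i}" by (simp add: SR_coboundaries_def D_def)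
  show "lin_closed pm_scale ?B"
    unfolding lin_closed_def B
  proof (intro conjI ballI allI)
    show "0 \<in> {d + j |d j. d \<in> D \<and> j \<in> SR_ideal L \<inter> ext_degree i}"
      using D(1) e(1)[of i] s(1)[of L] by (intro CollectI exI[of _ 0]) auto
  next
    fix x y assume "x \<in> {d + j |d j. d \<in> D \<and> j \<in> SR_ideal L \<inter> ext_degree i}" "y \<in> {d + j |d j. d \<in> D \<and> j \<in> SR_ideal L \<inter> ext_degree i}"
    then obtain d j d' j' where *: "x = d + j" "y = d' + j'" "d \<in> D" "d' \<in> D" "j \<in> SR_ideal L \<inter> ext_degree i" "j' \<in> SR_ideal L \<inter> ext_degree i" by blast
    then have "x + y = (d + d') + (j + j')" "d + d' \<in> D" "j + j' \<in> SR_ideal L \<inter> ext_degree i"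
      using D(2) e(2) s(2) by (auto simp: algebra_simps)
    then show "x + y \<in> {d + j |d j. d \<in> D \<and> j \<in> SR_ideal L \<inter> ext_degree i}" by blast
  next
    fix r x assume "x \<in> {d + j |d j. d \<in> D \<and> j \<in> SR_ideal L \<inter> ext_degree i}"
    then obtain d j where *: "x = d + j" "d \<in> D" "j \<in> SR_ideal L \<inter> ext_degree i" by blast
    then have "pm_scale r x = pm_scale r d + pm_scale r j" "pm_scale r d \<in> D" "pm_scale r j \<in> SR_ideal L \<inter> ext_degree i"
      using D(3) e(3) s(3) by (auto simp: pm.scale_right_distrib)
    then show "pm_scale r x \<in> {d + j |d j. d \<in> D \<and> j \<in> SR_ideal L \<inter> ext_degree i}" by blast
  qed
  have zD: "d \<in> ext_degree i \<and> z_elem W \<odot> d = 0" if "d \<in> D" for d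
    using that e(1) keys_z_elem_mult unfolding D_def
    by (auto split: nat.splits simp: z_elem_mult_twice z_elem_mult_0)
  have zj: "z_elem W \<odot> j \<in> SR_ideal L" if "j \<in> SR_ideal L" for j :: "'v set \<Rightarrow>\<^sub>0 'k"
  proof -
    have "lookup (z_elem W \<odot> j) \<tau> = 0" if \<tau>: "\<tau> \<in> L" for \<tau>
      unfolding lookup_z_elem_mult
    proof (rule pairing_disjoint)
      fix \<sigma> assume "lookup j \<sigma> \<noteq> 0"
      then have "\<sigma> \<notin> L" using \<open>j \<in> SR_ideal L\<close> by (auto simp: SR_ideal_iff[OF L] in_keys_iff)
      then have "insert v \<sigma> \<noteq> \<tau>" for v using down_closedD[OF L \<tau>, of \<sigma>] by auto
      then show "cbd (unit_ops W) (delta \<tau>) \<sigma> = 0"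
        unfolding cbd_def by (intro sum.neutral) (auto simp: unit_ops_def)
    qed
    then show ?thesis by (auto simp: SR_ideal_iff[OF L] in_keys_iff)
  qed
  show "?B \<subseteq> ?Z"
  proof
    fix x assume "x \<in> ?B"
    then obtain d j where *: "x = d + j" "d \<in> D" "j \<in> SR_ideal L" "j \<in> ext_degree i" unfolding B by blast
    then show "x \<in> ?Z" using zD[of d] zj[of j] by (simp add: SR_cocycles_def z_elem_mult_add e(2))
  qed
qed

text \<open>The pairing identifies chains on faces of \<open>L\<close> with functionals on the ring,
  under which \<open>cbd (unit_ops W)\<close> is dual to multiplication by z. A finite-dimensional
  complex and its dual are exact in the same degrees; both implications separate an element from a
  subspace by a functional.\<close>

lemma SR_betti_kexact:
  fixes L :: "'v::finite set set"
  assumes L: "down_closed L"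
  shows "SR_betti L (z_elem W :: 'v set \<Rightarrow>\<^sub>0 'k::field) i \<noteq> 0 \<longleftrightarrow> \<not> kexact (unit_ops W) (UNIV :: 'k set) L i"
proof -
  let ?z = "z_elem W :: 'v set \<Rightarrow>\<^sub>0 'k"
  let ?Z = "SR_cocycles L ?z i" and ?B = "SR_coboundaries L ?z i" and ?D = "cbd (unit_ops W) :: ('v set \<Rightarrow> 'k) \<Rightarrow> _"
  note ideal = SR_ideal_iff[OF L, where 'k = 'k]
  note e = lin_closedD[OF ext_degree_lin_closed] and s = lin_closedD[OF SR_ideal_lin_closed]
  have B_z: "?z \<odot> single \<tau> 1 \<in> ?B" if "i = Suc (card \<tau>)" for \<tau>
  proof -
    have "?z \<odot> single \<tau> 1 + 0 \<in> ?B"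
      unfolding SR_coboundaries_def using that e(1)[of i] s(1)[of L] by (intro CollectI exI conjI refl) (auto simp: ext_degree_def)
    then show ?thesis by simp
  qed
  have B_j: "single \<sigma> 1 \<in> ?B" if "\<sigma> \<notin> L" "card \<sigma> = i" for \<sigma>
  proof -
    have "0 \<in> (case i of 0 \<Rightarrow> {0} | Suc m \<Rightarrow> (\<lambda>a. ?z \<odot> a) ` ext_degree m)"
      using z_image_0 by (auto split: nat.splits)
    moreover have "single \<sigma> (1::'k) \<in> SR_ideal L \<inter> ext_degree i" using that by (simp add: ideal ext_degree_def)
    ultimately have "0 + single \<sigma> 1 \<in> ?B" unfolding SR_coboundaries_def by blast
    then show ?thesis by simp
  qed
  have "?Z = ?B \<longleftrightarrow> kexact (unit_ops W) (UNIV :: 'k set) L i"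
  proof
    assume ZB: "?Z = ?B"
    show "kexact (unit_ops W) (UNIV :: 'k set) L i"
      unfolding kexact_def
    proof (intro ballI impI, rule ccontr)
      fix c :: "'v set \<Rightarrow> 'k" assume c: "c \<in> kchains L i UNIV" "?D c = (\<lambda>_. 0)" and nb: "\<not> (\<exists>b\<in>kchains L (Suc i) UNIV. ?D b = c)"
      \<comment> \<open>The boundaries, recoded as finitely supported functions so that
        \<open>pairing_functional\<close> can separate c from them.\<close>
      define Bd where "Bd = (\<lambda>b. pm_of (?D b)) ` kchains L (Suc i) UNIV"
      have "lin_closed pm_scale Bd"
        unfolding lin_closed_def Bd_def
      proof (intro conjI ballI allI)
        have "pm_of (?D (\<lambda>_. 0)) = 0" by (rule poly_mapping_eqI) (simp add: cbd_0[OF additive_unit_ops])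
        then show "0 \<in> (\<lambda>b. pm_of (?D b)) ` kchains L (Suc i) UNIV"
          by (intro image_eqI[of _ _ "\<lambda>_. 0"]) (auto simp: kchains_def)
      next
        fix a b assume "a \<in> (\<lambda>b. pm_of (?D b)) ` kchains L (Suc i) UNIV" "b \<in> (\<lambda>b. pm_of (?D b)) ` kchains L (Suc i) UNIV"
        then obtain a' b' where *: "a = pm_of (?D a')" "b = pm_of (?D b')" "a' \<in> kchains L (Suc i) UNIV" "b' \<in> kchains L (Suc i) UNIV" by blast
        have "a + b = pm_of (?D (\<lambda>\<sigma>. a' \<sigma> + b' \<sigma>))"
          unfolding * by (rule poly_mapping_eqI) (simp add: lookup_add cbd_add[OF additive_unit_ops])
        moreover have "(\<lambda>\<sigma>. a' \<sigma> + b' \<sigma>) \<in> kchains L (Suc i) UNIV"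
          by (rule kchains_plus[OF _ *(3,4)]) (simp add: add_closed_def)
        ultimately show "a + b \<in> (\<lambda>b. pm_of (?D b)) ` kchains L (Suc i) UNIV" by blast
      next
        fix r a assume "a \<in> (\<lambda>b. pm_of (?D b)) ` kchains L (Suc i) UNIV"
        then obtain a' where *: "a = pm_of (?D a')" "a' \<in> kchains L (Suc i) UNIV" by blast
        have "pm_scale r a = pm_of (?D (\<lambda>\<sigma>. r * a' \<sigma>))"
        proof (rule poly_mapping_eqI)
          fix \<sigma>
          have "?D (\<lambda>\<sigma>. r * a' \<sigma>) \<sigma> = r * ?D a' \<sigma>"
            unfolding cbd_def sum_distrib_left by (intro sum.cong) (auto simp: sg_def unit_ops_def)
          then show "lookup (pm_scale r a) \<sigma> = lookup (pm_of (?D (\<lambda>\<sigma>. r * a' \<sigma>))) \<sigma>"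
            by (simp add: *(1) lookup_pm_scale)
        qed
        moreover have "(\<lambda>\<sigma>. r * a' \<sigma>) \<in> kchains L (Suc i) UNIV" using *(2) by (auto simp: kchains_def)
        ultimately show "pm_scale r a \<in> (\<lambda>b. pm_of (?D b)) ` kchains L (Suc i) UNIV" by blast
      qed
      moreover have "pm_of c \<notin> Bd"
      proof
        assume "pm_of c \<in> Bd"
        then obtain b where b: "b \<in> kchains L (Suc i) UNIV" "pm_of c = pm_of (?D b)" by (auto simp: Bd_def)
        have "?D b \<sigma> = c \<sigma>" for \<sigma> using arg_cong[OF b(2), of "\<lambda>a. lookup a \<sigma>"] by simp
        then show False using nb b(1) by auto
      qed
      ultimately have *: "lin_closed pm_scale Bd" "pm_of c \<notin> Bd" by blast+
      from pairing_functional[OF *] obtain g where g: "\<And>b. b \<in> Bd \<Longrightarrow> pairing b g = 0" "pairing (pm_of c) g \<noteq> 0"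
        by blast
      have sym: "pairing (pm_of f) h = pairing (pm_of h) f" for f h :: "'v set \<Rightarrow> 'k"
        by (simp add: pairing_def mult.commute)
      define a where "a = pm_of (\<lambda>\<sigma>. if card \<sigma> = i then g \<sigma> else 0)"
      have la: "lookup a \<sigma> = (if card \<sigma> = i then g \<sigma> else 0)" for \<sigma> by (simp add: a_def)
      have ga: "pairing a h = pairing (pm_of h) g" if "\<And>\<sigma>. card \<sigma> \<noteq> i \<Longrightarrow> h \<sigma> = 0" for h
      proof -
        have "pairing a h = pairing (pm_of g) h" unfolding pairing_def using that by (intro sum.cong) (auto simp: la)
        then show ?thesis using sym by simp
      qed
      have "lookup (?z \<odot> a) \<tau> = 0" if \<tau>: "\<tau> \<in> L" for \<tau>
      proof (cases "card \<tau> = Suc i")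
        case True
        have k: "delta \<tau> \<in> kchains L (Suc i) (UNIV :: 'k set)" using True \<tau> by (auto simp: kchains_def)
        have "?D (delta \<tau>) \<sigma> = 0" if "card \<sigma> \<noteq> i" for \<sigma>
          unfolding cbd_def using that True by (intro sum.neutral) (auto simp: unit_ops_def)
        then have "lookup (?z \<odot> a) \<tau> = pairing (pm_of (?D (delta \<tau>))) g" unfolding lookup_z_elem_mult by (rule ga)
        then show ?thesis using g(1) k by (auto simp: Bd_def)
      next
        case False
        have "a \<in> ext_degree i" by (auto simp: ext_degree_def in_keys_iff la split: if_splits)
        then show ?thesis using keys_z_elem_mult[of a i W] False by (auto simp: ext_degree_def in_keys_iff)
      qed
      then have "?z \<odot> a \<in> SR_ideal L" by (auto simp: ideal in_keys_iff)
      then have "a \<in> ?Z" by (auto simp: SR_cocycles_def ext_degree_def in_keys_iff la split: if_splits)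
      then have "a \<in> ?B" using ZB by simp
      then obtain d j where dj: "a = d + j" "d \<in> (case i of 0 \<Rightarrow> {0} | Suc m \<Rightarrow> (\<lambda>a. ?z \<odot> a) ` ext_degree m)" "j \<in> SR_ideal L"
        unfolding SR_coboundaries_def by blast
      have "pairing d c = 0"
      proof (cases i)
        case 0 then show ?thesis using dj(2) by (simp add: pairing_0)
      next
        case (Suc m)
        then obtain d' where d': "d = ?z \<odot> d'" using dj(2) by auto
        show ?thesis unfolding d' pairing_z_elem c(2) by (rule pairing_disjoint) simp
      qed
      moreover have "pairing j c = 0"
        using dj(3) c(1) by (intro pairing_disjoint) (auto simp: ideal kchains_def in_keys_iff)
      ultimately have "pairing a c = 0" by (simp add: dj(1) pairing_add)
      moreover have "pairing a c = pairing (pm_of c) g" using c(1) by (intro ga) (auto simp: kchains_def)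
      ultimately show False using g(2) by simp
    qed
  next
    assume ex: "kexact (unit_ops W) (UNIV :: 'k set) L i"
    note lc = SR_cohomology_closed(2)[OF L, of W i, where 'k = 'k] and BZ = SR_cohomology_closed(3)[OF L, of W i, where 'k = 'k]
    have "a \<in> ?B" if a: "a \<in> ?Z" for a
    proof (rule ccontr)
      assume "a \<notin> ?B"
      from pairing_functional[OF lc this] obtain g where g: "\<And>b. b \<in> ?B \<Longrightarrow> pairing b g = 0" "pairing a g \<noteq> 0" by blast
      \<comment> \<open>The degree i part of the separating functional. Because it kills the ideal
        it is a chain on faces of \<open>L\<close>, and because it kills the multiples of z it is a
        cycle.\<close>
      define c where "c = (\<lambda>\<sigma>. if card \<sigma> = i then g \<sigma> else 0)"
      have "c \<sigma> = 0" if "\<sigma> \<notin> L" for \<sigma> using g(1)[OF B_j[OF that]] by (auto simp: c_def)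
      moreover have "card \<sigma> = i" if "c \<sigma> \<noteq> 0" for \<sigma> using that by (simp add: c_def split: if_splits)
      ultimately have ck: "c \<in> kchains L i UNIV" unfolding kchains_def by blast
      have "?D c \<tau> = 0" for \<tau>
      proof (cases "i = Suc (card \<tau>)")
        case True
        have "?D c \<tau> = ?D g \<tau>" unfolding cbd_def using True by (intro sum.cong) (auto simp: c_def)
        also have "\<dots> = pairing (?z \<odot> single \<tau> 1) g" by (simp add: pairing_z_elem)
        finally show ?thesis using g(1)[OF B_z[OF True]] by simp
      next
        case False
        then show ?thesis unfolding cbd_def by (intro sum.neutral) (auto simp: c_def unit_ops_def)
      qed
      then have "?D c = (\<lambda>_. 0)" by (rule ext)
      then obtain b where b: "b \<in> kchains L (Suc i) UNIV" "?D b = c" using ex ck unfolding kexact_def by blast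
      have "pairing a g = pairing a c"
        using a by (intro pairing_cong) (auto simp: c_def SR_cocycles_def ext_degree_def in_keys_iff)
      also have "\<dots> = pairing (?z \<odot> a) b" by (simp add: pairing_z_elem b(2))
      also have "\<dots> = 0"
        using a b(1) by (intro pairing_disjoint) (auto simp: SR_cocycles_def ideal kchains_def in_keys_iff)
      finally show False using g(2) by simp
    qed
    then show "?Z = ?B" using BZ by blast
  qed
  then show ?thesis unfolding SR_betti_def by (simp add: quotient_dim_zero_iff SR_cohomology_closed[OF L])
qed


section \<open>The fibre of the kernel cover as a lattice\<close>

subsection \<open>The fibre of the covering of a kernel\<close>

locale toric_kernel_cover =
  fixes L :: "'v::finite set set" and r :: nat and \<nu> :: "(real \<Rightarrow> complex ^ 'v) set \<Rightarrow> nat \<Rightarrow> int"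
    and E :: "'e::topological_space set" and e :: 'e and p :: "'e \<Rightarrow> complex ^ 'v"
  assumes complex: "simplicial_complex L"
    and epi: "\<nu> \<in> epi (toric_group L) (lattice_group r)"
    and cover: "covering_of_subgroup E e p (toric_complex L) toric_basepoint (kernel (toric_group L) (lattice_group r) \<nu>)"
begin

sublocale toric_cover L E p
  using complex cover by unfold_locales (auto simp: covering_of_subgroup_def)

abbreviation "S \<equiv> toric_complex L"
abbreviation "x0 \<equiv> (toric_basepoint :: complex ^ 'v)"
abbreviation "F \<equiv> EK {{}}"

lemma E_connected: "path_connected E" and e_E: "e \<in> E" and p_e: "p e = x0"
  and image_kernel: "fundamental_group_map S p ` carrier (fundamental_group E e) = kernel (toric_group L) (lattice_group r) \<nu>"
  using cover by (auto simp: covering_of_subgroup_def)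

lemma F_iff: "y \<in> F \<longleftrightarrow> y \<in> E \<and> p y = x0"
  by (auto simp: EK_def supp_def toric_basepoint_def vec_eq_iff)

lemma p_E: "y \<in> E \<Longrightarrow> p y \<in> S"
  using cov by (auto simp: covering_space_def)

text \<open>The value of \<nu> on a loop, cut off to 0 outside the first r coordinates, so that it
  belongs to \<open>grp (lattice_mod r)\<close>; elements of the product group are
  \<open>undefined\<close> there.\<close>

definition wind :: "(real \<Rightarrow> complex ^ 'v) \<Rightarrow> nat \<Rightarrow> int"
  where "wind g j = (if j < r then \<nu> (path_class S g) j else 0)"

lemma path_class_eq: "homotopic_paths S g h \<Longrightarrow> path_class S g = path_class S h"
  unfolding path_class_def by (auto intro: homotopic_paths_trans homotopic_paths_sym)

lemma wind_homotopic: "homotopic_paths S g h \<Longrightarrow> wind g = wind h"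
  by (simp add: fun_eq_iff wind_def path_class_eq)

lemma path_class_join:
  assumes g: "g \<in> loops S x0" and h: "h \<in> loops S x0"
  shows "path_class S g \<otimes>\<^bsub>toric_group L\<^esub> path_class S h = path_class S (g +++ h)"
proof -
  have "path_class S (g' +++ h') = path_class S (g +++ h)" if "g' \<in> path_class S g" "h' \<in> path_class S h" for g' h'
  proof -
    have *: "homotopic_paths S g' g" "homotopic_paths S h' h"
      using that by (auto simp: path_class_def intro: homotopic_paths_sym)
    have "pathfinish g' = pathstart h'"
      using homotopic_paths_imp_pathfinish[OF *(1)] homotopic_paths_imp_pathstart[OF *(2)] g h by (simp add: loops_def)
    then show ?thesis by (intro path_class_eq homotopic_paths_join *)
  qed
  moreover have "g \<in> path_class S g" "h \<in> path_class S h" using g h by (auto simp: path_class_def loops_def)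
  ultimately have "(\<Union>g'\<in>path_class S g. \<Union>h'\<in>path_class S h. path_class S (g' +++ h')) = path_class S (g +++ h)"
    by blast
  then show ?thesis by (simp add: fundamental_group_def)
qed

lemma class_in: "g \<in> loops S x0 \<Longrightarrow> path_class S g \<in> carrier (toric_group L)"
  by (simp add: fundamental_group_def)

lemma loops_join: "g \<in> loops S x0 \<Longrightarrow> h \<in> loops S x0 \<Longrightarrow> g +++ h \<in> loops S x0"
  by (auto simp: loops_def path_image_join)

lemma loops_reverse: "g \<in> loops S x0 \<Longrightarrow> reversepath g \<in> loops S x0"
  by (auto simp: loops_def)

lemma wind_join:
  assumes "g \<in> loops S x0" "h \<in> loops S x0"
  shows "wind (g +++ h) j = wind g j + wind h j"
proof -
  have "\<nu> (path_class S g \<otimes>\<^bsub>toric_group L\<^esub> path_class S h) = \<nu> (path_class S g) \<otimes>\<^bsub>lattice_group r\<^esub> \<nu> (path_class S h)"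
    using epi class_in[OF assms(1)] class_in[OF assms(2)] by (auto simp: epi_def hom_def)
  then show ?thesis by (simp add: path_class_join[OF assms] wind_def)
qed

lemma nu_carrier: "g \<in> loops S x0 \<Longrightarrow> \<nu> (path_class S g) \<in> carrier (lattice_group r)"
  using epi class_in by (auto simp: epi_def hom_def)

lemma wind_zero_iff:
  assumes g: "g \<in> loops S x0"
  shows "(\<forall>j. wind g j = 0) \<longleftrightarrow> path_class S g \<in> kernel (toric_group L) (lattice_group r) \<nu>"
proof -
  have "(\<forall>j. wind g j = 0) \<longleftrightarrow> \<nu> (path_class S g) = (\<lambda>j\<in>{..<r}. 0)"
    using nu_carrier[OF g] by (auto simp: wind_def fun_eq_iff PiE_def extensional_def restrict_def)
  then show ?thesis using class_in[OF g] by (simp add: kernel_def)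
qed

lemma wind_const: "wind (\<lambda>_. x0) j = 0"
proof -
  have c: "(\<lambda>_. x0) \<in> loops S x0"
    using p_E[OF e_E] p_e by (auto simp: loops_def path_def path_image_def pathstart_def pathfinish_def)
  have "(\<lambda>_. x0) +++ (\<lambda>_. x0) = (\<lambda>_. x0)" by (auto simp: joinpaths_def)
  then show ?thesis using wind_join[OF c c, of j] by simp
qed

lemma loop_start: "g \<in> loops S x0 \<Longrightarrow> path g \<and> path_image g \<subseteq> S \<and> pathstart g = x0 \<and> pathfinish g = x0"
  by (simp add: loops_def)

lemma wind_reverse:
  assumes g: "g \<in> loops S x0"
  shows "wind (reversepath g) j = - wind g j"
proof -
  note l = loop_start[OF g]
  have "homotopic_paths S (g +++ reversepath g) (linepath x0 x0)"
    using homotopic_paths_rinv[of g S] l by simp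
  then have "wind (g +++ reversepath g) = wind (linepath x0 x0)" by (rule wind_homotopic)
  moreover have "linepath x0 x0 = (\<lambda>_. x0)" by (auto simp: linepath_def algebra_simps)
  ultimately show ?thesis using wind_join[OF g loops_reverse[OF g], of j] wind_const[of j] by simp
qed

definition epath :: "'e \<Rightarrow> (real \<Rightarrow> 'e) \<Rightarrow> bool"
  where "epath y \<gamma> \<longleftrightarrow> path \<gamma> \<and> path_image \<gamma> \<subseteq> E \<and> \<gamma> 0 = e \<and> \<gamma> 1 = y"

lemma epath_loop: "y \<in> F \<Longrightarrow> epath y \<gamma> \<Longrightarrow> p \<circ> \<gamma> \<in> loops S x0"
  unfolding loops_def epath_def using p_e p_E
  by (auto simp: F_iff pathstart_def pathfinish_def path_image_def intro!: path_continuous_image continuous_on_subset[OF p_cont])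

text \<open>A loop lies in the kernel exactly when its lift at \<open>e\<close> is closed.\<close>

lemma wind_zero_lift:
  assumes g: "g \<in> loops S x0" and k: "epath y k" "\<And>t. t \<in> {0..1} \<Longrightarrow> p (k t) = g t"
  shows "(\<forall>j. wind g j = 0) \<longleftrightarrow> y = e"
  unfolding wind_zero_iff[OF g]
proof
  note kk = k(1)[unfolded epath_def]
  assume "path_class S g \<in> kernel (toric_group L) (lattice_group r) \<nu>"
  then obtain l where l: "l \<in> loops E e" "path_class S g = fundamental_group_map S p (path_class E l)"
    unfolding image_kernel[symmetric] by (auto simp: fundamental_group_def)
  have "l \<in> path_class E l" using l(1) by (auto simp: path_class_def loops_def)
  moreover have pl: "p \<circ> l \<in> path_class S (p \<circ> l)"
    using l(1) p_E by (auto simp: path_class_def loops_def path_image_def intro!: path_continuous_image continuous_on_subset[OF p_cont])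
  ultimately have "p \<circ> l \<in> path_class S g" unfolding l(2) fundamental_group_map_def by blast
  then have "homotopic_paths S g (p \<circ> l)" by (simp add: path_class_def)
  then have "k 1 = l 1"
    by (rule covering_lift_homotopic_finish[OF cov]) (use kk k(2) l(1) in \<open>auto simp: loops_def pathstart_def\<close>)
  then show "y = e" using kk l(1) by (auto simp: loops_def pathfinish_def)
next
  note kk = k(1)[unfolded epath_def]
  assume "y = e"
  then have k_loop: "k \<in> loops E e" using kk by (auto simp: loops_def pathstart_def pathfinish_def)
  have "fundamental_group_map S p (path_class E k) = path_class S g"
  proof -
    have "path_class S (p \<circ> h) = path_class S g" if "h \<in> path_class E k" for h
    proof (rule path_class_eq)
      have "homotopic_paths S (p \<circ> k) (p \<circ> h)"
        using that homotopic_paths_continuous_image[of E k h p S] p_cont p_E by (auto simp: path_class_def)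
      moreover have "homotopic_paths S g (p \<circ> k)"
        by (rule homotopic_paths_eq) (use loop_start[OF g] k(2) in auto)
      ultimately show "homotopic_paths S (p \<circ> h) g" by (meson homotopic_paths_sym homotopic_paths_trans)
    qed
    moreover have "k \<in> path_class E k" using kk by (simp add: path_class_def)
    ultimately show ?thesis unfolding fundamental_group_map_def by blast
  qed
  moreover have "path_class E k \<in> carrier (fundamental_group E e)" using k_loop by (simp add: fundamental_group_def)
  ultimately show "path_class S g \<in> kernel (toric_group L) (lattice_group r) \<nu>" unfolding image_kernel[symmetric] by blast
qed

lemma epath_exists: "y \<in> E \<Longrightarrow> \<exists>\<gamma>. epath y \<gamma>"
  using E_connected e_E unfolding path_connected_def epath_def pathstart_def pathfinish_def by blast

lemma lift_exists:
  assumes "g \<in> loops S x0"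
  obtains y k where "y \<in> F" "epath y k" "\<And>t. t \<in> {0..1} \<Longrightarrow> p (k t) = g t"
proof -
  have g: "path g" "path_image g \<subseteq> S" "p e = g 0" "g 1 = x0" using loop_start[OF assms] p_e by (auto simp: pathstart_def pathfinish_def)
  obtain k where k: "path k" "path_image k \<subseteq> E" "k 0 = e" "\<And>t. t \<in> {0..1} \<Longrightarrow> p (k t) = g t"
    using covering_lift_path[OF cov g(1,2) e_E g(3)] by blast
  have "k 1 \<in> E" using k(2) by (auto simp: path_image_def)
  then have "k 1 \<in> F" using k(4)[of 1] g(4) by (simp add: F_iff)
  then show ?thesis using that[of "k 1" k] k by (simp add: epath_def)
qed

lemma wind_lift: "g \<in> loops S x0 \<Longrightarrow> (\<And>t. t \<in> {0..1} \<Longrightarrow> p (k t) = g t) \<Longrightarrow> wind (p \<circ> k) = wind g"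
  by (rule wind_homotopic, rule homotopic_paths_sym, rule homotopic_paths_eq) (auto dest: loop_start)

text \<open>The loop that runs along \<gamma> and back along \<gamma>' has value 0 under \<nu>
  exactly when its lift at e closes up. By uniqueness of lifts this happens exactly when \<gamma>
  and \<gamma>' end at the same point.\<close>

lemma wind_eq_iff:
  assumes y: "y \<in> F" "epath y \<gamma>" and y': "y' \<in> F" "epath y' \<gamma>'"
  shows "wind (p \<circ> \<gamma>) = wind (p \<circ> \<gamma>') \<longleftrightarrow> y = y'"
proof -
  let ?g = "p \<circ> \<gamma>" and ?h = "p \<circ> \<gamma>'"
  have g: "?g \<in> loops S x0" and h: "?h \<in> loops S x0" using epath_loop assms by auto
  let ?l = "?g +++ reversepath ?h"
  have l: "?l \<in> loops S x0" by (intro loops_join loops_reverse g h)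
  have wl: "wind ?l j = wind ?g j - wind ?h j" for j
    by (simp add: wind_join[OF g loops_reverse[OF h]] wind_reverse[OF h])
  obtain z k where k: "z \<in> F" "epath z k" "\<And>t. t \<in> {0..1} \<Longrightarrow> p (k t) = ?l t" using lift_exists[OF l] by blast
  note kk = k(2)[unfolded epath_def] and yy = y(2)[unfolded epath_def] and yy' = y'(2)[unfolded epath_def]
  have kc: "continuous_on {0..1} k" using kk by (simp add: path_def)
  \<comment> \<open>The first half of the lift is \<gamma>, so it reaches y; if the lift is closed,
    its second half run backwards is \<gamma>'.\<close>
  have half: "k (1 / 2) = y"
  proof -
    have "k ((1 / 2) * t) = \<gamma> t" if "t \<in> {0..1}" for t
    proof (rule covering_lift_path_unique[OF cov _ _ _ _ _ _ _ that, where a = 0])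
      show "path (\<lambda>t. k ((1 / 2) * t))" unfolding path_def
        by (rule continuous_on_compose2[OF kc]) (auto intro!: continuous_intros)
      show "path_image (\<lambda>t. k ((1 / 2) * t)) \<subseteq> E" using kk unfolding path_image_def by (auto simp: image_subset_iff)
      show "p (k ((1 / 2) * s)) = p (\<gamma> s)" if "s \<in> {0..1}" for s
        using that by (subst k(3)) (auto simp: joinpaths_def)
    qed (use kk yy in auto)
    from this[of 1] show ?thesis using yy by simp
  qed
  show ?thesis
  proof
    assume "wind ?g = wind ?h"
    then have "z = e" using wind_zero_lift[OF l k(2,3)] wl by simp
    have "k (1 - (1 / 2) * t) = \<gamma>' t" if "t \<in> {0..1}" for t
    proof (rule covering_lift_path_unique[OF cov _ _ _ _ _ _ _ that, where a = 0])
      show "path (\<lambda>t. k (1 - (1 / 2) * t))" unfolding path_def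
        by (rule continuous_on_compose2[OF kc]) (auto intro!: continuous_intros)
      show "path_image (\<lambda>t. k (1 - (1 / 2) * t)) \<subseteq> E" using kk unfolding path_image_def by (auto simp: image_subset_iff)
      show "p (k (1 - (1 / 2) * s)) = p (\<gamma>' s)" if s: "s \<in> {0..1}" for s
      proof (cases "s = 1")
        case True
        then show ?thesis using half yy' y(1) y'(1) by (simp add: F_iff)
      next
        case False
        then have "\<not> 1 - (1 / 2) * s \<le> 1 / 2" using s by auto
        moreover have "1 - (2 * (1 - (1 / 2) * s) - 1) = s" by (simp add: algebra_simps)
        ultimately show ?thesis using s by (subst k(3)) (auto simp: joinpaths_def reversepath_def)
      qed
    qed (use kk yy' \<open>z = e\<close> in auto)
    from this[of 1] show "y = y'" using half yy' by simp
  next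
    assume "y = y'"
    let ?m = "\<gamma> +++ reversepath \<gamma>'"
    have m: "epath e ?m"
      unfolding epath_def
    proof (intro conjI)
      have "pathfinish \<gamma> = pathstart (reversepath \<gamma>')"
        using yy yy' \<open>y = y'\<close> by (simp add: reversepath_def pathstart_def pathfinish_def)
      then show "path ?m" by (rule path_join_imp[rotated 2]) (use yy yy' in auto)
      show "path_image ?m \<subseteq> E" using path_image_join_subset[of \<gamma> "reversepath \<gamma>'"] yy yy' by auto
    qed (use yy yy' in \<open>auto simp: joinpaths_def reversepath_def\<close>)
    have "p (?m t) = ?l t" for t by (simp add: joinpaths_def reversepath_def)
    then have "\<forall>j. wind ?l j = 0" using wind_zero_lift[OF l m] by simp
    then show "wind ?g = wind ?h" by (auto simp: fun_eq_iff wl)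
  qed
qed

definition mu :: "'e \<Rightarrow> nat \<Rightarrow> int"
  where "mu y = wind (p \<circ> (SOME \<gamma>. epath y \<gamma>))"

lemma some_epath: "y \<in> F \<Longrightarrow> epath y (SOME \<gamma>. epath y \<gamma>)"
  using someI_ex[OF epath_exists] by (simp add: F_iff)

lemma mu_eq: "y \<in> F \<Longrightarrow> epath y \<gamma> \<Longrightarrow> mu y = wind (p \<circ> \<gamma>)"
  unfolding mu_def using wind_eq_iff[OF _ some_epath, of y y \<gamma>] some_epath wind_eq_iff by blast

text \<open>Injectivity is \<open>wind_eq_iff\<close>. For surjectivity, a lattice point is \<nu> of
  some loop because \<nu> is onto, and the end point of the lifted loop has this coordinate.\<close>

lemma mu_bij: "bij_betw mu F (grp (lattice_mod r))"
proof (rule bij_betw_imageI)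
  show "inj_on mu F"
    using wind_eq_iff[OF _ some_epath _ some_epath] by (auto simp: inj_on_def mu_def)
  have "mu y \<in> grp (lattice_mod r)" for y by (auto simp: mu_def wind_def grp_def)
  moreover have "n \<in> mu ` F" if n: "n \<in> grp (lattice_mod r)" for n
  proof -
    have n0: "n j = 0" if "\<not> j < r" for j using n that by (auto simp: grp_def dest: spec[of _ j])
    have "restrict n {..<r} \<in> carrier (lattice_group r)" by auto
    moreover have "\<nu> ` carrier (toric_group L) = carrier (lattice_group r)" using epi by (simp add: epi_def)
    ultimately have "restrict n {..<r} \<in> \<nu> ` carrier (toric_group L)" by simp
    then obtain c where "c \<in> carrier (toric_group L)" "\<nu> c = restrict n {..<r}" by auto
    then obtain g where g: "g \<in> loops S x0" "\<nu> (path_class S g) = restrict n {..<r}"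
      by (auto simp: fundamental_group_def)
    obtain y k where k: "y \<in> F" "epath y k" "\<And>t. t \<in> {0..1} \<Longrightarrow> p (k t) = g t" using lift_exists[OF g(1)] by blast
    have "mu y = wind g" using mu_eq[OF k(1,2)] wind_lift[OF g(1) k(3)] by simp
    also have "\<dots> = n" by (auto simp: wind_def g(2) fun_eq_iff n0)
    finally show ?thesis using k(1) by blast
  qed
  ultimately show "mu ` F = grp (lattice_mod r)" by blast
qed

definition gens :: "'v \<Rightarrow> nat \<Rightarrow> int"
  where "gens v j = (if j < r then \<nu> (toric_generator L v) j else 0)"

lemma F_lk: "y \<in> F \<Longrightarrow> y \<in> EK (lk L v)"
  using complex by (auto simp: EK_def lk_def simplicial_complex_def)

lemma tau_F: "y \<in> F \<Longrightarrow> \<tau> v y \<in> F"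
  using complex by (intro tau_EK F_lk) (auto simp: simplicial_complex_def)

lemma flow_loop:
  fixes v :: 'v
  assumes y: "y \<in> F"
  defines "f \<equiv> \<lambda>t. flow v (y, t)"
  shows "path f" "path_image f \<subseteq> E" "f 0 = y" "p \<circ> f \<in> loops S x0" "path_class S (p \<circ> f) = toric_generator L v"
proof -
  note lk = F_lk[OF y, of v]
  show f: "path f" "path_image f \<subseteq> E" "f 0 = y"
    using flow_path_cont[OF lk, of "{0..1}" "\<lambda>t. t"] flow_E[OF lk] flow_0[OF lk]
    by (auto simp: f_def path_def path_image_def)
  have pf: "p (f t) = (\<chi> w. if w = v then cis (2 * pi * t) else 1)" if "t \<in> {0..1}" for t
    using p_flow[OF lk that] y by (simp add: f_def F_iff vec_eq_iff toric_basepoint_def)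
  show fl: "p \<circ> f \<in> loops S x0"
    unfolding loops_def
  proof (intro CollectI conjI)
    show "path (p \<circ> f)" by (rule path_continuous_image[OF f(1) continuous_on_subset[OF p_cont f(2)]])
    show "path_image (p \<circ> f) \<subseteq> S" using f(2) p_E by (auto simp: path_image_def)
    show "pathstart (p \<circ> f) = x0" using f(3) y by (simp add: pathstart_def F_iff)
    show "pathfinish (p \<circ> f) = x0" using tau_F[OF y, of v] by (simp add: pathfinish_def F_iff f_def)
  qed
  have "homotopic_paths S (p \<circ> f) (\<lambda>t. \<chi> w. if w = v then cis (2 * pi * t) else 1)"
    by (rule homotopic_paths_eq) (use loop_start[OF fl] pf in auto)
  then show "path_class S (p \<circ> f) = toric_generator L v" unfolding toric_generator_def by (rule path_class_eq)
qed

lemma e_F: "e \<in> F"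
  using e_E p_e by (simp add: F_iff)

lemma nu_generator: "\<nu> (toric_generator L v) \<in> carrier (lattice_group r)"
  using nu_carrier[OF flow_loop(4)[OF e_F, of v]] flow_loop(5)[OF e_F, of v] by simp

text \<open>Continuing a path to y by the flow of v appends the generator v to the projected
  loop.\<close>

lemma mu_tau:
  assumes y: "y \<in> F"
  shows "mu (\<tau> v y) j = mu y j + gens v j"
proof -
  obtain \<gamma> where \<gamma>: "epath y \<gamma>" using epath_exists y by (auto simp: F_iff)
  define f where "f = (\<lambda>t. flow v (y, t))"
  note f = flow_loop[OF y, of v, folded f_def]
  have "wind (p \<circ> f) = gens v" by (simp add: wind_def gens_def f(5) fun_eq_iff)
  moreover have "epath (\<tau> v y) (\<gamma> +++ f)"
    unfolding epath_def
  proof (intro conjI)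
    have e: "path \<gamma>" "path_image \<gamma> \<subseteq> E" "\<gamma> 0 = e" "\<gamma> 1 = y" using \<gamma> by (auto simp: epath_def)
    have "f 0 = y" using f(3) by (simp add: f_def)
    then show "path (\<gamma> +++ f)" using e f by (intro path_join_imp) (auto simp: pathstart_def pathfinish_def)
    show "path_image (\<gamma> +++ f) \<subseteq> E" using path_image_join_subset[of \<gamma> f] e f by auto
  qed (use \<gamma> in \<open>auto simp: joinpaths_def epath_def f_def\<close>)
  then have "mu (\<tau> v y) = wind (p \<circ> (\<gamma> +++ f))" by (rule mu_eq[OF tau_F[OF y]])
  ultimately show ?thesis
    using wind_join[OF epath_loop[OF y \<gamma>] f(4), of j] mu_eq[OF y \<gamma>] by (simp add: path_compose_join)
qed

definition fibre :: "(nat \<Rightarrow> int) \<Rightarrow> 'e"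
  where "fibre = inv_into F mu"

end


section \<open>Topological finiteness, coordinates of the image of \<nu>^*, and the final
  equivalence\<close>

lemma lin_closed_field_chains: "lin_closed pm_scale (field_chains i X :: (((nat \<Rightarrow> real) \<Rightarrow> 'a) \<Rightarrow>\<^sub>0 'k::field) set)"
  unfolding lin_closed_def
proof (intro conjI ballI allI)
  fix a b :: "((nat \<Rightarrow> real) \<Rightarrow> 'a) \<Rightarrow>\<^sub>0 'k" assume "a \<in> field_chains i X" "b \<in> field_chains i X"
  then show "a + b \<in> field_chains i X" using Poly_Mapping.keys_add[of a b] by (auto simp: field_chains_def)
next
  fix t and a :: "((nat \<Rightarrow> real) \<Rightarrow> 'a) \<Rightarrow>\<^sub>0 'k" assume "a \<in> field_chains i X"
  then show "pm_scale t a \<in> field_chains i X" using keys_pm_scale[of t a] by (auto simp: field_chains_def)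
qed (simp add: field_chains_def)

lemma field_boundary_scale: "field_boundary i (pm_scale t a) = pm_scale t (field_boundary i a)"
  by (simp add: field_boundary_kext kext_scale)

lemma lin_closed_field_cycles: "lin_closed pm_scale {c \<in> field_chains i X. field_boundary i c = (0 :: _ \<Rightarrow>\<^sub>0 'k::field)}"
  using lin_closed_field_chains[of i X, where 'k = 'k] unfolding lin_closed_def
  by (auto simp: field_boundary_add field_boundary_scale)

lemma lin_closed_field_boundaries:
  fixes X :: "'a topology"
  shows "lin_closed pm_scale (field_boundary (Suc i) ` field_chains (Suc i) X :: (_ \<Rightarrow>\<^sub>0 'k::field) set)"
  unfolding lin_closed_def
proof (intro conjI ballI allI)
  note c = lin_closedD[OF lin_closed_field_chains[of "Suc i" X, where 'k = 'k]]
  show "0 \<in> field_boundary (Suc i) ` field_chains (Suc i) X" using c(1) by (intro image_eqI[of _ _ 0]) auto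
  fix a :: "((nat \<Rightarrow> real) \<Rightarrow> 'a) \<Rightarrow>\<^sub>0 'k" and t assume a: "a \<in> field_boundary (Suc i) ` field_chains (Suc i) X"
  then show "pm_scale t a \<in> field_boundary (Suc i) ` field_chains (Suc i) X"
    by (auto simp: field_boundary_scale[symmetric] intro!: imageI c(3))
  fix b :: "((nat \<Rightarrow> real) \<Rightarrow> 'a) \<Rightarrow>\<^sub>0 'k" assume b: "b \<in> field_boundary (Suc i) ` field_chains (Suc i) X"
  with a show "a + b \<in> field_boundary (Suc i) ` field_chains (Suc i) X"
    by (auto simp: field_boundary_add[symmetric] intro!: imageI c(2))
qed

lemma homology_dim_finite_iff:
  "homology_dim TYPE('k::field) i X < \<infinity> \<longleftrightarrow>
    fin_quot pm_scale {c \<in> field_chains i X. field_boundary i c = (0 :: _ \<Rightarrow>\<^sub>0 'k)} (field_boundary (Suc i) ` field_chains (Suc i) X)"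
  unfolding homology_dim_def
  by (rule quotient_dim_finite_iff[OF lin_closed_field_cycles lin_closed_field_boundaries])
    (use field_boundary_chains_Suc field_boundary_boundary[where p = "Suc i"] in auto)

text \<open>A path from e to y is a singular 1-simplex whose boundary is the difference of the two
  points, so one point spans.\<close>

lemma homology_dim_0_path_connected:
  fixes E :: "'e::topological_space set"
  assumes E: "path_connected E" and e: "e \<in> E"
  shows "homology_dim TYPE('k::field) 0 (top_of_set E) < \<infinity>"
  unfolding homology_dim_finite_iff
proof (rule fin_quotI[where I = "{()}" and f = "\<lambda>_. single (restrict (\<lambda>_. e) (standard_simplex 0)) 1"])
  let ?c = "\<lambda>y. restrict (\<lambda>_. y) (standard_simplex 0)"
  let ?B = "field_boundary (Suc 0) ` field_chains (Suc 0) (top_of_set E) :: (((nat \<Rightarrow> real) \<Rightarrow> 'e) \<Rightarrow>\<^sub>0 'k) set"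
  have eu: "powertop_real UNIV = (euclidean :: (nat \<Rightarrow> real) topology)" by (simp add: euclidean_product_topology)
  have B: "single (?c y) 1 - single (?c e) 1 \<in> ?B" if y: "y \<in> E" for y
  proof -
    obtain \<gamma> where \<gamma>: "path \<gamma>" "path_image \<gamma> \<subseteq> E" "\<gamma> 0 = e" "\<gamma> 1 = y"
      using E e y unfolding path_connected_def pathstart_def pathfinish_def by blast
    define f where "f = restrict (\<lambda>x. \<gamma> (x 1)) (standard_simplex 1)"
    have x1: "x 1 \<in> {0..1}" if "x \<in> standard_simplex 1" for x using that by (auto simp: standard_simplex_def)
    have "continuous_on (standard_simplex 1) (\<lambda>x. \<gamma> (x 1))"
      by (rule continuous_on_compose2[OF \<gamma>(1)[unfolded path_def]]) (use x1 in \<open>auto intro: continuous_on_subset[OF continuous_on_product_coordinates]\<close>)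
    then have "continuous_on (standard_simplex 1) f" by (simp add: f_def cong: continuous_on_cong)
    moreover have "f \<in> standard_simplex 1 \<rightarrow> E" using \<gamma>(2) x1 by (auto simp: f_def path_image_def)
    ultimately have f: "singular_simplex (Suc 0) (top_of_set E) f"
      unfolding singular_simplex_def eu by (auto simp: continuous_map_in_subtopology f_def)
    have v: "x 0 = 1" if "x \<in> standard_simplex 0" for x using that by (auto simp: standard_simplex_0)
    have face0: "singular_face (Suc 0) 0 f = ?c y"
    proof
      fix x
      have "simplical_face 0 x \<in> standard_simplex 1" if "x \<in> standard_simplex 0"
        using simplical_face_in_standard_simplex[of 1 0 x] that by simp
      then show "singular_face (Suc 0) 0 f x = ?c y x"
        using v[of x] \<gamma>(4) by (auto simp: singular_face_def f_def simplical_face_def)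
    qed
    have face1: "singular_face (Suc 0) 1 f = ?c e"
    proof
      fix x
      have "simplical_face 1 x \<in> standard_simplex 1" if "x \<in> standard_simplex 0"
        using simplical_face_in_standard_simplex[of 1 1 x] that by simp
      then show "singular_face (Suc 0) 1 f x = ?c e x"
        using \<gamma>(3) by (auto simp: singular_face_def f_def simplical_face_def)
    qed
    have "field_boundary (Suc 0) (single f (1::'k)) = single (?c y) 1 - single (?c e) 1"
      using face0 face1 by (simp add: field_boundary_def single_uminus)
    moreover have "single f (1::'k) \<in> field_chains (Suc 0) (top_of_set E)" using f by (simp add: field_chains_def)
    ultimately show ?thesis by (metis imageI)
  qed
  fix u :: "((nat \<Rightarrow> real) \<Rightarrow> 'e) \<Rightarrow>\<^sub>0 'k" assume u: "u \<in> {c \<in> field_chains 0 (top_of_set E). field_boundary 0 c = 0}"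
  have s: "single s 1 - single (?c e) (1::'k) \<in> ?B" if "s \<in> keys u" for s
  proof -
    have ss: "singular_simplex 0 (top_of_set E) s" using u that by (auto simp: field_chains_def)
    then have "s (\<lambda>j. if j = 0 then 1 else 0) \<in> E"
      by (auto simp: singular_simplex_def continuous_map_in_subtopology standard_simplex_0)
    moreover have "s = ?c (s (\<lambda>j. if j = 0 then 1 else 0))"
    proof
      fix x show "s x = ?c (s (\<lambda>j. if j = 0 then 1 else 0)) x"
        using ss by (cases "x = (\<lambda>j. if j = 0 then 1 else 0)") (auto simp: singular_simplex_def standard_simplex_0 extensional_def)
    qed
    ultimately show ?thesis using B[of "s (\<lambda>j. if j = 0 then 1 else 0)"] by simp
  qed
  define t where "t = (\<Sum>s\<in>keys u. lookup u s)"
  have "u - pm_scale t (single (?c e) 1) = lin (\<lambda>s. single s 1 - single (?c e) 1) u"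
  proof -
    have "lin (\<lambda>s. single (?c e) 1) u = pm_scale t (single (?c e) 1)"
      unfolding lin_def t_def by (simp only: pm.scale_sum_left)
    then show ?thesis by (simp add: lin_fun_diff)
  qed
  also have "\<dots> \<in> ?B"
    unfolding lin_def by (intro lin_closed_sum[OF lin_closed_field_boundaries] lin_closedD(3)[OF lin_closed_field_boundaries] s)
  finally show "\<exists>a. u - (\<Sum>i\<in>{()}. pm_scale (a i) (single (?c e) 1)) \<in> ?B" by (intro exI[of _ "\<lambda>_. t"]) simp
qed simp

context toric_cover_fibre
begin

lemma homology_finite_iff_hfin:
  assumes "koszul xo X"
  shows "homology_dim TYPE('k) i (top_of_set E) < \<infinity> \<longleftrightarrow> hfin xo X L i"
proof -
  interpret koszul xo X by (rule assms)
  let ?U = "{c \<in> field_chains i (top_of_set E). field_boundary i c = (0 :: _ \<Rightarrow>\<^sub>0 'k)}"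
    and ?B = "field_boundary (Suc i) ` field_chains (Suc i) (top_of_set E) :: (_ \<Rightarrow>\<^sub>0 'k) set"
  have plus: "Phi (a + b) = Phi a + Phi b" for a b by (simp add: plus_fun_def Phi_add)
  have scl: "Phi (fsc t c) = pm_scale t (Phi c)" for t c by (simp add: Phi_def fsc_def lin_scale pm.scale_sum_right)
  have in_U: "Phi d \<in> ?U" if "d \<in> cyc xo X L i" for d
    using that Phi_chains[OF order_refl L_down, of d i] Phi_boundary[of d i] by (simp add: cyc_def EK_L)
  show ?thesis
    unfolding homology_dim_finite_iff hfin_def
  proof
    assume fin: "fin_quot pm_scale ?U ?B"
    show "fin_quot fsc (cyc xo X L i) (bds xo X L i)"
    proof (rule fin_quot_injective[where \<phi> = Phi, OF vector_space_fsc pm_vector_space lin_closed_cyc lin_closed_field_boundaries plus scl fin in_U])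
      fix d assume "d \<in> cyc xo X L i" "Phi d \<in> ?B"
      then show "d \<in> bds xo X L i" using Phi_boundaries_reflect[of d i] by (auto simp: cyc_def bds_def)
    qed
  next
    assume fin: "fin_quot fsc (cyc xo X L i) (bds xo X L i)"
    show "fin_quot pm_scale ?U ?B"
    proof (rule fin_quot_surjective[where \<phi> = Phi, OF vector_space_fsc lin_closedD(2)[OF lin_closed_field_boundaries] plus scl fin])
      fix b assume "b \<in> bds xo X L i"
      then obtain c where c: "c \<in> kchains L (Suc i) (pm_on X)" "b = cbd xo c" by (auto simp: bds_def)
      have "Phi b = field_boundary (Suc i) (Phi c)" by (simp add: Phi_boundary[OF c(1)] c(2))
      moreover have "Phi c \<in> field_chains (Suc i) (top_of_set E)" using Phi_chains[OF order_refl L_down c(1)] by (simp add: EK_L)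
      ultimately show "Phi b \<in> ?B" by blast
    next
      fix u assume "u \<in> ?U"
      then obtain d f where "d \<in> kchains L i N" "cbd xo d = (\<lambda>_. 0)" "f \<in> fch (Suc i) E" "u - Phi d = field_boundary (Suc i) f"
        using Phi_cycles_onto[of u i] by auto
      then show "\<exists>d\<in>cyc xo X L i. u - Phi d \<in> ?B" by (intro bexI[of _ d]) (auto simp: cyc_def)
    qed
  qed
qed

end

text \<open>For empty W the differential vanishes, and the empty face carries a nonzero class of
  degree 0.\<close>

lemma not_kexact_empty:
  fixes K :: "'v::finite set set"
  assumes "{} \<in> K"
  shows "\<not> kexact (unit_ops {}) (UNIV :: 'k::field set) K 0"
proof
  assume ex: "kexact (unit_ops {}) (UNIV :: 'k set) K 0"
  let ?c = "\<lambda>\<sigma> :: 'v set. if \<sigma> = {} then 1 else (0::'k)"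
  have z: "cbd (unit_ops {}) c = (\<lambda>_. 0)" for c :: "'v set \<Rightarrow> 'k" by (rule ext) (simp add: cbd_def unit_ops_def)
  have "?c \<in> kchains K 0 UNIV" using assms by (auto simp: kchains_def)
  then obtain b where b: "cbd (unit_ops {}) b = ?c" using ex[unfolded kexact_def, rule_format, of ?c] z[of ?c] by auto
  show False using fun_cong[OF b, of "{}"] by (simp add: z)
qed

lemma coordinate_subspace_iff: "coordinate_subspace W = {x. \<forall>v. v \<notin> W \<longrightarrow> x $ v = 0}"
proof (intro subset_antisym subsetI)
  fix x assume "x \<in> {x :: rat ^ 'a. \<forall>v. v \<notin> W \<longrightarrow> x $ v = 0}"
  then have "x = (\<Sum>v\<in>W. x $ v *s axis v 1)"
    by (auto simp: vec_eq_iff axis_def if_distrib cong: if_cong)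
  also have "\<dots> \<in> coordinate_subspace W"
    unfolding coordinate_subspace_def by (intro vec.span_sum vec.span_scale vec.span_base) auto
  finally show "x \<in> coordinate_subspace W" .
next
  have sub: "vec.subspace {x :: rat ^ 'a. \<forall>v. v \<notin> W \<longrightarrow> x $ v = 0}" by (auto simp: vec.subspace_def)
  have gen: "(\<lambda>v. axis v 1) ` W \<subseteq> {x :: rat ^ 'a. \<forall>v. v \<notin> W \<longrightarrow> x $ v = 0}" by (auto simp: axis_def)
  fix x assume "x \<in> coordinate_subspace W"
  then show "x \<in> {x :: rat ^ 'a. \<forall>v. v \<notin> W \<longrightarrow> x $ v = 0}"
    using vec.span_minimal[OF gen sub] by (auto simp: coordinate_subspace_def)
qed

lemma hom_lattice_rational:
  assumes \<phi>: "\<phi> \<in> hom (lattice_group r) rational_group"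
  obtains c where "\<And>x. x \<in> carrier (lattice_group r) \<Longrightarrow> \<phi> x = (\<Sum>j<r. c j * of_int (x j))"
proof -
  define \<psi> where "\<psi> = (\<lambda>g. \<phi> (restrict g {..<r}))"
  have add: "\<psi> (\<lambda>j. g j + h j) = \<psi> g + \<psi> h" for g h
  proof -
    have "restrict g {..<r} \<in> carrier (lattice_group r)" "restrict h {..<r} \<in> carrier (lattice_group r)" by auto
    from hom_mult[OF \<phi> this]
    have "\<phi> (restrict g {..<r} \<otimes>\<^bsub>lattice_group r\<^esub> restrict h {..<r}) = \<psi> g + \<psi> h"
      unfolding \<psi>_def by (simp add: rational_group_def)
    moreover have "restrict g {..<r} \<otimes>\<^bsub>lattice_group r\<^esub> restrict h {..<r} = restrict (\<lambda>j. g j + h j) {..<r}"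
      by (auto simp: fun_eq_iff)
    ultimately show ?thesis by (simp add: \<psi>_def)
  qed
  have zero: "\<psi> (\<lambda>_. 0) = 0" using add[of "\<lambda>_. 0" "\<lambda>_. 0"] by simp
  have neg: "\<psi> (\<lambda>j. - g j) = - \<psi> g" for g using add[of g "\<lambda>j. - g j"] zero by (simp add: eq_neg_iff_add_eq_0 add.commute)
  have nat: "\<psi> (\<lambda>j. int k * g j) = of_nat k * \<psi> g" for k g
  proof (induction k)
    case (Suc k)
    have "\<psi> (\<lambda>j. int (Suc k) * g j) = \<psi> (\<lambda>j. g j + int k * g j)" by (simp add: algebra_simps)
    then show ?case using Suc by (simp add: add algebra_simps)
  qed (simp add: zero)
  have scl: "\<psi> (\<lambda>j. m * g j) = of_int m * \<psi> g" for m g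
  proof (cases "m \<ge> 0")
    case True then show ?thesis using nat[of "nat m" g] by simp
  next
    case False then show ?thesis using nat[of "nat (- m)" g] neg[of "\<lambda>j. m * g j"] by simp
  qed
  have sm: "\<psi> (\<lambda>i. \<Sum>j\<in>J. f j i) = (\<Sum>j\<in>J. \<psi> (f j))" for f and J :: "nat set"
    by (induction J rule: infinite_finite_induct) (simp_all add: zero add)
  define c where "c = (\<lambda>j. \<psi> (\<lambda>i. if i = j then 1 else 0))"
  have "\<phi> x = (\<Sum>j<r. c j * of_int (x j))" if x: "x \<in> carrier (lattice_group r)" for x
  proof -
    have "\<phi> x = \<psi> x" using x by (simp add: \<psi>_def PiE_def extensional_restrict)
    also have "\<dots> = \<psi> (\<lambda>i. \<Sum>j<r. x j * (if i = j then 1 else 0))"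
    proof -
      have "restrict x {..<r} = restrict (\<lambda>i. \<Sum>j<r. x j * (if i = j then 1 else 0)) {..<r}"
        by (auto simp: fun_eq_iff if_distrib cong: if_cong)
      then show ?thesis by (simp add: \<psi>_def)
    qed
    also have "\<dots> = (\<Sum>j<r. c j * of_int (x j))" unfolding sm by (simp add: scl c_def mult.commute)
    finally show ?thesis .
  qed
  then show ?thesis using that by blast
qed

lemma lattice_hom: "(\<lambda>x. \<Sum>j<r. c j * of_int (x j)) \<in> hom (lattice_group r) rational_group"
  by (auto simp: hom_def rational_group_def algebra_simps sum.distrib[symmetric] intro!: sum.cong)

context toric_kernel_cover
begin

lemma homology_finite_iff:
  "homology_dim TYPE('k::field) i (top_of_set E) < \<infinity> \<longleftrightarrow>
    hfin (qops (lattice_mod r) {} gens :: _ \<Rightarrow> (_ \<Rightarrow>\<^sub>0 'k) \<Rightarrow> _) (grp (lattice_mod r)) L i"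
proof -
  let ?T = "\<lambda>v. tr (lattice_mod r) (gens v)"
  have inv: "fibre (mu y) = y" if "y \<in> F" for y
    unfolding fibre_def using mu_bij that by (intro inv_into_f_f) (auto simp: bij_betw_def)
  have fF: "fibre x \<in> F" "mu (fibre x) = x" if "x \<in> grp (lattice_mod r)" for x
    using mu_bij that unfolding fibre_def bij_betw_def by (auto intro: inv_into_into f_inv_into_f)
  interpret fb: toric_cover_fibre L E p "grp (lattice_mod r)" ?T fibre "TYPE('k)"
  proof unfold_locales
    show "bij_betw fibre (grp (lattice_mod r)) F" unfolding fibre_def by (rule bij_betw_inv_into[OF mu_bij])
    show "?T v x \<in> grp (lattice_mod r)" for v x by (rule tr_grp)
    show "?T v (?T w x) = ?T w (?T v x)" for v w x by (rule tr_commute)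
    fix x v assume x: "x \<in> grp (lattice_mod r)"
    have "mu (\<tau> v (fibre x)) = ?T v x"
    proof
      fix j
      have "x j mod lattice_mod r j = x j" using x by (simp add: grp_def)
      then show "mu (\<tau> v (fibre x)) j = ?T v x j"
        using mu_tau[OF fF(1)[OF x], of v j] by (auto simp: fF(2)[OF x] tr_def gens_def split: if_splits)
    qed
    then show "fibre (?T v x) = \<tau> v (fibre x)" using inv[OF tau_F[OF fF(1)[OF x]], of v] by simp
  qed
  have ops: "shift_op ?T = (qops (lattice_mod r) {} gens :: _ \<Rightarrow> (_ \<Rightarrow>\<^sub>0 'k) \<Rightarrow> _)"
    by (auto simp: fun_eq_iff shift_op_def qops_def push_def)
  show ?thesis
    using fb.homology_finite_iff_hfin[of i, unfolded ops, OF koszul_qops] .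
qed

text \<open>Rational functionals are scaled to integral ones so that
  \<open>functional_zero_of_hfin\<close> applies. Conversely the condition yields
  \<open>rat_spans\<close> off each W whose unit complex is not exact up to degree q, as required by
  \<open>hfin_of_spanning\<close>.\<close>

lemma finite_homology_iff_resonance:
  "(\<forall>i\<le>q. homology_dim TYPE('k::field) i (top_of_set E) < \<infinity>) \<longleftrightarrow>
    (\<forall>W. (\<exists>i\<le>q. \<not> kexact (unit_ops W) (UNIV :: 'k set) L i) \<longrightarrow>
      (\<forall>c :: nat \<Rightarrow> rat. (\<forall>v. v \<notin> W \<longrightarrow> (\<Sum>j<r. c j * of_int (gens v j)) = 0) \<longrightarrow> (\<forall>v. (\<Sum>j<r. c j * of_int (gens v j)) = 0)))"
  (is "?fin \<longleftrightarrow> ?res")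
proof -
  have vanish: "\<forall>j<r. c j = 0"
    if fin: "\<And>l. l \<le> i \<Longrightarrow> homology_dim TYPE('k) l (top_of_set E) < \<infinity>" and W: "\<not> kexact (unit_ops W) (UNIV :: 'k set) L i"
      and c: "\<And>v. v \<notin> W \<Longrightarrow> (\<Sum>j<r. c j * of_int (gens v j)) = 0" for i W and c :: "nat \<Rightarrow> rat"
  proof (intro allI impI)
    fix j0 assume j0: "j0 < r"
    obtain M where M: "M > 0" "\<And>j. j < r \<Longrightarrow> \<exists>k::int. c j * of_int M = of_int k" using common_denominator[of "{..<r}" c] by auto
    then have "\<forall>j. \<exists>k::int. j < r \<longrightarrow> c j * of_int M = of_int k" by blast
    from choice[OF this] obtain k where k: "\<And>j. j < r \<Longrightarrow> c j * of_int M = of_int (k j)" by blast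
    have "(\<Sum>j<r. k j * gens v j) = 0" if v: "v \<notin> W" for v
    proof -
      have "(of_int (\<Sum>j<r. k j * gens v j) :: rat) = (\<Sum>j<r. c j * of_int M * of_int (gens v j))" by (simp add: k)
      also have "\<dots> = of_int M * (\<Sum>j<r. c j * of_int (gens v j))" by (simp add: sum_distrib_left algebra_simps)
      also have "\<dots> = of_int 0" using c[OF v] by simp
      finally show ?thesis by (simp only: of_int_eq_iff)
    qed
    then have "k j0 = 0"
      using functional_zero_of_hfin[where 'k = 'k, OF L_down fin[unfolded homology_finite_iff] W _ j0] by blast
    then show "c j0 = 0" using k[OF j0] M(1) by simp
  qed
  show ?thesis
  proof
    assume ?fin
    then have fin: "homology_dim TYPE('k) l (top_of_set E) < \<infinity>" if "l \<le> i" "i \<le> q" for l i using that by simp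
    show ?res
    proof (intro allI impI, elim exE conjE)
      fix W v i and c :: "nat \<Rightarrow> rat"
      assume *: "\<forall>v. v \<notin> W \<longrightarrow> (\<Sum>j<r. c j * of_int (gens v j)) = 0" "i \<le> q" "\<not> kexact (unit_ops W) (UNIV :: 'k set) L i"
      have "\<forall>j<r. c j = 0" by (rule vanish[OF fin[OF _ *(2)] *(3)]) (use *(1) in auto)
      then show "(\<Sum>j<r. c j * of_int (gens v j)) = 0" by simp
    qed
  next
    assume res: ?res
    \<comment> \<open>Injectivity of \<nu>^* in coordinates. It is obtained from
      \<open>vanish\<close> for empty W in degree 0, where finiteness holds since the cover is
      connected; no presentation of the fundamental group enters.\<close>
    have all: "\<forall>j<r. c j = 0" if c: "\<And>v. (\<Sum>j<r. c j * of_int (gens v j)) = 0" for c :: "nat \<Rightarrow> rat"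
    proof (rule vanish[of 0 "{}"])
      show "homology_dim TYPE('k) l (top_of_set E) < \<infinity>" if "l \<le> 0" for l
        using homology_dim_0_path_connected[OF E_connected e_E] that by simp
      show "\<not> kexact (unit_ops {}) (UNIV :: 'k set) L 0"
        by (rule not_kexact_empty) (use complex in \<open>simp add: simplicial_complex_def\<close>)
    qed (use c in auto)
    show ?fin
      unfolding homology_finite_iff
    proof (intro allI impI)
      fix i assume i: "i \<le> q"
      show "hfin (qops (lattice_mod r) {} gens :: _ \<Rightarrow> (_ \<Rightarrow>\<^sub>0 'k) \<Rightarrow> _) (grp (lattice_mod r)) L i"
      proof (rule hfin_of_spanning[OF L_down _ _ i])
        show "gens v j = 0" if "j \<ge> r" for v j using that by (simp add: gens_def)
        show "rat_spans r gens (- W)" if "l \<le> q" "\<not> kexact (unit_ops W) (UNIV :: 'k set) L l" for W l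
          unfolding rat_spans_def using res that all by (metis ComplI)
      qed
    qed
  qed
qed

lemma resonance_iff:
  "H1_image L r \<nu> \<inter> coordinate_subspace W = {0} \<longleftrightarrow>
    (\<forall>c :: nat \<Rightarrow> rat. (\<forall>v. v \<notin> W \<longrightarrow> (\<Sum>j<r. c j * of_int (gens v j)) = 0) \<longrightarrow> (\<forall>v. (\<Sum>j<r. c j * of_int (gens v j)) = 0))"
proof -
  have coords: "H1_image L r \<nu> = (\<lambda>c :: nat \<Rightarrow> rat. \<chi> v. \<Sum>j<r. c j * of_int (gens v j)) ` UNIV"
  proof (intro subset_antisym subsetI)
    fix x assume "x \<in> H1_image L r \<nu>"
    then obtain \<phi> where \<phi>: "\<phi> \<in> hom (lattice_group r) rational_group" "x = H1_coords L (\<phi> \<circ> \<nu>)" by (auto simp: H1_image_def)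
    obtain c where c: "\<And>x. x \<in> carrier (lattice_group r) \<Longrightarrow> \<phi> x = (\<Sum>j<r. c j * of_int (x j))"
      using hom_lattice_rational[OF \<phi>(1)] by blast
    have "x = (\<chi> v. \<Sum>j<r. c j * of_int (gens v j))"
      using c[OF nu_generator] by (simp add: \<phi>(2) H1_coords_def vec_eq_iff gens_def)
    then show "x \<in> (\<lambda>c :: nat \<Rightarrow> rat. \<chi> v. \<Sum>j<r. c j * of_int (gens v j)) ` UNIV" by blast
  next
    fix x assume "x \<in> (\<lambda>c :: nat \<Rightarrow> rat. \<chi> v. \<Sum>j<r. c j * of_int (gens v j)) ` UNIV"
    then obtain c :: "nat \<Rightarrow> rat" where "x = (\<chi> v. \<Sum>j<r. c j * of_int (gens v j))" by blast
    then have "x = H1_coords L ((\<lambda>x. \<Sum>j<r. c j * of_int (x j)) \<circ> \<nu>)"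
      by (simp add: H1_coords_def vec_eq_iff gens_def)
    then show "x \<in> H1_image L r \<nu>" unfolding H1_image_def using lattice_hom[of c r] by blast
  qed
  have "(0 :: rat ^ 'v) \<in> H1_image L r \<nu>"
    unfolding coords by (rule image_eqI[of _ _ "\<lambda>_. 0"]) (simp_all add: vec_eq_iff)
  then have "(0 :: rat ^ 'v) \<in> H1_image L r \<nu> \<inter> coordinate_subspace W" by (simp add: coordinate_subspace_iff)
  then have "H1_image L r \<nu> \<inter> coordinate_subspace W = {0} \<longleftrightarrow>
      (\<forall>x\<in>H1_image L r \<nu>. x \<in> coordinate_subspace W \<longrightarrow> x = 0)" by blast
  also have "\<dots> \<longleftrightarrow> (\<forall>c :: nat \<Rightarrow> rat. (\<forall>v. v \<notin> W \<longrightarrow> (\<Sum>j<r. c j * of_int (gens v j)) = 0) \<longrightarrow> (\<forall>v. (\<Sum>j<r. c j * of_int (gens v j)) = 0))"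
    unfolding coords coordinate_subspace_iff by (simp add: vec_eq_iff)
  finally show ?thesis .
qed

end

theorem theorem15p2:
  fixes L :: "'v::finite set set"
    and r q :: nat
    and \<nu> :: "(real \<Rightarrow> complex ^ 'v) set \<Rightarrow> nat \<Rightarrow> int"
    and E :: "'e::topological_space set" and e :: 'e and p :: "'e \<Rightarrow> complex ^ 'v"
  assumes "simplicial_complex L"
    and "r \<ge> 1"
    and "\<nu> \<in> epi (toric_group L) (lattice_group r)"
    and "covering_of_subgroup E e p (toric_complex L) toric_basepoint
           (kernel (toric_group L) (lattice_group r) \<nu>)"
  shows "(\<forall>i\<le>q. homology_dim TYPE('k::field) i (top_of_set E) < \<infinity>) \<longleftrightarrow>
    (\<forall>W. (\<exists>i\<le>q. SR_betti L (z_elem W :: 'v set \<Rightarrow>\<^sub>0 'k) i \<noteq> 0) \<longrightarrow>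
         H1_image L r \<nu> \<inter> coordinate_subspace W = {0})"
proof -
  interpret toric_kernel_cover L r \<nu> E e p using assms by unfold_locales
  show ?thesis
    unfolding finite_homology_iff_resonance resonance_iff SR_betti_kexact[OF L_down] ..
qed

end
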